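(* Let $\mathcal{B}$ be a 0-closed symmetric monoidal 2-category. Then $\mathcal{B}$ admits a lax 1-contravariant $\mathrm{O}(1)$-volutive structure.
   Context: "2-category" means bicategory, "2-functor" means pseudofunctor, "2-transformation" means pseudonatural transformation. $\mathcal{B}^{1\mathrm{op}}$ denotes $\mathcal{B}$ with 1-morphisms reversed. A symmetric monoidal 2-category $\mathcal{B}$ is 0-closed if for every $a\in\mathcal{B}$ the 2-functor $(-)\otimes a\colon\mathcal{B}\to\mathcal{B}$ admits a right adjoint 2-functor $b\mapsto b^a$ (so $\mathrm{Hom}_{\mathcal{B}}(c,b^a)\simeq\mathrm{Hom}_{\mathcal{B}}(c\otimes a,b)$, 2-naturally). A lax 1-contravariant $\mathrm{O}(1)$-volutive structure on a 2-category $\mathcal{B}$ consists of a 2-functor $d\colon\mathcal{B}\to\mathcal{B}^{1\mathrm{op}}$, a 2-transformation $\eta\colon\mathrm{id}\to d^{1\mathrm{op}}\circ d$ (1-morphism components $\eta_a\colon a\to d^2(a)$ not required invertible), and an invertible modification $\tau$ with components 2-isomorphisms $\tau_a\colon d(\eta_a)\circ\eta_{d(a)}\to\mathrm{id}_{d(a)}$. These satisfy the following coherence condition over the fourfold product of $d$. For each $a$, the 2-isomorphism $d(\eta_{d(a)})\circ d^2(\eta_a)\circ\eta_a\cong\eta_a$ given by $d(\tau_a)$, and the 2-isomorphism $d(\eta_{d(a)})\circ\eta_{d^2(a)}\circ\eta_a\cong\eta_a$ given by $\tau_{d(a)}$, correspond to each other under the naturality 2-isomorphism $d^2(\eta_a)\circ\eta_a\cong\eta_{d^2(a)}\circ\eta_a$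 of $\eta$ at $\eta_a$. *)

theory Defs
  imports Main
begin

section \<open>Bicategories\<close>

text \<open>
  \<open>cmp1 B g f\<close> and \<open>hc B v u\<close> are the composites \<open>g \<circ> f\<close> and \<open>v * u\<close> in the usual order
  (first \<open>f\<close>, then \<open>g\<close>); \<open>vc B v u\<close> is vertical composition (first \<open>u\<close>, then \<open>v\<close>).  The operations
  are total functions, constrained only on the carriers \<open>obj\<close>, \<open>arr1\<close>, \<open>arr2\<close>.
\<close>

record ('o, 'm, 'c) bicat =
  obj :: "'o set"
  arr1 :: "'m set"
  arr2 :: "'c set"
  src :: "'m \<Rightarrow> 'o"
  trg :: "'m \<Rightarrow> 'o"
  dom2 :: "'c \<Rightarrow> 'm"
  cod2 :: "'c \<Rightarrow> 'm"
  id1 :: "'o \<Rightarrow> 'm"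
  id2 :: "'m \<Rightarrow> 'c"
  cmp1 :: "'m \<Rightarrow> 'm \<Rightarrow> 'm"
  vc :: "'c \<Rightarrow> 'c \<Rightarrow> 'c"
  hc :: "'c \<Rightarrow> 'c \<Rightarrow> 'c"
  asc :: "'m \<Rightarrow> 'm \<Rightarrow> 'm \<Rightarrow> 'c"
  lun :: "'m \<Rightarrow> 'c"
  run :: "'m \<Rightarrow> 'c"

definition hom1 :: "('o, 'm, 'c) bicat \<Rightarrow> 'o \<Rightarrow> 'o \<Rightarrow> 'm set" where
  "hom1 B a b = {f \<in> arr1 B. src B f = a \<and> trg B f = b}"

definition hom2 :: "('o, 'm, 'c) bicat \<Rightarrow> 'm \<Rightarrow> 'm \<Rightarrow> 'c set" where
  "hom2 B f g = {u \<in> arr2 B. dom2 B u = f \<and> cod2 B u = g}"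

definition is_inv2 :: "('o, 'm, 'c) bicat \<Rightarrow> 'c \<Rightarrow> 'c \<Rightarrow> bool" where
  "is_inv2 B u v \<longleftrightarrow> u \<in> arr2 B \<and> v \<in> hom2 B (cod2 B u) (dom2 B u) \<and>
     vc B v u = id2 B (dom2 B u) \<and> vc B u v = id2 B (cod2 B u)"

definition iso2 :: "('o, 'm, 'c) bicat \<Rightarrow> 'm \<Rightarrow> 'm \<Rightarrow> 'c set" where
  "iso2 B f g = {u \<in> hom2 B f g. \<exists>v. is_inv2 B u v}"

definition inv2 :: "('o, 'm, 'c) bicat \<Rightarrow> 'c \<Rightarrow> 'c" where
  "inv2 B u = (THE v. is_inv2 B u v)"

locale bicategory =
  fixes B :: "('o, 'm, 'c) bicat"
  assumes src_trg: "f \<in> arr1 B \<Longrightarrow> src B f \<in> obj B \<and> trg B f \<in> obj B"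
    and dom_cod: "u \<in> arr2 B \<Longrightarrow> dom2 B u \<in> arr1 B \<and> cod2 B u \<in> arr1 B \<and>
      src B (dom2 B u) = src B (cod2 B u) \<and> trg B (dom2 B u) = trg B (cod2 B u)"
    and id1_hom: "a \<in> obj B \<Longrightarrow> id1 B a \<in> hom1 B a a"
    and id2_hom: "f \<in> arr1 B \<Longrightarrow> id2 B f \<in> hom2 B f f"
    and cmp1_hom: "\<lbrakk>f \<in> hom1 B a b; g \<in> hom1 B b c\<rbrakk> \<Longrightarrow> cmp1 B g f \<in> hom1 B a c"
    and vc_hom: "\<lbrakk>u \<in> hom2 B f g; v \<in> hom2 B g h\<rbrakk> \<Longrightarrow> vc B v u \<in> hom2 B f h"
    and hc_hom: "\<lbrakk>u \<in> hom2 B f f'; v \<in> hom2 B g g'; trg B f = src B g\<rbrakk>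
      \<Longrightarrow> hc B v u \<in> hom2 B (cmp1 B g f) (cmp1 B g' f')"
    and vc_id: "u \<in> hom2 B f g \<Longrightarrow> vc B u (id2 B f) = u \<and> vc B (id2 B g) u = u"
    and vc_assoc: "\<lbrakk>u \<in> hom2 B f g; v \<in> hom2 B g h; w \<in> hom2 B h k\<rbrakk>
      \<Longrightarrow> vc B (vc B w v) u = vc B w (vc B v u)"
    and hc_id: "\<lbrakk>f \<in> hom1 B a b; g \<in> hom1 B b c\<rbrakk>
      \<Longrightarrow> hc B (id2 B g) (id2 B f) = id2 B (cmp1 B g f)"
    and interchange: "\<lbrakk>u \<in> hom2 B f f'; u' \<in> hom2 B f' f''; v \<in> hom2 B g g'; v' \<in> hom2 B g' g'';
      trg B f = src B g\<rbrakk>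
      \<Longrightarrow> hc B (vc B v' v) (vc B u' u) = vc B (hc B v' u') (hc B v u)"
    and asc_iso: "\<lbrakk>f \<in> hom1 B a b; g \<in> hom1 B b c; h \<in> hom1 B c d\<rbrakk>
      \<Longrightarrow> asc B h g f \<in> iso2 B (cmp1 B (cmp1 B h g) f) (cmp1 B h (cmp1 B g f))"
    and lun_iso: "f \<in> hom1 B a b \<Longrightarrow> lun B f \<in> iso2 B (cmp1 B (id1 B b) f) f"
    and run_iso: "f \<in> hom1 B a b \<Longrightarrow> run B f \<in> iso2 B (cmp1 B f (id1 B a)) f"
    and asc_nat: "\<lbrakk>u \<in> hom2 B f f'; v \<in> hom2 B g g'; w \<in> hom2 B h h';
      trg B f = src B g; trg B g = src B h\<rbrakk>
      \<Longrightarrow> vc B (asc B h' g' f') (hc B (hc B w v) u) = vc B (hc B w (hc B v u)) (asc B h g f)"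
    and lun_nat: "u \<in> hom2 B f g
      \<Longrightarrow> vc B (lun B g) (hc B (id2 B (id1 B (trg B f))) u) = vc B u (lun B f)"
    and run_nat: "u \<in> hom2 B f g
      \<Longrightarrow> vc B (run B g) (hc B u (id2 B (id1 B (src B f)))) = vc B u (run B f)"
    and pentagon: "\<lbrakk>f \<in> hom1 B a b; g \<in> hom1 B b c; h \<in> hom1 B c d; k \<in> hom1 B d e\<rbrakk>
      \<Longrightarrow> vc B (asc B k h (cmp1 B g f)) (asc B (cmp1 B k h) g f)
        = vc B (hc B (id2 B k) (asc B h g f))
            (vc B (asc B k (cmp1 B h g) f) (hc B (asc B k h g) (id2 B f)))"
    and triangle: "\<lbrakk>f \<in> hom1 B a b; g \<in> hom1 B b c\<rbrakk>
      \<Longrightarrow> vc B (hc B (id2 B g) (lun B f)) (asc B g (id1 B b) f) = hc B (run B g) (id2 B f)"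

definition prodB :: "('o, 'm, 'c) bicat \<Rightarrow> ('p, 'n, 'd) bicat \<Rightarrow> ('o \<times> 'p, 'm \<times> 'n, 'c \<times> 'd) bicat" where
  "prodB B C =
    \<lparr>obj = obj B \<times> obj C, arr1 = arr1 B \<times> arr1 C, arr2 = arr2 B \<times> arr2 C,
     src = map_prod (src B) (src C), trg = map_prod (trg B) (trg C),
     dom2 = map_prod (dom2 B) (dom2 C), cod2 = map_prod (cod2 B) (cod2 C),
     id1 = map_prod (id1 B) (id1 C), id2 = map_prod (id2 B) (id2 C),
     cmp1 = (\<lambda>g f. (cmp1 B (fst g) (fst f), cmp1 C (snd g) (snd f))),
     vc = (\<lambda>v u. (vc B (fst v) (fst u), vc C (snd v) (snd u))),
     hc = (\<lambda>v u. (hc B (fst v) (fst u), hc C (snd v) (snd u))),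
     asc = (\<lambda>h g f. (asc B (fst h) (fst g) (fst f), asc C (snd h) (snd g) (snd f))),
     lun = map_prod (lun B) (lun C), run = map_prod (run B) (run C)\<rparr>"

text \<open>The bicategory \<open>B\<^sup>1\<^sup>o\<^sup>p\<close>: 1-morphisms are reversed, 2-morphisms are not.\<close>

definition opB :: "('o, 'm, 'c) bicat \<Rightarrow> ('o, 'm, 'c) bicat" where
  "opB B =
    \<lparr>obj = obj B, arr1 = arr1 B, arr2 = arr2 B, src = trg B, trg = src B,
     dom2 = dom2 B, cod2 = cod2 B, id1 = id1 B, id2 = id2 B,
     cmp1 = (\<lambda>g f. cmp1 B f g), vc = vc B, hc = (\<lambda>v u. hc B u v),
     asc = (\<lambda>h g f. inv2 B (asc B f g h)), lun = run B, run = lun B\<rparr>"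


section \<open>Pseudofunctors\<close>

text \<open>\<open>Fc F g f : F g \<circ> F f \<Rightarrow> F (g \<circ> f)\<close> and \<open>Fu F a : id \<Rightarrow> F id\<close> are the structure 2-cells.\<close>

record ('o, 'm, 'c, 'p, 'n, 'd) pfun =
  F0 :: "'o \<Rightarrow> 'p"
  F1 :: "'m \<Rightarrow> 'n"
  F2 :: "'c \<Rightarrow> 'd"
  Fc :: "'m \<Rightarrow> 'm \<Rightarrow> 'd"
  Fu :: "'o \<Rightarrow> 'd"

locale pseudofunctor =
  fixes B :: "('o, 'm, 'c) bicat" and C :: "('p, 'n, 'd) bicat"
    and F :: "('o, 'm, 'c, 'p, 'n, 'd) pfun"
  assumes F0_obj: "a \<in> obj B \<Longrightarrow> F0 F a \<in> obj C"
    and F1_hom: "f \<in> hom1 B a b \<Longrightarrow> F1 F f \<in> hom1 C (F0 F a) (F0 F b)"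
    and F2_hom: "u \<in> hom2 B f g \<Longrightarrow> F2 F u \<in> hom2 C (F1 F f) (F1 F g)"
    and F2_id: "f \<in> arr1 B \<Longrightarrow> F2 F (id2 B f) = id2 C (F1 F f)"
    and F2_vc: "\<lbrakk>u \<in> hom2 B f g; v \<in> hom2 B g h\<rbrakk> \<Longrightarrow> F2 F (vc B v u) = vc C (F2 F v) (F2 F u)"
    and Fc_iso: "\<lbrakk>f \<in> hom1 B a b; g \<in> hom1 B b c\<rbrakk>
      \<Longrightarrow> Fc F g f \<in> iso2 C (cmp1 C (F1 F g) (F1 F f)) (F1 F (cmp1 B g f))"
    and Fu_iso: "a \<in> obj B \<Longrightarrow> Fu F a \<in> iso2 C (id1 C (F0 F a)) (F1 F (id1 B a))"
    and Fc_nat: "\<lbrakk>u \<in> hom2 B f f'; v \<in> hom2 B g g'; trg B f = src B g\<rbrakk>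
      \<Longrightarrow> vc C (Fc F g' f') (hc C (F2 F v) (F2 F u)) = vc C (F2 F (hc B v u)) (Fc F g f)"
    and Fc_assoc: "\<lbrakk>f \<in> hom1 B a b; g \<in> hom1 B b c; h \<in> hom1 B c d\<rbrakk>
      \<Longrightarrow> vc C (F2 F (asc B h g f)) (vc C (Fc F (cmp1 B h g) f) (hc C (Fc F h g) (id2 C (F1 F f))))
        = vc C (Fc F h (cmp1 B g f)) (vc C (hc C (id2 C (F1 F h)) (Fc F g f))
            (asc C (F1 F h) (F1 F g) (F1 F f)))"
    and Fu_left: "f \<in> hom1 B a b
      \<Longrightarrow> vc C (F2 F (lun B f)) (vc C (Fc F (id1 B b) f) (hc C (Fu F b) (id2 C (F1 F f))))
        = lun C (F1 F f)"
    and Fu_right: "f \<in> hom1 B a b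
      \<Longrightarrow> vc C (F2 F (run B f)) (vc C (Fc F f (id1 B a)) (hc C (id2 C (F1 F f)) (Fu F a)))
        = run C (F1 F f)"

text \<open>The strict functor into \<open>C\<close> given by three maps; used for identities and projections.\<close>

definition strictF ::
  "('p, 'n, 'd) bicat \<Rightarrow> ('o \<Rightarrow> 'p) \<Rightarrow> ('m \<Rightarrow> 'n) \<Rightarrow> ('c \<Rightarrow> 'd) \<Rightarrow> ('o, 'm, 'c, 'p, 'n, 'd) pfun" where
  "strictF C p0 p1 p2 = \<lparr>F0 = p0, F1 = p1, F2 = p2,
     Fc = (\<lambda>g f. id2 C (cmp1 C (p1 g) (p1 f))), Fu = (\<lambda>a. id2 C (id1 C (p0 a)))\<rparr>"

abbreviation idF :: "('o, 'm, 'c) bicat \<Rightarrow> ('o, 'm, 'c, 'o, 'm, 'c) pfun" where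
  "idF B \<equiv> strictF B (\<lambda>a. a) (\<lambda>f. f) (\<lambda>u. u)"

definition constF :: "('p, 'n, 'd) bicat \<Rightarrow> 'p \<Rightarrow> ('o, 'm, 'c, 'p, 'n, 'd) pfun" where
  "constF C x = \<lparr>F0 = (\<lambda>_. x), F1 = (\<lambda>_. id1 C x), F2 = (\<lambda>_. id2 C (id1 C x)),
     Fc = (\<lambda>_ _. lun C (id1 C x)), Fu = (\<lambda>_. id2 C (id1 C x))\<rparr>"

text \<open>\<open>compF D G F\<close> is \<open>G \<circ> F\<close>, where \<open>D\<close> is the target of \<open>G\<close>.\<close>

definition compF ::
  "('q, 'k, 'e) bicat \<Rightarrow> ('p, 'n, 'd, 'q, 'k, 'e) pfun \<Rightarrow> ('o, 'm, 'c, 'p, 'n, 'd) pfun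
    \<Rightarrow> ('o, 'm, 'c, 'q, 'k, 'e) pfun" where
  "compF D G F = \<lparr>F0 = F0 G \<circ> F0 F, F1 = F1 G \<circ> F1 F, F2 = F2 G \<circ> F2 F,
     Fc = (\<lambda>g f. vc D (F2 G (Fc F g f)) (Fc G (F1 F g) (F1 F f))),
     Fu = (\<lambda>a. vc D (F2 G (Fu F a)) (Fu G (F0 F a)))\<rparr>"

definition pairF ::
  "('o, 'm, 'c, 'p, 'n, 'd) pfun \<Rightarrow> ('o, 'm, 'c, 'q, 'k, 'e) pfun
    \<Rightarrow> ('o, 'm, 'c, 'p \<times> 'q, 'n \<times> 'k, 'd \<times> 'e) pfun" where
  "pairF F G = \<lparr>F0 = (\<lambda>a. (F0 F a, F0 G a)), F1 = (\<lambda>f. (F1 F f, F1 G f)), F2 = (\<lambda>u. (F2 F u, F2 G u)),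
     Fc = (\<lambda>g f. (Fc F g f, Fc G g f)), Fu = (\<lambda>a. (Fu F a, Fu G a))\<rparr>"

text \<open>\<open>F\<^sup>1\<^sup>o\<^sup>p : B\<^sup>1\<^sup>o\<^sup>p \<rightarrow> C\<^sup>1\<^sup>o\<^sup>p\<close> for \<open>F : B \<rightarrow> C\<close>.\<close>

definition opF :: "('o, 'm, 'c, 'p, 'n, 'd) pfun \<Rightarrow> ('o, 'm, 'c, 'p, 'n, 'd) pfun" where
  "opF F = F\<lparr>Fc := (\<lambda>g f. Fc F f g)\<rparr>"


section \<open>Pseudonatural transformations and modifications\<close>

text \<open>
  A transformation carries its source and target pseudofunctors.  For \<open>f : a \<rightarrow> b\<close> the naturality
  2-cell is \<open>t2 \<sigma> f : G f \<circ> \<sigma>\<^sub>a \<Rightarrow> \<sigma>\<^sub>b \<circ> F f\<close>.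
\<close>

record ('o, 'm, 'c, 'p, 'n, 'd) ptrans =
  tsrc :: "('o, 'm, 'c, 'p, 'n, 'd) pfun"
  ttrg :: "('o, 'm, 'c, 'p, 'n, 'd) pfun"
  t1 :: "'o \<Rightarrow> 'n"
  t2 :: "'m \<Rightarrow> 'd"

locale pseudonatural =
  fixes B :: "('o, 'm, 'c) bicat" and C :: "('p, 'n, 'd) bicat"
    and F G :: "('o, 'm, 'c, 'p, 'n, 'd) pfun"
    and \<sigma> :: "('o, 'm, 'c, 'p, 'n, 'd) ptrans"
  assumes tsrc: "tsrc \<sigma> = F" and ttrg: "ttrg \<sigma> = G"
    and t1_hom: "a \<in> obj B \<Longrightarrow> t1 \<sigma> a \<in> hom1 C (F0 F a) (F0 G a)"
    and t2_iso: "f \<in> hom1 B a b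
      \<Longrightarrow> t2 \<sigma> f \<in> iso2 C (cmp1 C (F1 G f) (t1 \<sigma> a)) (cmp1 C (t1 \<sigma> b) (F1 F f))"
    and t2_nat: "\<lbrakk>f \<in> hom1 B a b; u \<in> hom2 B f g\<rbrakk>
      \<Longrightarrow> vc C (t2 \<sigma> g) (hc C (F2 G u) (id2 C (t1 \<sigma> a)))
        = vc C (hc C (id2 C (t1 \<sigma> b)) (F2 F u)) (t2 \<sigma> f)"
    and t2_cmp: "\<lbrakk>f \<in> hom1 B a b; g \<in> hom1 B b c\<rbrakk>
      \<Longrightarrow> vc C (t2 \<sigma> (cmp1 B g f)) (hc C (Fc G g f) (id2 C (t1 \<sigma> a)))
        = vc C (hc C (id2 C (t1 \<sigma> c)) (Fc F g f))
            (vc C (asc C (t1 \<sigma> c) (F1 F g) (F1 F f))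
            (vc C (hc C (t2 \<sigma> g) (id2 C (F1 F f)))
            (vc C (inv2 C (asc C (F1 G g) (t1 \<sigma> b) (F1 F f)))
            (vc C (hc C (id2 C (F1 G g)) (t2 \<sigma> f))
              (asc C (F1 G g) (F1 G f) (t1 \<sigma> a))))))"
    and t2_id: "a \<in> obj B
      \<Longrightarrow> vc C (t2 \<sigma> (id1 B a)) (hc C (Fu G a) (id2 C (t1 \<sigma> a)))
        = vc C (hc C (id2 C (t1 \<sigma> a)) (Fu F a))
            (vc C (inv2 C (run C (t1 \<sigma> a))) (lun C (t1 \<sigma> a)))"

text \<open>In the next four definitions \<open>B\<close> is the domain and \<open>C\<close> the codomain of the resulting functors.\<close>

definition idT ::
  "('p, 'n, 'd) bicat \<Rightarrow> ('o, 'm, 'c, 'p, 'n, 'd) pfun \<Rightarrow> ('o, 'm, 'c, 'p, 'n, 'd) ptrans" where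
  "idT C F = \<lparr>tsrc = F, ttrg = F, t1 = (\<lambda>a. id1 C (F0 F a)),
     t2 = (\<lambda>f. vc C (inv2 C (lun C (F1 F f))) (run C (F1 F f)))\<rparr>"

definition vcT ::
  "('o, 'm, 'c) bicat \<Rightarrow> ('p, 'n, 'd) bicat \<Rightarrow> ('o, 'm, 'c, 'p, 'n, 'd) ptrans
    \<Rightarrow> ('o, 'm, 'c, 'p, 'n, 'd) ptrans \<Rightarrow> ('o, 'm, 'c, 'p, 'n, 'd) ptrans" where
  "vcT B C \<tau> \<sigma> = \<lparr>tsrc = tsrc \<sigma>, ttrg = ttrg \<tau>, t1 = (\<lambda>a. cmp1 C (t1 \<tau> a) (t1 \<sigma> a)),
     t2 = (\<lambda>f. let a = src B f; b = trg B f;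
                 F = F1 (tsrc \<sigma>) f; G = F1 (ttrg \<sigma>) f; H = F1 (ttrg \<tau>) f
       in vc C (inv2 C (asc C (t1 \<tau> b) (t1 \<sigma> b) F))
            (vc C (hc C (id2 C (t1 \<tau> b)) (t2 \<sigma> f))
            (vc C (asc C (t1 \<tau> b) G (t1 \<sigma> a))
            (vc C (hc C (t2 \<tau> f) (id2 C (t1 \<sigma> a)))
              (inv2 C (asc C H (t1 \<tau> a) (t1 \<sigma> a)))))))\<rparr>"

definition whiskL ::
  "('o, 'm, 'c) bicat \<Rightarrow> ('q, 'k, 'e) bicat \<Rightarrow> ('p, 'n, 'd, 'q, 'k, 'e) pfun
    \<Rightarrow> ('o, 'm, 'c, 'p, 'n, 'd) ptrans \<Rightarrow> ('o, 'm, 'c, 'q, 'k, 'e) ptrans" where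
  "whiskL B C H \<sigma> = \<lparr>tsrc = compF C H (tsrc \<sigma>), ttrg = compF C H (ttrg \<sigma>), t1 = F1 H \<circ> t1 \<sigma>,
     t2 = (\<lambda>f. vc C (inv2 C (Fc H (t1 \<sigma> (trg B f)) (F1 (tsrc \<sigma>) f)))
            (vc C (F2 H (t2 \<sigma> f)) (Fc H (F1 (ttrg \<sigma>) f) (t1 \<sigma> (src B f)))))\<rparr>"

definition whiskR ::
  "('q, 'k, 'e) bicat \<Rightarrow> ('p, 'n, 'd, 'q, 'k, 'e) ptrans \<Rightarrow> ('o, 'm, 'c, 'p, 'n, 'd) pfun
    \<Rightarrow> ('o, 'm, 'c, 'q, 'k, 'e) ptrans" where
  "whiskR C \<sigma> K = \<lparr>tsrc = compF C (tsrc \<sigma>) K, ttrg = compF C (ttrg \<sigma>) K,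
     t1 = t1 \<sigma> \<circ> F0 K, t2 = t2 \<sigma> \<circ> F1 K\<rparr>"

definition pairT ::
  "('o, 'm, 'c, 'p, 'n, 'd) ptrans \<Rightarrow> ('o, 'm, 'c, 'q, 'k, 'e) ptrans
    \<Rightarrow> ('o, 'm, 'c, 'p \<times> 'q, 'n \<times> 'k, 'd \<times> 'e) ptrans" where
  "pairT \<sigma> \<tau> = \<lparr>tsrc = pairF (tsrc \<sigma>) (tsrc \<tau>), ttrg = pairF (ttrg \<sigma>) (ttrg \<tau>),
     t1 = (\<lambda>a. (t1 \<sigma> a, t1 \<tau> a)), t2 = (\<lambda>f. (t2 \<sigma> f, t2 \<tau> f))\<rparr>"

text \<open>
  For \<open>\<sigma> : F \<rightarrow> G\<close> with values in \<open>C\<close>, \<open>opT C \<sigma>\<close> is the transformation \<open>G\<^sup>1\<^sup>o\<^sup>p \<rightarrow> F\<^sup>1\<^sup>o\<^sup>p\<close> with values in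
  \<open>C\<^sup>1\<^sup>o\<^sup>p\<close>: reversing 1-morphisms exchanges the two sides of the naturality squares.
\<close>

definition opT ::
  "('p, 'n, 'd) bicat \<Rightarrow> ('o, 'm, 'c, 'p, 'n, 'd) ptrans \<Rightarrow> ('o, 'm, 'c, 'p, 'n, 'd) ptrans" where
  "opT C \<sigma> = \<lparr>tsrc = opF (ttrg \<sigma>), ttrg = opF (tsrc \<sigma>), t1 = t1 \<sigma>, t2 = (\<lambda>f. inv2 C (t2 \<sigma> f))\<rparr>"

definition invertible_modification ::
  "('o, 'm, 'c) bicat \<Rightarrow> ('p, 'n, 'd) bicat \<Rightarrow> ('o, 'm, 'c, 'p, 'n, 'd) pfun
    \<Rightarrow> ('o, 'm, 'c, 'p, 'n, 'd) pfun \<Rightarrow> ('o, 'm, 'c, 'p, 'n, 'd) ptrans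
    \<Rightarrow> ('o, 'm, 'c, 'p, 'n, 'd) ptrans \<Rightarrow> ('o \<Rightarrow> 'd) \<Rightarrow> bool" where
  "invertible_modification B C F G \<sigma> \<tau> \<Gamma> \<longleftrightarrow>
     (\<forall>a\<in>obj B. \<Gamma> a \<in> iso2 C (t1 \<sigma> a) (t1 \<tau> a)) \<and>
     (\<forall>a b. \<forall>f\<in>hom1 B a b.
        vc C (hc C (\<Gamma> b) (id2 C (F1 F f))) (t2 \<sigma> f) = vc C (t2 \<tau> f) (hc C (id2 C (F1 G f)) (\<Gamma> a)))"

text \<open>
  Composite of a list of transformations starting at the functor \<open>F\<close>, listed in the order of \<open>\<circ>\<close> and
  bracketed to the right; the empty list gives the identity.
\<close>

fun compT ::
  "('o, 'm, 'c) bicat \<Rightarrow> ('p, 'n, 'd) bicat \<Rightarrow> ('o, 'm, 'c, 'p, 'n, 'd) pfun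
    \<Rightarrow> ('o, 'm, 'c, 'p, 'n, 'd) ptrans list \<Rightarrow> ('o, 'm, 'c, 'p, 'n, 'd) ptrans" where
  "compT B C F [] = idT C F"
| "compT B C F [\<sigma>] = \<sigma>"
| "compT B C F (\<tau> # \<sigma> # \<sigma>s) = vcT B C \<tau> (compT B C F (\<sigma> # \<sigma>s))"


section \<open>Pasting\<close>

text \<open>
  Pasting diagrams are written as sequences of rewriting steps on paths.  A path is a list of
  1-morphisms in the order of \<open>\<circ>\<close>; its composite is bracketed to the right, the empty path at \<open>x\<close>
  being \<open>id\<^sub>x\<close>.  All associators and unitors of the bicategory are inserted by \<open>join\<close>.
\<close>

fun pcomp :: "('o, 'm, 'c) bicat \<Rightarrow> 'o \<Rightarrow> 'm list \<Rightarrow> 'm" where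
  "pcomp B x [] = id1 B x"
| "pcomp B x [f] = f"
| "pcomp B x (h # g # p) = cmp1 B h (pcomp B x (g # p))"

text \<open>
  The canonical 2-isomorphism \<open>pcomp y q \<circ> pcomp x p \<Rightarrow> pcomp x (q @ p)\<close>, where \<open>y\<close> is the target
  of \<open>pcomp x p\<close>.
\<close>

fun join :: "('o, 'm, 'c) bicat \<Rightarrow> 'o \<Rightarrow> 'm list \<Rightarrow> 'm list \<Rightarrow> 'c" where
  "join B x [] p = lun B (pcomp B x p)"
| "join B x [g] [] = run B g"
| "join B x [g] (f # p) = id2 B (cmp1 B g (pcomp B x (f # p)))"
| "join B x (h # g # q) p = vc B (hc B (id2 B h) (join B x (g # q) p))
     (asc B h (pcomp B (trg B (pcomp B x p)) (g # q)) (pcomp B x p))"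

text \<open>\<open>PCell x p q u\<close> is a 2-cell \<open>u : pcomp x p \<Rightarrow> pcomp x q\<close> between paths starting at \<open>x\<close>.\<close>

datatype ('o, 'm, 'c) pcell =
  PCell (pbase: 'o) (psrc: "'m list") (ptrg: "'m list") (pcell: 'c)

definition pinv :: "('o, 'm, 'c) bicat \<Rightarrow> ('o, 'm, 'c) pcell \<Rightarrow> ('o, 'm, 'c) pcell" where
  "pinv B c = PCell (pbase c) (ptrg c) (psrc c) (inv2 B (pcell c))"

text \<open>Application of a pseudofunctor to a 2-cell between paths.\<close>

fun Fpath :: "('o, 'm, 'c) bicat \<Rightarrow> ('p, 'n, 'd) bicat \<Rightarrow> ('o, 'm, 'c, 'p, 'n, 'd) pfun
    \<Rightarrow> 'o \<Rightarrow> 'm list \<Rightarrow> 'd" where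
  "Fpath B C F x [] = Fu F x"
| "Fpath B C F x [f] = id2 C (F1 F f)"
| "Fpath B C F x (h # g # p) =
     vc C (Fc F h (pcomp B x (g # p))) (hc C (id2 C (F1 F h)) (Fpath B C F x (g # p)))"

definition pmap :: "('o, 'm, 'c) bicat \<Rightarrow> ('p, 'n, 'd) bicat \<Rightarrow> ('o, 'm, 'c, 'p, 'n, 'd) pfun
    \<Rightarrow> ('o, 'm, 'c) pcell \<Rightarrow> ('p, 'n, 'd) pcell" where
  "pmap B C F c = PCell (F0 F (pbase c)) (map (F1 F) (psrc c)) (map (F1 F) (ptrg c))
     (vc C (inv2 C (Fpath B C F (pbase c) (ptrg c)))
       (vc C (F2 F (pcell c)) (Fpath B C F (pbase c) (psrc c))))"

text \<open>
  The step \<open>(q, c, p)\<close> rewrites the path \<open>q @ psrc c @ p\<close> starting at \<open>x\<close> to \<open>q @ ptrg c @ p\<close>.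
\<close>

definition pstep :: "('o, 'm, 'c) bicat \<Rightarrow> 'o \<Rightarrow> 'm list \<times> ('o, 'm, 'c) pcell \<times> 'm list \<Rightarrow> 'c" where
  "pstep B x = (\<lambda>(q, c, p).
     let z = trg B (pcomp B (pbase c) (psrc c));
         u = vc B (join B x (ptrg c) p)
               (vc B (hc B (pcell c) (id2 B (pcomp B x p))) (inv2 B (join B x (psrc c) p)))
     in vc B (join B x q (ptrg c @ p))
          (vc B (hc B (id2 B (pcomp B z q)) u) (inv2 B (join B x q (psrc c @ p)))))"

text \<open>The vertical composite of a sequence of steps, performed from left to right, starting at the path \<open>p\<close>.\<close>

definition paste :: "('o, 'm, 'c) bicat \<Rightarrow> 'o \<Rightarrow> 'm list
    \<Rightarrow> ('m list \<times> ('o, 'm, 'c) pcell \<times> 'm list) list \<Rightarrow> 'c" where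
  "paste B x p ss = foldl (\<lambda>u s. vc B (pstep B x s) u) (id2 B (pcomp B x p)) ss"


section \<open>Adjoint equivalences and biadjunctions\<close>

text \<open>\<open>\<sigma> : F \<rightarrow> G\<close> with adjoint inverse \<open>\<tau>\<close>, unit \<open>\<eta> : id \<Rightarrow> \<tau> \<circ> \<sigma>\<close> and counit \<open>\<epsilon> : \<sigma> \<circ> \<tau> \<Rightarrow> id\<close>.\<close>

definition adjoint_equivalence ::
  "('o, 'm, 'c) bicat \<Rightarrow> ('p, 'n, 'd) bicat \<Rightarrow> ('o, 'm, 'c, 'p, 'n, 'd) pfun
    \<Rightarrow> ('o, 'm, 'c, 'p, 'n, 'd) pfun \<Rightarrow> ('o, 'm, 'c, 'p, 'n, 'd) ptrans
    \<Rightarrow> ('o, 'm, 'c, 'p, 'n, 'd) ptrans \<Rightarrow> ('o \<Rightarrow> 'd) \<Rightarrow> ('o \<Rightarrow> 'd) \<Rightarrow> bool" where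
  "adjoint_equivalence B C F G \<sigma> \<tau> \<eta> \<epsilon> \<longleftrightarrow>
     pseudonatural B C F G \<sigma> \<and> pseudonatural B C G F \<tau> \<and>
     invertible_modification B C F F (idT C F) (vcT B C \<tau> \<sigma>) \<eta> \<and>
     invertible_modification B C G G (vcT B C \<sigma> \<tau>) (idT C G) \<epsilon> \<and>
     (\<forall>a\<in>obj B.
        let s = t1 \<sigma> a; t = t1 \<tau> a; x = F0 F a; y = F0 G a;
            H = PCell x [] [t, s] (\<eta> a); E = PCell y [s, t] [] (\<epsilon> a)
        in paste C x [s] [([s], H, []), ([], E, [s])] = id2 C s \<and>
           paste C y [t] [([], H, [t]), ([t], E, [])] = id2 C t)"

text \<open>
  \<open>L : B \<rightarrow> C\<close> is left (bi)adjoint to \<open>R\<close>, with unit \<open>\<eta>\<close>, counit \<open>\<epsilon>\<close> and the triangle identities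
  holding up to the invertible modifications \<open>s\<close> and \<open>t\<close>.
\<close>

definition biadjunction ::
  "('o, 'm, 'c) bicat \<Rightarrow> ('p, 'n, 'd) bicat \<Rightarrow> ('o, 'm, 'c, 'p, 'n, 'd) pfun
    \<Rightarrow> ('p, 'n, 'd, 'o, 'm, 'c) pfun \<Rightarrow> ('o, 'm, 'c, 'o, 'm, 'c) ptrans
    \<Rightarrow> ('p, 'n, 'd, 'p, 'n, 'd) ptrans \<Rightarrow> ('o \<Rightarrow> 'd) \<Rightarrow> ('p \<Rightarrow> 'c) \<Rightarrow> bool" where
  "biadjunction B C L R \<eta> \<epsilon> s t \<longleftrightarrow>
     pseudofunctor B C L \<and> pseudofunctor C B R \<and>
     pseudonatural B B (idF B) (compF B R L) \<eta> \<and>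
     pseudonatural C C (compF C L R) (idF C) \<epsilon> \<and>
     invertible_modification B C L L (vcT B C (whiskR C \<epsilon> L) (whiskL B C L \<eta>)) (idT C L) s \<and>
     invertible_modification C B R R (vcT C B (whiskL C B R \<epsilon>) (whiskR B \<eta> R)) (idT B R) t"


section \<open>Symmetric monoidal bicategories\<close>

text \<open>
  \<open>al\<close> is the associator \<open>(a b) c \<rightarrow> a (b c)\<close>, with adjoint inverse \<open>als\<close>, unit \<open>al_unit\<close> and counit
  \<open>al_counit\<close>; \<open>lu : I a \<rightarrow> a\<close> and \<open>ru : a \<rightarrow> a I\<close> are the unit constraints, \<open>br : a b \<rightarrow> b a\<close> is the
  braiding.  \<open>piM\<close> is the pentagonator, \<open>muM\<close>, \<open>lamM\<close>, \<open>rhoM\<close> are the middle, left and right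
  2-unitors, \<open>rM\<close>, \<open>sM\<close> are the two hexagonators, and \<open>sylM\<close> is the syllepsis.
\<close>

record ('o, 'm, 'c) symmon =
  tensor :: "('o \<times> 'o, 'm \<times> 'm, 'c \<times> 'c, 'o, 'm, 'c) pfun"
  unit :: "'o"
  al :: "('o \<times> 'o \<times> 'o, 'm \<times> 'm \<times> 'm, 'c \<times> 'c \<times> 'c, 'o, 'm, 'c) ptrans"
  als :: "('o \<times> 'o \<times> 'o, 'm \<times> 'm \<times> 'm, 'c \<times> 'c \<times> 'c, 'o, 'm, 'c) ptrans"
  al_unit :: "'o \<times> 'o \<times> 'o \<Rightarrow> 'c"
  al_counit :: "'o \<times> 'o \<times> 'o \<Rightarrow> 'c"
  lu :: "('o, 'm, 'c, 'o, 'm, 'c) ptrans"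
  ru :: "('o, 'm, 'c, 'o, 'm, 'c) ptrans"
  br :: "('o \<times> 'o, 'm \<times> 'm, 'c \<times> 'c, 'o, 'm, 'c) ptrans"
  piM :: "'o \<times> 'o \<times> 'o \<times> 'o \<Rightarrow> 'c"
  muM :: "'o \<times> 'o \<Rightarrow> 'c"
  lamM :: "'o \<times> 'o \<Rightarrow> 'c"
  rhoM :: "'o \<times> 'o \<Rightarrow> 'c"
  rM :: "'o \<times> 'o \<times> 'o \<Rightarrow> 'c"
  sM :: "'o \<times> 'o \<times> 'o \<Rightarrow> 'c"
  sylM :: "'o \<times> 'o \<Rightarrow> 'c"

locale symmetric_monoidal_data =
  fixes B :: "('o, 'm, 'c) bicat" and M :: "('o, 'm, 'c) symmon"
begin

abbreviation "B2 \<equiv> prodB B B"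
abbreviation "B3 \<equiv> prodB B (prodB B B)"
abbreviation "B4 \<equiv> prodB B (prodB B (prodB B B))"

abbreviation "P1of2 \<equiv> strictF B fst fst fst"
abbreviation "P2of2 \<equiv> strictF B snd snd snd"
abbreviation "P1of3 \<equiv> strictF B fst fst fst"
abbreviation "P2of3 \<equiv> strictF B (fst \<circ> snd) (fst \<circ> snd) (fst \<circ> snd)"
abbreviation "P3of3 \<equiv> strictF B (snd \<circ> snd) (snd \<circ> snd) (snd \<circ> snd)"
abbreviation "P1of4 \<equiv> strictF B fst fst fst"
abbreviation "P2of4 \<equiv> strictF B (fst \<circ> snd) (fst \<circ> snd) (fst \<circ> snd)"
abbreviation "P3of4 \<equiv> strictF B (fst \<circ> snd \<circ> snd) (fst \<circ> snd \<circ> snd) (fst \<circ> snd \<circ> snd)"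
abbreviation "P4of4 \<equiv> strictF B (snd \<circ> snd \<circ> snd) (snd \<circ> snd \<circ> snd) (snd \<circ> snd \<circ> snd)"

abbreviation "constI \<equiv> constF B (unit M)"

text \<open>Tensor product of two \<open>B\<close>-valued functors, and of a transformation of such functors (on \<open>X\<close>) with a functor.\<close>

abbreviation tensF (infix "\<Otimes>" 75) where "F \<Otimes> G \<equiv> compF B (tensor M) (pairF F G)"
abbreviation trT where "trT X \<sigma> K \<equiv> whiskL X B (tensor M) (pairT \<sigma> (idT B K))"
abbreviation tlT where "tlT X K \<sigma> \<equiv> whiskL X B (tensor M) (pairT (idT B K) \<sigma>)"

abbreviation alT where "alT F G H \<equiv> whiskR B (al M) (pairF F (pairF G H))"
abbreviation alsT where "alsT F G H \<equiv> whiskR B (als M) (pairF F (pairF G H))"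
abbreviation luT where "luT F \<equiv> whiskR B (lu M) F"
abbreviation ruT where "ruT F \<equiv> whiskR B (ru M) F"
abbreviation brT where "brT F G \<equiv> whiskR B (br M) (pairF F G)"

text \<open>Tensor product of objects, and of a 1-morphism with an object (that is, its identity).\<close>

abbreviation tens0 (infix "\<otimes>" 75) where "a \<otimes> b \<equiv> F0 (tensor M) (a, b)"
abbreviation tensr (infix "\<lhd>" 75) where "f \<lhd> e \<equiv> F1 (tensor M) (f, id1 B e)"
abbreviation tensl (infix "\<rhd>" 75) where "a \<rhd> f \<equiv> F1 (tensor M) (id1 B a, f)"

abbreviation alp ("\<alpha>") where "\<alpha> a b c \<equiv> t1 (al M) (a, b, c)"
abbreviation alps ("\<alpha>''") where "\<alpha>' a b c \<equiv> t1 (als M) (a, b, c)"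
abbreviation bra ("\<beta>") where "\<beta> a b \<equiv> t1 (br M) (a, b)"
abbreviation unI ("I") where "I \<equiv> unit M"

text \<open>The pseudofunctors \<open>(-) \<otimes> e\<close> and \<open>a \<otimes> (-)\<close>, and their action on 2-cells between paths.\<close>

definition tensR :: "'o \<Rightarrow> ('o, 'm, 'c, 'o, 'm, 'c) pfun" where "tensR e = idF B \<Otimes> constF B e"
definition tensL :: "'o \<Rightarrow> ('o, 'm, 'c, 'o, 'm, 'c) pfun" where "tensL a = constF B a \<Otimes> idF B"
definition "rt c e = pmap B B (tensR e) c"
definition "lt a c = pmap B B (tensL a) c"

abbreviation (input) "iv \<equiv> pinv B"

text \<open>The structure 2-cells, as 2-cells between paths.\<close>

definition "Au a b c = PCell ((a \<otimes> b) \<otimes> c) [] [\<alpha>' a b c, \<alpha> a b c] (al_unit M (a, b, c))"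
definition "Ac a b c = PCell (a \<otimes> (b \<otimes> c)) [\<alpha> a b c, \<alpha>' a b c] [] (al_counit M (a, b, c))"
definition "Pi a b c d = PCell (((a \<otimes> b) \<otimes> c) \<otimes> d)
  [a \<rhd> \<alpha> b c d, \<alpha> a (b \<otimes> c) d, \<alpha> a b c \<lhd> d] [\<alpha> a b (c \<otimes> d), \<alpha> (a \<otimes> b) c d] (piM M (a, b, c, d))"
definition "Mu a b = PCell (a \<otimes> b) [a \<rhd> t1 (lu M) b, \<alpha> a I b, t1 (ru M) a \<lhd> b] [] (muM M (a, b))"
definition "Lam a b = PCell ((I \<otimes> a) \<otimes> b)
  [t1 (lu M) a \<lhd> b] [t1 (lu M) (a \<otimes> b), \<alpha> I a b] (lamM M (a, b))"
definition "Rho a b = PCell (a \<otimes> b)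
  [a \<rhd> t1 (ru M) b] [\<alpha> a b I, t1 (ru M) (a \<otimes> b)] (rhoM M (a, b))"
definition "R a b c = PCell ((a \<otimes> b) \<otimes> c)
  [b \<rhd> \<beta> a c, \<alpha> b a c, \<beta> a b \<lhd> c] [\<alpha> b c a, \<beta> a (b \<otimes> c), \<alpha> a b c] (rM M (a, b, c))"
definition "S a b c = PCell (a \<otimes> (b \<otimes> c))
  [\<beta> a c \<lhd> b, \<alpha>' a c b, a \<rhd> \<beta> b c] [\<alpha>' c a b, \<beta> (a \<otimes> b) c, \<alpha>' a b c] (sM M (a, b, c))"
definition "Syl a b = PCell (a \<otimes> b) [] [\<beta> b a, \<beta> a b] (sylM M (a, b))"

text \<open>
  Naturality in a single variable.  In two of the three variables of \<open>al\<close> the 2-cell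
  \<open>id \<Rightarrow> id \<otimes> id\<close> identifies \<open>f \<lhd> (b \<otimes> c)\<close> with \<open>f \<otimes> (id \<otimes> id)\<close>.
\<close>

definition "alnat1 f b c = (let a = src B f; a' = trg B f in PCell ((a \<otimes> b) \<otimes> c)
  [f \<lhd> (b \<otimes> c), \<alpha> a b c] [\<alpha> a' b c, (f \<lhd> b) \<lhd> c]
  (vc B (t2 (al M) (f, id1 B b, id1 B c))
    (hc B (F2 (tensor M) (id2 B f, Fu (tensor M) (b, c))) (id2 B (\<alpha> a b c)))))"
definition "alnat2 a g c = (let b = src B g; b' = trg B g in PCell ((a \<otimes> b) \<otimes> c)
  [a \<rhd> (g \<lhd> c), \<alpha> a b c] [\<alpha> a b' c, (a \<rhd> g) \<lhd> c]
  (t2 (al M) (id1 B a, g, id1 B c)))"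
definition "alnat3 a b h = (let c = src B h; c' = trg B h in PCell ((a \<otimes> b) \<otimes> c)
  [a \<rhd> (b \<rhd> h), \<alpha> a b c] [\<alpha> a b c', (a \<otimes> b) \<rhd> h]
  (vc B (hc B (id2 B (\<alpha> a b c')) (F2 (tensor M) (inv2 B (Fu (tensor M) (a, b)), id2 B h)))
    (t2 (al M) (id1 B a, id1 B b, h))))"
definition "alsnat1 f b c = (let a = src B f; a' = trg B f in PCell (a \<otimes> (b \<otimes> c))
  [(f \<lhd> b) \<lhd> c, \<alpha>' a b c] [\<alpha>' a' b c, f \<lhd> (b \<otimes> c)]
  (vc B (hc B (id2 B (\<alpha>' a' b c)) (F2 (tensor M) (id2 B f, inv2 B (Fu (tensor M) (b, c)))))
    (t2 (als M) (f, id1 B b, id1 B c))))"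
definition "alsnat2 a g c = (let b = src B g; b' = trg B g in PCell (a \<otimes> (b \<otimes> c))
  [(a \<rhd> g) \<lhd> c, \<alpha>' a b c] [\<alpha>' a b' c, a \<rhd> (g \<lhd> c)]
  (t2 (als M) (id1 B a, g, id1 B c)))"
definition "alsnat3 a b h = (let c = src B h; c' = trg B h in PCell (a \<otimes> (b \<otimes> c))
  [(a \<otimes> b) \<rhd> h, \<alpha>' a b c] [\<alpha>' a b c', a \<rhd> (b \<rhd> h)]
  (vc B (t2 (als M) (id1 B a, id1 B b, h))
    (hc B (F2 (tensor M) (Fu (tensor M) (a, b), id2 B h)) (id2 B (\<alpha>' a b c)))))"
definition "brnat1 f b = (let a = src B f; a' = trg B f in PCell (a \<otimes> b)
  [b \<rhd> f, \<beta> a b] [\<beta> a' b, f \<lhd> b] (t2 (br M) (f, id1 B b)))"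
definition "brnat2 a g = (let b = src B g; b' = trg B g in PCell (a \<otimes> b)
  [g \<lhd> a, \<beta> a b] [\<beta> a b', a \<rhd> g] (t2 (br M) (id1 B a, g)))"

text \<open>The interchange 2-cell \<open>(a' \<rhd> g) \<circ> (f \<lhd> b) \<Rightarrow> (f \<lhd> b') \<circ> (a \<rhd> g)\<close>, through \<open>f \<otimes> g\<close>.\<close>

definition "xchg f g = (let a = src B f; a' = trg B f; b = src B g; b' = trg B g in PCell (a \<otimes> b)
  [a' \<rhd> g, f \<lhd> b] [f \<lhd> b', a \<rhd> g]
  (vc B (inv2 B (vc B (F2 (tensor M) (run B f, lun B g)) (Fc (tensor M) (f, id1 B b') (id1 B a, g))))
    (vc B (F2 (tensor M) (lun B f, run B g)) (Fc (tensor M) (id1 B a', g) (f, id1 B b)))))"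

text \<open>
  Mates: \<open>Pis\<close> is the pentagonator rewritten for \<open>als\<close> in place of \<open>al\<close>; \<open>Rh\<close> and \<open>Sh\<close> are the
  hexagonators solved for the braiding with a tensor product.
\<close>

definition "Pis a b c d =
  (let x = a \<otimes> (b \<otimes> (c \<otimes> d)); p = [\<alpha>' a b c \<lhd> d, \<alpha>' a (b \<otimes> c) d, a \<rhd> \<alpha>' b c d];
       q = [\<alpha>' (a \<otimes> b) c d, \<alpha>' a b (c \<otimes> d)]
   in PCell x p q (paste B x p
     [([], Au (a \<otimes> b) c d, p),
      ([\<alpha>' (a \<otimes> b) c d], Au a b (c \<otimes> d), \<alpha> (a \<otimes> b) c d # p),
      (q, iv (Pi a b c d), p),
      (q @ [a \<rhd> \<alpha> b c d, \<alpha> a (b \<otimes> c) d], rt (Ac a b c) d, [\<alpha>' a (b \<otimes> c) d, a \<rhd> \<alpha>' b c d]),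
      (q @ [a \<rhd> \<alpha> b c d], Ac a (b \<otimes> c) d, [a \<rhd> \<alpha>' b c d]),
      (q, lt a (Ac b c d), [])]))"

definition "Rh a b c =
  (let x = a \<otimes> (b \<otimes> c); p = [\<beta> a (b \<otimes> c)];
       q = [\<alpha>' b c a, b \<rhd> \<beta> a c, \<alpha> b a c, \<beta> a b \<lhd> c, \<alpha>' a b c]
   in PCell x p q (paste B x p
     [(p, iv (Ac a b c), []),
      ([], Au b c a, [\<beta> a (b \<otimes> c), \<alpha> a b c, \<alpha>' a b c]),
      ([\<alpha>' b c a], iv (R a b c), [\<alpha>' a b c])]))"

definition "Sh a b c =
  (let x = (a \<otimes> b) \<otimes> c; p = [\<beta> (a \<otimes> b) c];
       q = [\<alpha> c a b, \<beta> a c \<lhd> b, \<alpha>' a c b, a \<rhd> \<beta> b c, \<alpha> a b c]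
   in PCell x p q (paste B x p
     [(p, Au a b c, []),
      ([], iv (Ac c a b), [\<beta> (a \<otimes> b) c, \<alpha>' a b c, \<alpha> a b c]),
      ([\<alpha> c a b], iv (S a b c), [\<alpha> a b c])]))"

text \<open>Equality of two pastings with common initial path \<open>p\<close> starting at \<open>x\<close>.\<close>

definition commutes where "commutes x p ss ts \<longleftrightarrow> paste B x p ss = paste B x p ts"

subsection \<open>Axioms of a monoidal bicategory\<close>

definition "nonabelian_cocycle a b c d e \<longleftrightarrow> commutes ((((a \<otimes> b) \<otimes> c) \<otimes> d) \<otimes> e)
  [a \<rhd> (b \<rhd> \<alpha> c d e), a \<rhd> \<alpha> b (c \<otimes> d) e, \<alpha> a (b \<otimes> (c \<otimes> d)) e,
   (a \<rhd> \<alpha> b c d) \<lhd> e, \<alpha> a (b \<otimes> c) d \<lhd> e, (\<alpha> a b c \<lhd> d) \<lhd> e]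
  [([a \<rhd> (b \<rhd> \<alpha> c d e), a \<rhd> \<alpha> b (c \<otimes> d) e, \<alpha> a (b \<otimes> (c \<otimes> d)) e], rt (Pi a b c d) e, []),
   ([a \<rhd> (b \<rhd> \<alpha> c d e)], Pi a b (c \<otimes> d) e, [\<alpha> (a \<otimes> b) c d \<lhd> e]),
   ([], alnat3 a b (\<alpha> c d e), [\<alpha> (a \<otimes> b) (c \<otimes> d) e, \<alpha> (a \<otimes> b) c d \<lhd> e]),
   ([\<alpha> a b (c \<otimes> (d \<otimes> e))], Pi (a \<otimes> b) c d e, [])]
  [([a \<rhd> (b \<rhd> \<alpha> c d e), a \<rhd> \<alpha> b (c \<otimes> d) e], iv (alnat2 a (\<alpha> b c d) e),
     [\<alpha> a (b \<otimes> c) d \<lhd> e, (\<alpha> a b c \<lhd> d) \<lhd> e]),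
   ([], lt a (Pi b c d e), [\<alpha> a ((b \<otimes> c) \<otimes> d) e, \<alpha> a (b \<otimes> c) d \<lhd> e, (\<alpha> a b c \<lhd> d) \<lhd> e]),
   ([a \<rhd> \<alpha> b c (d \<otimes> e)], Pi a (b \<otimes> c) d e, [(\<alpha> a b c \<lhd> d) \<lhd> e]),
   ([a \<rhd> \<alpha> b c (d \<otimes> e), \<alpha> a (b \<otimes> c) (d \<otimes> e)], iv (alnat1 (\<alpha> a b c) d e), []),
   ([], Pi a b c (d \<otimes> e), [\<alpha> ((a \<otimes> b) \<otimes> c) d e])]"

definition "left_normalization a b c \<longleftrightarrow> commutes ((a \<otimes> b) \<otimes> c)
  [\<alpha> a b c, (a \<rhd> t1 (lu M) b) \<lhd> c, \<alpha> a I b \<lhd> c, (t1 (ru M) a \<lhd> b) \<lhd> c]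
  [([\<alpha> a b c], rt (Mu a b) c, [])]
  [([], iv (alnat2 a (t1 (lu M) b) c), [\<alpha> a I b \<lhd> c, (t1 (ru M) a \<lhd> b) \<lhd> c]),
   ([], lt a (Lam b c), [\<alpha> a (I \<otimes> b) c, \<alpha> a I b \<lhd> c, (t1 (ru M) a \<lhd> b) \<lhd> c]),
   ([a \<rhd> t1 (lu M) (b \<otimes> c)], Pi a I b c, [(t1 (ru M) a \<lhd> b) \<lhd> c]),
   ([a \<rhd> t1 (lu M) (b \<otimes> c), \<alpha> a I (b \<otimes> c)], iv (alnat1 (t1 (ru M) a) b c), []),
   ([], Mu a (b \<otimes> c), [\<alpha> a b c])]"

definition "right_normalization a b c \<longleftrightarrow> commutes ((a \<otimes> b) \<otimes> c)
  [a \<rhd> (b \<rhd> t1 (lu M) c), a \<rhd> \<alpha> b I c, a \<rhd> (t1 (ru M) b \<lhd> c), \<alpha> a b c]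
  [([], lt a (Mu b c), [\<alpha> a b c])]
  [([a \<rhd> (b \<rhd> t1 (lu M) c), a \<rhd> \<alpha> b I c], alnat2 a (t1 (ru M) b) c, []),
   ([a \<rhd> (b \<rhd> t1 (lu M) c), a \<rhd> \<alpha> b I c, \<alpha> a (b \<otimes> I) c], rt (Rho a b) c, []),
   ([a \<rhd> (b \<rhd> t1 (lu M) c)], Pi a b I c, [t1 (ru M) (a \<otimes> b) \<lhd> c]),
   ([], alnat3 a b (t1 (lu M) c), [\<alpha> (a \<otimes> b) I c, t1 (ru M) (a \<otimes> b) \<lhd> c]),
   ([\<alpha> a b c], Mu (a \<otimes> b) c, [])]"

subsection \<open>Axioms of a braiding\<close>

text \<open>The crossing axioms concern \<open>\<beta> a (b c d)\<close>, \<open>\<beta> (a b c) d\<close> and \<open>\<beta> (a b) (c d)\<close> respectively.\<close>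

definition "crossing13 a b c d \<longleftrightarrow> commutes (((a \<otimes> b) \<otimes> c) \<otimes> d)
  [b \<rhd> (c \<rhd> \<beta> a d), b \<rhd> \<alpha> c a d, \<alpha> b (c \<otimes> a) d, (b \<rhd> \<beta> a c) \<lhd> d, \<alpha> b a c \<lhd> d, (\<beta> a b \<lhd> c) \<lhd> d]
  [([b \<rhd> (c \<rhd> \<beta> a d), b \<rhd> \<alpha> c a d, \<alpha> b (c \<otimes> a) d], rt (R a b c) d, []),
   ([b \<rhd> (c \<rhd> \<beta> a d)], Pi b c a d, [\<beta> a (b \<otimes> c) \<lhd> d, \<alpha> a b c \<lhd> d]),
   ([], alnat3 b c (\<beta> a d), [\<alpha> (b \<otimes> c) a d, \<beta> a (b \<otimes> c) \<lhd> d, \<alpha> a b c \<lhd> d]),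
   ([\<alpha> b c (d \<otimes> a)], R a (b \<otimes> c) d, [\<alpha> a b c \<lhd> d]),
   ([], iv (Pi b c d a), [\<beta> a ((b \<otimes> c) \<otimes> d), \<alpha> a (b \<otimes> c) d, \<alpha> a b c \<lhd> d]),
   ([b \<rhd> \<alpha> c d a, \<alpha> b (c \<otimes> d) a], brnat2 a (\<alpha> b c d), [\<alpha> a (b \<otimes> c) d, \<alpha> a b c \<lhd> d]),
   ([b \<rhd> \<alpha> c d a, \<alpha> b (c \<otimes> d) a, \<beta> a (b \<otimes> (c \<otimes> d))], Pi a b c d, [])]
  [([b \<rhd> (c \<rhd> \<beta> a d), b \<rhd> \<alpha> c a d], iv (alnat2 b (\<beta> a c) d), [\<alpha> b a c \<lhd> d, (\<beta> a b \<lhd> c) \<lhd> d]),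
   ([], lt b (R a c d), [\<alpha> b (a \<otimes> c) d, \<alpha> b a c \<lhd> d, (\<beta> a b \<lhd> c) \<lhd> d]),
   ([b \<rhd> \<alpha> c d a, b \<rhd> \<beta> a (c \<otimes> d)], Pi b a c d, [(\<beta> a b \<lhd> c) \<lhd> d]),
   ([b \<rhd> \<alpha> c d a, b \<rhd> \<beta> a (c \<otimes> d), \<alpha> b a (c \<otimes> d)], iv (alnat1 (\<beta> a b) c d), []),
   ([b \<rhd> \<alpha> c d a], R a b (c \<otimes> d), [\<alpha> (a \<otimes> b) c d])]"

definition "crossing31 a b c d \<longleftrightarrow> commutes (a \<otimes> (b \<otimes> (c \<otimes> d)))
  [(\<beta> a d \<lhd> b) \<lhd> c, \<alpha>' a d b \<lhd> c, \<alpha>' a (d \<otimes> b) c, a \<rhd> (\<beta> b d \<lhd> c), a \<rhd> \<alpha>' b d c, a \<rhd> (b \<rhd> \<beta> c d)]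
  [([(\<beta> a d \<lhd> b) \<lhd> c, \<alpha>' a d b \<lhd> c, \<alpha>' a (d \<otimes> b) c], lt a (S b c d), []),
   ([(\<beta> a d \<lhd> b) \<lhd> c], Pis a d b c, [a \<rhd> \<beta> (b \<otimes> c) d, a \<rhd> \<alpha>' b c d]),
   ([], alsnat1 (\<beta> a d) b c, [\<alpha>' a d (b \<otimes> c), a \<rhd> \<beta> (b \<otimes> c) d, a \<rhd> \<alpha>' b c d]),
   ([\<alpha>' (d \<otimes> a) b c], S a (b \<otimes> c) d, [a \<rhd> \<alpha>' b c d]),
   ([], iv (Pis d a b c), [\<beta> (a \<otimes> (b \<otimes> c)) d, \<alpha>' a (b \<otimes> c) d, a \<rhd> \<alpha>' b c d]),
   ([\<alpha>' d a b \<lhd> c, \<alpha>' d (a \<otimes> b) c], brnat1 (\<alpha>' a b c) d, [\<alpha>' a (b \<otimes> c) d, a \<rhd> \<alpha>' b c d]),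
   ([\<alpha>' d a b \<lhd> c, \<alpha>' d (a \<otimes> b) c, \<beta> ((a \<otimes> b) \<otimes> c) d], Pis a b c d, [])]
  [([(\<beta> a d \<lhd> b) \<lhd> c, \<alpha>' a d b \<lhd> c], iv (alsnat2 a (\<beta> b d) c), [a \<rhd> \<alpha>' b d c, a \<rhd> (b \<rhd> \<beta> c d)]),
   ([], rt (S a b d) c, [\<alpha>' a (b \<otimes> d) c, a \<rhd> \<alpha>' b d c, a \<rhd> (b \<rhd> \<beta> c d)]),
   ([\<alpha>' d a b \<lhd> c, \<beta> (a \<otimes> b) d \<lhd> c], Pis a b d c, [a \<rhd> (b \<rhd> \<beta> c d)]),
   ([\<alpha>' d a b \<lhd> c, \<beta> (a \<otimes> b) d \<lhd> c, \<alpha>' (a \<otimes> b) d c], iv (alsnat3 a b (\<beta> c d)), []),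
   ([\<alpha>' d a b \<lhd> c], S (a \<otimes> b) c d, [\<alpha>' a b (c \<otimes> d)])]"

definition "crossing22 a b c d \<longleftrightarrow> commutes (((a \<otimes> b) \<otimes> c) \<otimes> d)
  [\<alpha> c d (a \<otimes> b), \<beta> (a \<otimes> b) (c \<otimes> d), \<alpha> (a \<otimes> b) c d]
  [([], iv (R (a \<otimes> b) c d), []),
   ([c \<rhd> \<beta> (a \<otimes> b) d, \<alpha> c (a \<otimes> b) d], rt (Sh a b c) d, []),
   ([], lt c (Sh a b d),
     [\<alpha> c (a \<otimes> b) d, \<alpha> c a b \<lhd> d, (\<beta> a c \<lhd> b) \<lhd> d, \<alpha>' a c b \<lhd> d, (a \<rhd> \<beta> b c) \<lhd> d, \<alpha> a b c \<lhd> d]),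
   ([c \<rhd> \<alpha> d a b, c \<rhd> (\<beta> a d \<lhd> b), c \<rhd> \<alpha>' a d b, c \<rhd> (a \<rhd> \<beta> b d)], Pi c a b d,
     [(\<beta> a c \<lhd> b) \<lhd> d, \<alpha>' a c b \<lhd> d, (a \<rhd> \<beta> b c) \<lhd> d, \<alpha> a b c \<lhd> d]),
   ([c \<rhd> \<alpha> d a b, c \<rhd> (\<beta> a d \<lhd> b), c \<rhd> \<alpha>' a d b], alnat3 c a (\<beta> b d),
     [\<alpha> (c \<otimes> a) b d, (\<beta> a c \<lhd> b) \<lhd> d, \<alpha>' a c b \<lhd> d, (a \<rhd> \<beta> b c) \<lhd> d, \<alpha> a b c \<lhd> d]),
   ([c \<rhd> \<alpha> d a b, c \<rhd> (\<beta> a d \<lhd> b), c \<rhd> \<alpha>' a d b, \<alpha> c a (d \<otimes> b), (c \<otimes> a) \<rhd> \<beta> b d],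
     iv (alnat1 (\<beta> a c) b d), [\<alpha>' a c b \<lhd> d, (a \<rhd> \<beta> b c) \<lhd> d, \<alpha> a b c \<lhd> d]),
   ([c \<rhd> \<alpha> d a b, c \<rhd> (\<beta> a d \<lhd> b), c \<rhd> \<alpha>' a d b, \<alpha> c a (d \<otimes> b)],
     xchg (\<beta> a c) (\<beta> b d), [\<alpha> (a \<otimes> c) b d, \<alpha>' a c b \<lhd> d, (a \<rhd> \<beta> b c) \<lhd> d, \<alpha> a b c \<lhd> d])]
  [([\<alpha> c d (a \<otimes> b)], Sh a b (c \<otimes> d), [\<alpha> (a \<otimes> b) c d]),
   ([\<alpha> c d (a \<otimes> b), \<alpha> (c \<otimes> d) a b], rt (Rh a c d) b,
     [\<alpha>' a (c \<otimes> d) b, a \<rhd> \<beta> b (c \<otimes> d), \<alpha> a b (c \<otimes> d), \<alpha> (a \<otimes> b) c d]),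
   ([\<alpha> c d (a \<otimes> b), \<alpha> (c \<otimes> d) a b, \<alpha>' c d a \<lhd> b, (c \<rhd> \<beta> a d) \<lhd> b, \<alpha> c a d \<lhd> b, (\<beta> a c \<lhd> d) \<lhd> b,
     \<alpha>' a c d \<lhd> b, \<alpha>' a (c \<otimes> d) b], lt a (Rh b c d), [\<alpha> a b (c \<otimes> d), \<alpha> (a \<otimes> b) c d]),
   ([\<alpha> c d (a \<otimes> b), \<alpha> (c \<otimes> d) a b, \<alpha>' c d a \<lhd> b, (c \<rhd> \<beta> a d) \<lhd> b, \<alpha> c a d \<lhd> b, (\<beta> a c \<lhd> d) \<lhd> b,
     \<alpha>' a c d \<lhd> b, \<alpha>' a (c \<otimes> d) b, a \<rhd> \<alpha>' c d b, a \<rhd> (c \<rhd> \<beta> b d), a \<rhd> \<alpha> c b d, a \<rhd> (\<beta> b c \<lhd> d),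
     a \<rhd> \<alpha>' b c d], iv (Pi a b c d), []),
   ([\<alpha> c d (a \<otimes> b), \<alpha> (c \<otimes> d) a b, \<alpha>' c d a \<lhd> b, (c \<rhd> \<beta> a d) \<lhd> b, \<alpha> c a d \<lhd> b, (\<beta> a c \<lhd> d) \<lhd> b,
     \<alpha>' a c d \<lhd> b, \<alpha>' a (c \<otimes> d) b, a \<rhd> \<alpha>' c d b, a \<rhd> (c \<rhd> \<beta> b d), a \<rhd> \<alpha> c b d, a \<rhd> (\<beta> b c \<lhd> d)],
     iv (lt a (Au b c d)), [\<alpha> a (b \<otimes> c) d, \<alpha> a b c \<lhd> d]),
   ([\<alpha> c d (a \<otimes> b), \<alpha> (c \<otimes> d) a b, \<alpha>' c d a \<lhd> b, (c \<rhd> \<beta> a d) \<lhd> b, \<alpha> c a d \<lhd> b, (\<beta> a c \<lhd> d) \<lhd> b,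
     \<alpha>' a c d \<lhd> b, \<alpha>' a (c \<otimes> d) b, a \<rhd> \<alpha>' c d b, a \<rhd> (c \<rhd> \<beta> b d), a \<rhd> \<alpha> c b d],
     alnat2 a (\<beta> b c) d, [\<alpha> a b c \<lhd> d]),
   ([\<alpha> c d (a \<otimes> b), \<alpha> (c \<otimes> d) a b, \<alpha>' c d a \<lhd> b, (c \<rhd> \<beta> a d) \<lhd> b, \<alpha> c a d \<lhd> b, (\<beta> a c \<lhd> d) \<lhd> b,
     \<alpha>' a c d \<lhd> b, \<alpha>' a (c \<otimes> d) b, a \<rhd> \<alpha>' c d b, a \<rhd> (c \<rhd> \<beta> b d), a \<rhd> \<alpha> c b d, \<alpha> a (c \<otimes> b) d],
     iv (rt (Ac a c b) d), [(a \<rhd> \<beta> b c) \<lhd> d, \<alpha> a b c \<lhd> d]),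
   ([\<alpha> c d (a \<otimes> b), \<alpha> (c \<otimes> d) a b, \<alpha>' c d a \<lhd> b, (c \<rhd> \<beta> a d) \<lhd> b, \<alpha> c a d \<lhd> b, (\<beta> a c \<lhd> d) \<lhd> b,
     \<alpha>' a c d \<lhd> b, \<alpha>' a (c \<otimes> d) b, a \<rhd> \<alpha>' c d b, a \<rhd> (c \<rhd> \<beta> b d)],
     Pi a c b d, [\<alpha>' a c b \<lhd> d, (a \<rhd> \<beta> b c) \<lhd> d, \<alpha> a b c \<lhd> d]),
   ([\<alpha> c d (a \<otimes> b), \<alpha> (c \<otimes> d) a b, \<alpha>' c d a \<lhd> b, (c \<rhd> \<beta> a d) \<lhd> b, \<alpha> c a d \<lhd> b, (\<beta> a c \<lhd> d) \<lhd> b,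
     \<alpha>' a c d \<lhd> b, \<alpha>' a (c \<otimes> d) b, a \<rhd> \<alpha>' c d b],
     alnat3 a c (\<beta> b d), [\<alpha> (a \<otimes> c) b d, \<alpha>' a c b \<lhd> d, (a \<rhd> \<beta> b c) \<lhd> d, \<alpha> a b c \<lhd> d]),
   ([\<alpha> c d (a \<otimes> b), \<alpha> (c \<otimes> d) a b, \<alpha>' c d a \<lhd> b, (c \<rhd> \<beta> a d) \<lhd> b, \<alpha> c a d \<lhd> b, (\<beta> a c \<lhd> d) \<lhd> b],
     Pis a c d b,
     [\<alpha> a c (d \<otimes> b), (a \<otimes> c) \<rhd> \<beta> b d, \<alpha> (a \<otimes> c) b d, \<alpha>' a c b \<lhd> d, (a \<rhd> \<beta> b c) \<lhd> d, \<alpha> a b c \<lhd> d]),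
   ([\<alpha> c d (a \<otimes> b), \<alpha> (c \<otimes> d) a b, \<alpha>' c d a \<lhd> b, (c \<rhd> \<beta> a d) \<lhd> b, \<alpha> c a d \<lhd> b, (\<beta> a c \<lhd> d) \<lhd> b,
     \<alpha>' (a \<otimes> c) d b], iv (Au a c (d \<otimes> b)),
     [(a \<otimes> c) \<rhd> \<beta> b d, \<alpha> (a \<otimes> c) b d, \<alpha>' a c b \<lhd> d, (a \<rhd> \<beta> b c) \<lhd> d, \<alpha> a b c \<lhd> d]),
   ([\<alpha> c d (a \<otimes> b), \<alpha> (c \<otimes> d) a b, \<alpha>' c d a \<lhd> b, (c \<rhd> \<beta> a d) \<lhd> b, \<alpha> c a d \<lhd> b],
     alsnat1 (\<beta> a c) d b,
     [(a \<otimes> c) \<rhd> \<beta> b d, \<alpha> (a \<otimes> c) b d, \<alpha>' a c b \<lhd> d, (a \<rhd> \<beta> b c) \<lhd> d, \<alpha> a b c \<lhd> d]),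
   ([\<alpha> c d (a \<otimes> b), \<alpha> (c \<otimes> d) a b, \<alpha>' c d a \<lhd> b, (c \<rhd> \<beta> a d) \<lhd> b],
     Au c (a \<otimes> d) b,
     [\<alpha> c a d \<lhd> b, \<alpha>' (c \<otimes> a) d b, \<beta> a c \<lhd> (d \<otimes> b), (a \<otimes> c) \<rhd> \<beta> b d, \<alpha> (a \<otimes> c) b d,
      \<alpha>' a c b \<lhd> d, (a \<rhd> \<beta> b c) \<lhd> d, \<alpha> a b c \<lhd> d]),
   ([\<alpha> c d (a \<otimes> b), \<alpha> (c \<otimes> d) a b, \<alpha>' c d a \<lhd> b, (c \<rhd> \<beta> a d) \<lhd> b, \<alpha>' c (a \<otimes> d) b],
     lt c (Au a d b),
     [\<alpha> c (a \<otimes> d) b, \<alpha> c a d \<lhd> b, \<alpha>' (c \<otimes> a) d b, \<beta> a c \<lhd> (d \<otimes> b), (a \<otimes> c) \<rhd> \<beta> b d, \<alpha> (a \<otimes> c) b d,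
      \<alpha>' a c b \<lhd> d, (a \<rhd> \<beta> b c) \<lhd> d, \<alpha> a b c \<lhd> d]),
   ([\<alpha> c d (a \<otimes> b), \<alpha> (c \<otimes> d) a b, \<alpha>' c d a \<lhd> b, (c \<rhd> \<beta> a d) \<lhd> b, \<alpha>' c (a \<otimes> d) b, c \<rhd> \<alpha>' a d b],
     Pi c a d b,
     [\<alpha>' (c \<otimes> a) d b, \<beta> a c \<lhd> (d \<otimes> b), (a \<otimes> c) \<rhd> \<beta> b d, \<alpha> (a \<otimes> c) b d,
      \<alpha>' a c b \<lhd> d, (a \<rhd> \<beta> b c) \<lhd> d, \<alpha> a b c \<lhd> d]),
   ([\<alpha> c d (a \<otimes> b), \<alpha> (c \<otimes> d) a b, \<alpha>' c d a \<lhd> b, (c \<rhd> \<beta> a d) \<lhd> b, \<alpha>' c (a \<otimes> d) b, c \<rhd> \<alpha>' a d b,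
     \<alpha> c a (d \<otimes> b)], Ac (c \<otimes> a) d b,
     [\<beta> a c \<lhd> (d \<otimes> b), (a \<otimes> c) \<rhd> \<beta> b d, \<alpha> (a \<otimes> c) b d,
      \<alpha>' a c b \<lhd> d, (a \<rhd> \<beta> b c) \<lhd> d, \<alpha> a b c \<lhd> d]),
   ([\<alpha> c d (a \<otimes> b), \<alpha> (c \<otimes> d) a b, \<alpha>' c d a \<lhd> b], alsnat2 c (\<beta> a d) b,
     [c \<rhd> \<alpha>' a d b, \<alpha> c a (d \<otimes> b), \<beta> a c \<lhd> (d \<otimes> b), (a \<otimes> c) \<rhd> \<beta> b d, \<alpha> (a \<otimes> c) b d,
      \<alpha>' a c b \<lhd> d, (a \<rhd> \<beta> b c) \<lhd> d, \<alpha> a b c \<lhd> d]),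
   ([], iv (Pi c d a b),
     [\<alpha>' c d a \<lhd> b, \<alpha>' c (d \<otimes> a) b, c \<rhd> (\<beta> a d \<lhd> b),
      c \<rhd> \<alpha>' a d b, \<alpha> c a (d \<otimes> b), \<beta> a c \<lhd> (d \<otimes> b), (a \<otimes> c) \<rhd> \<beta> b d, \<alpha> (a \<otimes> c) b d,
      \<alpha>' a c b \<lhd> d, (a \<rhd> \<beta> b c) \<lhd> d, \<alpha> a b c \<lhd> d]),
   ([c \<rhd> \<alpha> d a b, \<alpha> c (d \<otimes> a) b], rt (Ac c d a) b,
     [\<alpha>' c (d \<otimes> a) b, c \<rhd> (\<beta> a d \<lhd> b),
      c \<rhd> \<alpha>' a d b, \<alpha> c a (d \<otimes> b), \<beta> a c \<lhd> (d \<otimes> b), (a \<otimes> c) \<rhd> \<beta> b d, \<alpha> (a \<otimes> c) b d,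
      \<alpha>' a c b \<lhd> d, (a \<rhd> \<beta> b c) \<lhd> d, \<alpha> a b c \<lhd> d]),
   ([c \<rhd> \<alpha> d a b], Ac c (d \<otimes> a) b,
     [c \<rhd> (\<beta> a d \<lhd> b), c \<rhd> \<alpha>' a d b, \<alpha> c a (d \<otimes> b), \<beta> a c \<lhd> (d \<otimes> b), (a \<otimes> c) \<rhd> \<beta> b d,
      \<alpha> (a \<otimes> c) b d, \<alpha>' a c b \<lhd> d, (a \<rhd> \<beta> b c) \<lhd> d, \<alpha> a b c \<lhd> d])]"

definition "yang_baxter a b c \<longleftrightarrow> commutes ((a \<otimes> b) \<otimes> c)
  [\<beta> b c \<lhd> a, \<alpha>' b c a, b \<rhd> \<beta> a c, \<alpha> b a c, \<beta> a b \<lhd> c]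
  [([\<beta> b c \<lhd> a, \<alpha>' b c a], R a b c, []),
   ([\<beta> b c \<lhd> a], iv (Au b c a), [\<beta> a (b \<otimes> c), \<alpha> a b c]),
   ([], brnat2 a (\<beta> b c), [\<alpha> a b c]),
   ([], Rh a c b, [a \<rhd> \<beta> b c, \<alpha> a b c])]
  [([], S b a c, [\<alpha> b a c, \<beta> a b \<lhd> c]),
   ([\<alpha>' c b a, \<beta> (b \<otimes> a) c], iv (Au b a c), [\<beta> a b \<lhd> c]),
   ([\<alpha>' c b a], iv (brnat1 (\<beta> a b) c), []),
   ([\<alpha>' c b a, c \<rhd> \<beta> a b], Sh a b c, [])]"

subsection \<open>Axioms of a symmetric syllepsis\<close>

definition "syllepsis12 a b c \<longleftrightarrow> commutes ((a \<otimes> b) \<otimes> c) []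
  [([], rt (Syl a b) c, []),
   ([\<beta> b a \<lhd> c], Au b a c, [\<beta> a b \<lhd> c]),
   ([\<beta> b a \<lhd> c, \<alpha>' b a c], lt b (Syl a c), [\<alpha> b a c, \<beta> a b \<lhd> c]),
   ([\<beta> b a \<lhd> c, \<alpha>' b a c, b \<rhd> \<beta> c a], R a b c, []),
   ([], S b c a, [\<alpha> b c a, \<beta> a (b \<otimes> c), \<alpha> a b c]),
   ([\<alpha>' a b c, \<beta> (b \<otimes> c) a], iv (Au b c a), [\<beta> a (b \<otimes> c), \<alpha> a b c])]
  [([], Au a b c, []),
   ([\<alpha>' a b c], Syl a (b \<otimes> c), [\<alpha> a b c])]"

definition "syllepsis21 a b c \<longleftrightarrow> commutes (a \<otimes> (b \<otimes> c)) []
  [([], lt a (Syl b c), []),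
   ([a \<rhd> \<beta> c b], iv (Ac a c b), [a \<rhd> \<beta> b c]),
   ([a \<rhd> \<beta> c b, \<alpha> a c b], rt (Syl a c) b, [\<alpha>' a c b, a \<rhd> \<beta> b c]),
   ([a \<rhd> \<beta> c b, \<alpha> a c b, \<beta> c a \<lhd> b], S a b c, []),
   ([], R c a b, [\<alpha>' c a b, \<beta> (a \<otimes> b) c, \<alpha>' a b c]),
   ([\<alpha> a b c, \<beta> c (a \<otimes> b)], Ac c a b, [\<beta> (a \<otimes> b) c, \<alpha>' a b c])]
  [([], iv (Ac a b c), []),
   ([\<alpha> a b c], Syl (a \<otimes> b) c, [\<alpha>' a b c])]"

definition "symmetry_axiom a b \<longleftrightarrow> commutes (a \<otimes> b) [\<beta> a b]
  [([\<beta> a b], Syl a b, [])]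
  [([], Syl b a, [\<beta> a b])]"

end

locale symmetric_monoidal_bicategory = symmetric_monoidal_data B M + bicategory B
  for B :: "('o, 'm, 'c) bicat" and M :: "('o, 'm, 'c) symmon" +
  assumes tensor: "pseudofunctor B2 B (tensor M)"
    and unit_obj: "I \<in> obj B"
    and al_equiv: "adjoint_equivalence B3 B ((P1of3 \<Otimes> P2of3) \<Otimes> P3of3) (P1of3 \<Otimes> (P2of3 \<Otimes> P3of3))
      (al M) (als M) (al_unit M) (al_counit M)"
    and lu_equiv: "\<exists>\<tau> \<eta> \<epsilon>. adjoint_equivalence B B (constI \<Otimes> idF B) (idF B) (lu M) \<tau> \<eta> \<epsilon>"
    and ru_equiv: "\<exists>\<tau> \<eta> \<epsilon>. adjoint_equivalence B B (idF B) (idF B \<Otimes> constI) (ru M) \<tau> \<eta> \<epsilon>"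
    and br_equiv: "\<exists>\<tau> \<eta> \<epsilon>. adjoint_equivalence B2 B (P1of2 \<Otimes> P2of2) (P2of2 \<Otimes> P1of2) (br M) \<tau> \<eta> \<epsilon>"
    and pi_modification: "let F = ((P1of4 \<Otimes> P2of4) \<Otimes> P3of4) \<Otimes> P4of4; G = P1of4 \<Otimes> (P2of4 \<Otimes> (P3of4 \<Otimes> P4of4)) in
      invertible_modification B4 B F G
        (compT B4 B F [tlT B4 P1of4 (alT P2of4 P3of4 P4of4), alT P1of4 (P2of4 \<Otimes> P3of4) P4of4,
           trT B4 (alT P1of4 P2of4 P3of4) P4of4])
        (compT B4 B F [alT P1of4 P2of4 (P3of4 \<Otimes> P4of4), alT (P1of4 \<Otimes> P2of4) P3of4 P4of4])
        (piM M)"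
    and mu_modification: "let F = P1of2 \<Otimes> P2of2 in
      invertible_modification B2 B F F
        (compT B2 B F [tlT B2 P1of2 (luT P2of2), alT P1of2 constI P2of2, trT B2 (ruT P1of2) P2of2])
        (compT B2 B F [])
        (muM M)"
    and lam_modification: "let F = (constI \<Otimes> P1of2) \<Otimes> P2of2; G = P1of2 \<Otimes> P2of2 in
      invertible_modification B2 B F G
        (compT B2 B F [trT B2 (luT P1of2) P2of2])
        (compT B2 B F [luT (P1of2 \<Otimes> P2of2), alT constI P1of2 P2of2])
        (lamM M)"
    and rho_modification: "let F = P1of2 \<Otimes> P2of2; G = P1of2 \<Otimes> (P2of2 \<Otimes> constI) in
      invertible_modification B2 B F G
        (compT B2 B F [tlT B2 P1of2 (ruT P2of2)])
        (compT B2 B F [alT P1of2 P2of2 constI, ruT (P1of2 \<Otimes> P2of2)])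
        (rhoM M)"
    and r_modification: "let F = (P1of3 \<Otimes> P2of3) \<Otimes> P3of3; G = P2of3 \<Otimes> (P3of3 \<Otimes> P1of3) in
      invertible_modification B3 B F G
        (compT B3 B F [tlT B3 P2of3 (brT P1of3 P3of3), alT P2of3 P1of3 P3of3,
           trT B3 (brT P1of3 P2of3) P3of3])
        (compT B3 B F [alT P2of3 P3of3 P1of3, brT P1of3 (P2of3 \<Otimes> P3of3), alT P1of3 P2of3 P3of3])
        (rM M)"
    and s_modification: "let F = P1of3 \<Otimes> (P2of3 \<Otimes> P3of3); G = (P3of3 \<Otimes> P1of3) \<Otimes> P2of3 in
      invertible_modification B3 B F G
        (compT B3 B F [trT B3 (brT P1of3 P3of3) P2of3, alsT P1of3 P3of3 P2of3,
           tlT B3 P1of3 (brT P2of3 P3of3)])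
        (compT B3 B F [alsT P3of3 P1of3 P2of3, brT (P1of3 \<Otimes> P2of3) P3of3, alsT P1of3 P2of3 P3of3])
        (sM M)"
    and syl_modification: "let F = P1of2 \<Otimes> P2of2 in
      invertible_modification B2 B F F
        (compT B2 B F []) (compT B2 B F [brT P2of2 P1of2, brT P1of2 P2of2])
        (sylM M)"
    and cocycle: "\<lbrakk>a \<in> obj B; b \<in> obj B; c \<in> obj B; d \<in> obj B; e \<in> obj B\<rbrakk>
      \<Longrightarrow> nonabelian_cocycle a b c d e"
    and normalization: "\<lbrakk>a \<in> obj B; b \<in> obj B; c \<in> obj B\<rbrakk>
      \<Longrightarrow> left_normalization a b c \<and> right_normalization a b c"
    and crossing: "\<lbrakk>a \<in> obj B; b \<in> obj B; c \<in> obj B; d \<in> obj B\<rbrakk>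
      \<Longrightarrow> crossing13 a b c d \<and> crossing31 a b c d \<and> crossing22 a b c d"
    and yang_baxter: "\<lbrakk>a \<in> obj B; b \<in> obj B; c \<in> obj B\<rbrakk> \<Longrightarrow> yang_baxter a b c"
    and syllepsis: "\<lbrakk>a \<in> obj B; b \<in> obj B; c \<in> obj B\<rbrakk> \<Longrightarrow> syllepsis12 a b c \<and> syllepsis21 a b c"
    and symmetry: "\<lbrakk>a \<in> obj B; b \<in> obj B\<rbrakk> \<Longrightarrow> symmetry_axiom a b"

locale zero_closed_symmetric_monoidal_bicategory = symmetric_monoidal_bicategory +
  assumes zero_closed: "a \<in> obj B \<Longrightarrow> \<exists>H \<eta> \<epsilon> s t. biadjunction B B (tensR a) H \<eta> \<epsilon> s t"


section \<open>Lax contravariant volutive structures\<close>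

text \<open>
  Here \<open>d : B \<rightarrow> B\<^sup>1\<^sup>o\<^sup>p\<close> and \<open>\<eta> : id \<rightarrow> d\<^sup>1\<^sup>o\<^sup>p \<circ> d\<close>.  The modification \<open>\<tau>\<close> goes from
  \<open>d\<^sup>1\<^sup>o\<^sup>p \<rightarrow> d\<^sup>1\<^sup>o\<^sup>p d d\<^sup>1\<^sup>o\<^sup>p \<rightarrow> d\<^sup>1\<^sup>o\<^sup>p\<close>, with components \<open>d (\<eta>\<^sub>a) \<circ> \<eta>\<^bsub>d a\<^esub>\<close>, to the identity of
  \<open>d\<^sup>1\<^sup>o\<^sup>p : B\<^sup>1\<^sup>o\<^sup>p \<rightarrow> B\<close>.  In the coherence condition \<open>D\<close> is \<open>d (\<tau>\<^sub>a)\<close>, made into a 2-cell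
  \<open>d (\<eta>\<^bsub>d a\<^esub>) \<circ> d (d \<eta>\<^sub>a) \<Rightarrow> id\<close> by the structure 2-cells of \<open>d\<close>.
\<close>

definition lax_contravariant_O1_volutive ::
  "('o, 'm, 'c) bicat \<Rightarrow> ('o, 'm, 'c, 'o, 'm, 'c) pfun \<Rightarrow> ('o, 'm, 'c, 'o, 'm, 'c) ptrans
    \<Rightarrow> ('o \<Rightarrow> 'c) \<Rightarrow> bool" where
  "lax_contravariant_O1_volutive B d \<eta> \<tau> \<longleftrightarrow>
     pseudofunctor B (opB B) d \<and>
     pseudonatural B B (idF B) (compF B (opF d) d) \<eta> \<and>
     invertible_modification (opB B) B (opF d) (opF d)
       (vcT (opB B) B (whiskL (opB B) B (opF d) (opT B \<eta>)) (whiskR B \<eta> (opF d)))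
       (idT B (opF d)) \<tau> \<and>
     (\<forall>a\<in>obj B.
        let da = F0 d a; dda = F0 d da; e = t1 \<eta> a; de = F1 d e; d_eda = F1 d (t1 \<eta> da);
            D = PCell dda [d_eda, F1 d de] []
              (vc B (inv2 B (Fu d da)) (vc B (F2 d (\<tau> a)) (Fc d de (t1 \<eta> da))));
            T = PCell dda [d_eda, t1 \<eta> dda] [] (\<tau> da);
            N = PCell a [F1 d de, e] [t1 \<eta> dda, e] (t2 \<eta> e)
        in paste B a [d_eda, F1 d de, e] [([], D, [e])] =
           paste B a [d_eda, F1 d de, e] [([d_eda], N, []), ([], T, [e])])"

end

theory Submission
  imports Defs
begin

text \<open>
  Let \<open>I\<close> be the unit and \<open>d a = I\<^sup>a\<close>, with evaluation \<open>ev\<^sub>a : d a \<otimes> a \<rightarrow> I\<close>.  The categories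
  \<open>P(c, a) = Hom(c \<otimes> a, I)\<close> form a pseudofunctor in both variables, and the braiding gives equivalences
  \<open>P(c, a) \<simeq> P(a, c)\<close> which are mutually inverse by the syllepsis, coherently by the symmetry axiom.  So
  \<open>P\<close> is a symmetric pairing, and after replacing its categories by equivalent ones both actions commute
  strictly with each other and the symmetry is a strict involution.  Now \<open>d f\<close> is determined
  up to isomorphism by \<open>ev\<^sub>a \<circ> (d f \<otimes> a) \<cong> ev\<^sub>b \<circ> (d b \<otimes> f)\<close>, and \<open>\<eta>\<^sub>a : a \<rightarrow> d (d a)\<close> by the condition that it
  represents the image of \<open>ev\<^sub>a\<close> under the involution.  Since \<open>Hom(c, d a) \<rightarrow> P(c, a)\<close>, \<open>h \<mapsto> ev\<^sub>a \<circ> (h \<otimes> a)\<close>, is an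
  equivalence, all 2-cells, \<open>\<tau>\<close> included, can be defined and all equations between them checked after
  evaluation.
\<close>

text \<open>The equivalences Hom(c, d a) ~ P(c, a) ~ P(a, c) ~ Hom(a, d c) say that d is adjoint to
  itself on the right. Its unit and counit are both \<eta>, both triangle 2-cells are instances of
  \<tau>, and the required coherence has the shape of the swallowtail identity. Accordingly \<tau>
  at \<open>a\<close> arises by using the isomorphism that defines \<eta> twice: once for
  \<open>d a\<close>, and once for \<open>a\<close> after reflecting it in the involution.

  What shapes the proof is the bookkeeping. With the original pairing an evaluated 2-cell also
  carries the interchange of the two tensor factors, the naturality cells of the braiding and the
  syllepsis. These are dealt with once, in the passage to formal objects: a 1-morphism acting in
  either variable is merely recorded, and the involution merely toggles a flag. Afterwards
  interchange is an equality of objects and the second action is expressed through the first, so a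
  law is proved in one variable and reflected into the other.\<close>

context bicategory
begin

section \<open>Invertible 2-cells and unit coherence in a bicategory\<close>

definition isoc :: "'c \<Rightarrow> bool" where
  "isoc u \<longleftrightarrow> (\<exists>v. is_inv2 B u v)"

lemma arr1_hom1: "f \<in> arr1 B \<Longrightarrow> f \<in> hom1 B (src B f) (trg B f)"
  by (simp add: hom1_def)

lemma arr2_hom2: "u \<in> arr2 B \<Longrightarrow> u \<in> hom2 B (dom2 B u) (cod2 B u)"
  by (simp add: hom2_def)

lemma src_obj [simp]: "f \<in> arr1 B \<Longrightarrow> src B f \<in> obj B"
  and trg_obj [simp]: "f \<in> arr1 B \<Longrightarrow> trg B f \<in> obj B"
  using src_trg by auto

lemma dom2_arr1 [simp]: "u \<in> arr2 B \<Longrightarrow> dom2 B u \<in> arr1 B"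
  and cod2_arr1 [simp]: "u \<in> arr2 B \<Longrightarrow> cod2 B u \<in> arr1 B"
  and src_cod2 [simp]: "u \<in> arr2 B \<Longrightarrow> src B (cod2 B u) = src B (dom2 B u)"
  and trg_cod2 [simp]: "u \<in> arr2 B \<Longrightarrow> trg B (cod2 B u) = trg B (dom2 B u)"
  using dom_cod by auto

lemma id1_simps [simp]:
  "a \<in> obj B \<Longrightarrow> id1 B a \<in> arr1 B"
  "a \<in> obj B \<Longrightarrow> src B (id1 B a) = a"
  "a \<in> obj B \<Longrightarrow> trg B (id1 B a) = a"
  using id1_hom by (auto simp: hom1_def)

lemma id2_simps [simp]:
  "f \<in> arr1 B \<Longrightarrow> id2 B f \<in> arr2 B"
  "f \<in> arr1 B \<Longrightarrow> dom2 B (id2 B f) = f"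
  "f \<in> arr1 B \<Longrightarrow> cod2 B (id2 B f) = f"
  using id2_hom by (auto simp: hom2_def)

lemma cmp1_simps [simp]:
  assumes "f \<in> arr1 B" "g \<in> arr1 B" "trg B f = src B g"
  shows "cmp1 B g f \<in> arr1 B" "src B (cmp1 B g f) = src B f" "trg B (cmp1 B g f) = trg B g"
  using cmp1_hom[of f "src B f" "trg B f" g "trg B g"] assms by (auto simp: hom1_def)

lemma vc_simps [simp]:
  assumes "u \<in> arr2 B" "v \<in> arr2 B" "cod2 B u = dom2 B v"
  shows "vc B v u \<in> arr2 B" "dom2 B (vc B v u) = dom2 B u" "cod2 B (vc B v u) = cod2 B v"
  using vc_hom[of u "dom2 B u" "cod2 B u" v "cod2 B v"] assms by (auto simp: hom2_def)

lemma hc_simps [simp]: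
  assumes "u \<in> arr2 B" "v \<in> arr2 B" "trg B (dom2 B u) = src B (dom2 B v)"
  shows "hc B v u \<in> arr2 B" "dom2 B (hc B v u) = cmp1 B (dom2 B v) (dom2 B u)"
    "cod2 B (hc B v u) = cmp1 B (cod2 B v) (cod2 B u)"
  using hc_hom[of u "dom2 B u" "cod2 B u" v "dom2 B v" "cod2 B v"] assms by (auto simp: hom2_def)

lemma vc_id_simps [simp]:
  "\<lbrakk>u \<in> arr2 B; dom2 B u = f\<rbrakk> \<Longrightarrow> vc B u (id2 B f) = u"
  "\<lbrakk>u \<in> arr2 B; cod2 B u = f\<rbrakk> \<Longrightarrow> vc B (id2 B f) u = u"
  using vc_id[of u "dom2 B u" "cod2 B u"] by (auto simp: hom2_def)

lemma vc_assoc' [simp]: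
  assumes "u \<in> arr2 B" "v \<in> arr2 B" "w \<in> arr2 B" "cod2 B u = dom2 B v" "cod2 B v = dom2 B w"
  shows "vc B (vc B w v) u = vc B w (vc B v u)"
  using vc_assoc[of u "dom2 B u" "dom2 B v" v "dom2 B w" w "cod2 B w"] assms by (auto simp: hom2_def)

text \<open>Composites are kept bracketed to the right, so an equation for a two-fold composite is
  not visible inside a longer chain. This form extends it by a tail \<open>u\<close>.\<close>

lemma vc_reassoc:
  assumes "vc B w v = x" "u \<in> arr2 B" "v \<in> arr2 B" "w \<in> arr2 B" "cod2 B u = dom2 B v" "cod2 B v = dom2 B w"
  shows "vc B w (vc B v u) = vc B x u"
  using assms by (simp flip: vc_assoc')

lemma hc_id_simps [simp]:
  assumes "f \<in> arr1 B" "g \<in> arr1 B" "trg B f = src B g"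
  shows "hc B (id2 B g) (id2 B f) = id2 B (cmp1 B g f)"
  using hc_id[of f "src B f" "trg B f" g "trg B g"] assms by (auto simp: hom1_def)

lemma interchange':
  assumes "u \<in> arr2 B" "u' \<in> arr2 B" "v \<in> arr2 B" "v' \<in> arr2 B"
    "cod2 B u = dom2 B u'" "cod2 B v = dom2 B v'" "trg B (dom2 B u) = src B (dom2 B v)"
  shows "vc B (hc B v' u') (hc B v u) = hc B (vc B v' v) (vc B u' u)"
  using interchange[of u "dom2 B u" "dom2 B u'" u' "cod2 B u'" v "dom2 B v" "dom2 B v'" v' "cod2 B v'"] assms
  by (auto simp: hom2_def)

text \<open>Two inverses of the same 2-cell agree, so the definite description in
  \<open>inv2\<close> denotes.\<close>

lemma isoc_inv2:
  assumes "isoc u"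
  shows "is_inv2 B u (inv2 B u)"
proof -
  obtain v where v: "is_inv2 B u v" using assms isoc_def by auto
  have "w = v" if w: "is_inv2 B u w" for w
  proof -
    have t: "u \<in> arr2 B" "v \<in> arr2 B" "w \<in> arr2 B" "cod2 B u = dom2 B v" "cod2 B u = dom2 B w"
      "cod2 B v = dom2 B u" "cod2 B w = dom2 B u" "vc B v u = id2 B (dom2 B u)" "vc B u w = id2 B (cod2 B u)"
      using v w by (auto simp: is_inv2_def hom2_def)
    have "vc B (vc B v u) w = vc B v (vc B u w)" by (rule vc_assoc') (use t in auto)
    with t show "w = v" by simp
  qed
  with v show ?thesis unfolding inv2_def by (metis theI)
qed

lemma isoc_arr2: "isoc u \<Longrightarrow> u \<in> arr2 B"
  using isoc_inv2 by (auto simp: is_inv2_def)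

lemma isoc_simps [simp]:
  assumes "isoc u"
  shows "inv2 B u \<in> arr2 B" "dom2 B (inv2 B u) = cod2 B u" "cod2 B (inv2 B u) = dom2 B u"
    "vc B (inv2 B u) u = id2 B (dom2 B u)" "vc B u (inv2 B u) = id2 B (cod2 B u)"
  using isoc_inv2[OF assms] by (auto simp: is_inv2_def hom2_def)

lemma isocI:
  assumes "u \<in> arr2 B" "v \<in> arr2 B" "dom2 B v = cod2 B u" "cod2 B v = dom2 B u"
    "vc B v u = id2 B (dom2 B u)" "vc B u v = id2 B (cod2 B u)"
  shows "isoc u"
  using assms unfolding isoc_def is_inv2_def hom2_def by auto

lemma inv2_eqI:
  assumes "u \<in> arr2 B" "v \<in> arr2 B" "dom2 B v = cod2 B u" "cod2 B v = dom2 B u"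
    "vc B v u = id2 B (dom2 B u)" "vc B u v = id2 B (cod2 B u)"
  shows "inv2 B u = v"
proof -
  have i: "isoc u" using isocI assms by blast
  have "vc B (vc B v u) (inv2 B u) = vc B v (vc B u (inv2 B u))"
    by (rule vc_assoc') (use i assms in auto)
  with i assms show ?thesis by simp
qed

lemma iso2_iff: "u \<in> iso2 B f g \<longleftrightarrow> isoc u \<and> dom2 B u = f \<and> cod2 B u = g"
  unfolding iso2_def isoc_def hom2_def is_inv2_def by auto

lemma vc_inv_cancel [simp]:
  assumes "isoc u" "v \<in> arr2 B"
  shows "cod2 B v = dom2 B u \<Longrightarrow> vc B (inv2 B u) (vc B u v) = v"
    "cod2 B v = cod2 B u \<Longrightarrow> vc B u (vc B (inv2 B u) v) = v"
proof -
  note a [simp] = isoc_arr2[OF assms(1)]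
  show "cod2 B v = dom2 B u \<Longrightarrow> vc B (inv2 B u) (vc B u v) = v"
    using vc_assoc'[of v u "inv2 B u"] assms by simp
  show "cod2 B v = cod2 B u \<Longrightarrow> vc B u (vc B (inv2 B u) v) = v"
    using vc_assoc'[of v "inv2 B u" u] assms by simp
qed

lemma isoc_id2 [simp]: "f \<in> arr1 B \<Longrightarrow> isoc (id2 B f)"
  by (rule isocI[of _ "id2 B f"]) auto

lemma inv2_id2 [simp]: "f \<in> arr1 B \<Longrightarrow> inv2 B (id2 B f) = id2 B f"
  by (rule inv2_eqI) auto

lemma isoc_inv [simp]: "isoc u \<Longrightarrow> isoc (inv2 B u)"
  by (rule isocI[of _ u]) (auto simp: isoc_arr2)

lemma isoc_vc [simp]:
  assumes "isoc u" "isoc v" "cod2 B u = dom2 B v"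
  shows "isoc (vc B v u)" "inv2 B (vc B v u) = vc B (inv2 B u) (inv2 B v)"
proof -
  note a [simp] = isoc_arr2[OF assms(1)] isoc_arr2[OF assms(2)]
  show "isoc (vc B v u)"
    by (rule isocI[of _ "vc B (inv2 B u) (inv2 B v)"]) (use assms in auto)
  show "inv2 B (vc B v u) = vc B (inv2 B u) (inv2 B v)"
    by (rule inv2_eqI) (use assms in auto)
qed

lemma isoc_hc [simp]:
  assumes "isoc u" "isoc v" "trg B (dom2 B u) = src B (dom2 B v)"
  shows "isoc (hc B v u)" "inv2 B (hc B v u) = hc B (inv2 B v) (inv2 B u)"
proof -
  note a [simp] = isoc_arr2[OF assms(1)] isoc_arr2[OF assms(2)]
  have t: "trg B (cod2 B u) = src B (cod2 B v)" using assms by auto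
  have t': "trg B (dom2 B (inv2 B u)) = src B (dom2 B (inv2 B v))" using assms t by simp
  have "vc B (hc B (inv2 B v) (inv2 B u)) (hc B v u) = id2 B (dom2 B (hc B v u))"
    "vc B (hc B v u) (hc B (inv2 B v) (inv2 B u)) = id2 B (cod2 B (hc B v u))"
    using interchange'[of u "inv2 B u" v "inv2 B v"] interchange'[of "inv2 B u" u "inv2 B v" v] assms t' by auto
  then show "isoc (hc B v u)" "inv2 B (hc B v u) = hc B (inv2 B v) (inv2 B u)"
    using isocI[of "hc B v u" "hc B (inv2 B v) (inv2 B u)"]
      inv2_eqI[of "hc B v u" "hc B (inv2 B v) (inv2 B u)"] assms t' by auto
qed

lemma iso_cancel_left:
  assumes "isoc w" "vc B w u = vc B w v" "u \<in> arr2 B" "v \<in> arr2 B" "cod2 B u = dom2 B w" "cod2 B v = dom2 B w"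
  shows "u = v"
proof -
  have "vc B (inv2 B w) (vc B w u) = u" "vc B (inv2 B w) (vc B w v) = v"
    using assms(1,3-) by simp_all
  with assms(2) show ?thesis by metis
qed

lemma iso_cancel_right:
  assumes "isoc w" "vc B u w = vc B v w" "u \<in> arr2 B" "v \<in> arr2 B" "dom2 B u = cod2 B w" "dom2 B v = cod2 B w"
  shows "u = v"
proof -
  note isoc_arr2[OF assms(1), simp]
  have "vc B (vc B u w) (inv2 B w) = u" "vc B (vc B v w) (inv2 B w) = v"
    using assms(1,3-) by simp_all
  with assms(2) show ?thesis by metis
qed

lemma asc_simps [simp]:
  assumes "f \<in> arr1 B" "g \<in> arr1 B" "h \<in> arr1 B" "trg B f = src B g" "trg B g = src B h"
  shows "isoc (asc B h g f)" "asc B h g f \<in> arr2 B" "dom2 B (asc B h g f) = cmp1 B (cmp1 B h g) f"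
    "cod2 B (asc B h g f) = cmp1 B h (cmp1 B g f)"
  using asc_iso[of f "src B f" "trg B f" g "trg B g" h "trg B h"] assms
  by (auto simp: hom1_def iso2_iff isoc_arr2)

lemma lun_simps [simp]:
  assumes "f \<in> arr1 B"
  shows "isoc (lun B f)" "lun B f \<in> arr2 B" "dom2 B (lun B f) = cmp1 B (id1 B (trg B f)) f" "cod2 B (lun B f) = f"
  using lun_iso[of f "src B f" "trg B f"] assms by (auto simp: hom1_def iso2_iff isoc_arr2)

lemma run_simps [simp]:
  assumes "f \<in> arr1 B"
  shows "isoc (run B f)" "run B f \<in> arr2 B" "dom2 B (run B f) = cmp1 B f (id1 B (src B f))" "cod2 B (run B f) = f"
  using run_iso[of f "src B f" "trg B f"] assms by (auto simp: hom1_def iso2_iff isoc_arr2)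

lemma asc_nat':
  assumes "u \<in> arr2 B" "v \<in> arr2 B" "w \<in> arr2 B"
    "trg B (dom2 B u) = src B (dom2 B v)" "trg B (dom2 B v) = src B (dom2 B w)"
  shows "vc B (asc B (cod2 B w) (cod2 B v) (cod2 B u)) (hc B (hc B w v) u) =
    vc B (hc B w (hc B v u)) (asc B (dom2 B w) (dom2 B v) (dom2 B u))"
  using asc_nat[of u _ _ v _ _ w] assms by (auto simp: hom2_def)

lemma lun_nat':
  "u \<in> arr2 B \<Longrightarrow> vc B (lun B (cod2 B u)) (hc B (id2 B (id1 B (trg B (dom2 B u)))) u) = vc B u (lun B (dom2 B u))"
  using lun_nat[of u "dom2 B u" "cod2 B u"] by (auto simp: hom2_def)

lemma run_nat':
  "u \<in> arr2 B \<Longrightarrow> vc B (run B (cod2 B u)) (hc B u (id2 B (id1 B (src B (dom2 B u))))) = vc B u (run B (dom2 B u))"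
  using run_nat[of u "dom2 B u" "cod2 B u"] by (auto simp: hom2_def)

lemma pentagon':
  assumes "f \<in> arr1 B" "g \<in> arr1 B" "h \<in> arr1 B" "k \<in> arr1 B"
    "trg B f = src B g" "trg B g = src B h" "trg B h = src B k"
  shows "vc B (asc B k h (cmp1 B g f)) (asc B (cmp1 B k h) g f)
        = vc B (hc B (id2 B k) (asc B h g f))
            (vc B (asc B k (cmp1 B h g) f) (hc B (asc B k h g) (id2 B f)))"
  using pentagon[of f "src B f" "trg B f" g "trg B g" h "trg B h" k "trg B k"] assms by (auto simp: hom1_def)

lemma triangle':
  assumes "f \<in> arr1 B" "g \<in> arr1 B" "trg B f = src B g"
  shows "vc B (hc B (id2 B g) (lun B f)) (asc B g (id1 B (src B g)) f) = hc B (run B g) (id2 B f)"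
  using triangle[of f "src B f" "trg B f" g "trg B g"] assms by (auto simp: hom1_def)

text \<open>The right unitor is a natural isomorphism from whiskering with an identity to the
  identity functor, and a functor isomorphic to the identity is faithful.\<close>

lemma run_faithful:
  assumes "hc B u (id2 B (id1 B (src B (dom2 B u)))) = hc B v (id2 B (id1 B (src B (dom2 B u))))"
    "u \<in> arr2 B" "v \<in> arr2 B" "dom2 B u = dom2 B v" "cod2 B u = cod2 B v"
  shows "u = v"
proof -
  have "vc B u (run B (dom2 B u)) = vc B v (run B (dom2 B u))"
    using run_nat'[of u] run_nat'[of v] assms(1) unfolding assms(4,5) using assms(2,3) by metis
  then show ?thesis
    by (rule iso_cancel_right[rotated]) (use assms in simp_all)
qed

lemma lun_faithful:
  assumes "hc B (id2 B (id1 B (trg B (dom2 B u)))) u = hc B (id2 B (id1 B (trg B (dom2 B u)))) v"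
    "u \<in> arr2 B" "v \<in> arr2 B" "dom2 B u = dom2 B v" "cod2 B u = cod2 B v"
  shows "u = v"
proof -
  have "vc B u (lun B (dom2 B u)) = vc B v (lun B (dom2 B u))"
    using lun_nat'[of u] lun_nat'[of v] assms(1) unfolding assms(4,5) using assms(2,3) by metis
  then show ?thesis
    by (rule iso_cancel_right[rotated]) (use assms in simp_all)
qed

text \<open>Kelly's argument: composition with an identity is faithful, and after it the two sides are
  related by the pentagon and three triangles.\<close>

lemma run_cmp1:
  assumes [simp]: "f \<in> arr1 B" "g \<in> arr1 B" "trg B f = src B g"
  shows "run B (cmp1 B g f) = vc B (hc B (id2 B g) (run B f)) (asc B g f (id1 B (src B f)))"
proof -
  let ?e = "id1 B (src B f)"
  let ?A = "asc B g f ?e"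
  let ?R = "vc B (hc B (id2 B g) (run B f)) ?A"
  let ?L = "hc B (id2 B g) (hc B (id2 B f) (lun B ?e))"
  have 0: "vc B ?A (hc B (id2 B (cmp1 B g f)) (lun B ?e)) = vc B ?L (asc B g f (cmp1 B ?e ?e))"
    using asc_nat'[of "lun B ?e" "id2 B f" "id2 B g"] by simp
  have "vc B ?A (hc B (run B (cmp1 B g f)) (id2 B ?e))
    = vc B ?A (vc B (hc B (id2 B (cmp1 B g f)) (lun B ?e)) (asc B (cmp1 B g f) ?e ?e))"
    using triangle'[of ?e "cmp1 B g f"] by simp
  also have "\<dots> = vc B ?L (vc B (asc B g f (cmp1 B ?e ?e)) (asc B (cmp1 B g f) ?e ?e))"
    using vc_reassoc[OF 0, of "asc B (cmp1 B g f) ?e ?e"] by simp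
  also have "\<dots> = vc B ?L (vc B (hc B (id2 B g) (asc B f ?e ?e))
            (vc B (asc B g (cmp1 B f ?e) ?e) (hc B ?A (id2 B ?e))))"
    using pentagon'[of ?e ?e f g] by simp
  also have "\<dots> = vc B (hc B (id2 B g) (hc B (run B f) (id2 B ?e)))
            (vc B (asc B g (cmp1 B f ?e) ?e) (hc B ?A (id2 B ?e)))"
  proof -
    have "vc B ?L (hc B (id2 B g) (asc B f ?e ?e)) = hc B (id2 B g) (hc B (run B f) (id2 B ?e))"
      using interchange'[of "asc B f ?e ?e" "hc B (id2 B f) (lun B ?e)" "id2 B g" "id2 B g"] triangle'[of ?e f]
      by simp
    from vc_reassoc[OF this, of "vc B (asc B g (cmp1 B f ?e) ?e) (hc B ?A (id2 B ?e))"] show ?thesis by simp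
  qed
  also have "\<dots> = vc B ?A (vc B (hc B (hc B (id2 B g) (run B f)) (id2 B ?e)) (hc B ?A (id2 B ?e)))"
  proof -
    have "vc B (hc B (id2 B g) (hc B (run B f) (id2 B ?e))) (asc B g (cmp1 B f ?e) ?e)
     = vc B ?A (hc B (hc B (id2 B g) (run B f)) (id2 B ?e))"
      using asc_nat'[of "id2 B ?e" "run B f" "id2 B g"] by simp
    from vc_reassoc[OF this, of "hc B ?A (id2 B ?e)"] show ?thesis by simp
  qed
  also have "vc B (hc B (hc B (id2 B g) (run B f)) (id2 B ?e)) (hc B ?A (id2 B ?e)) = hc B ?R (id2 B ?e)"
    using interchange'[of "id2 B ?e" "id2 B ?e" ?A "hc B (id2 B g) (run B f)"] by simp
  finally have "hc B (run B (cmp1 B g f)) (id2 B ?e) = hc B ?R (id2 B ?e)"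
    using iso_cancel_left[of ?A "hc B (run B (cmp1 B g f)) (id2 B ?e)" "hc B ?R (id2 B ?e)"] by simp
  then show ?thesis using run_faithful[of "run B (cmp1 B g f)" ?R] by simp
qed

text \<open>Naturality of \<open>run\<close> at the cell \<open>run B ?e\<close> itself shows that
  whiskering this cell with the identity gives \<open>run\<close> of the composite. Comparing
  \<open>run_cmp1\<close> with the triangle law and cancelling the associator leaves the two
  unitors, both whiskered with an identity.\<close>

lemma lun_id1_eq_run_id1:
  assumes "a \<in> obj B"
  shows "lun B (id1 B a) = run B (id1 B a)"
proof -
  let ?e = "id1 B a"
  have "vc B (run B ?e) (hc B (run B ?e) (id2 B ?e)) = vc B (run B ?e) (run B (cmp1 B ?e ?e))"
    using run_nat'[of "run B ?e"] assms by simp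
  then have "hc B (run B ?e) (id2 B ?e) = run B (cmp1 B ?e ?e)"
    using iso_cancel_left[of "run B ?e"] assms by simp
  then have "vc B (hc B (id2 B ?e) (lun B ?e)) (asc B ?e ?e ?e) = vc B (hc B (id2 B ?e) (run B ?e)) (asc B ?e ?e ?e)"
    using run_cmp1[of ?e ?e] triangle'[of ?e ?e] assms by simp
  then have "hc B (id2 B ?e) (lun B ?e) = hc B (id2 B ?e) (run B ?e)"
    using iso_cancel_right[of "asc B ?e ?e ?e" "hc B (id2 B ?e) (lun B ?e)" "hc B (id2 B ?e) (run B ?e)"] assms by simp
  then show ?thesis using lun_faithful[of "lun B ?e" "run B ?e"] assms by simp
qed

end

section \<open>Pseudo-actions of a bicategory on categories\<close>

text \<open>
  A record of this type stands for a pseudofunctor from \<open>B\<^sup>1\<^sup>o\<^sup>p\<close> to categories, written as a right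
  action: the objects \<open>X\<close> of all the categories are collected in \<open>Ob\<close>, and \<open>bs X\<close> is the object of
  \<open>B\<close> over which \<open>X\<close> lives.  \<open>ac\<close>, \<open>am\<close> and \<open>a2\<close> are the actions \<open>X \<cdot> k\<close>, \<open>u \<cdot> k\<close> and \<open>X \<cdot> w\<close> of 1-morphisms
  on objects, of 1-morphisms on morphisms and of 2-morphisms on objects.
\<close>

record ('o, 'm, 'c, 'x, 'y) rmod =
  Ob :: "'x set"
  bs :: "'x \<Rightarrow> 'o"
  Ar :: "'y set"
  dm :: "'y \<Rightarrow> 'x"
  cd :: "'y \<Rightarrow> 'x"
  one :: "'x \<Rightarrow> 'y"
  cp :: "'y \<Rightarrow> 'y \<Rightarrow> 'y"
  ac :: "'x \<Rightarrow> 'm \<Rightarrow> 'x"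
  am :: "'y \<Rightarrow> 'm \<Rightarrow> 'y"
  a2 :: "'x \<Rightarrow> 'c \<Rightarrow> 'y"
  io :: "'x \<Rightarrow> 'm \<Rightarrow> 'm \<Rightarrow> 'y"
  un :: "'x \<Rightarrow> 'y"

definition is_invP :: "('o, 'm, 'c, 'x, 'y) rmod \<Rightarrow> 'y \<Rightarrow> 'y \<Rightarrow> bool" where
  "is_invP Q u v \<longleftrightarrow> u \<in> Ar Q \<and> v \<in> Ar Q \<and> dm Q v = cd Q u \<and> cd Q v = dm Q u \<and>
     cp Q v u = one Q (dm Q u) \<and> cp Q u v = one Q (cd Q u)"

definition isoP :: "('o, 'm, 'c, 'x, 'y) rmod \<Rightarrow> 'y \<Rightarrow> bool" where
  "isoP Q u \<longleftrightarrow> (\<exists>v. is_invP Q u v)"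

definition inP :: "('o, 'm, 'c, 'x, 'y) rmod \<Rightarrow> 'y \<Rightarrow> 'y" where
  "inP Q u = (SOME v. is_invP Q u v)"

text \<open>The constraint \<open>io\<close> leads from the action of a composite to two successive
  actions. This direction is opposite to that of \<open>Fc\<close>, which is why inverse associators
  and inverses of \<open>Fc\<close> appear in the instances.\<close>

locale rmodule =
  fixes B :: "('o, 'm, 'c) bicat" and Q :: "('o, 'm, 'c, 'x, 'y) rmod"
  assumes bs_obj: "X \<in> Ob Q \<Longrightarrow> bs Q X \<in> obj B"
    and ar: "u \<in> Ar Q \<Longrightarrow> dm Q u \<in> Ob Q \<and> cd Q u \<in> Ob Q \<and> bs Q (cd Q u) = bs Q (dm Q u)"
    and one: "X \<in> Ob Q \<Longrightarrow> one Q X \<in> Ar Q \<and> dm Q (one Q X) = X \<and> cd Q (one Q X) = X"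
    and cp: "\<lbrakk>u \<in> Ar Q; v \<in> Ar Q; cd Q u = dm Q v\<rbrakk>
      \<Longrightarrow> cp Q v u \<in> Ar Q \<and> dm Q (cp Q v u) = dm Q u \<and> cd Q (cp Q v u) = cd Q v"
    and cp_one: "u \<in> Ar Q \<Longrightarrow> cp Q u (one Q (dm Q u)) = u \<and> cp Q (one Q (cd Q u)) u = u"
    and cp_assoc: "\<lbrakk>u \<in> Ar Q; v \<in> Ar Q; w \<in> Ar Q; cd Q u = dm Q v; cd Q v = dm Q w\<rbrakk>
      \<Longrightarrow> cp Q (cp Q w v) u = cp Q w (cp Q v u)"
    and ac: "\<lbrakk>X \<in> Ob Q; k \<in> arr1 B; trg B k = bs Q X\<rbrakk> \<Longrightarrow> ac Q X k \<in> Ob Q \<and> bs Q (ac Q X k) = src B k"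
    and am: "\<lbrakk>u \<in> Ar Q; k \<in> arr1 B; trg B k = bs Q (dm Q u)\<rbrakk>
      \<Longrightarrow> am Q u k \<in> Ar Q \<and> dm Q (am Q u k) = ac Q (dm Q u) k \<and> cd Q (am Q u k) = ac Q (cd Q u) k"
    and am_one: "\<lbrakk>X \<in> Ob Q; k \<in> arr1 B; trg B k = bs Q X\<rbrakk> \<Longrightarrow> am Q (one Q X) k = one Q (ac Q X k)"
    and am_cp: "\<lbrakk>u \<in> Ar Q; v \<in> Ar Q; cd Q u = dm Q v; k \<in> arr1 B; trg B k = bs Q (dm Q u)\<rbrakk>
      \<Longrightarrow> am Q (cp Q v u) k = cp Q (am Q v k) (am Q u k)"
    and a2: "\<lbrakk>X \<in> Ob Q; p \<in> arr2 B; trg B (dom2 B p) = bs Q X\<rbrakk>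
      \<Longrightarrow> a2 Q X p \<in> Ar Q \<and> dm Q (a2 Q X p) = ac Q X (dom2 B p) \<and> cd Q (a2 Q X p) = ac Q X (cod2 B p)"
    and a2_id: "\<lbrakk>X \<in> Ob Q; k \<in> arr1 B; trg B k = bs Q X\<rbrakk> \<Longrightarrow> a2 Q X (id2 B k) = one Q (ac Q X k)"
    and a2_vc: "\<lbrakk>X \<in> Ob Q; p \<in> arr2 B; q \<in> arr2 B; cod2 B p = dom2 B q; trg B (dom2 B p) = bs Q X\<rbrakk>
      \<Longrightarrow> a2 Q X (vc B q p) = cp Q (a2 Q X q) (a2 Q X p)"
    and nat: "\<lbrakk>u \<in> Ar Q; p \<in> arr2 B; trg B (dom2 B p) = bs Q (dm Q u)\<rbrakk>
      \<Longrightarrow> cp Q (a2 Q (cd Q u) p) (am Q u (dom2 B p)) = cp Q (am Q u (cod2 B p)) (a2 Q (dm Q u) p)"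
    and io: "\<lbrakk>X \<in> Ob Q; f \<in> arr1 B; g \<in> arr1 B; trg B f = src B g; trg B g = bs Q X\<rbrakk>
      \<Longrightarrow> isoP Q (io Q X g f) \<and> dm Q (io Q X g f) = ac Q X (cmp1 B g f) \<and> cd Q (io Q X g f) = ac Q (ac Q X g) f"
    and io_nat: "\<lbrakk>u \<in> Ar Q; f \<in> arr1 B; g \<in> arr1 B; trg B f = src B g; trg B g = bs Q (dm Q u)\<rbrakk>
      \<Longrightarrow> cp Q (io Q (cd Q u) g f) (am Q u (cmp1 B g f)) = cp Q (am Q (am Q u g) f) (io Q (dm Q u) g f)"
    and io_hc: "\<lbrakk>X \<in> Ob Q; p \<in> arr2 B; q \<in> arr2 B; trg B (dom2 B p) = src B (dom2 B q); trg B (dom2 B q) = bs Q X\<rbrakk>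
      \<Longrightarrow> cp Q (io Q X (cod2 B q) (cod2 B p)) (a2 Q X (hc B q p))
        = cp Q (am Q (a2 Q X q) (cod2 B p)) (cp Q (a2 Q (ac Q X (dom2 B q)) p) (io Q X (dom2 B q) (dom2 B p)))"
    and io_asc: "\<lbrakk>X \<in> Ob Q; f \<in> arr1 B; g \<in> arr1 B; h \<in> arr1 B; trg B f = src B g; trg B g = src B h; trg B h = bs Q X\<rbrakk>
      \<Longrightarrow> cp Q (io Q (ac Q X h) g f) (cp Q (io Q X h (cmp1 B g f)) (a2 Q X (asc B h g f)))
        = cp Q (am Q (io Q X h g) f) (io Q X (cmp1 B h g) f)"
    and un: "X \<in> Ob Q \<Longrightarrow> isoP Q (un Q X) \<and> dm Q (un Q X) = ac Q X (id1 B (bs Q X)) \<and> cd Q (un Q X) = X"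
    and un_nat: "u \<in> Ar Q \<Longrightarrow> cp Q (un Q (cd Q u)) (am Q u (id1 B (bs Q (dm Q u)))) = cp Q u (un Q (dm Q u))"
    and un_lun: "\<lbrakk>X \<in> Ob Q; f \<in> arr1 B; trg B f = bs Q X\<rbrakk>
      \<Longrightarrow> cp Q (am Q (un Q X) f) (io Q X (id1 B (bs Q X)) f) = a2 Q X (lun B f)"
    and un_run: "\<lbrakk>X \<in> Ob Q; f \<in> arr1 B; trg B f = bs Q X\<rbrakk>
      \<Longrightarrow> cp Q (un Q (ac Q X f)) (io Q X f (id1 B (src B f))) = a2 Q X (run B f)"
begin

abbreviation cpQ (infixr "\<odot>" 70) where "v \<odot> u \<equiv> cp Q v u"
abbreviation acQ (infixl "\<cdot>" 80) where "X \<cdot> k \<equiv> ac Q X k"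
abbreviation amQ (infixl "\<cdot>\<^sub>1" 80) where "u \<cdot>\<^sub>1 k \<equiv> am Q u k"
abbreviation a2Q (infixl "\<cdot>\<^sub>2" 80) where "X \<cdot>\<^sub>2 w \<equiv> a2 Q X w"
abbreviation iso where "iso u \<equiv> isoP Q u"
abbreviation inv where "inv u \<equiv> inP Q u"

lemma bs_simps [simp]: "X \<in> Ob Q \<Longrightarrow> bs Q X \<in> obj B"
  using bs_obj by simp

lemma ar_simps [simp]: "u \<in> Ar Q \<Longrightarrow> dm Q u \<in> Ob Q" "u \<in> Ar Q \<Longrightarrow> cd Q u \<in> Ob Q"
  "u \<in> Ar Q \<Longrightarrow> bs Q (cd Q u) = bs Q (dm Q u)"
  using ar by auto

lemma one_simps [simp]: "X \<in> Ob Q \<Longrightarrow> one Q X \<in> Ar Q" "X \<in> Ob Q \<Longrightarrow> dm Q (one Q X) = X"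
  "X \<in> Ob Q \<Longrightarrow> cd Q (one Q X) = X"
  using one by auto

lemma cp_simps [simp]:
  assumes "u \<in> Ar Q" "v \<in> Ar Q" "cd Q u = dm Q v"
  shows "v \<odot> u \<in> Ar Q" "dm Q (v \<odot> u) = dm Q u" "cd Q (v \<odot> u) = cd Q v"
  using cp[OF assms] by auto

lemma cp_one_simps [simp]:
  "\<lbrakk>u \<in> Ar Q; dm Q u = X\<rbrakk> \<Longrightarrow> u \<odot> one Q X = u"
  "\<lbrakk>u \<in> Ar Q; cd Q u = X\<rbrakk> \<Longrightarrow> one Q X \<odot> u = u"
  using cp_one by auto

lemmas cp_assoc' [simp] = cp_assoc

lemma cp_reassoc:
  assumes "w \<odot> v = x" "u \<in> Ar Q" "v \<in> Ar Q" "w \<in> Ar Q" "cd Q u = dm Q v" "cd Q v = dm Q w"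
  shows "w \<odot> v \<odot> u = x \<odot> u"
  using cp_assoc[OF assms(2-6)] assms(1) by simp

lemma ac_simps [simp]:
  assumes "X \<in> Ob Q" "k \<in> arr1 B" "trg B k = bs Q X"
  shows "X \<cdot> k \<in> Ob Q" "bs Q (X \<cdot> k) = src B k"
  using ac[OF assms] by auto

lemma am_simps [simp]:
  assumes "u \<in> Ar Q" "k \<in> arr1 B" "trg B k = bs Q (dm Q u)"
  shows "u \<cdot>\<^sub>1 k \<in> Ar Q" "dm Q (u \<cdot>\<^sub>1 k) = dm Q u \<cdot> k" "cd Q (u \<cdot>\<^sub>1 k) = cd Q u \<cdot> k"
  using am[OF assms] by auto

lemmas am_one' [simp] = am_one

lemma a2_simps [simp]:
  assumes "X \<in> Ob Q" "w \<in> arr2 B" "trg B (dom2 B w) = bs Q X"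
  shows "X \<cdot>\<^sub>2 w \<in> Ar Q" "dm Q (X \<cdot>\<^sub>2 w) = X \<cdot> dom2 B w" "cd Q (X \<cdot>\<^sub>2 w) = X \<cdot> cod2 B w"
  using a2[OF assms] by auto

lemmas a2_id' [simp] = a2_id

lemma iso_invP: "iso u \<Longrightarrow> is_invP Q u (inv u)"
  unfolding isoP_def inP_def by (rule someI_ex)

lemma iso_ar: "iso u \<Longrightarrow> u \<in> Ar Q"
  using iso_invP is_invP_def by metis

lemma inv_simps [simp]:
  assumes "iso u"
  shows "inv u \<in> Ar Q" "dm Q (inv u) = cd Q u" "cd Q (inv u) = dm Q u"
    "inv u \<odot> u = one Q (dm Q u)" "u \<odot> inv u = one Q (cd Q u)"
  using iso_invP[OF assms] unfolding is_invP_def by auto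

lemma isoI: "is_invP Q u v \<Longrightarrow> iso u"
  unfolding isoP_def by auto

lemma inv_cancel [simp]:
  assumes "iso u" "v \<in> Ar Q"
  shows "cd Q v = dm Q u \<Longrightarrow> inv u \<odot> u \<odot> v = v" "cd Q v = cd Q u \<Longrightarrow> u \<odot> inv u \<odot> v = v"
proof -
  note iso_ar[OF assms(1), simp]
  show "cd Q v = dm Q u \<Longrightarrow> inv u \<odot> u \<odot> v = v"
    using cp_reassoc[OF inv_simps(4)[OF assms(1)], of v] assms by simp
  show "cd Q v = cd Q u \<Longrightarrow> u \<odot> inv u \<odot> v = v"
    using cp_reassoc[OF inv_simps(5)[OF assms(1)], of v] assms by simp
qed

lemma inv_eqI:
  assumes "is_invP Q u v"
  shows "inv u = v"
proof -
  have i: "iso u" using isoI assms by blast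
  note t = assms[unfolded is_invP_def] inv_simps[OF i]
  have "(v \<odot> u) \<odot> inv u = v \<odot> (u \<odot> inv u)"
    by (rule cp_assoc) (use t in simp_all)
  moreover have "(v \<odot> u) \<odot> inv u = inv u" "v \<odot> (u \<odot> inv u) = v"
    using t by (simp_all del: cp_assoc')
  ultimately show ?thesis by simp
qed

lemma iso_one [simp]: "X \<in> Ob Q \<Longrightarrow> iso (one Q X)" "X \<in> Ob Q \<Longrightarrow> inv (one Q X) = one Q X"
proof -
  assume "X \<in> Ob Q"
  then have "is_invP Q (one Q X) (one Q X)" by (simp add: is_invP_def)
  then show "iso (one Q X)" "inv (one Q X) = one Q X" by (auto intro: isoI inv_eqI)
qed

lemma iso_inv [simp]: "iso u \<Longrightarrow> iso (inv u)" "iso u \<Longrightarrow> inv (inv u) = u"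
proof -
  assume "iso u"
  then have "is_invP Q (inv u) u" using iso_invP[of u] by (simp add: is_invP_def)
  then show "iso (inv u)" "inv (inv u) = u" by (auto intro: isoI inv_eqI)
qed

lemma iso_cp [simp]:
  assumes "iso u" "iso v" "cd Q u = dm Q v"
  shows "iso (v \<odot> u)" "inv (v \<odot> u) = inv u \<odot> inv v"
proof -
  note iso_ar[OF assms(1), simp] iso_ar[OF assms(2), simp]
  have "is_invP Q (v \<odot> u) (inv u \<odot> inv v)" using assms by (simp add: is_invP_def)
  then show "iso (v \<odot> u)" "inv (v \<odot> u) = inv u \<odot> inv v" by (auto intro: isoI inv_eqI)
qed

lemma iso_am [simp]:
  assumes "iso u" "k \<in> arr1 B" "trg B k = bs Q (dm Q u)"
  shows "iso (u \<cdot>\<^sub>1 k)" "inv (u \<cdot>\<^sub>1 k) = inv u \<cdot>\<^sub>1 k"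
proof -
  note iso_ar[OF assms(1), simp]
  have "is_invP Q (u \<cdot>\<^sub>1 k) (inv u \<cdot>\<^sub>1 k)" using assms by (simp add: is_invP_def flip: am_cp)
  then show "iso (u \<cdot>\<^sub>1 k)" "inv (u \<cdot>\<^sub>1 k) = inv u \<cdot>\<^sub>1 k" by (auto intro: isoI inv_eqI)
qed

lemma iso_cancel_left:
  assumes "w \<odot> u = w \<odot> v" "iso w" "u \<in> Ar Q" "v \<in> Ar Q" "cd Q u = dm Q w" "cd Q v = dm Q w"
  shows "u = v"
proof -
  have "inv w \<odot> w \<odot> u = u" "inv w \<odot> w \<odot> v = v" using assms(2-) by simp_all
  with assms(1) show ?thesis by metis
qed

lemma cp_inv_right:
  assumes "w = u \<odot> p" "iso p" "u \<in> Ar Q" "dm Q u = cd Q p"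
  shows "w \<odot> inv p = u"
  using assms by (simp add: iso_ar)

text \<open>Inverting two opposite sides of a commuting square leaves it commuting. Laws stated for
  \<open>io\<close>, \<open>nu\<close> or the absorbing cells are brought in this way into the form
  for their inverses.\<close>

lemma inP_swap:
  assumes "q \<odot> u = v \<odot> p" "iso p" "iso q" "u \<in> Ar Q" "v \<in> Ar Q"
    "cd Q u = dm Q q" "cd Q p = dm Q v"
  shows "inv q \<odot> v = u \<odot> inv p"
proof -
  note [simp] = iso_ar[OF assms(2)] iso_ar[OF assms(3)]
  have c: "cd Q v = cd Q q" "dm Q u = dm Q p"
    using arg_cong[OF assms(1), of "cd Q"] arg_cong[OF assms(1), of "dm Q"] assms(2-) by simp_all
  have "inv q \<odot> v = inv q \<odot> ((v \<odot> p) \<odot> inv p)" using assms(2-) c by simp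
  also have "\<dots> = inv q \<odot> ((q \<odot> u) \<odot> inv p)" by (simp only: assms(1))
  also have "\<dots> = u \<odot> inv p" using assms(2-) c by simp
  finally show ?thesis .
qed

lemma io_simps [simp]:
  assumes "X \<in> Ob Q" "f \<in> arr1 B" "g \<in> arr1 B" "trg B f = src B g" "trg B g = bs Q X"
  shows "iso (io Q X g f)" "io Q X g f \<in> Ar Q" "dm Q (io Q X g f) = X \<cdot> cmp1 B g f"
    "cd Q (io Q X g f) = X \<cdot> g \<cdot> f"
  using io[OF assms] iso_ar by auto

lemma un_simps [simp]:
  assumes "X \<in> Ob Q"
  shows "iso (un Q X)" "un Q X \<in> Ar Q" "dm Q (un Q X) = X \<cdot> id1 B (bs Q X)" "cd Q (un Q X) = X"
  using un[OF assms] iso_ar by auto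

end

text \<open>A bicategory together with one right action of it; despite the name there is no second
  action.\<close>

locale bimodule = bicategory B + rmodule B Q
  for B :: "('o, 'm, 'c) bicat" and Q :: "('o, 'm, 'c, 'x, 'y) rmod"
begin

lemma iso_a2 [simp]:
  assumes "isoc w" "X \<in> Ob Q" "trg B (dom2 B w) = bs Q X"
  shows "iso (X \<cdot>\<^sub>2 w)" "inv (X \<cdot>\<^sub>2 w) = X \<cdot>\<^sub>2 inv2 B w"
proof -
  note isoc_arr2[OF assms(1), simp]
  have "is_invP Q (X \<cdot>\<^sub>2 w) (X \<cdot>\<^sub>2 inv2 B w)" using assms by (simp add: is_invP_def flip: a2_vc)
  then show "iso (X \<cdot>\<^sub>2 w)" "inv (X \<cdot>\<^sub>2 w) = X \<cdot>\<^sub>2 inv2 B w" by (auto intro: isoI inv_eqI)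
qed

end

section \<open>The representable actions Hom(-, x)\<close>

context bicategory
begin

lemma inv2_swap:
  assumes "vc B q u = vc B v p" "isoc p" "isoc q" "u \<in> arr2 B" "v \<in> arr2 B"
    "cod2 B u = dom2 B q" "cod2 B p = dom2 B v"
  shows "vc B (inv2 B q) v = vc B u (inv2 B p)"
proof -
  note [simp] = isoc_arr2[OF assms(2)] isoc_arr2[OF assms(3)]
  have c: "cod2 B v = cod2 B q" "dom2 B u = dom2 B p"
    using arg_cong[OF assms(1), of "cod2 B"] arg_cong[OF assms(1), of "dom2 B"] assms(2-) by simp_all
  have "vc B (inv2 B q) v = vc B (inv2 B q) (vc B (vc B v p) (inv2 B p))"
    using assms(2-) c by simp
  also have "\<dots> = vc B (inv2 B q) (vc B (vc B q u) (inv2 B p))" by (simp only: assms(1))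
  also have "\<dots> = vc B u (inv2 B p)" using assms(2-) c by simp
  finally show ?thesis .
qed

lemma vc_inv_right:
  assumes "w = vc B u p" "isoc p" "u \<in> arr2 B" "dom2 B u = cod2 B p"
  shows "vc B w (inv2 B p) = u"
  using assms by (simp add: isoc_arr2)

text \<open>The Yoneda action by precomposition. An inverse associator serves as \<open>io\<close>
  because a composite action has to be unfolded into two successive ones.\<close>

definition rep :: "'o \<Rightarrow> ('o, 'm, 'c, 'm, 'c) rmod" where
  "rep x = \<lparr>Ob = {r \<in> arr1 B. trg B r = x}, bs = src B, Ar = {u \<in> arr2 B. trg B (dom2 B u) = x},
     dm = dom2 B, cd = cod2 B, one = id2 B, cp = vc B, ac = cmp1 B,
     am = (\<lambda>u k. hc B u (id2 B k)), a2 = (\<lambda>r w. hc B (id2 B r) w),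
     io = (\<lambda>r g f. inv2 B (asc B r g f)), un = run B\<rparr>"

lemma rep_simps [simp]:
  "Ob (rep x) = {r \<in> arr1 B. trg B r = x}" "bs (rep x) = src B"
  "Ar (rep x) = {u \<in> arr2 B. trg B (dom2 B u) = x}"
  "dm (rep x) = dom2 B" "cd (rep x) = cod2 B" "one (rep x) = id2 B" "cp (rep x) = vc B" "ac (rep x) = cmp1 B"
  "am (rep x) u k = hc B u (id2 B k)" "a2 (rep x) r w = hc B (id2 B r) w"
  "io (rep x) r g f = inv2 B (asc B r g f)" "un (rep x) = run B"
  by (simp_all add: rep_def)

lemma isoP_rep: "isoP (rep x) u \<longleftrightarrow> isoc u \<and> trg B (dom2 B u) = x"
  unfolding isoP_def is_invP_def isoc_def is_inv2_def hom2_def by auto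

lemma pentagon_inv:
  assumes [simp]: "f \<in> arr1 B" "g \<in> arr1 B" "h \<in> arr1 B" "k \<in> arr1 B"
    "trg B f = src B g" "trg B g = src B h" "trg B h = src B k"
  shows "vc B (inv2 B (asc B (cmp1 B k h) g f)) (vc B (inv2 B (asc B k h (cmp1 B g f))) (hc B (id2 B k) (asc B h g f)))
    = vc B (hc B (inv2 B (asc B k h g)) (id2 B f)) (inv2 B (asc B k (cmp1 B h g) f))"
proof -
  let ?q = "vc B (asc B k h (cmp1 B g f)) (asc B (cmp1 B k h) g f)"
  let ?p = "vc B (asc B k (cmp1 B h g) f) (hc B (asc B k h g) (id2 B f))"
  have "vc B ?q (id2 B (cmp1 B (cmp1 B (cmp1 B k h) g) f)) = vc B (hc B (id2 B k) (asc B h g f)) ?p"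
    using pentagon'[of f g h k] by simp
  from inv2_swap[OF this] show ?thesis by simp
qed

text \<open>Associativity of the action is the pentagon with some associators inverted, the left
  unit law is the triangle, and the right unit law is \<open>run_cmp1\<close>; this is what that
  consequence of the axioms is for.\<close>

lemma rep_rmodule:
  assumes x: "x \<in> obj B"
  shows "bimodule B (rep x)"
proof -
  have "rmodule B (rep x)"
  proof
    fix u k assume "u \<in> Ar (rep x)" "k \<in> arr2 B" "trg B (dom2 B k) = bs (rep x) (dm (rep x) u)"
    then show "cp (rep x) (a2 (rep x) (cd (rep x) u) k) (am (rep x) u (dom2 B k)) =
       cp (rep x) (am (rep x) u (cod2 B k)) (a2 (rep x) (dm (rep x) u) k)"
      using interchange'[of "id2 B (dom2 B k)" k u "id2 B (cod2 B u)"]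
        interchange'[of k "id2 B (cod2 B k)" "id2 B (dom2 B u)" u] by simp
  next
    fix u f g assume "u \<in> Ar (rep x)" and [simp]: "f \<in> arr1 B" "g \<in> arr1 B" "trg B f = src B g"
      "trg B g = bs (rep x) (dm (rep x) u)"
    then have [simp]: "u \<in> arr2 B" "trg B (dom2 B u) = x" "trg B g = src B (dom2 B u)" by auto
    show "cp (rep x) (io (rep x) (cd (rep x) u) g f) (am (rep x) u (cmp1 B g f)) =
       cp (rep x) (am (rep x) (am (rep x) u g) f) (io (rep x) (dm (rep x) u) g f)"
      using inv2_swap[OF asc_nat'[of "id2 B f" "id2 B g" u]] by simp
  next
    fix X p q assume "X \<in> Ob (rep x)" and [simp]: "p \<in> arr2 B" "q \<in> arr2 B" "trg B (dom2 B p) = src B (dom2 B q)"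
      and "trg B (dom2 B q) = bs (rep x) X"
    then have [simp]: "X \<in> arr1 B" "trg B X = x" "trg B (dom2 B q) = src B X" by auto
    have 1: "vc B (hc B (hc B (id2 B X) q) (id2 B (cod2 B p))) (hc B (id2 B (cmp1 B X (dom2 B q))) p) = hc B (hc B (id2 B X) q) p"
      using interchange'[of p "id2 B (cod2 B p)" "id2 B (cmp1 B X (dom2 B q))" "hc B (id2 B X) q"] by simp
    show "cp (rep x) (io (rep x) X (cod2 B q) (cod2 B p)) (a2 (rep x) X (hc B q p)) =
       cp (rep x) (am (rep x) (a2 (rep x) X q) (cod2 B p))
        (cp (rep x) (a2 (rep x) (ac (rep x) X (dom2 B q)) p) (io (rep x) X (dom2 B q) (dom2 B p)))"
      using inv2_swap[OF asc_nat'[of p q "id2 B X"]] vc_reassoc[OF 1, of "inv2 B (asc B X (dom2 B q) (dom2 B p))"] by simp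
  next
    fix X f assume "X \<in> Ob (rep x)" "f \<in> arr1 B" "trg B f = bs (rep x) X"
    then have [simp]: "X \<in> arr1 B" "trg B X = x" "f \<in> arr1 B" "trg B f = src B X" by auto
    show "cp (rep x) (am (rep x) (un (rep x) X) f) (io (rep x) X (id1 B (bs (rep x) X)) f) = a2 (rep x) X (lun B f)"
      using triangle'[of f X] by (simp flip: triangle')
    show "cp (rep x) (un (rep x) (ac (rep x) X f)) (io (rep x) X f (id1 B (src B f))) = a2 (rep x) X (run B f)"
      by (simp add: run_cmp1)
  next
    fix u assume "u \<in> Ar (rep x)"
    then show "cp (rep x) (un (rep x) (cd (rep x) u)) (am (rep x) u (id1 B (bs (rep x) (dm (rep x) u)))) =
         cp (rep x) u (un (rep x) (dm (rep x) u))"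
      using run_nat'[of u] by simp
  qed (use x in \<open>auto simp: interchange' isoP_rep pentagon_inv\<close>)
  then show ?thesis by (simp add: bimodule_def bicategory_axioms)
qed

end

section \<open>Products of bicategories, and restriction of an action along a pseudofunctor\<close>

lemma prodB_simps [simp]:
  "obj (prodB B C) = obj B \<times> obj C" "arr1 (prodB B C) = arr1 B \<times> arr1 C" "arr2 (prodB B C) = arr2 B \<times> arr2 C"
  "src (prodB B C) f = (src B (fst f), src C (snd f))" "trg (prodB B C) f = (trg B (fst f), trg C (snd f))"
  "dom2 (prodB B C) u = (dom2 B (fst u), dom2 C (snd u))" "cod2 (prodB B C) u = (cod2 B (fst u), cod2 C (snd u))"
  "id1 (prodB B C) a = (id1 B (fst a), id1 C (snd a))" "id2 (prodB B C) f = (id2 B (fst f), id2 C (snd f))"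
  "cmp1 (prodB B C) g f = (cmp1 B (fst g) (fst f), cmp1 C (snd g) (snd f))"
  "vc (prodB B C) v u = (vc B (fst v) (fst u), vc C (snd v) (snd u))"
  "hc (prodB B C) v u = (hc B (fst v) (fst u), hc C (snd v) (snd u))"
  "asc (prodB B C) h g f = (asc B (fst h) (fst g) (fst f), asc C (snd h) (snd g) (snd f))"
  "lun (prodB B C) f = (lun B (fst f), lun C (snd f))" "run (prodB B C) f = (run B (fst f), run C (snd f))"
  by (simp_all add: prodB_def map_prod_def case_prod_unfold)

lemma hom_prodB:
  "f \<in> hom1 (prodB B C) a b \<longleftrightarrow> fst f \<in> hom1 B (fst a) (fst b) \<and> snd f \<in> hom1 C (snd a) (snd b)"
  "u \<in> hom2 (prodB B C) f g \<longleftrightarrow> fst u \<in> hom2 B (fst f) (fst g) \<and> snd u \<in> hom2 C (snd f) (snd g)"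
  by (auto simp: hom1_def hom2_def mem_Times_iff prod_eq_iff)

lemma is_inv2_prodB:
  "is_inv2 (prodB B C) u v \<longleftrightarrow> is_inv2 B (fst u) (fst v) \<and> is_inv2 C (snd u) (snd v)"
  by (auto simp: is_inv2_def hom2_def mem_Times_iff prod_eq_iff)

lemma iso2_prodB:
  "u \<in> iso2 (prodB B C) f g \<longleftrightarrow> fst u \<in> iso2 B (fst f) (fst g) \<and> snd u \<in> iso2 C (snd f) (snd g)"
  by (force simp: iso2_def is_inv2_prodB hom_prodB)

lemma prodB_bicategory:
  assumes "bicategory B" "bicategory C"
  shows "bicategory (prodB B C)"
proof -
  interpret B: bicategory B by fact
  interpret C: bicategory C by fact
  note [simp] = hom_prodB iso2_prodB mem_Times_iff prod_eq_iff
  show ?thesis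
  proof (unfold_locales, goal_cases)
    case 1 then show ?case using B.src_trg C.src_trg by auto
  next
    case 2 then show ?case using B.dom_cod C.dom_cod by auto
  next
    case 3 then show ?case by simp (blast intro: B.id1_hom C.id1_hom)
  next
    case 4 then show ?case by simp (blast intro: B.id2_hom C.id2_hom)
  next
    case 5 then show ?case by simp (blast intro: B.cmp1_hom C.cmp1_hom)
  next
    case 6 then show ?case by simp (blast intro: B.vc_hom C.vc_hom)
  next
    case 7 then show ?case by simp (blast intro: B.hc_hom C.hc_hom)
  next
    case 8 then show ?case using B.vc_id[of "fst u" "fst f" "fst g" for u f g] C.vc_id[of "snd u" "snd f" "snd g" for u f g] by simp blast
  next
    case 9 then show ?case by simp (blast intro: B.vc_assoc C.vc_assoc)
  next
    case 10 then show ?case by simp (blast intro: B.hc_id C.hc_id)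
  next
    case 11 then show ?case by simp (blast intro: B.interchange C.interchange)
  next
    case 12 then show ?case by simp (blast intro: B.asc_iso C.asc_iso)
  next
    case 13 then show ?case by simp (blast intro: B.lun_iso C.lun_iso)
  next
    case 14 then show ?case by simp (blast intro: B.run_iso C.run_iso)
  next
    case 15 then show ?case by simp (blast intro: B.asc_nat C.asc_nat)
  next
    case 16 then show ?case by simp (blast intro: B.lun_nat C.lun_nat)
  next
    case 17 then show ?case by simp (blast intro: B.run_nat C.run_nat)
  next
    case 18 then show ?case by simp (blast intro: B.pentagon C.pentagon)
  next
    case 19 then show ?case by simp (blast intro: B.triangle C.triangle)
  qed
qed

text \<open>Objects and morphisms carry an object of \<open>C\<close> as second component, since the
  base \<open>F0 F a\<close> in \<open>B\<close> does not determine \<open>a\<close>.\<close>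

definition pull :: "('p, 'n, 'd) bicat \<Rightarrow> ('o, 'm, 'c) bicat \<Rightarrow> ('p, 'n, 'd, 'o, 'm, 'c) pfun
    \<Rightarrow> ('o, 'm, 'c, 'x, 'y) rmod \<Rightarrow> ('p, 'n, 'd, 'x \<times> 'p, 'y \<times> 'p) rmod" where
  "pull C B F Q = \<lparr>Ob = {X. fst X \<in> Ob Q \<and> snd X \<in> obj C \<and> bs Q (fst X) = F0 F (snd X)}, bs = snd,
     Ar = {u. fst u \<in> Ar Q \<and> snd u \<in> obj C \<and> bs Q (dm Q (fst u)) = F0 F (snd u)},
     dm = (\<lambda>u. (dm Q (fst u), snd u)), cd = (\<lambda>u. (cd Q (fst u), snd u)),
     one = (\<lambda>X. (one Q (fst X), snd X)), cp = (\<lambda>v u. (cp Q (fst v) (fst u), snd u)),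
     ac = (\<lambda>X k. (ac Q (fst X) (F1 F k), src C k)), am = (\<lambda>u k. (am Q (fst u) (F1 F k), src C k)),
     a2 = (\<lambda>X w. (a2 Q (fst X) (F2 F w), src C (dom2 C w))),
     io = (\<lambda>X g f. (cp Q (io Q (fst X) (F1 F g) (F1 F f)) (a2 Q (fst X) (inv2 B (Fc F g f))), src C f)),
     un = (\<lambda>X. (cp Q (un Q (fst X)) (a2 Q (fst X) (inv2 B (Fu F (snd X)))), snd X))\<rparr>"

lemma pull_simps [simp]:
  "Ob (pull C B F Q) = {X. fst X \<in> Ob Q \<and> snd X \<in> obj C \<and> bs Q (fst X) = F0 F (snd X)}"
  "bs (pull C B F Q) = snd"
  "Ar (pull C B F Q) = {u. fst u \<in> Ar Q \<and> snd u \<in> obj C \<and> bs Q (dm Q (fst u)) = F0 F (snd u)}"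
  "dm (pull C B F Q) u = (dm Q (fst u), snd u)" "cd (pull C B F Q) u = (cd Q (fst u), snd u)"
  "one (pull C B F Q) X = (one Q (fst X), snd X)" "cp (pull C B F Q) v u = (cp Q (fst v) (fst u), snd u)"
  "ac (pull C B F Q) X k = (ac Q (fst X) (F1 F k), src C k)"
  "am (pull C B F Q) u k = (am Q (fst u) (F1 F k), src C k)"
  "a2 (pull C B F Q) X w = (a2 Q (fst X) (F2 F w), src C (dom2 C w))"
  "io (pull C B F Q) X g f = (cp Q (io Q (fst X) (F1 F g) (F1 F f)) (a2 Q (fst X) (inv2 B (Fc F g f))), src C f)"
  "un (pull C B F Q) X = (cp Q (un Q (fst X)) (a2 Q (fst X) (inv2 B (Fu F (snd X)))), snd X)"
  by (simp_all add: pull_def)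

locale pseudofunctor' = pseudofunctor B C F + B: bicategory B + C: bicategory C
  for B :: "('o, 'm, 'c) bicat" and C :: "('p, 'n, 'd) bicat" and F :: "('o, 'm, 'c, 'p, 'n, 'd) pfun"
begin

lemma F0_simps [simp]: "a \<in> obj B \<Longrightarrow> F0 F a \<in> obj C"
  by (rule F0_obj)

lemma F1_simps [simp]:
  assumes "f \<in> arr1 B"
  shows "F1 F f \<in> arr1 C" "src C (F1 F f) = F0 F (src B f)" "trg C (F1 F f) = F0 F (trg B f)"
  using F1_hom[OF B.arr1_hom1[OF assms]] by (auto simp: hom1_def)

lemma F2_simps [simp]:
  assumes "u \<in> arr2 B"
  shows "F2 F u \<in> arr2 C" "dom2 C (F2 F u) = F1 F (dom2 B u)" "cod2 C (F2 F u) = F1 F (cod2 B u)"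
  using F2_hom[OF B.arr2_hom2[OF assms]] by (auto simp: hom2_def)

lemmas F2_id' [simp] = F2_id

lemma F2_vc':
  assumes "u \<in> arr2 B" "v \<in> arr2 B" "cod2 B u = dom2 B v"
  shows "F2 F (vc B v u) = vc C (F2 F v) (F2 F u)"
  using F2_vc[of u "dom2 B u" "dom2 B v" v "cod2 B v"] assms by (auto simp: hom2_def)

lemma Fc_simps [simp]:
  assumes "f \<in> arr1 B" "g \<in> arr1 B" "trg B f = src B g"
  shows "C.isoc (Fc F g f)" "Fc F g f \<in> arr2 C" "dom2 C (Fc F g f) = cmp1 C (F1 F g) (F1 F f)"
    "cod2 C (Fc F g f) = F1 F (cmp1 B g f)"
  using Fc_iso[of f "src B f" "trg B f" g "trg B g"] assms by (auto simp: hom1_def C.iso2_iff C.isoc_arr2)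

lemma Fu_simps [simp]:
  assumes "a \<in> obj B"
  shows "C.isoc (Fu F a)" "Fu F a \<in> arr2 C" "dom2 C (Fu F a) = id1 C (F0 F a)"
    "cod2 C (Fu F a) = F1 F (id1 B a)"
  using Fu_iso[of a] assms by (auto simp: C.iso2_iff C.isoc_arr2)

lemma F2_isoc [simp]:
  assumes "B.isoc u"
  shows "C.isoc (F2 F u)" "inv2 C (F2 F u) = F2 F (inv2 B u)"
proof -
  note [simp] = B.isoc_arr2[OF assms]
  have 1: "vc C (F2 F (inv2 B u)) (F2 F u) = id2 C (F1 F (dom2 B u))"
    "vc C (F2 F u) (F2 F (inv2 B u)) = id2 C (F1 F (cod2 B u))"
    using assms by (simp_all flip: F2_vc')
  show "C.isoc (F2 F u)" by (rule C.isocI[of _ "F2 F (inv2 B u)"]) (use assms 1 in auto)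
  show "inv2 C (F2 F u) = F2 F (inv2 B u)" by (rule C.inv2_eqI) (use assms 1 in auto)
qed

lemma Fc_nat':
  assumes "u \<in> arr2 B" "v \<in> arr2 B" "trg B (dom2 B u) = src B (dom2 B v)"
  shows "vc C (Fc F (cod2 B v) (cod2 B u)) (hc C (F2 F v) (F2 F u)) = vc C (F2 F (hc B v u)) (Fc F (dom2 B v) (dom2 B u))"
  using Fc_nat[of u _ _ v] assms by (auto simp: hom2_def)

text \<open>Restricting an action along \<open>F\<close> uses the inverses of \<open>Fc\<close> and
  \<open>Fu\<close>. This and the next three lemmas solve the coherence laws of \<open>F\<close> for
  these inverses.\<close>

lemma inv_Fc_nat:
  assumes [simp]: "u \<in> arr2 B" "v \<in> arr2 B" "trg B (dom2 B u) = src B (dom2 B v)"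
  shows "vc C (inv2 C (Fc F (cod2 B v) (cod2 B u))) (F2 F (hc B v u))
    = vc C (hc C (F2 F v) (F2 F u)) (inv2 C (Fc F (dom2 B v) (dom2 B u)))"
  using C.inv2_swap[OF Fc_nat'[of u v]] by simp

lemma inv_Fc_assoc:
  assumes [simp]: "f \<in> arr1 B" "g \<in> arr1 B" "h \<in> arr1 B" "trg B f = src B g" "trg B g = src B h"
  shows "vc C (hc C (id2 C (F1 F h)) (inv2 C (Fc F g f))) (vc C (inv2 C (Fc F h (cmp1 B g f))) (F2 F (asc B h g f)))
    = vc C (asc C (F1 F h) (F1 F g) (F1 F f))
       (vc C (hc C (inv2 C (Fc F h g)) (id2 C (F1 F f))) (inv2 C (Fc F (cmp1 B h g) f)))"
proof -
  let ?p = "vc C (Fc F (cmp1 B h g) f) (hc C (Fc F h g) (id2 C (F1 F f)))"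
  let ?q = "vc C (Fc F h (cmp1 B g f)) (hc C (id2 C (F1 F h)) (Fc F g f))"
  have "vc C ?q (asc C (F1 F h) (F1 F g) (F1 F f)) = vc C (F2 F (asc B h g f)) ?p"
    using Fc_assoc[of f "src B f" "trg B f" g "trg B g" h "trg B h"] by (simp add: hom1_def)
  from C.inv2_swap[OF this] show ?thesis by simp
qed

lemma inv_Fu_left:
  assumes [simp]: "f \<in> arr1 B"
  shows "vc C (lun C (F1 F f)) (vc C (hc C (inv2 C (Fu F (trg B f))) (id2 C (F1 F f))) (inv2 C (Fc F (id1 B (trg B f)) f)))
    = F2 F (lun B f)"
proof -
  let ?p = "vc C (Fc F (id1 B (trg B f)) f) (hc C (Fu F (trg B f)) (id2 C (F1 F f)))"
  have "vc C (lun C (F1 F f)) (id2 C (cmp1 C (id1 C (F0 F (trg B f))) (F1 F f))) = vc C (F2 F (lun B f)) ?p"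
    using Fu_left[of f "src B f" "trg B f"] by (simp add: hom1_def)
  from C.vc_inv_right[OF this] show ?thesis by simp
qed

lemma inv_Fu_right:
  assumes [simp]: "f \<in> arr1 B"
  shows "vc C (run C (F1 F f)) (vc C (hc C (id2 C (F1 F f)) (inv2 C (Fu F (src B f)))) (inv2 C (Fc F f (id1 B (src B f)))))
    = F2 F (run B f)"
proof -
  let ?p = "vc C (Fc F f (id1 B (src B f))) (hc C (id2 C (F1 F f)) (Fu F (src B f)))"
  have "vc C (run C (F1 F f)) (id2 C (cmp1 C (F1 F f) (id1 C (F0 F (src B f))))) = vc C (F2 F (run B f)) ?p"
    using Fu_right[of f "src B f" "trg B f"] by (simp add: hom1_def)
  from C.vc_inv_right[OF this] show ?thesis by simp
qed

end

lemma (in rmodule) isoP_pull: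
  assumes "iso (fst u)" "snd u \<in> obj C" "bs Q (dm Q (fst u)) = F0 F (snd u)"
  shows "isoP (pull C B F Q) u"
proof -
  have "is_invP (pull C B F Q) u (inv (fst u), snd u)"
    using assms iso_invP[OF assms(1)] by (auto simp: is_invP_def)
  then show ?thesis unfolding isoP_def by blast
qed

text \<open>The nontrivial laws follow one pattern: a structure 2-cell of \<open>F\<close> is
  carried across \<open>io\<close> or \<open>un\<close> by naturality, the corresponding law of
  \<open>Q\<close> is applied, and the remaining cells are matched by a coherence law of
  \<open>F\<close> in its inverted form.\<close>

lemma pull_rmodule:
  assumes "bicategory C" "bimodule B Q" "pseudofunctor C B F"
  shows "bimodule C (pull C B F Q)"
proof -
  interpret C: bicategory C by fact
  interpret bimodule B Q by fact
  interpret F: pseudofunctor C B F by fact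
  interpret F: pseudofunctor' C B F by unfold_locales
  have natF: "cp Q (a2 Q (cd Q a) (F2 F p)) (am Q a (F1 F (dom2 C p))) = cp Q (am Q a (F1 F (cod2 C p))) (a2 Q (dm Q a) (F2 F p))"
    if "a \<in> Ar Q" "p \<in> arr2 C" "bs Q (dm Q a) = F0 F (trg C (dom2 C p))" for a p
    using nat[of a "F2 F p"] that by simp
  have "rmodule C (pull C B F Q)"
  proof
    fix u f g
    assume "u \<in> Ar (pull C B F Q)" "trg C g = bs (pull C B F Q) (dm (pull C B F Q) u)"
      and f [simp]: "f \<in> arr1 C" "g \<in> arr1 C" "trg C f = src C g"
    then have [simp]: "fst u \<in> Ar Q" "snd u \<in> obj C" "trg C g = snd u" "bs Q (dm Q (fst u)) = F0 F (snd u)" by auto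
    let ?u = "fst u" and ?w = "inv2 B (Fc F g f)"
    have "cp Q (io Q (cd Q ?u) (F1 F g) (F1 F f)) (cp Q (a2 Q (cd Q ?u) ?w) (am Q ?u (F1 F (cmp1 C g f))))
      = cp Q (io Q (cd Q ?u) (F1 F g) (F1 F f)) (cp Q (am Q ?u (cmp1 B (F1 F g) (F1 F f))) (a2 Q (dm Q ?u) ?w))"
      using nat[of ?u ?w] by simp
    also have "\<dots> = cp Q (am Q (am Q ?u (F1 F g)) (F1 F f)) (cp Q (io Q (dm Q ?u) (F1 F g) (F1 F f)) (a2 Q (dm Q ?u) ?w))"
      using cp_reassoc[OF io_nat[of ?u "F1 F f" "F1 F g"], of "a2 Q (dm Q ?u) ?w"] by simp
    finally show "cp (pull C B F Q) (io (pull C B F Q) (cd (pull C B F Q) u) g f) (am (pull C B F Q) u (cmp1 C g f)) =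
       cp (pull C B F Q) (am (pull C B F Q) (am (pull C B F Q) u g) f) (io (pull C B F Q) (dm (pull C B F Q) u) g f)"
      by simp
  next
    fix X p q assume "X \<in> Ob (pull C B F Q)" "trg C (dom2 C q) = bs (pull C B F Q) X"
     and [simp]: "p \<in> arr2 C" "q \<in> arr2 C" "trg C (dom2 C p) = src C (dom2 C q)"
    then have [simp]: "fst X \<in> Ob Q" "snd X \<in> obj C" "bs Q (fst X) = F0 F (snd X)" "trg C (dom2 C q) = snd X" by auto
    let ?X = "fst X" and ?w = "inv2 B (Fc F (dom2 C q) (dom2 C p))" and ?w' = "inv2 B (Fc F (cod2 C q) (cod2 C p))"
    have "cp Q (io Q ?X (F1 F (cod2 C q)) (F1 F (cod2 C p))) (cp Q (a2 Q ?X ?w') (a2 Q ?X (F2 F (hc C q p))))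
      = cp Q (io Q ?X (F1 F (cod2 C q)) (F1 F (cod2 C p))) (cp Q (a2 Q ?X (hc B (F2 F q) (F2 F p))) (a2 Q ?X ?w))"
      using a2_vc[of ?X "F2 F (hc C q p)" ?w'] a2_vc[of ?X ?w "hc B (F2 F q) (F2 F p)"] F.inv_Fc_nat[of p q] by simp
    also have "\<dots> = cp Q (am Q (a2 Q ?X (F2 F q)) (F1 F (cod2 C p)))
       (cp Q (a2 Q (ac Q ?X (F1 F (dom2 C q))) (F2 F p)) (cp Q (io Q ?X (F1 F (dom2 C q)) (F1 F (dom2 C p))) (a2 Q ?X ?w)))"
      using cp_reassoc[OF io_hc[of ?X "F2 F p" "F2 F q"], of "a2 Q ?X ?w"] by simp
    finally show "cp (pull C B F Q) (io (pull C B F Q) X (cod2 C q) (cod2 C p)) (a2 (pull C B F Q) X (hc C q p)) =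
       cp (pull C B F Q) (am (pull C B F Q) (a2 (pull C B F Q) X q) (cod2 C p))
        (cp (pull C B F Q) (a2 (pull C B F Q) (ac (pull C B F Q) X (dom2 C q)) p)
          (io (pull C B F Q) X (dom2 C q) (dom2 C p)))"
      by simp
  next
    fix X f g h assume "X \<in> Ob (pull C B F Q)" "trg C h = bs (pull C B F Q) X"
     and [simp]: "f \<in> arr1 C" "g \<in> arr1 C" "h \<in> arr1 C" "trg C f = src C g" "trg C g = src C h"
    then have [simp]: "fst X \<in> Ob Q" "snd X \<in> obj C" "bs Q (fst X) = F0 F (snd X)" "trg C h = snd X" by auto
    let ?X = "fst X" and ?f = "F1 F f" and ?g = "F1 F g" and ?h = "F1 F h"
    let ?l = "io Q (ac Q ?X ?h) ?g ?f"
    \<comment> \<open>With an identity in one slot, \<open>io_hc\<close> becomes the naturality of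
      \<open>io\<close> in the other; this carries the structure cells of \<open>F\<close> out of
      the way.\<close>
    have 1: "cp Q (a2 Q (ac Q ?X ?h) (inv2 B (Fc F g f))) (io Q ?X ?h (F1 F (cmp1 C g f)))
       = cp Q (io Q ?X ?h (cmp1 B ?g ?f)) (a2 Q ?X (hc B (id2 B ?h) (inv2 B (Fc F g f))))"
      using io_hc[of ?X "inv2 B (Fc F g f)" "id2 B ?h"] by simp
    have 2: "cp Q (am Q (a2 Q ?X (inv2 B (Fc F h g))) ?f) (io Q ?X (F1 F (cmp1 C h g)) ?f)
       = cp Q (io Q ?X (cmp1 B ?h ?g) ?f) (a2 Q ?X (hc B (inv2 B (Fc F h g)) (id2 B ?f)))"
      using io_hc[of ?X "id2 B ?f" "inv2 B (Fc F h g)"] by simp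
    let ?r = "vc B (inv2 B (Fc F h (cmp1 C g f))) (F2 F (asc C h g f))"
    let ?s = "vc B (hc B (inv2 B (Fc F h g)) (id2 B ?f)) (inv2 B (Fc F (cmp1 C h g) f))"
    have "cp Q ?l (cp Q (a2 Q (ac Q ?X ?h) (inv2 B (Fc F g f))) (cp Q (io Q ?X ?h (F1 F (cmp1 C g f))) (a2 Q ?X ?r)))
       = cp Q ?l (cp Q (io Q ?X ?h (cmp1 B ?g ?f)) (cp Q (a2 Q ?X (hc B (id2 B ?h) (inv2 B (Fc F g f)))) (a2 Q ?X ?r)))"
      using cp_reassoc[OF 1, of "a2 Q ?X ?r"] by simp
    also have "\<dots> = cp Q ?l (cp Q (io Q ?X ?h (cmp1 B ?g ?f)) (a2 Q ?X (vc B (asc B ?h ?g ?f) ?s)))"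
      using F.inv_Fc_assoc[of f g h] by (simp flip: a2_vc)
    also have "\<dots> = cp Q (cp Q (am Q (io Q ?X ?h ?g) ?f) (io Q ?X (cmp1 B ?h ?g) ?f)) (a2 Q ?X ?s)"
      by (simp add: a2_vc flip: io_asc)
    also have "\<dots> = cp Q (am Q (io Q ?X ?h ?g) ?f) (cp Q (am Q (a2 Q ?X (inv2 B (Fc F h g))) ?f)
       (cp Q (io Q ?X (F1 F (cmp1 C h g)) ?f) (a2 Q ?X (inv2 B (Fc F (cmp1 C h g) f)))))"
      using cp_reassoc[OF 2[symmetric], of "a2 Q ?X (inv2 B (Fc F (cmp1 C h g) f))"] by (simp add: a2_vc)
    finally show "cp (pull C B F Q) (io (pull C B F Q) (ac (pull C B F Q) X h) g f)
        (cp (pull C B F Q) (io (pull C B F Q) X h (cmp1 C g f)) (a2 (pull C B F Q) X (asc C h g f))) =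
       cp (pull C B F Q) (am (pull C B F Q) (io (pull C B F Q) X h g) f) (io (pull C B F Q) X (cmp1 C h g) f)"
      by (simp add: am_cp a2_vc)
  next
    fix X f assume "X \<in> Ob (pull C B F Q)" "trg C f = bs (pull C B F Q) X" and [simp]: "f \<in> arr1 C"
    then have [simp]: "fst X \<in> Ob Q" "snd X \<in> obj C" "bs Q (fst X) = F0 F (snd X)" "trg C f = snd X" by auto
    let ?X = "fst X" and ?f = "F1 F f" and ?e = "id1 C (snd X)" and ?u = "inv2 B (Fu F (snd X))"
    have 1: "cp Q (am Q (a2 Q ?X ?u) ?f) (io Q ?X (F1 F ?e) ?f)
       = cp Q (io Q ?X (id1 B (F0 F (snd X))) ?f) (a2 Q ?X (hc B ?u (id2 B ?f)))"
      using io_hc[of ?X "id2 B ?f" ?u] by simp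
    have "cp Q (am Q (un Q ?X) ?f) (cp Q (am Q (a2 Q ?X ?u) ?f) (cp Q (io Q ?X (F1 F ?e) ?f) (a2 Q ?X (inv2 B (Fc F ?e f)))))
       = cp Q (a2 Q ?X (lun B ?f)) (cp Q (a2 Q ?X (hc B ?u (id2 B ?f))) (a2 Q ?X (inv2 B (Fc F ?e f))))"
      using cp_reassoc[OF 1, of "a2 Q ?X (inv2 B (Fc F ?e f))"] un_lun[of ?X ?f] by (simp flip: un_lun)
    also have "\<dots> = a2 Q ?X (F2 F (lun C f))"
      using F.inv_Fu_left[of f] by (simp flip: a2_vc)
    finally show "cp (pull C B F Q) (am (pull C B F Q) (un (pull C B F Q) X) f)
        (io (pull C B F Q) X (id1 C (bs (pull C B F Q) X)) f) = a2 (pull C B F Q) X (lun C f)"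
      by (simp add: am_cp)
    let ?e = "id1 C (src C f)" and ?u = "inv2 B (Fu F (src C f))"
    have 1: "cp Q (a2 Q (ac Q ?X ?f) ?u) (io Q ?X ?f (F1 F ?e))
       = cp Q (io Q ?X ?f (id1 B (F0 F (src C f)))) (a2 Q ?X (hc B (id2 B ?f) ?u))"
      using io_hc[of ?X ?u "id2 B ?f"] by simp
    have "cp Q (un Q (ac Q ?X ?f)) (cp Q (a2 Q (ac Q ?X ?f) ?u) (cp Q (io Q ?X ?f (F1 F ?e)) (a2 Q ?X (inv2 B (Fc F f ?e)))))
       = cp Q (a2 Q ?X (run B ?f)) (cp Q (a2 Q ?X (hc B (id2 B ?f) ?u)) (a2 Q ?X (inv2 B (Fc F f ?e))))"
      using cp_reassoc[OF 1, of "a2 Q ?X (inv2 B (Fc F f ?e))"] by (simp flip: un_run)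
    also have "\<dots> = a2 Q ?X (F2 F (run C f))"
      using F.inv_Fu_right[of f] by (simp flip: a2_vc)
    finally show "cp (pull C B F Q) (un (pull C B F Q) (ac (pull C B F Q) X f))
        (io (pull C B F Q) X f (id1 C (src C f))) = a2 (pull C B F Q) X (run C f)"
      by simp
  next
    fix u assume "u \<in> Ar (pull C B F Q)"
    then have [simp]: "fst u \<in> Ar Q" "snd u \<in> obj C" "bs Q (dm Q (fst u)) = F0 F (snd u)" by auto
    let ?u = "fst u" and ?e = "id1 C (snd u)" and ?w = "inv2 B (Fu F (snd u))"
    have "cp Q (un Q (cd Q ?u)) (cp Q (a2 Q (cd Q ?u) ?w) (am Q ?u (F1 F ?e)))
      = cp Q (un Q (cd Q ?u)) (cp Q (am Q ?u (id1 B (F0 F (snd u)))) (a2 Q (dm Q ?u) ?w))"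
      using nat[of ?u ?w] by simp
    also have "\<dots> = cp Q ?u (cp Q (un Q (dm Q ?u)) (a2 Q (dm Q ?u) ?w))"
      using cp_reassoc[OF un_nat[of ?u], of "a2 Q (dm Q ?u) ?w"] by simp
    finally show "cp (pull C B F Q) (un (pull C B F Q) (cd (pull C B F Q) u))
        (am (pull C B F Q) u (id1 C (bs (pull C B F Q) (dm (pull C B F Q) u)))) =
       cp (pull C B F Q) u (un (pull C B F Q) (dm (pull C B F Q) u))"
      by simp
  qed (auto intro!: isoP_pull simp: am_cp a2_vc F.F2_vc' natF)
  then show ?thesis by (simp add: bimodule_def C.bicategory_axioms)
qed

section \<open>Symmetric pairings\<close>

text \<open>
  Morphisms over \<open>c\<close> in \<open>Q\<close> are thought of as lying over a pair \<open>(c, a)\<close>, where \<open>a\<close> is the base of the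
  image under the involution \<open>sg\<close>.  The action in the second variable is conjugate to the one in the
  first variable, and commutes strictly with it.
\<close>

locale pairing = bimodule B Q
  for B :: "('o, 'm, 'c) bicat" and Q :: "('o, 'm, 'c, 'x, 'y) rmod" +
  fixes sg :: "'x \<Rightarrow> 'x" and sm :: "'y \<Rightarrow> 'y"
  assumes sg_Ob: "X \<in> Ob Q \<Longrightarrow> sg X \<in> Ob Q" and sg_sg: "X \<in> Ob Q \<Longrightarrow> sg (sg X) = X"
    and sm_Ar: "u \<in> Ar Q \<Longrightarrow> sm u \<in> Ar Q \<and> dm Q (sm u) = sg (dm Q u) \<and> cd Q (sm u) = sg (cd Q u)"
    and sm_one: "X \<in> Ob Q \<Longrightarrow> sm (one Q X) = one Q (sg X)"
    and sm_cp: "\<lbrakk>u \<in> Ar Q; v \<in> Ar Q; cd Q u = dm Q v\<rbrakk> \<Longrightarrow> sm (cp Q v u) = cp Q (sm v) (sm u)"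
    and sm_sm: "u \<in> Ar Q \<Longrightarrow> sm (sm u) = u"
    and bs_sg_ac: "\<lbrakk>X \<in> Ob Q; k \<in> arr1 B; trg B k = bs Q X\<rbrakk> \<Longrightarrow> bs Q (sg (ac Q X k)) = bs Q (sg X)"
    and ac_st: "\<lbrakk>X \<in> Ob Q; k \<in> arr1 B; l \<in> arr1 B; trg B k = bs Q X; trg B l = bs Q (sg X)\<rbrakk>
      \<Longrightarrow> ac Q (sg (ac Q (sg X) l)) k = sg (ac Q (sg (ac Q X k)) l)"
    and am_st: "\<lbrakk>u \<in> Ar Q; k \<in> arr1 B; l \<in> arr1 B; trg B k = bs Q (dm Q u); trg B l = bs Q (sg (dm Q u))\<rbrakk>
      \<Longrightarrow> am Q (sm (am Q (sm u) l)) k = sm (am Q (sm (am Q u k)) l)"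
    and a2_st: "\<lbrakk>X \<in> Ob Q; p \<in> arr2 B; l \<in> arr1 B; trg B (dom2 B p) = bs Q X; trg B l = bs Q (sg X)\<rbrakk>
      \<Longrightarrow> a2 Q (sg (ac Q (sg X) l)) p = sm (am Q (sm (a2 Q X p)) l)"
    and io_st: "\<lbrakk>X \<in> Ob Q; f \<in> arr1 B; g \<in> arr1 B; l \<in> arr1 B; trg B f = src B g; trg B g = bs Q X; trg B l = bs Q (sg X)\<rbrakk>
      \<Longrightarrow> io Q (sg (ac Q (sg X) l)) g f = sm (am Q (sm (io Q X g f)) l)"
    and un_st: "\<lbrakk>X \<in> Ob Q; l \<in> arr1 B; trg B l = bs Q (sg X)\<rbrakk>
      \<Longrightarrow> un Q (sg (ac Q (sg X) l)) = sm (am Q (sm (un Q X)) l)"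

section \<open>Strictification of an action of \<open>B \<times> B\<close> with a pseudo-involution\<close>

text \<open>The pairing before strictification: an involution that respects the action, and squares
  to the identity, only up to isomorphism. \<open>nu\<close> compares acting outside with acting
  inside the involution, \<open>sy\<close> compares an object with its double image.
  \<open>sy_sg\<close> equates the two isomorphisms from \<open>sg X\<close> to
  \<open>sg (sg (sg X))\<close>; it is what lets the strict involution square to the identity on
  morphisms.\<close>

locale imodule = B: bicategory B + bimodule "prodB B B" Q
  for B :: "('o, 'm, 'c) bicat" and Q :: "('o \<times> 'o, 'm \<times> 'm, 'c \<times> 'c, 'x, 'y) rmod" +
  fixes sg :: "'x \<Rightarrow> 'x" and sm :: "'y \<Rightarrow> 'y" and nu :: "'x \<Rightarrow> 'm \<times> 'm \<Rightarrow> 'y" and sy :: "'x \<Rightarrow> 'y"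
  assumes sg: "X \<in> Ob Q \<Longrightarrow> sg X \<in> Ob Q \<and> bs Q (sg X) = prod.swap (bs Q X)"
    and sm: "u \<in> Ar Q \<Longrightarrow> sm u \<in> Ar Q \<and> dm Q (sm u) = sg (dm Q u) \<and> cd Q (sm u) = sg (cd Q u)"
    and sm_one: "X \<in> Ob Q \<Longrightarrow> sm (one Q X) = one Q (sg X)"
    and sm_cp: "\<lbrakk>u \<in> Ar Q; v \<in> Ar Q; cd Q u = dm Q v\<rbrakk> \<Longrightarrow> sm (cp Q v u) = cp Q (sm v) (sm u)"
    and nu: "\<lbrakk>X \<in> Ob Q; k \<in> arr1 (prodB B B); trg (prodB B B) k = prod.swap (bs Q X)\<rbrakk>
      \<Longrightarrow> isoP Q (nu X k) \<and> dm Q (nu X k) = ac Q (sg X) k \<and> cd Q (nu X k) = sg (ac Q X (prod.swap k))"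
    and nu_nat: "\<lbrakk>u \<in> Ar Q; k \<in> arr1 (prodB B B); trg (prodB B B) k = prod.swap (bs Q (dm Q u))\<rbrakk>
      \<Longrightarrow> cp Q (nu (cd Q u) k) (am Q (sm u) k) = cp Q (sm (am Q u (prod.swap k))) (nu (dm Q u) k)"
    and nu_cell: "\<lbrakk>X \<in> Ob Q; p \<in> arr2 (prodB B B); trg (prodB B B) (dom2 (prodB B B) p) = prod.swap (bs Q X)\<rbrakk>
      \<Longrightarrow> cp Q (nu X (cod2 (prodB B B) p)) (a2 Q (sg X) p) = cp Q (sm (a2 Q X (prod.swap p))) (nu X (dom2 (prodB B B) p))"
    and nu_io: "\<lbrakk>X \<in> Ob Q; f \<in> arr1 (prodB B B); g \<in> arr1 (prodB B B);
        trg (prodB B B) f = src (prodB B B) g; trg (prodB B B) g = prod.swap (bs Q X)\<rbrakk>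
      \<Longrightarrow> cp Q (nu (ac Q X (prod.swap g)) f) (cp Q (am Q (nu X g) f) (io Q (sg X) g f))
        = cp Q (sm (io Q X (prod.swap g) (prod.swap f))) (nu X (cmp1 (prodB B B) g f))"
    and nu_un: "X \<in> Ob Q \<Longrightarrow> cp Q (sm (un Q X)) (nu X (id1 (prodB B B) (prod.swap (bs Q X)))) = un Q (sg X)"
    and sy: "X \<in> Ob Q \<Longrightarrow> isoP Q (sy X) \<and> dm Q (sy X) = X \<and> cd Q (sy X) = sg (sg X)"
    and sy_nat: "u \<in> Ar Q \<Longrightarrow> cp Q (sy (cd Q u)) u = cp Q (sm (sm u)) (sy (dm Q u))"
    and sy_nu: "\<lbrakk>X \<in> Ob Q; k \<in> arr1 (prodB B B); trg (prodB B B) k = bs Q X\<rbrakk>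
      \<Longrightarrow> cp Q (sm (nu X (prod.swap k))) (cp Q (nu (sg X) k) (am Q (sy X) k)) = sy (ac Q X k)"
    and sy_sg: "X \<in> Ob Q \<Longrightarrow> sy (sg X) = sm (sy X)"
begin

abbreviation "C \<equiv> prodB B B"

lemma sg_simps [simp]: "X \<in> Ob Q \<Longrightarrow> sg X \<in> Ob Q" "X \<in> Ob Q \<Longrightarrow> bs Q (sg X) = prod.swap (bs Q X)"
  using sg by auto

lemma sm_simps [simp]: "u \<in> Ar Q \<Longrightarrow> sm u \<in> Ar Q" "u \<in> Ar Q \<Longrightarrow> dm Q (sm u) = sg (dm Q u)"
  "u \<in> Ar Q \<Longrightarrow> cd Q (sm u) = sg (cd Q u)"
  using sm by auto

lemmas sm_one' [simp] = sm_one

lemma iso_sm [simp]: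
  assumes "iso u"
  shows "iso (sm u)" "inv (sm u) = sm (inv u)"
proof -
  note iso_ar[OF assms, simp]
  have "is_invP Q (sm u) (sm (inv u))" using assms by (simp add: is_invP_def flip: sm_cp)
  then show "iso (sm u)" "inv (sm u) = sm (inv u)" by (auto intro: isoI inv_eqI)
qed

lemma nu_simps [simp]:
  assumes "X \<in> Ob Q" "k \<in> arr1 C" "trg C k = prod.swap (bs Q X)"
  shows "iso (nu X k)" "nu X k \<in> Ar Q" "dm Q (nu X k) = sg X \<cdot> k" "cd Q (nu X k) = sg (X \<cdot> prod.swap k)"
  using nu[OF assms] iso_ar by auto

lemma sy_simps [simp]:
  assumes "X \<in> Ob Q"
  shows "iso (sy X)" "sy X \<in> Ar Q" "dm Q (sy X) = X" "cd Q (sy X) = sg (sg X)"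
  using sy[OF assms] iso_ar by auto

section \<open>Absorbing an acting 1-morphism into a formal object\<close>

definition rO :: "bool \<Rightarrow> 'x \<Rightarrow> 'm \<times> 'm \<Rightarrow> 'x" where
  "rO fl P m = (if fl then sg (P \<cdot> prod.swap m) else P \<cdot> m)"

definition rh :: "bool \<Rightarrow> 'x \<Rightarrow> 'c \<times> 'c \<Rightarrow> 'y" where
  "rh fl P w = (if fl then sm (P \<cdot>\<^sub>2 prod.swap w) else P \<cdot>\<^sub>2 w)"

text \<open>Moves an acting 1-morphism \<open>k\<close> into the formal factor \<open>m\<close>. In
  the flagged case \<open>k\<close> acts outside the involution, so it is first brought inside by
  \<open>nu\<close> and only then merged by \<open>io\<close>.\<close>

definition al :: "bool \<Rightarrow> 'x \<Rightarrow> 'm \<times> 'm \<Rightarrow> 'm \<times> 'm \<Rightarrow> 'y" where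
  "al fl P m k = (if fl then sm (inv (io Q P (prod.swap m) (prod.swap k))) \<odot> nu (P \<cdot> prod.swap m) k
     else inv (io Q P m k))"

definition wf :: "bool \<Rightarrow> 'x \<Rightarrow> 'o \<times> 'o \<Rightarrow> bool" where
  "wf fl P y \<longleftrightarrow> P \<in> Ob Q \<and> bs Q P = (if fl then prod.swap y else y)"

lemma swap_conv [simp]: "prod.swap p = (snd p, fst p)"
  by (simp add: prod.swap_def)

lemma arrC_iff [simp]: "f \<in> arr1 B \<times> arr1 B \<longleftrightarrow> fst f \<in> arr1 B \<and> snd f \<in> arr1 B"
  "u \<in> arr2 B \<times> arr2 B \<longleftrightarrow> fst u \<in> arr2 B \<and> snd u \<in> arr2 B"
  "y \<in> obj B \<times> obj B \<longleftrightarrow> fst y \<in> obj B \<and> snd y \<in> obj B"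
  by (simp_all add: mem_Times_iff)

lemma a2_id_pair [simp]:
  assumes "X \<in> Ob Q" "f \<in> arr1 B" "g \<in> arr1 B" "bs Q X = (trg B f, trg B g)"
  shows "X \<cdot>\<^sub>2 (id2 B f, id2 B g) = one Q (X \<cdot> (f, g))"
  using a2_id[of X "(f, g)"] assms by simp

lemma rO_simps [simp]:
  assumes "wf fl P (trg C m)" "m \<in> arr1 C"
  shows "rO fl P m \<in> Ob Q" "bs Q (rO fl P m) = src C m"
  using assms by (cases fl, simp_all add: wf_def rO_def)

lemma rh_simps [simp]:
  assumes "wf fl P (trg C (dom2 C w))" "w \<in> arr2 C"
  shows "rh fl P w \<in> Ar Q" "dm Q (rh fl P w) = rO fl P (dom2 C w)" "cd Q (rh fl P w) = rO fl P (cod2 C w)"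
  using assms by (cases fl, simp_all add: wf_def rO_def rh_def)

lemma rh_id [simp]:
  assumes "wf fl P (trg C m)" "m \<in> arr1 C"
  shows "rh fl P (id2 C m) = one Q (rO fl P m)"
  using assms by (cases fl, simp_all add: wf_def rO_def rh_def)

lemma rh_vc:
  assumes "wf fl P (trg C (dom2 C w))" "w \<in> arr2 C" "w' \<in> arr2 C" "dom2 C w' = cod2 C w"
  shows "rh fl P (vc C w' w) = rh fl P w' \<odot> rh fl P w"
proof -
  have "P \<cdot>\<^sub>2 vc C w' w = P \<cdot>\<^sub>2 w' \<odot> P \<cdot>\<^sub>2 w" if "\<not> fl"
    using a2_vc[of P w w'] assms that by (simp add: wf_def)
  moreover have "P \<cdot>\<^sub>2 vc C (prod.swap w') (prod.swap w) = P \<cdot>\<^sub>2 prod.swap w' \<odot> P \<cdot>\<^sub>2 prod.swap w" if fl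
    using a2_vc[of P "prod.swap w" "prod.swap w'"] assms that by (simp add: wf_def)
  ultimately show ?thesis using assms by (cases fl) (simp_all add: rh_def wf_def sm_cp)
qed

lemma al_simps [simp]:
  assumes "wf fl P (trg C m)" "m \<in> arr1 C" "k \<in> arr1 C" "trg C k = src C m"
  shows "iso (al fl P m k)" "al fl P m k \<in> Ar Q" "dm Q (al fl P m k) = rO fl P m \<cdot> k"
    "cd Q (al fl P m k) = rO fl P (cmp1 C m k)"
  using assms by (cases fl, simp_all add: wf_def rO_def al_def)

lemma io_inv_asc:
  assumes [simp]: "P \<in> Ob Q" "f \<in> arr1 C" "g \<in> arr1 C" "h \<in> arr1 C" "trg C f = src C g" "trg C g = src C h" "trg C h = bs Q P"
  shows "P \<cdot>\<^sub>2 asc C h g f \<odot> inv (io Q P (cmp1 C h g) f) \<odot> inv (io Q P h g) \<cdot>\<^sub>1 f \<odot> io Q (P \<cdot> h) g f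
    = inv (io Q P h (cmp1 C g f))"
proof -
  note [simp del] = prodB_simps
  have 1: "io Q (P \<cdot> h) g f \<odot> io Q P h (cmp1 C g f) \<odot> P \<cdot>\<^sub>2 asc C h g f = io Q P h g \<cdot>\<^sub>1 f \<odot> io Q P (cmp1 C h g) f"
    by (rule io_asc) auto
  have "inv (io Q P h g \<cdot>\<^sub>1 f \<odot> io Q P (cmp1 C h g) f) \<odot> io Q (P \<cdot> h) g f = inv (io Q P h (cmp1 C g f) \<odot> P \<cdot>\<^sub>2 asc C h g f)"
    unfolding 1[symmetric] by simp
  then have "P \<cdot>\<^sub>2 asc C h g f \<odot> (inv (io Q P h g \<cdot>\<^sub>1 f \<odot> io Q P (cmp1 C h g) f) \<odot> io Q (P \<cdot> h) g f)
    = P \<cdot>\<^sub>2 asc C h g f \<odot> inv (io Q P h (cmp1 C g f) \<odot> P \<cdot>\<^sub>2 asc C h g f)" by simp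
  then show ?thesis by (simp del: iso_a2(2) add: inv_cancel(2))
qed

text \<open>The unflagged case is the associativity law \<open>io_asc\<close> solved for inverses.
  The flagged case reflects it: \<open>nu_nat\<close> exchanges \<open>io\<close> with
  \<open>nu\<close>, \<open>nu_io\<close> fuses the two copies of \<open>nu\<close>, and the rest is
  \<open>io_inv_asc\<close> under \<open>sm\<close>.\<close>

lemma al_asc:
  assumes P: "wf fl P (trg C m)" and S: "m \<in> arr1 C" "k \<in> arr1 C" "k' \<in> arr1 C" "trg C k = src C m" "trg C k' = src C k"
  shows "rh fl P (asc C m k k') \<odot> al fl P (cmp1 C m k) k' \<odot> al fl P m k \<cdot>\<^sub>1 k' \<odot> io Q (rO fl P m) k k'
    = al fl P m (cmp1 C k k')"
proof -
  note [simp] = S[simplified]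
  show ?thesis
  proof (cases fl)
  case False
  with P have [simp]: "P \<in> Ob Q" "bs Q P = trg C m" by (auto simp: wf_def)
  show ?thesis using io_inv_asc[of P k' k m] False by (simp add: rh_def al_def rO_def)
next
  case True
  let ?m = "prod.swap m" and ?k = "prod.swap k" and ?l = "prod.swap k'"
  from True P have [simp]: "P \<in> Ob Q" "bs Q P = trg C ?m" by (auto simp: wf_def)
  let ?v = "inv (io Q P ?m ?k)" and ?mk = "cmp1 C ?m ?k"
  have 1: "nu (P \<cdot> ?mk) k' \<odot> sm ?v \<cdot>\<^sub>1 k' = sm (?v \<cdot>\<^sub>1 ?l) \<odot> nu (P \<cdot> ?m \<cdot> ?k) k'"
    using nu_nat[of ?v k'] by simp
  have 2: "nu (P \<cdot> ?m \<cdot> ?k) k' \<odot> nu (P \<cdot> ?m) k \<cdot>\<^sub>1 k' \<odot> io Q (sg (P \<cdot> ?m)) k k'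
    = sm (io Q (P \<cdot> ?m) ?k ?l) \<odot> nu (P \<cdot> ?m) (cmp1 C k k')"
    using nu_io[of "P \<cdot> ?m" k' k] by simp
  have 3: "sm (P \<cdot>\<^sub>2 asc C ?m ?k ?l) \<odot> sm (inv (io Q P ?mk ?l)) \<odot> sm (?v \<cdot>\<^sub>1 ?l) \<odot> sm (io Q (P \<cdot> ?m) ?k ?l)
    = sm (inv (io Q P ?m (cmp1 C ?k ?l)))"
    using arg_cong[OF io_inv_asc[of P ?l ?k ?m], of sm] by (simp add: sm_cp del: iso_am(2))
  have "rh fl P (asc C m k k') \<odot> al fl P (cmp1 C m k) k' \<odot> al fl P m k \<cdot>\<^sub>1 k' \<odot> io Q (rO fl P m) k k'
    = sm (P \<cdot>\<^sub>2 asc C ?m ?k ?l) \<odot> sm (inv (io Q P ?mk ?l)) \<odot> nu (P \<cdot> ?mk) k' \<odot> sm ?v \<cdot>\<^sub>1 k'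
       \<odot> nu (P \<cdot> ?m) k \<cdot>\<^sub>1 k' \<odot> io Q (sg (P \<cdot> ?m)) k k'"
    using True by (simp add: rh_def al_def rO_def am_cp)
  also have "\<dots> = sm (P \<cdot>\<^sub>2 asc C ?m ?k ?l) \<odot> sm (inv (io Q P ?mk ?l)) \<odot> sm (?v \<cdot>\<^sub>1 ?l) \<odot> sm (io Q (P \<cdot> ?m) ?k ?l)
     \<odot> nu (P \<cdot> ?m) (cmp1 C k k')"
    using cp_reassoc[OF 1, of "nu (P \<cdot> ?m) k \<cdot>\<^sub>1 k' \<odot> io Q (sg (P \<cdot> ?m)) k k'"] 2 by simp
  also have "\<dots> = al fl P m (cmp1 C k k')"
    using arg_cong[OF 3, of "\<lambda>u. u \<odot> nu (P \<cdot> ?m) (cmp1 C k k')"] True by (simp add: al_def)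
  finally show ?thesis .
  qed
qed

lemma al_run:
  assumes P: "wf fl P (trg C m)" and S: "m \<in> arr1 C"
  shows "rh fl P (run C m) \<odot> al fl P m (id1 C (src C m)) = un Q (rO fl P m)"
proof -
  note [simp] = S[simplified]
  show ?thesis
  proof (cases fl)
  case False
  with P have [simp]: "P \<in> Ob Q" "bs Q P = trg C m" by (auto simp: wf_def)
  show ?thesis using cp_inv_right[OF un_run[of P m, symmetric]] False by (simp add: rh_def al_def rO_def)
next
  case True
  let ?m = "prod.swap m"
  from True P have [simp]: "P \<in> Ob Q" "bs Q P = trg C ?m" by (auto simp: wf_def)
  let ?i = "io Q P ?m (id1 C (src C ?m))"
  have "sm (P \<cdot>\<^sub>2 run C ?m) \<odot> sm (inv ?i) = sm (un Q (P \<cdot> ?m))"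
    using arg_cong[OF cp_inv_right[OF un_run[of P ?m, symmetric]], of sm] by (simp add: sm_cp)
  from arg_cong[OF this, of "\<lambda>u. u \<odot> nu (P \<cdot> ?m) (id1 C (src C m))"]
  show ?thesis using True nu_un[of "P \<cdot> ?m"] by (simp add: rh_def al_def rO_def)
  qed
qed

lemma al_cell:
  assumes P: "wf fl P (trg C m)" and S: "m \<in> arr1 C" "w \<in> arr2 C" "trg C (dom2 C w) = src C m"
  shows "al fl P m (cod2 C w) \<odot> rO fl P m \<cdot>\<^sub>2 w = rh fl P (hc C (id2 C m) w) \<odot> al fl P m (dom2 C w)"
proof -
  note [simp] = S[simplified]
  have 1: "inv (io Q P m (cod2 C w)) \<odot> (P \<cdot> m) \<cdot>\<^sub>2 w = P \<cdot>\<^sub>2 hc C (id2 C m) w \<odot> inv (io Q P m (dom2 C w))"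
    if S: "P \<in> Ob Q" "bs Q P = trg C m" "m \<in> arr1 C" "w \<in> arr2 C" "trg C (dom2 C w) = src C m" for m w
  proof (rule inP_swap)
  qed (use io_hc[of P w "id2 C m"] S in simp_all)
  show ?thesis
  proof (cases fl)
    case False
    with P have [simp]: "P \<in> Ob Q" "bs Q P = trg C m" by (auto simp: wf_def)
    show ?thesis using 1[of m w] False by (simp add: rh_def al_def rO_def)
  next
    case True
    let ?m = "prod.swap m" and ?w = "prod.swap w"
    from True P have [simp]: "P \<in> Ob Q" "bs Q P = trg C ?m" by (auto simp: wf_def)
    have 2: "sm (inv (io Q P ?m (cod2 C ?w))) \<odot> sm ((P \<cdot> ?m) \<cdot>\<^sub>2 ?w)
      = sm (P \<cdot>\<^sub>2 hc C (id2 C ?m) ?w) \<odot> sm (inv (io Q P ?m (dom2 C ?w)))"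
      using arg_cong[OF 1[of ?m ?w], of sm] by (simp add: sm_cp)
    show ?thesis using nu_cell[of "P \<cdot> ?m" w] cp_reassoc[OF 2, of "nu (P \<cdot> ?m) (dom2 C w)"] True
      by (simp add: rh_def al_def rO_def)
  qed
qed

lemma al_nat:
  assumes P: "wf fl P (trg C (dom2 C w))" and S: "k \<in> arr1 C" "w \<in> arr2 C" "trg C k = src C (dom2 C w)"
  shows "al fl P (cod2 C w) k \<odot> rh fl P w \<cdot>\<^sub>1 k = rh fl P (hc C w (id2 C k)) \<odot> al fl P (dom2 C w) k"
proof -
  note [simp] = S[simplified]
  have 1: "inv (io Q P (cod2 C w) k) \<odot> (P \<cdot>\<^sub>2 w) \<cdot>\<^sub>1 k = P \<cdot>\<^sub>2 hc C w (id2 C k) \<odot> inv (io Q P (dom2 C w) k)"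
    if S: "P \<in> Ob Q" "bs Q P = trg C (dom2 C w)" "k \<in> arr1 C" "w \<in> arr2 C" "trg C k = src C (dom2 C w)" for k w
  proof (rule inP_swap)
  qed (use io_hc[of P "id2 C k" w] S in simp_all)
  show ?thesis
  proof (cases fl)
    case False
    with P have [simp]: "P \<in> Ob Q" "bs Q P = trg C (dom2 C w)" by (auto simp: wf_def)
    show ?thesis using 1[of w k] False by (simp add: rh_def al_def rO_def)
  next
    case True
    let ?k = "prod.swap k" and ?w = "prod.swap w"
    from True P have [simp]: "P \<in> Ob Q" "bs Q P = trg C (dom2 C ?w)" by (auto simp: wf_def)
    have 2: "sm (inv (io Q P (cod2 C ?w) ?k)) \<odot> sm ((P \<cdot>\<^sub>2 ?w) \<cdot>\<^sub>1 ?k)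
      = sm (P \<cdot>\<^sub>2 hc C ?w (id2 C ?k)) \<odot> sm (inv (io Q P (dom2 C ?w) ?k))"
      using arg_cong[OF 1[of ?w ?k], of sm] by (simp add: sm_cp)
    show ?thesis using nu_nat[of "P \<cdot>\<^sub>2 ?w" k] cp_reassoc[OF 2, of "nu (P \<cdot> dom2 C ?w) k"] True
      by (simp add: rh_def al_def rO_def)
  qed
qed

lemma rh_cp:
  assumes "wf fl P (trg B (dom2 B s), trg B (dom2 B t))" "s \<in> arr2 B" "t \<in> arr2 B" "s' \<in> arr2 B" "t' \<in> arr2 B"
    "cod2 B s = dom2 B s'" "cod2 B t = dom2 B t'"
  shows "rh fl P (s', t') \<odot> rh fl P (s, t) = rh fl P (vc B s' s, vc B t' t)"
  using rh_vc[of fl P "(s, t)" "(s', t')"] assms by simp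

lemma rh_cp_tail:
  assumes "wf fl P (trg B (dom2 B s), trg B (dom2 B t))" "s \<in> arr2 B" "t \<in> arr2 B" "s' \<in> arr2 B" "t' \<in> arr2 B"
    "cod2 B s = dom2 B s'" "cod2 B t = dom2 B t'" "u \<in> Ar Q" "cd Q u = rO fl P (dom2 B s, dom2 B t)"
  shows "rh fl P (s', t') \<odot> rh fl P (s, t) \<odot> u = rh fl P (vc B s' s, vc B t' t) \<odot> u"
proof -
  have [simp]: "trg B (dom2 B s') = trg B (dom2 B s)" "trg B (dom2 B t') = trg B (dom2 B t)"
    using assms(2-7) B.trg_cod2[of s] B.trg_cod2[of t] by simp_all
  show ?thesis using cp_reassoc[OF rh_cp[OF assms(1-7)], of u] assms by simp
qed

lemma rh_one [simp]:
  assumes "wf fl P (trg B f, trg B g)" "f \<in> arr1 B" "g \<in> arr1 B"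
  shows "rh fl P (id2 B f, id2 B g) = one Q (rO fl P (f, g))"
  using rh_id[of fl P "(f, g)"] assms by simp

lemma rh_iso [simp]:
  assumes "wf fl P (trg B (dom2 B s), trg B (dom2 B t))" "B.isoc s" "B.isoc t"
  shows "iso (rh fl P (s, t))"
proof -
  note [simp] = B.isoc_arr2[OF assms(2)] B.isoc_arr2[OF assms(3)]
  have [simp]: "trg B (cod2 B s) = trg B (dom2 B s)" "trg B (cod2 B t) = trg B (dom2 B t)" by simp_all
  have "is_invP Q (rh fl P (s, t)) (rh fl P (inv2 B s, inv2 B t))"
    using assms by (simp add: is_invP_def rh_cp)
  then show ?thesis by (rule isoI)
qed

lemma al_asc_inv:
  assumes [simp]: "wf fl P (trg B f, trg B g)" "f \<in> arr1 B" "g \<in> arr1 B" "h \<in> arr1 B" "k \<in> arr1 B" "h' \<in> arr1 B" "k' \<in> arr1 B"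
    "trg B h = src B f" "trg B k = src B h" "trg B h' = src B g" "trg B k' = src B h'"
  shows "al fl P (cmp1 B f h, cmp1 B g h') (k, k') \<odot> al fl P (f, g) (h, h') \<cdot>\<^sub>1 (k, k') \<odot> io Q (rO fl P (f, g)) (h, h') (k, k')
    = rh fl P (inv2 B (asc B f h k), inv2 B (asc B g h' k')) \<odot> al fl P (f, g) (cmp1 B h k, cmp1 B h' k')"
  using arg_cong[OF al_asc[of fl P "(f, g)" "(h, h')" "(k, k')"], of "\<lambda>u. rh fl P (inv2 B (asc B f h k), inv2 B (asc B g h' k')) \<odot> u"]
  by (simp add: rh_cp_tail)

text \<open>Absorption of a 1-morphism that acts in the first variable only. The identity acting in
  the second variable is composed onto \<open>g\<close> by \<open>al\<close> and removed again by
  \<open>run\<close>, so that the formal second factor stays \<open>g\<close>.\<close>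

definition A1 :: "bool \<Rightarrow> 'x \<Rightarrow> 'm \<Rightarrow> 'm \<Rightarrow> 'm \<Rightarrow> 'y" where
  "A1 fl P f g k = rh fl P (id2 B (cmp1 B f k), run B g) \<odot> al fl P (f, g) (k, id1 B (src B g))"

definition A2 :: "bool \<Rightarrow> 'x \<Rightarrow> 'm \<Rightarrow> 'm \<Rightarrow> 'm \<Rightarrow> 'y" where
  "A2 fl P f g l = rh fl P (run B f, id2 B (cmp1 B g l)) \<odot> al fl P (f, g) (id1 B (src B f), l)"

lemma A1_simps [simp]:
  assumes "wf fl P (trg B f, trg B g)" "f \<in> arr1 B" "g \<in> arr1 B" "k \<in> arr1 B" "trg B k = src B f"
  shows "iso (A1 fl P f g k)" "A1 fl P f g k \<in> Ar Q" "dm Q (A1 fl P f g k) = rO fl P (f, g) \<cdot> (k, id1 B (src B g))"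
    "cd Q (A1 fl P f g k) = rO fl P (cmp1 B f k, g)"
  using assms by (simp_all add: A1_def)

lemma A2_simps [simp]:
  assumes "wf fl P (trg B f, trg B g)" "f \<in> arr1 B" "g \<in> arr1 B" "l \<in> arr1 B" "trg B l = src B g"
  shows "iso (A2 fl P f g l)" "A2 fl P f g l \<in> Ar Q" "dm Q (A2 fl P f g l) = rO fl P (f, g) \<cdot> (id1 B (src B f), l)"
    "cd Q (A2 fl P f g l) = rO fl P (f, cmp1 B g l)"
  using assms by (simp_all add: A2_def)

lemma A1_rh:
  assumes [simp]: "wf fl P (trg B (dom2 B s), trg B (dom2 B t))" "s \<in> arr2 B" "t \<in> arr2 B" "k \<in> arr1 B" "trg B k = src B (dom2 B s)"
  shows "A1 fl P (cod2 B s) (cod2 B t) k \<odot> rh fl P (s, t) \<cdot>\<^sub>1 (k, id1 B (src B (dom2 B t)))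
    = rh fl P (hc B s (id2 B k), t) \<odot> A1 fl P (dom2 B s) (dom2 B t) k"
  using al_nat[of fl P "(s, t)" "(k, id1 B (src B (dom2 B t)))"] B.run_nat'[of t]
  by (simp add: A1_def rh_cp_tail)

lemma A2_rh:
  assumes [simp]: "wf fl P (trg B (dom2 B s), trg B (dom2 B t))" "s \<in> arr2 B" "t \<in> arr2 B" "l \<in> arr1 B" "trg B l = src B (dom2 B t)"
  shows "A2 fl P (cod2 B s) (cod2 B t) l \<odot> rh fl P (s, t) \<cdot>\<^sub>1 (id1 B (src B (dom2 B s)), l)
    = rh fl P (s, hc B t (id2 B l)) \<odot> A2 fl P (dom2 B s) (dom2 B t) l"
  using al_nat[of fl P "(s, t)" "(id1 B (src B (dom2 B s)), l)"] B.run_nat'[of s]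
  by (simp add: A2_def rh_cp_tail)

lemma A1_cell:
  assumes [simp]: "wf fl P (trg B f, trg B g)" "f \<in> arr1 B" "g \<in> arr1 B" "w \<in> arr2 B" "trg B (dom2 B w) = src B f"
  shows "A1 fl P f g (cod2 B w) \<odot> rO fl P (f, g) \<cdot>\<^sub>2 (w, id2 B (id1 B (src B g)))
    = rh fl P (hc B (id2 B f) w, id2 B g) \<odot> A1 fl P f g (dom2 B w)"
  using al_cell[of fl P "(f, g)" "(w, id2 B (id1 B (src B g)))"]
  by (simp add: A1_def rh_cp_tail)

text \<open>The pair \<open>(cmp1 B h k, e)\<close> is not the composite of \<open>(h, e)\<close>
  and \<open>(k, e)\<close>, whose second component is \<open>e\<close> composed with itself; the
  inverse of \<open>lun\<close> bridges this. The unitors in the second variable then have to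
  cancel.\<close>

lemma A1_cmp:
  assumes [simp]: "wf fl P (trg B f, trg B g)" "f \<in> arr1 B" "g \<in> arr1 B" "h \<in> arr1 B" "k \<in> arr1 B"
    "trg B h = src B f" "trg B k = src B h"
  defines "e \<equiv> id1 B (src B g)"
  shows "A1 fl P (cmp1 B f h) g k \<odot> A1 fl P f g h \<cdot>\<^sub>1 (k, e) \<odot> io Q (rO fl P (f, g)) (h, e) (k, e)
      \<odot> rO fl P (f, g) \<cdot>\<^sub>2 (id2 B (cmp1 B h k), inv2 B (lun B e))
    = rh fl P (inv2 B (asc B f h k), id2 B g) \<odot> A1 fl P f g (cmp1 B h k)"
proof -
  have e [simp]: "e \<in> arr1 B" "src B e = src B g" "trg B e = src B g" by (simp_all add: e_def)
  note [simp] = e_def[symmetric]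
  let ?r = "rO fl P (f, g)" and ?fh = "cmp1 B f h" and ?ge = "cmp1 B g e"
  let ?i = "io Q ?r (h, e) (k, e) \<odot> ?r \<cdot>\<^sub>2 (id2 B (cmp1 B h k), inv2 B (lun B e))"
  have 1: "A1 fl P ?fh g k \<odot> rh fl P (id2 B ?fh, run B g) \<cdot>\<^sub>1 (k, e) = rh fl P (id2 B (cmp1 B ?fh k), run B g) \<odot> A1 fl P ?fh ?ge k"
    using A1_rh[of fl P "id2 B ?fh" "run B g" k] by simp
  have 2: "al fl P (?fh, ?ge) (k, e) \<odot> al fl P (f, g) (h, e) \<cdot>\<^sub>1 (k, e) \<odot> io Q ?r (h, e) (k, e)
    = rh fl P (inv2 B (asc B f h k), inv2 B (asc B g e e)) \<odot> al fl P (f, g) (cmp1 B h k, cmp1 B e e)"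
    by (rule al_asc_inv) simp_all
  have 3: "al fl P (f, g) (cmp1 B h k, cmp1 B e e) \<odot> ?r \<cdot>\<^sub>2 (id2 B (cmp1 B h k), inv2 B (lun B e))
    = rh fl P (id2 B (cmp1 B f (cmp1 B h k)), hc B (id2 B g) (inv2 B (lun B e))) \<odot> al fl P (f, g) (cmp1 B h k, e)"
    using al_cell[of fl P "(f, g)" "(id2 B (cmp1 B h k), inv2 B (lun B e))"] by simp
  \<comment> \<open>The cells left over in the second variable cancel because \<open>lun\<close> and
    \<open>run\<close> agree on an identity.\<close>
  have 4: "vc B (run B ?ge) (vc B (inv2 B (asc B g e e)) (hc B (id2 B g) (inv2 B (lun B e)))) = id2 B ?ge"
  proof -
    have "vc B (hc B (id2 B g) (run B e)) (hc B (id2 B g) (inv2 B (run B e))) = id2 B ?ge"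
      using B.interchange'[of "inv2 B (run B e)" "run B e" "id2 B g" "id2 B g"] by simp
    then show ?thesis using B.run_cmp1[of e g] B.lun_id1_eq_run_id1[of "src B g"] by simp
  qed
  have "A1 fl P ?fh g k \<odot> A1 fl P f g h \<cdot>\<^sub>1 (k, e) \<odot> ?i
    = A1 fl P ?fh g k \<odot> rh fl P (id2 B ?fh, run B g) \<cdot>\<^sub>1 (k, e) \<odot> al fl P (f, g) (h, e) \<cdot>\<^sub>1 (k, e) \<odot> ?i"
    by (simp add: A1_def[of fl P f g h] am_cp)
  also have "\<dots> = rh fl P (id2 B (cmp1 B ?fh k), run B g) \<odot> A1 fl P ?fh ?ge k \<odot> al fl P (f, g) (h, e) \<cdot>\<^sub>1 (k, e) \<odot> ?i"
    using cp_reassoc[OF 1, of "al fl P (f, g) (h, e) \<cdot>\<^sub>1 (k, e) \<odot> ?i"] by simp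
  also have "\<dots> = rh fl P (id2 B (cmp1 B ?fh k), run B g) \<odot> rh fl P (id2 B (cmp1 B ?fh k), run B ?ge) \<odot>
      al fl P (?fh, ?ge) (k, e) \<odot> al fl P (f, g) (h, e) \<cdot>\<^sub>1 (k, e) \<odot> ?i"
    by (simp add: A1_def)
  also have "\<dots> = rh fl P (id2 B (cmp1 B ?fh k), run B g) \<odot> rh fl P (id2 B (cmp1 B ?fh k), run B ?ge) \<odot>
     rh fl P (inv2 B (asc B f h k), inv2 B (asc B g e e)) \<odot> al fl P (f, g) (cmp1 B h k, cmp1 B e e)
     \<odot> ?r \<cdot>\<^sub>2 (id2 B (cmp1 B h k), inv2 B (lun B e))"
    using arg_cong[OF 2, of "\<lambda>u. u \<odot> ?r \<cdot>\<^sub>2 (id2 B (cmp1 B h k), inv2 B (lun B e))"] by simp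
  also have "\<dots> = rh fl P (inv2 B (asc B f h k), id2 B g) \<odot> A1 fl P f g (cmp1 B h k)"
    by (simp add: 3 rh_cp_tail 4 A1_def)
  finally show ?thesis .
qed

lemma A1_un:
  assumes [simp]: "wf fl P (trg B f, trg B g)" "f \<in> arr1 B" "g \<in> arr1 B"
  shows "rh fl P (run B f, id2 B g) \<odot> A1 fl P f g (id1 B (src B f)) = un Q (rO fl P (f, g))"
  using al_run[of fl P "(f, g)"] by (simp add: A1_def rh_cp_tail)

text \<open>The interchange isomorphism of the two variables: acting by \<open>l\<close> and then
  \<open>k\<close> is compared with acting by \<open>k\<close> and then \<open>l\<close>, both being
  the action of the pair \<open>(k, l)\<close> up to unitors.\<close>

definition chi :: "'x \<Rightarrow> 'm \<Rightarrow> 'm \<Rightarrow> 'y" where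
  "chi Z k l = (let e = id1 B (trg B k); e' = id1 B (src B k); d = id1 B (trg B l); d' = id1 B (src B l) in
     io Q Z (k, d) (e', l) \<odot> Z \<cdot>\<^sub>2 (vc B (inv2 B (run B k)) (lun B k), vc B (inv2 B (lun B l)) (run B l))
       \<odot> inv (io Q Z (e, l) (k, d')))"

text \<open>Both orders end in the same formal object, and once everything is absorbed the
  interchange isomorphism disappears. This is the source of the strict commutation of the two
  actions in \<open>strict_pairing\<close>.\<close>

lemma A1_A2:
  assumes [simp]: "wf fl P (trg B f, trg B g)" "f \<in> arr1 B" "g \<in> arr1 B" "k \<in> arr1 B" "l \<in> arr1 B"
    "trg B k = src B f" "trg B l = src B g"
  shows "A1 fl P f (cmp1 B g l) k \<odot> A2 fl P f g l \<cdot>\<^sub>1 (k, id1 B (src B l))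
    = A2 fl P (cmp1 B f k) g l \<odot> A1 fl P f g k \<cdot>\<^sub>1 (id1 B (src B k), l) \<odot> chi (rO fl P (f, g)) k l"
proof -
  define e where "e = id1 B (src B f)"
  define e' where "e' = id1 B (src B k)"
  define d where "d = id1 B (src B g)"
  define d' where "d' = id1 B (src B l)"
  have [simp]: "e \<in> arr1 B" "src B e = src B f" "trg B e = src B f" "e' \<in> arr1 B" "src B e' = src B k" "trg B e' = src B k"
    "d \<in> arr1 B" "src B d = src B g" "trg B d = src B g" "d' \<in> arr1 B" "src B d' = src B l" "trg B d' = src B l"
    by (simp_all add: e_def e'_def d_def d'_def)
  note folds [simp] = e_def[symmetric] e'_def[symmetric] d_def[symmetric] d'_def[symmetric]
  let ?r = "rO fl P (f, g)" and ?fk = "cmp1 B f k" and ?gl = "cmp1 B g l"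
  let ?a = "al fl P (f, g)"
  \<comment> \<open>The triangle law and \<open>run_cmp1\<close>, solved so that the inverse
    associators produced by \<open>al_asc_inv\<close> are eliminated.\<close>
  have tk: "vc B (hc B (run B f) (id2 B k)) (inv2 B (asc B f e k)) = hc B (id2 B f) (lun B k)"
    using B.vc_inv_right[OF B.triangle'[of k f, symmetric]] by simp
  have tl: "vc B (hc B (run B g) (id2 B l)) (inv2 B (asc B g d l)) = hc B (id2 B g) (lun B l)"
    using B.vc_inv_right[OF B.triangle'[of l g, symmetric]] by simp
  have rk: "vc B (run B ?fk) (inv2 B (asc B f k e')) = hc B (id2 B f) (run B k)"
    using B.vc_inv_right[OF B.run_cmp1[of k f]] by simp
  have rl: "vc B (run B ?gl) (inv2 B (asc B g l d')) = hc B (id2 B g) (run B l)"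
    using B.vc_inv_right[OF B.run_cmp1[of l g]] by simp
  have 1: "A1 fl P f ?gl k \<odot> rh fl P (run B f, id2 B ?gl) \<cdot>\<^sub>1 (k, d')
     = rh fl P (hc B (run B f) (id2 B k), id2 B ?gl) \<odot> A1 fl P (cmp1 B f e) ?gl k"
    using A1_rh[of fl P "run B f" "id2 B ?gl" k] by simp
  have 2: "al fl P (cmp1 B f e, ?gl) (k, d') \<odot> ?a (e, l) \<cdot>\<^sub>1 (k, d') \<odot> io Q ?r (e, l) (k, d')
     = rh fl P (inv2 B (asc B f e k), inv2 B (asc B g l d')) \<odot> ?a (cmp1 B e k, cmp1 B l d')"
    by (rule al_asc_inv) simp_all
  have "A1 fl P f ?gl k \<odot> A2 fl P f g l \<cdot>\<^sub>1 (k, d') \<odot> io Q ?r (e, l) (k, d')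
    = A1 fl P f ?gl k \<odot> rh fl P (run B f, id2 B ?gl) \<cdot>\<^sub>1 (k, d') \<odot> ?a (e, l) \<cdot>\<^sub>1 (k, d') \<odot> io Q ?r (e, l) (k, d')"
    by (simp add: A2_def[of fl P f g l] am_cp)
  also have "\<dots> = rh fl P (hc B (run B f) (id2 B k), id2 B ?gl) \<odot> A1 fl P (cmp1 B f e) ?gl k \<odot> ?a (e, l) \<cdot>\<^sub>1 (k, d') \<odot> io Q ?r (e, l) (k, d')"
    using cp_reassoc[OF 1, of "?a (e, l) \<cdot>\<^sub>1 (k, d') \<odot> io Q ?r (e, l) (k, d')"] by simp
  also have "\<dots> = rh fl P (hc B (id2 B f) (lun B k), hc B (id2 B g) (run B l)) \<odot> ?a (cmp1 B e k, cmp1 B l d')"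
    using 2 by (simp add: A1_def folds rh_cp_tail tk rl)
  finally have L: "A1 fl P f ?gl k \<odot> A2 fl P f g l \<cdot>\<^sub>1 (k, d') \<odot> io Q ?r (e, l) (k, d')
    = rh fl P (hc B (id2 B f) (lun B k), hc B (id2 B g) (run B l)) \<odot> ?a (cmp1 B e k, cmp1 B l d')" .
  have 3: "A2 fl P ?fk g l \<odot> rh fl P (id2 B ?fk, run B g) \<cdot>\<^sub>1 (e', l)
     = rh fl P (id2 B ?fk, hc B (run B g) (id2 B l)) \<odot> A2 fl P ?fk (cmp1 B g d) l"
    using A2_rh[of fl P "id2 B ?fk" "run B g" l] by simp
  have 4: "al fl P (?fk, cmp1 B g d) (e', l) \<odot> ?a (k, d) \<cdot>\<^sub>1 (e', l) \<odot> io Q ?r (k, d) (e', l)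
     = rh fl P (inv2 B (asc B f k e'), inv2 B (asc B g d l)) \<odot> ?a (cmp1 B k e', cmp1 B d l)"
    by (rule al_asc_inv) simp_all
  have "A2 fl P ?fk g l \<odot> A1 fl P f g k \<cdot>\<^sub>1 (e', l) \<odot> io Q ?r (k, d) (e', l)
    = A2 fl P ?fk g l \<odot> rh fl P (id2 B ?fk, run B g) \<cdot>\<^sub>1 (e', l) \<odot> ?a (k, d) \<cdot>\<^sub>1 (e', l) \<odot> io Q ?r (k, d) (e', l)"
    by (simp add: A1_def[of fl P f g k] am_cp)
  also have "\<dots> = rh fl P (id2 B ?fk, hc B (run B g) (id2 B l)) \<odot> A2 fl P ?fk (cmp1 B g d) l \<odot> ?a (k, d) \<cdot>\<^sub>1 (e', l) \<odot> io Q ?r (k, d) (e', l)"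
    using cp_reassoc[OF 3, of "?a (k, d) \<cdot>\<^sub>1 (e', l) \<odot> io Q ?r (k, d) (e', l)"] by simp
  also have "\<dots> = rh fl P (hc B (id2 B f) (run B k), hc B (id2 B g) (lun B l)) \<odot> ?a (cmp1 B k e', cmp1 B d l)"
    using 4 by (simp add: A2_def folds rh_cp_tail tl rk)
  finally have R: "A2 fl P ?fk g l \<odot> A1 fl P f g k \<cdot>\<^sub>1 (e', l) \<odot> io Q ?r (k, d) (e', l)
    = rh fl P (hc B (id2 B f) (run B k), hc B (id2 B g) (lun B l)) \<odot> ?a (cmp1 B k e', cmp1 B d l)" .
  let ?w = "vc B (inv2 B (run B k)) (lun B k)" and ?w' = "vc B (inv2 B (lun B l)) (run B l)"
  \<comment> \<open>It remains to slide the unitors of \<open>chi\<close> through the absorption,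
    which turns \<open>R\<close> into \<open>L\<close>.\<close>
  have 5: "?a (cmp1 B k e', cmp1 B d l) \<odot> ?r \<cdot>\<^sub>2 (?w, ?w')
    = rh fl P (hc B (id2 B f) ?w, hc B (id2 B g) ?w') \<odot> ?a (cmp1 B e k, cmp1 B l d')"
    using al_cell[of fl P "(f, g)" "(?w, ?w')"] by simp
  have w: "vc B (hc B (id2 B f) (run B k)) (hc B (id2 B f) ?w) = hc B (id2 B f) (lun B k)"
    "vc B (hc B (id2 B g) (lun B l)) (hc B (id2 B g) ?w') = hc B (id2 B g) (run B l)"
    using B.interchange'[of ?w "run B k" "id2 B f" "id2 B f"] B.interchange'[of ?w' "lun B l" "id2 B g" "id2 B g"]
    by simp_all
  have "A2 fl P ?fk g l \<odot> A1 fl P f g k \<cdot>\<^sub>1 (e', l) \<odot> io Q ?r (k, d) (e', l) \<odot> ?r \<cdot>\<^sub>2 (?w, ?w')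
    = A1 fl P f ?gl k \<odot> A2 fl P f g l \<cdot>\<^sub>1 (k, d') \<odot> io Q ?r (e, l) (k, d')"
    unfolding L using arg_cong[OF R, of "\<lambda>u. u \<odot> ?r \<cdot>\<^sub>2 (?w, ?w')"] by (simp add: 5 rh_cp_tail w)
  from arg_cong[OF this, of "\<lambda>u. u \<odot> inv (io Q ?r (e, l) (k, d'))"]
  show ?thesis by (simp add: chi_def Let_def)
qed

lemma chi_simps [simp]:
  assumes "Z \<in> Ob Q" "k \<in> arr1 B" "l \<in> arr1 B" "bs Q Z = (trg B k, trg B l)"
  shows "iso (chi Z k l)" "chi Z k l \<in> Ar Q" "dm Q (chi Z k l) = Z \<cdot> (id1 B (trg B k), l) \<cdot> (k, id1 B (src B l))"
    "cd Q (chi Z k l) = Z \<cdot> (k, id1 B (trg B l)) \<cdot> (id1 B (src B k), l)"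
proof -
  have "B.isoc (vc B (inv2 B (run B k)) (lun B k))" "B.isoc (vc B (inv2 B (lun B l)) (run B l))" using assms by simp_all
  moreover have "isoP Q (Z \<cdot>\<^sub>2 (s, t))" if "B.isoc s" "B.isoc t" "bs Q Z = (trg B (dom2 B s), trg B (dom2 B t))" for s t
  proof -
    note [simp] = B.isoc_arr2[OF that(1)] B.isoc_arr2[OF that(2)]
    have "is_invP Q (Z \<cdot>\<^sub>2 (s, t)) (Z \<cdot>\<^sub>2 (inv2 B s, inv2 B t))"
      using assms(1) that a2_vc[of Z "(s, t)" "(inv2 B s, inv2 B t)"] a2_vc[of Z "(inv2 B s, inv2 B t)" "(s, t)"]
      by (simp add: is_invP_def)
    then show ?thesis by (rule isoI)
  qed
  ultimately show "iso (chi Z k l)"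
    using assms by (simp add: chi_def Let_def)
  show "chi Z k l \<in> Ar Q" "dm Q (chi Z k l) = Z \<cdot> (id1 B (trg B k), l) \<cdot> (k, id1 B (src B l))"
    "cd Q (chi Z k l) = Z \<cdot> (k, id1 B (trg B l)) \<cdot> (id1 B (src B k), l)"
    using assms by (simp_all add: chi_def Let_def)
qed

lemma chi_nat:
  assumes [simp]: "u \<in> Ar Q" "k \<in> arr1 B" "l \<in> arr1 B" "bs Q (dm Q u) = (trg B k, trg B l)"
  shows "chi (cd Q u) k l \<odot> u \<cdot>\<^sub>1 (id1 B (trg B k), l) \<cdot>\<^sub>1 (k, id1 B (src B l))
    = u \<cdot>\<^sub>1 (k, id1 B (trg B l)) \<cdot>\<^sub>1 (id1 B (src B k), l) \<odot> chi (dm Q u) k l"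
proof -
  define e where "e = id1 B (trg B k)"
  define e' where "e' = id1 B (src B k)"
  define d where "d = id1 B (trg B l)"
  define d' where "d' = id1 B (src B l)"
  have [simp]: "e \<in> arr1 B" "src B e = trg B k" "trg B e = trg B k" "e' \<in> arr1 B" "src B e' = src B k" "trg B e' = src B k"
    "d \<in> arr1 B" "src B d = trg B l" "trg B d = trg B l" "d' \<in> arr1 B" "src B d' = src B l" "trg B d' = src B l"
    by (simp_all add: e_def e'_def d_def d'_def)
  note folds [simp] = e_def[symmetric] e'_def[symmetric] d_def[symmetric] d'_def[symmetric]
  let ?w = "(vc B (inv2 B (run B k)) (lun B k), vc B (inv2 B (lun B l)) (run B l))"
  let ?X = "dm Q u" and ?Y = "cd Q u"
  have 1: "inv (io Q ?Y (e, l) (k, d')) \<odot> u \<cdot>\<^sub>1 (e, l) \<cdot>\<^sub>1 (k, d') = u \<cdot>\<^sub>1 cmp1 C (e, l) (k, d') \<odot> inv (io Q ?X (e, l) (k, d'))"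
    by (rule inP_swap[OF io_nat]) simp_all
  have 2: "?Y \<cdot>\<^sub>2 ?w \<odot> u \<cdot>\<^sub>1 cmp1 C (e, l) (k, d') = u \<cdot>\<^sub>1 cmp1 C (k, d) (e', l) \<odot> ?X \<cdot>\<^sub>2 ?w"
    using nat[of u ?w] by simp
  have 3: "io Q ?Y (k, d) (e', l) \<odot> u \<cdot>\<^sub>1 cmp1 C (k, d) (e', l) = u \<cdot>\<^sub>1 (k, d) \<cdot>\<^sub>1 (e', l) \<odot> io Q ?X (k, d) (e', l)"
    by (rule io_nat) simp_all
  have "io Q ?Y (k, d) (e', l) \<odot> ?Y \<cdot>\<^sub>2 ?w \<odot> inv (io Q ?Y (e, l) (k, d')) \<odot> u \<cdot>\<^sub>1 (e, l) \<cdot>\<^sub>1 (k, d')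
    = io Q ?Y (k, d) (e', l) \<odot> u \<cdot>\<^sub>1 cmp1 C (k, d) (e', l) \<odot> ?X \<cdot>\<^sub>2 ?w \<odot> inv (io Q ?X (e, l) (k, d'))"
    unfolding 1 using cp_reassoc[OF 2, of "inv (io Q ?X (e, l) (k, d'))"] by simp
  also have "\<dots> = u \<cdot>\<^sub>1 (k, d) \<cdot>\<^sub>1 (e', l) \<odot> io Q ?X (k, d) (e', l) \<odot> ?X \<cdot>\<^sub>2 ?w \<odot> inv (io Q ?X (e, l) (k, d'))"
    using cp_reassoc[OF 3, of "?X \<cdot>\<^sub>2 ?w \<odot> inv (io Q ?X (e, l) (k, d'))"] by simp
  finally show ?thesis by (simp add: chi_def Let_def)
qed

section \<open>The strictified action on formal objects\<close>

definition strict_Ob :: "(bool \<times> 'x \<times> 'm \<times> 'm) set" where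
  "strict_Ob = {(fl, P, f, g). f \<in> arr1 B \<and> g \<in> arr1 B \<and> wf fl P (trg B f, trg B g)}"

definition rr :: "bool \<times> 'x \<times> 'm \<times> 'm \<Rightarrow> 'x" where
  "rr = (\<lambda>(fl, P, f, g). rO fl P (f, g))"

text \<open>
  The formal object \<open>(fl, P, f, g)\<close> over \<open>(src f, src g)\<close> stands for \<open>P \<cdot> (f, g)\<close>, or for \<open>sg (P \<cdot> (g, f))\<close>
  if \<open>fl\<close> holds; a morphism is a morphism in \<open>Q\<close> between the objects denoted.  Only the action in the
  first variable is recorded: the action in the second one is its conjugate by \<open>sgS\<close>.
\<close>

definition strict :: "('o, 'm, 'c, bool \<times> 'x \<times> 'm \<times> 'm, (bool \<times> 'x \<times> 'm \<times> 'm) \<times> 'y \<times> (bool \<times> 'x \<times> 'm \<times> 'm)) rmod" where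
  "strict = \<lparr>Ob = strict_Ob, bs = (\<lambda>(fl, P, f, g). src B f),
     Ar = {(X, u, Y). X \<in> strict_Ob \<and> Y \<in> strict_Ob \<and> u \<in> Ar Q \<and> dm Q u = rr X \<and> cd Q u = rr Y},
     dm = fst, cd = snd \<circ> snd, one = (\<lambda>X. (X, one Q (rr X), X)),
     cp = (\<lambda>v u. (fst u, fst (snd v) \<odot> fst (snd u), snd (snd v))),
     ac = (\<lambda>(fl, P, f, g) k. (fl, P, cmp1 B f k, g)),
     am = (\<lambda>((fl, P, f, g), u, (fl', P', f', g')) k. ((fl, P, cmp1 B f k, g),
        A1 fl' P' f' g' k \<odot> u \<cdot>\<^sub>1 (k, id1 B (src B g)) \<odot> inv (A1 fl P f g k), (fl', P', cmp1 B f' k, g'))),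
     a2 = (\<lambda>(fl, P, f, g) w. ((fl, P, cmp1 B f (dom2 B w), g), rh fl P (hc B (id2 B f) w, id2 B g),
        (fl, P, cmp1 B f (cod2 B w), g))),
     io = (\<lambda>(fl, P, f, g) h k. ((fl, P, cmp1 B f (cmp1 B h k), g), rh fl P (inv2 B (asc B f h k), id2 B g),
        (fl, P, cmp1 B (cmp1 B f h) k, g))),
     un = (\<lambda>(fl, P, f, g). ((fl, P, cmp1 B f (id1 B (src B f)), g), rh fl P (run B f, id2 B g), (fl, P, f, g)))\<rparr>"

lemma strict_Ob_iff [simp]:
  "(fl, P, f, g) \<in> strict_Ob \<longleftrightarrow> f \<in> arr1 B \<and> g \<in> arr1 B \<and> wf fl P (trg B f, trg B g)"
  by (simp add: strict_Ob_def)

lemma rr_simp [simp]: "rr (fl, P, f, g) = rO fl P (f, g)"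
  by (simp add: rr_def)

lemma strict_simps [simp]:
  "Ob strict = strict_Ob" "bs strict (fl, P, f, g) = src B f"
  "(X, u, Y) \<in> Ar strict \<longleftrightarrow> X \<in> strict_Ob \<and> Y \<in> strict_Ob \<and> u \<in> Ar Q \<and> dm Q u = rr X \<and> cd Q u = rr Y"
  "dm strict (X, u, Y) = X" "cd strict (X, u, Y) = Y" "one strict X = (X, one Q (rr X), X)"
  "cp strict (Y', v, Z) (X, u, Y) = (X, v \<odot> u, Z)"
  "ac strict (fl, P, f, g) k = (fl, P, cmp1 B f k, g)"
  "am strict ((fl, P, f, g), u, (fl', P', f', g')) k = ((fl, P, cmp1 B f k, g),
        A1 fl' P' f' g' k \<odot> u \<cdot>\<^sub>1 (k, id1 B (src B g)) \<odot> inv (A1 fl P f g k), (fl', P', cmp1 B f' k, g'))"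
  "a2 strict (fl, P, f, g) w = ((fl, P, cmp1 B f (dom2 B w), g), rh fl P (hc B (id2 B f) w, id2 B g),
        (fl, P, cmp1 B f (cod2 B w), g))"
  "io strict (fl, P, f, g) h k = ((fl, P, cmp1 B f (cmp1 B h k), g), rh fl P (inv2 B (asc B f h k), id2 B g),
        (fl, P, cmp1 B (cmp1 B f h) k, g))"
  "un strict (fl, P, f, g) = ((fl, P, cmp1 B f (id1 B (src B f)), g), rh fl P (run B f, id2 B g), (fl, P, f, g))"
  by (simp_all add: strict_def)

lemma strict_ObE:
  assumes "X \<in> strict_Ob"
  obtains fl P f g where "X = (fl, P, f, g)" "f \<in> arr1 B" "g \<in> arr1 B" "wf fl P (trg B f, trg B g)"
  using assms by (auto simp: strict_Ob_def)

lemma strict_ArE: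
  assumes "u \<in> Ar strict"
  obtains fl P f g v fl' P' f' g' where "u = ((fl, P, f, g), v, (fl', P', f', g'))" "f \<in> arr1 B" "g \<in> arr1 B"
    "wf fl P (trg B f, trg B g)" "f' \<in> arr1 B" "g' \<in> arr1 B" "wf fl' P' (trg B f', trg B g')" "v \<in> Ar Q"
    "dm Q v = rO fl P (f, g)" "cd Q v = rO fl' P' (f', g')" "src B f' = src B f" "src B g' = src B g"
proof -
  obtain X v Y where u: "u = (X, v, Y)" by (metis prod_cases3)
  then have "X \<in> strict_Ob" "Y \<in> strict_Ob" "v \<in> Ar Q" "dm Q v = rr X" "cd Q v = rr Y" using assms by auto
  moreover obtain fl P f g where X: "X = (fl, P, f, g)" "f \<in> arr1 B" "g \<in> arr1 B" "wf fl P (trg B f, trg B g)"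
    using \<open>X \<in> strict_Ob\<close> by (rule strict_ObE)
  moreover obtain fl' P' f' g' where Y: "Y = (fl', P', f', g')" "f' \<in> arr1 B" "g' \<in> arr1 B" "wf fl' P' (trg B f', trg B g')"
    using \<open>Y \<in> strict_Ob\<close> by (rule strict_ObE)
  moreover have "bs Q (cd Q v) = bs Q (dm Q v)" using \<open>v \<in> Ar Q\<close> by simp
  ultimately show ?thesis using that u by simp
qed

lemma isoP_strict:
  assumes "iso u" "X \<in> strict_Ob" "Y \<in> strict_Ob" "dm Q u = rr X" "cd Q u = rr Y"
  shows "isoP strict (X, u, Y)"
proof -
  note [simp] = iso_ar[OF assms(1)]
  have "is_invP strict (X, u, Y) (Y, inv u, X)" using assms by (simp add: is_invP_def)
  then show ?thesis unfolding isoP_def by blast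
qed

text \<open>On formal objects, cells that come from \<open>B\<close> are acted on by plain
  whiskering, without a trace of \<open>A1\<close>. Laws of \<open>strict\<close> that involve only
  such cells thus reduce to laws of a representable action.\<close>

lemma A1_conj_rh:
  assumes "wf fl P (trg B (dom2 B s), trg B (dom2 B t))" "s \<in> arr2 B" "t \<in> arr2 B" "k \<in> arr1 B" "trg B k = src B (dom2 B s)"
    "dom2 B s = f" "dom2 B t = g" "cod2 B s = f'" "cod2 B t = g'"
  shows "A1 fl P f' g' k \<odot> rh fl P (s, t) \<cdot>\<^sub>1 (k, id1 B (src B g)) \<odot> inv (A1 fl P f g k)
    = rh fl P (hc B s (id2 B k), t)"
proof -
  have [simp]: "src B f' = src B f" "trg B f' = trg B f" "src B g' = src B g" "trg B g' = trg B g"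
    using B.src_cod2[of s] B.trg_cod2[of s] B.src_cod2[of t] B.trg_cod2[of t] assms by simp_all
  have "(A1 fl P f' g' k \<odot> rh fl P (s, t) \<cdot>\<^sub>1 (k, id1 B (src B g))) \<odot> inv (A1 fl P f g k) = rh fl P (hc B s (id2 B k), t)"
    by (rule cp_inv_right) (use A1_rh[of fl P s t k] assms B.cod2_arr1[of s] B.cod2_arr1[of t] in auto)
  then show ?thesis using assms B.cod2_arr1[of s] B.cod2_arr1[of t] by auto
qed

lemma A2_conj_rh:
  assumes "wf fl P (trg B (dom2 B s), trg B (dom2 B t))" "s \<in> arr2 B" "t \<in> arr2 B" "k \<in> arr1 B" "trg B k = src B (dom2 B t)"
    "dom2 B s = f" "dom2 B t = g" "cod2 B s = f'" "cod2 B t = g'"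
  shows "A2 fl P f' g' k \<odot> rh fl P (s, t) \<cdot>\<^sub>1 (id1 B (src B f), k) \<odot> inv (A2 fl P f g k)
    = rh fl P (s, hc B t (id2 B k))"
proof -
  have [simp]: "src B f' = src B f" "trg B f' = trg B f" "src B g' = src B g" "trg B g' = trg B g"
    using B.src_cod2[of s] B.trg_cod2[of s] B.src_cod2[of t] B.trg_cod2[of t] assms by simp_all
  have "(A2 fl P f' g' k \<odot> rh fl P (s, t) \<cdot>\<^sub>1 (id1 B (src B f), k)) \<odot> inv (A2 fl P f g k) = rh fl P (s, hc B t (id2 B k))"
    by (rule cp_inv_right) (use A2_rh[of fl P s t k] assms B.cod2_arr1[of s] B.cod2_arr1[of t] in auto)
  then show ?thesis using assms B.cod2_arr1[of s] B.cod2_arr1[of t] by auto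
qed

text \<open>The naturality laws of \<open>a2\<close>, \<open>io\<close> and \<open>un\<close>
  involve a morphism of \<open>Q\<close> and are proved by moving the conjugating \<open>A1\<close>
  across with \<open>A1_cell\<close>, \<open>A1_cmp\<close> and \<open>A1_un\<close>. The coherence
  laws see only composition with \<open>f\<close> and are those of the representable action at its
  target.\<close>

lemma strict_rmodule: "bimodule B strict"
proof -
  have "rmodule B strict"
  proof (unfold_locales, goal_cases)
    case (1 X) then show ?case by (auto elim!: strict_ObE)
  next
    case (2 u) then show ?case by (auto elim!: strict_ArE)
  next
    case (3 X) then show ?case by (auto elim!: strict_ObE)
  next
    case (4 u v) then show ?case by (auto elim!: strict_ArE)
  next
    case (5 u) then show ?case by (auto elim!: strict_ArE)
  next
    case (6 u v w) then show ?case by (auto elim!: strict_ArE)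
  next
    case (7 X k) then show ?case by (auto elim!: strict_ObE)
  next
    case (8 u k) then show ?case by (auto elim!: strict_ArE)
  next
    case (9 X k) then show ?case by (auto elim!: strict_ObE)
  next
    case (10 u v k) then show ?case by (auto elim!: strict_ArE simp: am_cp)
  next
    case (11 X p) then show ?case by (auto elim!: strict_ObE)
  next
    case (12 X k) then show ?case by (auto elim!: strict_ObE)
  next
    case (13 X p q)
    obtain fl P f g where X [simp]: "X = (fl, P, f, g)" "f \<in> arr1 B" "g \<in> arr1 B" "wf fl P (trg B f, trg B g)"
      using 13(1) by (auto elim: strict_ObE)
    from 13 have [simp]: "p \<in> arr2 B" "q \<in> arr2 B" "trg B (dom2 B p) = src B f" "dom2 B q = cod2 B p" by auto
    have [simp]: "trg B (dom2 B q) = src B f" by simp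
    interpret r: bimodule B "B.rep (trg B f)" by (rule B.rep_rmodule) simp
    show ?case using r.a2_vc[of f p q] by (simp add: rh_cp)
  next
    case (14 u p)
    obtain fl P f g v fl' P' f' g' where u [simp]: "u = ((fl, P, f, g), v, (fl', P', f', g'))" "f \<in> arr1 B" "g \<in> arr1 B"
      "wf fl P (trg B f, trg B g)" "f' \<in> arr1 B" "g' \<in> arr1 B" "wf fl' P' (trg B f', trg B g')" "v \<in> Ar Q"
      "dm Q v = rO fl P (f, g)" "cd Q v = rO fl' P' (f', g')" "src B f' = src B f" "src B g' = src B g"
      using 14(1) by (rule strict_ArE)
    from 14 have [simp]: "p \<in> arr2 B" "trg B (dom2 B p) = src B f" by auto
    let ?e = "id1 B (src B g)"
    let ?p = "(p, id2 B ?e)"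
    have 1: "rh fl' P' (hc B (id2 B f') p, id2 B g') \<odot> A1 fl' P' f' g' (dom2 B p) = A1 fl' P' f' g' (cod2 B p) \<odot> rO fl' P' (f', g') \<cdot>\<^sub>2 ?p"
      using A1_cell[of fl' P' f' g' p] by simp
    have 2: "inv (A1 fl P f g (cod2 B p)) \<odot> rh fl P (hc B (id2 B f) p, id2 B g) = rO fl P (f, g) \<cdot>\<^sub>2 ?p \<odot> inv (A1 fl P f g (dom2 B p))"
      by (rule inP_swap[OF A1_cell]) simp_all
    have 3: "rO fl' P' (f', g') \<cdot>\<^sub>2 ?p \<odot> v \<cdot>\<^sub>1 (dom2 B p, ?e) = v \<cdot>\<^sub>1 (cod2 B p, ?e) \<odot> rO fl P (f, g) \<cdot>\<^sub>2 ?p"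
      using nat[of v ?p] by simp
    have "rh fl' P' (hc B (id2 B f') p, id2 B g') \<odot> A1 fl' P' f' g' (dom2 B p) \<odot> v \<cdot>\<^sub>1 (dom2 B p, ?e) \<odot> inv (A1 fl P f g (dom2 B p))
      = A1 fl' P' f' g' (cod2 B p) \<odot> rO fl' P' (f', g') \<cdot>\<^sub>2 ?p \<odot> v \<cdot>\<^sub>1 (dom2 B p, ?e) \<odot> inv (A1 fl P f g (dom2 B p))"
      using cp_reassoc[OF 1, of "v \<cdot>\<^sub>1 (dom2 B p, ?e) \<odot> inv (A1 fl P f g (dom2 B p))"] by simp
    also have "\<dots> = A1 fl' P' f' g' (cod2 B p) \<odot> v \<cdot>\<^sub>1 (cod2 B p, ?e) \<odot> inv (A1 fl P f g (cod2 B p)) \<odot> rh fl P (hc B (id2 B f) p, id2 B g)"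
      unfolding 2 using cp_reassoc[OF 3, of "inv (A1 fl P f g (dom2 B p))"] by simp
    finally show ?case by simp
  next
    case (15 X f g) then show ?case by (auto elim!: strict_ObE intro!: isoP_strict)
  next
    case (16 u h k)
    obtain fl P f g v fl' P' f' g' where u [simp]: "u = ((fl, P, f, g), v, (fl', P', f', g'))" "f \<in> arr1 B" "g \<in> arr1 B"
      "wf fl P (trg B f, trg B g)" "f' \<in> arr1 B" "g' \<in> arr1 B" "wf fl' P' (trg B f', trg B g')" "v \<in> Ar Q"
      "dm Q v = rO fl P (f, g)" "cd Q v = rO fl' P' (f', g')" "src B f' = src B f" "src B g' = src B g"
      using 16(1) by (rule strict_ArE)
    from 16 have [simp]: "h \<in> arr1 B" "k \<in> arr1 B" "trg B h = src B k" "trg B k = src B f" by auto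
    define e where "e = id1 B (src B g)"
    have [simp]: "e \<in> arr1 B" "src B e = src B g" "trg B e = src B g" by (simp_all add: e_def)
    note [simp] = e_def[symmetric]
    \<comment> \<open>\<open>I\<close> splits the action of a composite in the first variable into
      two actions, duplicating the identity in the second.\<close>
    define I where "I Z = io Q Z (k, e) (h, e) \<odot> Z \<cdot>\<^sub>2 (id2 B (cmp1 B k h), inv2 B (lun B e))" for Z
    have I [simp]: "I Z \<in> Ar Q" "dm Q (I Z) = Z \<cdot> (cmp1 B k h, e)" "cd Q (I Z) = Z \<cdot> (k, e) \<cdot> (h, e)"
      if "Z \<in> Ob Q" "bs Q Z = (src B f, src B g)" for Z
      using that by (simp_all add: I_def)
    let ?X = "rO fl P (f, g)" and ?Y = "rO fl' P' (f', g')" and ?kh = "cmp1 B k h"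
    have I_nat: "I ?Y \<odot> v \<cdot>\<^sub>1 (?kh, e) = v \<cdot>\<^sub>1 (k, e) \<cdot>\<^sub>1 (h, e) \<odot> I ?X"
    proof -
      let ?w = "(id2 B (cmp1 B k h), inv2 B (lun B e))"
      have a: "?Y \<cdot>\<^sub>2 ?w \<odot> v \<cdot>\<^sub>1 (?kh, e) = v \<cdot>\<^sub>1 (?kh, cmp1 B e e) \<odot> ?X \<cdot>\<^sub>2 ?w"
        using nat[of v ?w] by simp
      have b: "io Q ?Y (k, e) (h, e) \<odot> v \<cdot>\<^sub>1 (?kh, cmp1 B e e) = v \<cdot>\<^sub>1 (k, e) \<cdot>\<^sub>1 (h, e) \<odot> io Q ?X (k, e) (h, e)"
        using io_nat[of v "(h, e)" "(k, e)"] by simp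
      show ?thesis using a cp_reassoc[OF b, of "?X \<cdot>\<^sub>2 ?w"] by (simp add: I_def)
    qed
    have c: "A1 b R (cmp1 B m k) n h \<odot> A1 b R m n k \<cdot>\<^sub>1 (h, e) \<odot> I (rO b R (m, n))
       = rh b R (inv2 B (asc B m k h), id2 B n) \<odot> A1 b R m n ?kh"
      if "wf b R (trg B m, trg B n)" "m \<in> arr1 B" "n \<in> arr1 B" "src B m = src B f" "src B n = src B g" for b R m n
      using A1_cmp[of b R m n k h] that by (simp add: I_def)
    let ?r = "rh fl P (inv2 B (asc B f k h), id2 B g)" and ?r' = "rh fl' P' (inv2 B (asc B f' k h), id2 B g')"
    let ?a = "A1 fl P f g ?kh" and ?a' = "A1 fl' P' f' g' ?kh"
    let ?b = "A1 fl P (cmp1 B f k) g h" and ?b' = "A1 fl' P' (cmp1 B f' k) g' h"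
    let ?c = "A1 fl P f g k" and ?c' = "A1 fl' P' f' g' k"
    have X: "?b \<odot> ?c \<cdot>\<^sub>1 (h, e) \<odot> I ?X = ?r \<odot> ?a" by (rule c) simp_all
    have Y: "?b' \<odot> ?c' \<cdot>\<^sub>1 (h, e) \<odot> I ?Y = ?r' \<odot> ?a'" by (rule c) simp_all
    have X': "I ?X \<odot> inv ?a = inv (?c \<cdot>\<^sub>1 (h, e)) \<odot> inv ?b \<odot> ?r"
    proof -
      have "inv (?b \<odot> ?c \<cdot>\<^sub>1 (h, e)) \<odot> ?r = I ?X \<odot> inv ?a"
        by (rule inP_swap) (use X in simp_all)
      then show ?thesis by simp
    qed
    have "?r' \<odot> ?a' \<odot> v \<cdot>\<^sub>1 (?kh, e) \<odot> inv ?a = ?b' \<odot> ?c' \<cdot>\<^sub>1 (h, e) \<odot> I ?Y \<odot> v \<cdot>\<^sub>1 (?kh, e) \<odot> inv ?a"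
      using arg_cong[OF Y, of "\<lambda>x. x \<odot> v \<cdot>\<^sub>1 (?kh, e) \<odot> inv ?a"] by simp
    also have "\<dots> = ?b' \<odot> ?c' \<cdot>\<^sub>1 (h, e) \<odot> v \<cdot>\<^sub>1 (k, e) \<cdot>\<^sub>1 (h, e) \<odot> inv (?c \<cdot>\<^sub>1 (h, e)) \<odot> inv ?b \<odot> ?r"
      using cp_reassoc[OF I_nat, of "inv ?a"] X' by simp
    finally show ?case by (simp add: am_cp)
  next
    case (17 X p q)
    obtain fl P f g where X [simp]: "X = (fl, P, f, g)" "f \<in> arr1 B" "g \<in> arr1 B" "wf fl P (trg B f, trg B g)"
      using 17(1) by (auto elim: strict_ObE)
    from 17 have [simp]: "p \<in> arr2 B" "q \<in> arr2 B" "trg B (dom2 B p) = src B (dom2 B q)" "trg B (dom2 B q) = src B f" by auto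
    interpret r: bimodule B "B.rep (trg B f)" by (rule B.rep_rmodule) simp
    show ?case using r.io_hc[of f p q] by (simp add: A1_conj_rh rh_cp rh_cp_tail)
  next
    case (18 X k h m)
    obtain fl P f g where X [simp]: "X = (fl, P, f, g)" "f \<in> arr1 B" "g \<in> arr1 B" "wf fl P (trg B f, trg B g)"
      using 18(1) by (auto elim: strict_ObE)
    from 18 have [simp]: "k \<in> arr1 B" "h \<in> arr1 B" "m \<in> arr1 B" "trg B k = src B h" "trg B h = src B m" "trg B m = src B f" by auto
    interpret r: bimodule B "B.rep (trg B f)" by (rule B.rep_rmodule) simp
    show ?case using r.io_asc[of f k h m] by (simp add: A1_conj_rh rh_cp rh_cp_tail)
  next
    case (19 X) then show ?case by (auto elim!: strict_ObE intro!: isoP_strict)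
  next
    case (20 u)
    obtain fl P f g v fl' P' f' g' where u [simp]: "u = ((fl, P, f, g), v, (fl', P', f', g'))" "f \<in> arr1 B" "g \<in> arr1 B"
      "wf fl P (trg B f, trg B g)" "f' \<in> arr1 B" "g' \<in> arr1 B" "wf fl' P' (trg B f', trg B g')" "v \<in> Ar Q"
      "dm Q v = rO fl P (f, g)" "cd Q v = rO fl' P' (f', g')" "src B f' = src B f" "src B g' = src B g"
      using 20(1) by (rule strict_ArE)
    let ?e = "(id1 B (src B f), id1 B (src B g))" and ?a = "A1 fl P f g (id1 B (src B f))"
    have 1: "rh fl' P' (run B f', id2 B g') \<odot> A1 fl' P' f' g' (id1 B (src B f)) = un Q (rO fl' P' (f', g'))"
      using A1_un[of fl' P' f' g'] by simp
    have 2: "rh fl P (run B f, id2 B g) \<odot> ?a = un Q (rO fl P (f, g))"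
      using A1_un[of fl P f g] by simp
    have "rh fl' P' (run B f', id2 B g') \<odot> A1 fl' P' f' g' (id1 B (src B f)) \<odot> v \<cdot>\<^sub>1 ?e \<odot> inv ?a
      = (un Q (rO fl' P' (f', g')) \<odot> v \<cdot>\<^sub>1 ?e) \<odot> inv ?a"
      using cp_reassoc[OF 1, of "v \<cdot>\<^sub>1 ?e \<odot> inv ?a"] by simp
    also have "un Q (rO fl' P' (f', g')) \<odot> v \<cdot>\<^sub>1 ?e = v \<odot> rh fl P (run B f, id2 B g) \<odot> ?a"
      using un_nat[of v] 2 by simp
    finally show ?case by simp
  next
    case (21 X k)
    obtain fl P f g where X [simp]: "X = (fl, P, f, g)" "f \<in> arr1 B" "g \<in> arr1 B" "wf fl P (trg B f, trg B g)"
      using 21(1) by (auto elim: strict_ObE)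
    from 21 have [simp]: "k \<in> arr1 B" "trg B k = src B f" by auto
    interpret r: bimodule B "B.rep (trg B f)" by (rule B.rep_rmodule) simp
    show ?case using r.un_lun[of f k] by (simp add: A1_conj_rh rh_cp rh_cp_tail)
  next
    case (22 X k)
    obtain fl P f g where X [simp]: "X = (fl, P, f, g)" "f \<in> arr1 B" "g \<in> arr1 B" "wf fl P (trg B f, trg B g)"
      using 22(1) by (auto elim: strict_ObE)
    from 22 have [simp]: "k \<in> arr1 B" "trg B k = src B f" by auto
    interpret r: bimodule B "B.rep (trg B f)" by (rule B.rep_rmodule) simp
    show ?case using r.un_run[of f k] by (simp add: A1_conj_rh rh_cp rh_cp_tail)
  qed
  then show ?thesis by (simp add: bimodule_def B.bicategory_axioms)
qed

section \<open>The strict involution on formal objects\<close>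

definition sgS :: "bool \<times> 'x \<times> 'm \<times> 'm \<Rightarrow> bool \<times> 'x \<times> 'm \<times> 'm" where
  "sgS = (\<lambda>(fl, P, f, g). (\<not> fl, P, g, f))"

text \<open>\<open>sgS\<close> toggles the flag instead of applying \<open>sg\<close>, so it squares
  to the identity on the nose, but what it denotes agrees with \<open>sg\<close> only up to this
  isomorphism. Toggling a flag that is set removes one \<open>sg\<close> where \<open>sg\<close>
  would add another, and this is where \<open>sy\<close> enters.\<close>

definition kap :: "bool \<Rightarrow> 'x \<Rightarrow> 'm \<Rightarrow> 'm \<Rightarrow> 'y" where
  "kap fl P f g = (if fl then sy (P \<cdot> (g, f)) else one Q (sg (P \<cdot> (f, g))))"

definition smS :: "(bool \<times> 'x \<times> 'm \<times> 'm) \<times> 'y \<times> (bool \<times> 'x \<times> 'm \<times> 'm)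
    \<Rightarrow> (bool \<times> 'x \<times> 'm \<times> 'm) \<times> 'y \<times> (bool \<times> 'x \<times> 'm \<times> 'm)" where
  "smS = (\<lambda>((fl, P, f, g), u, (fl', P', f', g')).
     ((\<not> fl, P, g, f), inv (kap fl' P' f' g') \<odot> sm u \<odot> kap fl P f g, (\<not> fl', P', g', f')))"

lemma sgS_simp [simp]: "sgS (fl, P, f, g) = (\<not> fl, P, g, f)"
  by (simp add: sgS_def)

lemma smS_simp [simp]:
  "smS ((fl, P, f, g), u, (fl', P', f', g')) =
     ((\<not> fl, P, g, f), inv (kap fl' P' f' g') \<odot> sm u \<odot> kap fl P f g, (\<not> fl', P', g', f'))"
  by (simp add: smS_def)

lemma wf_not [simp]: "wf (\<not> fl) P (a, b) \<longleftrightarrow> wf fl P (b, a)"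
  by (simp add: wf_def)

lemma kap_simps [simp]:
  assumes "wf fl P (trg B f, trg B g)" "f \<in> arr1 B" "g \<in> arr1 B"
  shows "iso (kap fl P f g)" "kap fl P f g \<in> Ar Q" "dm Q (kap fl P f g) = rO (\<not> fl) P (g, f)"
    "cd Q (kap fl P f g) = sg (rO fl P (f, g))"
  using assms by (cases fl, simp_all add: kap_def rO_def wf_def)

text \<open>Going around twice always yields \<open>sy\<close>: directly if the flag is not set, and
  through \<open>sy_sg\<close> otherwise.\<close>

lemma sm_kap:
  assumes "wf fl P (trg B f, trg B g)" "f \<in> arr1 B" "g \<in> arr1 B"
  shows "sm (kap fl P f g) \<odot> kap (\<not> fl) P g f = sy (rO fl P (f, g))"
  using assms by (cases fl) (simp_all add: kap_def rO_def wf_def sy_sg)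

text \<open>The reason why \<open>smS\<close> is an involution: at both ends the comparisons combine
  to \<open>sy\<close> by \<open>sm_kap\<close>, and these cancel by \<open>sy_nat\<close>.\<close>

lemma sm_conj_sm:
  assumes "wf fl P (trg B f, trg B g)" "f \<in> arr1 B" "g \<in> arr1 B" "wf fl' P' (trg B f', trg B g')" "f' \<in> arr1 B" "g' \<in> arr1 B"
    "v \<in> Ar Q" "dm Q v = rO fl P (f, g)" "cd Q v = rO fl' P' (f', g')"
  shows "inv (kap (\<not> fl') P' g' f') \<odot> sm (inv (kap fl' P' f' g') \<odot> sm v \<odot> kap fl P f g) \<odot> kap (\<not> fl) P g f = v"
proof -
  note [simp] = assms
  let ?k = "kap fl P f g" and ?l = "kap fl' P' f' g'" and ?k' = "kap (\<not> fl) P g f" and ?l' = "kap (\<not> fl') P' g' f'"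
  have "inv ?l' \<odot> inv (sm ?l) = inv (sy (rO fl' P' (f', g')))"
    using arg_cong[OF sm_kap[of fl' P' f' g'], of inv] by simp
  then have 1: "inv ?l' \<odot> sm (inv ?l) = inv (sy (rO fl' P' (f', g')))" by simp
  have "inv ?l' \<odot> sm (inv ?l \<odot> sm v \<odot> ?k) \<odot> ?k' = inv ?l' \<odot> sm (inv ?l) \<odot> sm (sm v) \<odot> sm ?k \<odot> ?k'"
    by (simp add: sm_cp)
  also have "\<dots> = inv (sy (rO fl' P' (f', g'))) \<odot> sm (sm v) \<odot> sy (rO fl P (f, g))"
    using cp_reassoc[OF 1, of "sm (sm v) \<odot> sm ?k \<odot> ?k'"] by (simp add: sm_kap)
  also have "\<dots> = v" using arg_cong[OF sy_nat[of v, symmetric], of "\<lambda>x. inv (sy (rO fl' P' (f', g'))) \<odot> x"] by simp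
  finally show ?thesis .
qed

text \<open>Through this comparison, conjugation by the involution turns \<open>A1\<close> into \<open>A2\<close>.\<close>

definition xi :: "'x \<Rightarrow> 'm \<Rightarrow> 'y" where
  "xi Z l = inv (sy (Z \<cdot> (id1 B (fst (bs Q Z)), l))) \<odot> sm (nu Z (l, id1 B (fst (bs Q Z))))"

lemma xi_simps [simp]:
  assumes "Z \<in> Ob Q" "l \<in> arr1 B" "bs Q Z = (a, trg B l)"
  shows "iso (xi Z l)" "xi Z l \<in> Ar Q" "dm Q (xi Z l) = sg (sg Z \<cdot> (l, id1 B a))" "cd Q (xi Z l) = Z \<cdot> (id1 B a, l)"
  using assms B.id1_simps bs_obj[of Z] by (simp_all add: xi_def)

lemma xi_nat:
  assumes "u \<in> Ar Q" "l \<in> arr1 B" "bs Q (dm Q u) = (a, trg B l)"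
  shows "xi (cd Q u) l \<odot> sm (sm u \<cdot>\<^sub>1 (l, id1 B a)) = u \<cdot>\<^sub>1 (id1 B a, l) \<odot> xi (dm Q u) l"
proof -
  have a [simp]: "a \<in> obj B" using bs_obj[of "dm Q u"] assms by simp
  note [simp] = assms
  have 1: "inv (sy (cd Q u \<cdot> (id1 B a, l))) \<odot> sm (sm (u \<cdot>\<^sub>1 (id1 B a, l))) = u \<cdot>\<^sub>1 (id1 B a, l) \<odot> inv (sy (dm Q u \<cdot> (id1 B a, l)))"
    by (rule inP_swap) (use sy_nat[of "u \<cdot>\<^sub>1 (id1 B a, l)"] in simp_all)
  have 2: "sm (nu (cd Q u) (l, id1 B a)) \<odot> sm (sm u \<cdot>\<^sub>1 (l, id1 B a)) = sm (sm (u \<cdot>\<^sub>1 (id1 B a, l))) \<odot> sm (nu (dm Q u) (l, id1 B a))"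
    using arg_cong[OF nu_nat[of u "(l, id1 B a)"], of sm] by (simp add: sm_cp)
  show ?thesis using cp_reassoc[OF 1, of "sm (nu (dm Q u) (l, id1 B a))"] by (simp add: xi_def 2)
qed

text \<open>If \<open>fl\<close> is not set, the reflected \<open>A1\<close> is a flagged one, and
  the claim is naturality of \<open>sy\<close> at the absorbing cell \<open>?v\<close>. If it is
  set, both sides contain the same reflected cell, and what remains, fact \<open>2\<close>, is the
  coherence of \<open>sy\<close> with \<open>nu\<close>.\<close>

lemma sm_A1:
  assumes S: "wf fl P (trg B f, trg B g)" "f \<in> arr1 B" "g \<in> arr1 B" "l \<in> arr1 B" "trg B l = src B g"
  shows "sm (A1 (\<not> fl) P g f l)
    = kap (\<not> fl) P (cmp1 B g l) f \<odot> A2 fl P f g l \<odot> xi (rO fl P (f, g)) l \<odot> sm (kap fl P f g \<cdot>\<^sub>1 (l, id1 B (src B f)))"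
proof (cases fl)
  case False
  note [simp] = S(2-)
  have [simp]: "P \<in> Ob Q" "bs Q P = (trg B f, trg B g)" using S(1) False by (auto simp: wf_def)
  let ?e = "id1 B (src B f)"
  let ?v = "P \<cdot>\<^sub>2 (run B f, id2 B (cmp1 B g l)) \<odot> inv (io Q P (f, g) (?e, l))"
  have "inv (sy (P \<cdot> (f, g) \<cdot> (?e, l))) = inv (sy (dm Q ?v))" by simp
  have 1: "sy (P \<cdot> (f, cmp1 B g l)) \<odot> ?v \<odot> inv (sy (P \<cdot> (f, g) \<cdot> (?e, l))) = sm (sm ?v)"
    using cp_inv_right[OF sy_nat[of ?v]] by simp
  have "kap (\<not> fl) P (cmp1 B g l) f \<odot> A2 fl P f g l \<odot> xi (rO fl P (f, g)) l \<odot> sm (kap fl P f g \<cdot>\<^sub>1 (l, ?e))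
    = (sy (P \<cdot> (f, cmp1 B g l)) \<odot> ?v \<odot> inv (sy (P \<cdot> (f, g) \<cdot> (?e, l)))) \<odot> sm (nu (P \<cdot> (f, g)) (l, ?e))"
    using False by (simp add: A2_def kap_def xi_def rO_def rh_def al_def)
  also have "\<dots> = sm (A1 (\<not> fl) P g f l)"
    unfolding 1 using False by (simp add: A1_def rO_def rh_def al_def sm_cp)
  finally show ?thesis by simp
next
  case True
  note [simp] = S(2-)
  have [simp]: "P \<in> Ob Q" "bs Q P = (trg B g, trg B f)" using S(1) True by (auto simp: wf_def)
  let ?e = "id1 B (src B f)"
  let ?m = "P \<cdot> (g, f)"
  \<comment> \<open>Under \<open>sm\<close>, the law \<open>sy_nu\<close> contains a doubly
    reflected \<open>nu\<close>. By \<open>sy_sg\<close> and naturality of \<open>sy\<close> at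
    \<open>nu\<close> the same factor appears on the outside of the other expression, so it can be
    cancelled.\<close>
  have 1: "sy (sg ?m \<cdot> (?e, l)) = sm (nu (sg ?m) (l, ?e)) \<odot> sm (sy ?m \<cdot>\<^sub>1 (l, ?e)) \<odot> nu ?m (?e, l)"
  proof -
    have "sm (nu ?m (?e, l)) \<odot> nu (sg ?m) (l, ?e) \<odot> sy ?m \<cdot>\<^sub>1 (l, ?e) = sy (?m \<cdot> (l, ?e))"
      using sy_nu[of ?m "(l, ?e)"] by simp
    from arg_cong[OF this, of sm]
    have "sm (sm (nu ?m (?e, l))) \<odot> sm (nu (sg ?m) (l, ?e)) \<odot> sm (sy ?m \<cdot>\<^sub>1 (l, ?e)) = sm (sy (?m \<cdot> (l, ?e)))"
      by (simp add: sm_cp)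
    from arg_cong[OF this, of "\<lambda>u. u \<odot> nu ?m (?e, l)"]
    have "sm (sm (nu ?m (?e, l))) \<odot> sm (nu (sg ?m) (l, ?e)) \<odot> sm (sy ?m \<cdot>\<^sub>1 (l, ?e)) \<odot> nu ?m (?e, l)
      = sy (sg (?m \<cdot> (l, ?e))) \<odot> nu ?m (?e, l)" by (simp add: sy_sg)
    also have "\<dots> = sm (sm (nu ?m (?e, l))) \<odot> sy (sg ?m \<cdot> (?e, l))"
      using sy_nat[of "nu ?m (?e, l)"] by simp
    finally show ?thesis
      by (rule iso_cancel_left[symmetric]) simp_all
  qed
  have 2: "nu ?m (?e, l) \<odot> inv (sy (sg ?m \<cdot> (?e, l))) \<odot> sm (nu (sg ?m) (l, ?e)) \<odot> sm (sy ?m \<cdot>\<^sub>1 (l, ?e)) = one Q (sg (?m \<cdot> (l, ?e)))"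
    unfolding 1 by (simp del: iso_sm(2))
  let ?v = "P \<cdot>\<^sub>2 (id2 B (cmp1 B g l), run B f) \<odot> inv (io Q P (g, f) (l, ?e))"
  have "kap (\<not> fl) P (cmp1 B g l) f \<odot> A2 fl P f g l \<odot> xi (rO fl P (f, g)) l \<odot> sm (kap fl P f g \<cdot>\<^sub>1 (l, ?e))
    = sm ?v \<odot> nu ?m (?e, l) \<odot> inv (sy (sg ?m \<cdot> (?e, l))) \<odot> sm (nu (sg ?m) (l, ?e)) \<odot> sm (sy ?m \<cdot>\<^sub>1 (l, ?e))"
    using True by (simp add: A2_def kap_def xi_def rO_def rh_def al_def sm_cp)
  also have "\<dots> = sm (A1 (\<not> fl) P g f l)"
    unfolding 2 using True by (simp add: A1_def rO_def rh_def al_def sm_cp)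
  finally show ?thesis by simp
qed

text \<open>Identifies the conjugate of the first action with the second action of \<open>Q\<close>,
  transported along \<open>A2\<close>. By \<open>sm_A1\<close> the comparison cells occur in inverse
  pairs around the morphism, and \<open>xi_nat\<close> lets them cancel.\<close>

lemma am_conj_sm:
  assumes S: "wf fl P (trg B f, trg B g)" "f \<in> arr1 B" "g \<in> arr1 B" "wf fl' P' (trg B f', trg B g')" "f' \<in> arr1 B" "g' \<in> arr1 B"
    "v \<in> Ar Q" "dm Q v = rO fl P (f, g)" "cd Q v = rO fl' P' (f', g')" "src B f' = src B f" "src B g' = src B g"
    "l \<in> arr1 B" "trg B l = src B g"
  shows "smS (am strict (smS ((fl, P, f, g), v, (fl', P', f', g'))) l)
    = ((fl, P, f, cmp1 B g l), A2 fl' P' f' g' l \<odot> v \<cdot>\<^sub>1 (id1 B (src B f), l) \<odot> inv (A2 fl P f g l), (fl', P', f', cmp1 B g' l))"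
proof -
  note [simp] = S
  let ?e = "id1 B (src B f)"
  let ?k = "kap fl P f g" and ?k' = "kap fl' P' f' g'"
  let ?n = "kap (\<not> fl) P (cmp1 B g l) f" and ?n' = "kap (\<not> fl') P' (cmp1 B g' l) f'"
  let ?a = "A2 fl P f g l" and ?a' = "A2 fl' P' f' g' l"
  let ?x = "xi (rO fl P (f, g)) l" and ?x' = "xi (rO fl' P' (f', g')) l"
  have 1: "sm (inv (A1 (\<not> fl) P g f l)) = sm (inv ?k \<cdot>\<^sub>1 (l, ?e)) \<odot> inv ?x \<odot> inv ?a \<odot> inv ?n"
    using arg_cong[OF sm_A1[of fl P f g l], of inv] by simp
  have 2: "sm (A1 (\<not> fl') P' g' f' l) = ?n' \<odot> ?a' \<odot> ?x' \<odot> sm (?k' \<cdot>\<^sub>1 (l, ?e))"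
    using sm_A1[of fl' P' f' g' l] by simp
  have 3: "sm (?k' \<cdot>\<^sub>1 (l, ?e)) \<odot> sm ((inv ?k' \<odot> sm v \<odot> ?k) \<cdot>\<^sub>1 (l, ?e)) \<odot> sm (inv ?k \<cdot>\<^sub>1 (l, ?e)) = sm (sm v \<cdot>\<^sub>1 (l, ?e))"
    by (simp flip: sm_cp am_cp)
  have "sm (A1 (\<not> fl') P' g' f' l \<odot> (inv ?k' \<odot> sm v \<odot> ?k) \<cdot>\<^sub>1 (l, ?e) \<odot> inv (A1 (\<not> fl) P g f l))
    = ?n' \<odot> ?a' \<odot> ?x' \<odot> (sm (?k' \<cdot>\<^sub>1 (l, ?e)) \<odot> sm ((inv ?k' \<odot> sm v \<odot> ?k) \<cdot>\<^sub>1 (l, ?e)) \<odot> sm (inv ?k \<cdot>\<^sub>1 (l, ?e)))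
       \<odot> inv ?x \<odot> inv ?a \<odot> inv ?n"
    by (simp add: sm_cp 1 2 del: iso_sm(2))
  also have "\<dots> = ?n' \<odot> ?a' \<odot> (?x' \<odot> sm (sm v \<cdot>\<^sub>1 (l, ?e))) \<odot> inv ?x \<odot> inv ?a \<odot> inv ?n"
    unfolding 3 by simp
  also have "?x' \<odot> sm (sm v \<cdot>\<^sub>1 (l, ?e)) = v \<cdot>\<^sub>1 (?e, l) \<odot> ?x"
    using xi_nat[of v l "src B f"] by simp
  finally have "sm (A1 (\<not> fl') P' g' f' l \<odot> (inv ?k' \<odot> sm v \<odot> ?k) \<cdot>\<^sub>1 (l, ?e) \<odot> inv (A1 (\<not> fl) P g f l))
    = ?n' \<odot> ?a' \<odot> v \<cdot>\<^sub>1 (?e, l) \<odot> inv ?a \<odot> inv ?n" by simp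
  then show ?thesis by simp
qed

lemma st_rh:
  assumes S: "wf fl P (trg B (dom2 B s), trg B (dom2 B t))" "s \<in> arr2 B" "t \<in> arr2 B" "l \<in> arr1 B" "trg B l = src B (dom2 B t)"
    "dom2 B s = f" "dom2 B t = g" "cod2 B s = f'" "cod2 B t = g'"
  shows "smS (am strict (smS ((fl, P, f, g), rh fl P (s, t), (fl, P, f', g'))) l)
    = ((fl, P, f, cmp1 B g l), rh fl P (s, hc B t (id2 B l)), (fl, P, f', cmp1 B g' l))"
proof -
  have [simp]: "src B f' = src B f" "trg B f' = trg B f" "src B g' = src B g" "trg B g' = trg B g"
    "f \<in> arr1 B" "g \<in> arr1 B" "f' \<in> arr1 B" "g' \<in> arr1 B"
    using B.src_cod2[of s] B.trg_cod2[of s] B.src_cod2[of t] B.trg_cod2[of t] B.cod2_arr1[of s] B.cod2_arr1[of t]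
      B.dom2_arr1[of s] B.dom2_arr1[of t] S
    by (simp_all del: B.cod2_arr1 B.dom2_arr1)
  show ?thesis
    using am_conj_sm[of fl P f g fl P f' g' "rh fl P (s, t)" l] A2_conj_rh[of fl P s t l f g f' g'] S by simp
qed

text \<open>On objects the strict laws hold because formal objects are tuples and the two actions
  alter different components. For cells coming from \<open>B\<close> they follow from
  \<open>st_rh\<close>; for general morphisms they rest on interchange.\<close>

lemma strict_pairing: "pairing B strict sgS smS"
proof -
  interpret S: bimodule B strict by (rule strict_rmodule)
  show ?thesis
  proof (unfold_locales, goal_cases)
    case (1 X) then show ?case by (auto elim!: strict_ObE)
  next
    case (2 X) then show ?case by (auto elim!: strict_ObE)
  next
    case (3 u) then show ?case by (auto elim!: strict_ArE)
  next
    case (4 X) then show ?case by (auto elim!: strict_ObE)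
  next
    case (5 u v) then show ?case by (auto elim!: strict_ArE simp: sm_cp)
  next
    case (6 u) then show ?case by (auto elim!: strict_ArE simp: sm_conj_sm)
  next
    case (7 X k) then show ?case by (auto elim!: strict_ObE)
  next
    case (8 X k l) then show ?case by (auto elim!: strict_ObE)
  next
    case (9 u k l)
    obtain fl P f g v fl' P' f' g' where u: "u = ((fl, P, f, g), v, (fl', P', f', g'))" and S: "f \<in> arr1 B" "g \<in> arr1 B"
      "wf fl P (trg B f, trg B g)" "f' \<in> arr1 B" "g' \<in> arr1 B" "wf fl' P' (trg B f', trg B g')" "v \<in> Ar Q"
      "dm Q v = rO fl P (f, g)" "cd Q v = rO fl' P' (f', g')" "src B f' = src B f" "src B g' = src B g"
      using 9(1) by (rule strict_ArE)
    from 9 u have T: "k \<in> arr1 B" "l \<in> arr1 B" "trg B k = src B f" "trg B l = src B g" by auto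
    note [simp] = S T
    let ?e = "id1 B (src B f)" and ?e' = "id1 B (src B k)" and ?d = "id1 B (src B g)" and ?d' = "id1 B (src B l)"
    let ?a = "A1 fl P f (cmp1 B g l) k" and ?a' = "A1 fl' P' f' (cmp1 B g' l) k"
    let ?b = "A2 fl P f g l \<cdot>\<^sub>1 (k, ?d')" and ?b' = "A2 fl' P' f' g' l \<cdot>\<^sub>1 (k, ?d')"
    let ?c = "A2 fl P (cmp1 B f k) g l" and ?c' = "A2 fl' P' (cmp1 B f' k) g' l"
    let ?q = "A1 fl P f g k \<cdot>\<^sub>1 (?e', l)" and ?q' = "A1 fl' P' f' g' k \<cdot>\<^sub>1 (?e', l)"
    let ?x = "chi (rO fl P (f, g)) k l" and ?x' = "chi (rO fl' P' (f', g')) k l"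
    \<comment> \<open>The two orders of action differ by conjugation with \<open>chi\<close>, which
      is natural in \<open>v\<close> and therefore cancels.\<close>
    have 1: "?a \<odot> ?b = ?c \<odot> ?q \<odot> ?x" using A1_A2[of fl P f g k l] by simp
    have 2: "?a' \<odot> ?b' = ?c' \<odot> ?q' \<odot> ?x'" using A1_A2[of fl' P' f' g' k l] by simp
    have 3: "?x' \<odot> v \<cdot>\<^sub>1 (?e, l) \<cdot>\<^sub>1 (k, ?d') = v \<cdot>\<^sub>1 (k, ?d) \<cdot>\<^sub>1 (?e', l) \<odot> ?x"
      using chi_nat[of v k l] by simp
    have 1: "inv ?b \<odot> inv ?a = inv ?x \<odot> inv ?q \<odot> inv ?c"
      using arg_cong[OF 1, of inv] by simp
    have "?a' \<odot> ?b' \<odot> v \<cdot>\<^sub>1 (?e, l) \<cdot>\<^sub>1 (k, ?d') \<odot> inv ?b \<odot> inv ?a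
      = (?a' \<odot> ?b') \<odot> v \<cdot>\<^sub>1 (?e, l) \<cdot>\<^sub>1 (k, ?d') \<odot> (inv ?b \<odot> inv ?a)" by simp
    also have "\<dots> = ?c' \<odot> ?q' \<odot> (?x' \<odot> v \<cdot>\<^sub>1 (?e, l) \<cdot>\<^sub>1 (k, ?d')) \<odot> inv ?x \<odot> inv ?q \<odot> inv ?c"
      unfolding 1 2 by simp
    also have "\<dots> = ?c' \<odot> ?q' \<odot> v \<cdot>\<^sub>1 (k, ?d) \<cdot>\<^sub>1 (?e', l) \<odot> inv ?q \<odot> inv ?c"
      unfolding 3 by simp
    finally have "?a' \<odot> ?b' \<odot> v \<cdot>\<^sub>1 (?e, l) \<cdot>\<^sub>1 (k, ?d') \<odot> inv ?b \<odot> inv ?a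
      = ?c' \<odot> ?q' \<odot> v \<cdot>\<^sub>1 (k, ?d) \<cdot>\<^sub>1 (?e', l) \<odot> inv ?q \<odot> inv ?c" .
    then show ?case by (simp add: u am_conj_sm am_cp del: smS_simp)
  next
    case (10 X p l)
    obtain fl P f g where X [simp]: "X = (fl, P, f, g)" "f \<in> arr1 B" "g \<in> arr1 B" "wf fl P (trg B f, trg B g)"
      using 10(1) by (auto elim: strict_ObE)
    from 10 have [simp]: "p \<in> arr2 B" "trg B (dom2 B p) = src B f" "l \<in> arr1 B" "trg B l = src B g" by auto
    show ?case by (simp add: st_rh del: smS_simp)
  next
    case (11 X k h l)
    obtain fl P f g where X [simp]: "X = (fl, P, f, g)" "f \<in> arr1 B" "g \<in> arr1 B" "wf fl P (trg B f, trg B g)"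
      using 11(1) by (auto elim: strict_ObE)
    from 11 have [simp]: "k \<in> arr1 B" "h \<in> arr1 B" "trg B k = src B h" "trg B h = src B f" "l \<in> arr1 B" "trg B l = src B g" by auto
    show ?case by (simp add: st_rh del: smS_simp)
  next
    case (12 X l)
    obtain fl P f g where X [simp]: "X = (fl, P, f, g)" "f \<in> arr1 B" "g \<in> arr1 B" "wf fl P (trg B f, trg B g)"
      using 12(1) by (auto elim: strict_ObE)
    from 12 have [simp]: "l \<in> arr1 B" "trg B l = src B g" by auto
    show ?case by (simp add: st_rh del: smS_simp)
  qed
qed

end

section \<open>Calculus of the two strictly commuting actions\<close>

context pairing
begin

lemmas sg_simps [simp] = sg_Ob sg_sg

lemma sm_simps [simp]:
  "u \<in> Ar Q \<Longrightarrow> sm u \<in> Ar Q" "u \<in> Ar Q \<Longrightarrow> dm Q (sm u) = sg (dm Q u)" "u \<in> Ar Q \<Longrightarrow> cd Q (sm u) = sg (cd Q u)"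
  "u \<in> Ar Q \<Longrightarrow> sm (sm u) = u" "X \<in> Ob Q \<Longrightarrow> sm (one Q X) = one Q (sg X)"
  using sm_Ar sm_sm sm_one by auto

lemma iso_sm [simp]:
  assumes "iso u"
  shows "iso (sm u)" "inv (sm u) = sm (inv u)"
proof -
  note iso_ar[OF assms, simp]
  have "is_invP Q (sm u) (sm (inv u))" using assms by (simp add: is_invP_def flip: sm_cp)
  then show "iso (sm u)" "inv (sm u) = sm (inv u)" by (auto intro: isoI inv_eqI)
qed

lemma bs_sg_cd [simp]: "u \<in> Ar Q \<Longrightarrow> bs Q (sg (cd Q u)) = bs Q (sg (dm Q u))"
  using ar_simps(3)[of "sm u"] by simp

lemma bs_sg_ac' [simp]: "\<lbrakk>X \<in> Ob Q; k \<in> arr1 B; trg B k = bs Q X\<rbrakk> \<Longrightarrow> bs Q (sg (X \<cdot> k)) = bs Q (sg X)"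
  by (rule bs_sg_ac)

text \<open>The action in the second variable and its structure cells. The simplification rules for
  them push \<open>sg\<close> and \<open>sm\<close> inward and move \<star> outside \<cdot>; this
  normal form makes expressions built in different orders of the two variables coincide.\<close>

definition st (infixl "\<star>" 80) where "X \<star> l = sg (sg X \<cdot> l)"
definition stm (infixl "\<star>\<^sub>1" 80) where "u \<star>\<^sub>1 l = sm (sm u \<cdot>\<^sub>1 l)"
definition st2 (infixl "\<star>\<^sub>2" 80) where "X \<star>\<^sub>2 w = sm (sg X \<cdot>\<^sub>2 w)"
definition ios where "ios X g f = sm (io Q (sg X) g f)"
definition uns where "uns X = sm (un Q (sg X))"

lemma st_simps [simp]:
  assumes "X \<in> Ob Q" "l \<in> arr1 B" "trg B l = bs Q (sg X)"
  shows "X \<star> l \<in> Ob Q" "bs Q (X \<star> l) = bs Q X" "bs Q (sg (X \<star> l)) = src B l" "sg (X \<star> l) = sg X \<cdot> l"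
  using assms bs_sg_ac[of "sg X" l] by (simp_all add: st_def)

lemma sg_ac [simp]: "\<lbrakk>X \<in> Ob Q; k \<in> arr1 B; trg B k = bs Q X\<rbrakk> \<Longrightarrow> sg (X \<cdot> k) = sg X \<star> k"
  by (simp add: st_def)

lemma st_ac [simp]:
  "\<lbrakk>X \<in> Ob Q; k \<in> arr1 B; l \<in> arr1 B; trg B k = bs Q X; trg B l = bs Q (sg X)\<rbrakk> \<Longrightarrow> (X \<star> l) \<cdot> k = X \<cdot> k \<star> l"
  unfolding st_def by (rule ac_st)

lemma stm_simps [simp]:
  assumes "u \<in> Ar Q" "l \<in> arr1 B" "trg B l = bs Q (sg (dm Q u))"
  shows "u \<star>\<^sub>1 l \<in> Ar Q" "dm Q (u \<star>\<^sub>1 l) = dm Q u \<star> l" "cd Q (u \<star>\<^sub>1 l) = cd Q u \<star> l" "sm (u \<star>\<^sub>1 l) = sm u \<cdot>\<^sub>1 l"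
  using assms by (simp_all add: stm_def st_def del: sg_ac)

lemma sm_am [simp]: "\<lbrakk>u \<in> Ar Q; k \<in> arr1 B; trg B k = bs Q (dm Q u)\<rbrakk> \<Longrightarrow> sm (u \<cdot>\<^sub>1 k) = sm u \<star>\<^sub>1 k"
  by (simp add: stm_def)

lemma stm_am [simp]:
  "\<lbrakk>u \<in> Ar Q; k \<in> arr1 B; l \<in> arr1 B; trg B k = bs Q (dm Q u); trg B l = bs Q (sg (dm Q u))\<rbrakk> \<Longrightarrow> u \<star>\<^sub>1 l \<cdot>\<^sub>1 k = u \<cdot>\<^sub>1 k \<star>\<^sub>1 l"
  unfolding stm_def by (rule am_st)

lemma stm_cp:
  "\<lbrakk>u \<in> Ar Q; v \<in> Ar Q; cd Q u = dm Q v; k \<in> arr1 B; trg B k = bs Q (sg (dm Q u))\<rbrakk> \<Longrightarrow> (v \<odot> u) \<star>\<^sub>1 k = v \<star>\<^sub>1 k \<odot> u \<star>\<^sub>1 k"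
  using ar_simps(3)[of "sm u"] by (simp add: stm_def sm_cp am_cp del: sm_am)

lemma iso_stm [simp]:
  assumes "iso u" "l \<in> arr1 B" "trg B l = bs Q (sg (dm Q u))"
  shows "iso (u \<star>\<^sub>1 l)" "inv (u \<star>\<^sub>1 l) = inv u \<star>\<^sub>1 l"
  using assms iso_ar[OF assms(1)] by (simp_all add: stm_def del: sm_am)

lemma st2_simps [simp]:
  assumes "X \<in> Ob Q" "w \<in> arr2 B" "trg B (dom2 B w) = bs Q (sg X)"
  shows "X \<star>\<^sub>2 w \<in> Ar Q" "dm Q (X \<star>\<^sub>2 w) = X \<star> dom2 B w" "cd Q (X \<star>\<^sub>2 w) = X \<star> cod2 B w" "sm (X \<star>\<^sub>2 w) = sg X \<cdot>\<^sub>2 w"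
  using assms by (simp_all add: st2_def st_def del: sg_ac)

lemma sm_a2 [simp]: "\<lbrakk>X \<in> Ob Q; w \<in> arr2 B; trg B (dom2 B w) = bs Q X\<rbrakk> \<Longrightarrow> sm (X \<cdot>\<^sub>2 w) = sg X \<star>\<^sub>2 w"
  by (simp add: st2_def)

lemma iso_st2 [simp]:
  assumes "isoc w" "X \<in> Ob Q" "trg B (dom2 B w) = bs Q (sg X)"
  shows "iso (X \<star>\<^sub>2 w)" "inv (X \<star>\<^sub>2 w) = X \<star>\<^sub>2 inv2 B w"
  using assms isoc_arr2[OF assms(1)] by (simp_all add: st2_def del: sm_a2)

lemma st_a2 [simp]:
  "\<lbrakk>X \<in> Ob Q; w \<in> arr2 B; l \<in> arr1 B; trg B (dom2 B w) = bs Q X; trg B l = bs Q (sg X)\<rbrakk> \<Longrightarrow> (X \<star> l) \<cdot>\<^sub>2 w = X \<cdot>\<^sub>2 w \<star>\<^sub>1 l"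
  unfolding st_def stm_def by (rule a2_st)

lemma st2_am [simp]:
  assumes "X \<in> Ob Q" "w \<in> arr2 B" "l \<in> arr1 B" "trg B (dom2 B w) = bs Q (sg X)" "trg B l = bs Q X"
  shows "X \<star>\<^sub>2 w \<cdot>\<^sub>1 l = (X \<cdot> l) \<star>\<^sub>2 w"
proof -
  have "sm (sg X \<cdot>\<^sub>2 w \<star>\<^sub>1 l) = sm ((sg X \<star> l) \<cdot>\<^sub>2 w)" using assms by (simp del: sm_a2 sm_am)
  then show ?thesis using assms by (simp del: st_a2 sm_a2 add: st2_def)
qed

lemma st2_vc:
  "\<lbrakk>X \<in> Ob Q; p \<in> arr2 B; q \<in> arr2 B; dom2 B q = cod2 B p; trg B (dom2 B p) = bs Q (sg X)\<rbrakk> \<Longrightarrow> X \<star>\<^sub>2 vc B q p = X \<star>\<^sub>2 q \<odot> X \<star>\<^sub>2 p"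
  by (simp add: st2_def a2_vc sm_cp del: sm_a2)

lemma st2_id [simp]: "\<lbrakk>X \<in> Ob Q; k \<in> arr1 B; trg B k = bs Q (sg X)\<rbrakk> \<Longrightarrow> X \<star>\<^sub>2 id2 B k = one Q (X \<star> k)"
  by (simp add: st2_def st_def del: sm_a2 sg_ac)

lemma st_nat:
  assumes "u \<in> Ar Q" "p \<in> arr2 B" "trg B (dom2 B p) = bs Q (sg (dm Q u))"
  shows "cd Q u \<star>\<^sub>2 p \<odot> u \<star>\<^sub>1 dom2 B p = u \<star>\<^sub>1 cod2 B p \<odot> dm Q u \<star>\<^sub>2 p"
  using arg_cong[OF nat[of "sm u" p], of sm] assms by (simp add: sm_cp)

lemma ios_simps [simp]:
  assumes "X \<in> Ob Q" "f \<in> arr1 B" "g \<in> arr1 B" "trg B f = src B g" "trg B g = bs Q (sg X)"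
  shows "iso (ios X g f)" "ios X g f \<in> Ar Q" "dm Q (ios X g f) = X \<star> cmp1 B g f" "cd Q (ios X g f) = X \<star> g \<star> f"
    "sm (ios X g f) = io Q (sg X) g f"
  using assms by (simp_all add: ios_def)

lemma sm_io [simp]:
  "\<lbrakk>X \<in> Ob Q; f \<in> arr1 B; g \<in> arr1 B; trg B f = src B g; trg B g = bs Q X\<rbrakk> \<Longrightarrow> sm (io Q X g f) = ios (sg X) g f"
  by (simp add: ios_def)

lemma uns_simps [simp]:
  assumes "X \<in> Ob Q"
  shows "iso (uns X)" "uns X \<in> Ar Q" "dm Q (uns X) = X \<star> id1 B (bs Q (sg X))" "cd Q (uns X) = X" "sm (uns X) = un Q (sg X)"
  using assms by (simp_all add: uns_def)

lemma sm_un [simp]: "X \<in> Ob Q \<Longrightarrow> sm (un Q X) = uns (sg X)"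
  by (simp add: uns_def)

lemma st_io [simp]:
  "\<lbrakk>X \<in> Ob Q; f \<in> arr1 B; g \<in> arr1 B; l \<in> arr1 B; trg B f = src B g; trg B g = bs Q X; trg B l = bs Q (sg X)\<rbrakk>
   \<Longrightarrow> io Q (X \<star> l) g f = io Q X g f \<star>\<^sub>1 l"
  unfolding st_def stm_def by (rule io_st)

lemma ios_am [simp]:
  assumes "X \<in> Ob Q" "f \<in> arr1 B" "g \<in> arr1 B" "l \<in> arr1 B" "trg B f = src B g" "trg B g = bs Q (sg X)" "trg B l = bs Q X"
  shows "ios X g f \<cdot>\<^sub>1 l = ios (X \<cdot> l) g f"
proof -
  have "sm (io Q (sg X) g f \<star>\<^sub>1 l) = sm (io Q (sg X \<star> l) g f)" using assms by (simp del: sm_io sm_am)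
  then show ?thesis using assms by (simp del: st_io)
qed

lemma st_un [simp]: "\<lbrakk>X \<in> Ob Q; l \<in> arr1 B; trg B l = bs Q (sg X)\<rbrakk> \<Longrightarrow> un Q (X \<star> l) = un Q X \<star>\<^sub>1 l"
  unfolding st_def stm_def by (rule un_st)

lemma uns_am [simp]:
  assumes "X \<in> Ob Q" "l \<in> arr1 B" "trg B l = bs Q X"
  shows "uns X \<cdot>\<^sub>1 l = uns (X \<cdot> l)"
proof -
  have "sm (un Q (sg X) \<star>\<^sub>1 l) = sm (un Q (sg X \<star> l))" using assms by (simp del: sm_un sm_am)
  then show ?thesis using assms by (simp del: st_un)
qed

lemma ios_nat:
  "\<lbrakk>u \<in> Ar Q; f \<in> arr1 B; g \<in> arr1 B; trg B f = src B g; trg B g = bs Q (sg (dm Q u))\<rbrakk>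
   \<Longrightarrow> ios (cd Q u) g f \<odot> u \<star>\<^sub>1 cmp1 B g f = u \<star>\<^sub>1 g \<star>\<^sub>1 f \<odot> ios (dm Q u) g f"
  using arg_cong[OF io_nat[of "sm u" f g], of sm] by (simp add: sm_cp)

lemma ios_hc:
  "\<lbrakk>X \<in> Ob Q; p \<in> arr2 B; q \<in> arr2 B; trg B (dom2 B p) = src B (dom2 B q); trg B (dom2 B q) = bs Q (sg X)\<rbrakk>
   \<Longrightarrow> ios X (cod2 B q) (cod2 B p) \<odot> X \<star>\<^sub>2 hc B q p = X \<star>\<^sub>2 q \<star>\<^sub>1 cod2 B p \<odot> (X \<star> dom2 B q) \<star>\<^sub>2 p \<odot> ios X (dom2 B q) (dom2 B p)"
  using arg_cong[OF io_hc[of "sg X" p q], of sm] by (simp add: sm_cp)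

lemma ios_asc:
  "\<lbrakk>X \<in> Ob Q; f \<in> arr1 B; g \<in> arr1 B; h \<in> arr1 B; trg B f = src B g; trg B g = src B h; trg B h = bs Q (sg X)\<rbrakk>
   \<Longrightarrow> ios (X \<star> h) g f \<odot> ios X h (cmp1 B g f) \<odot> X \<star>\<^sub>2 asc B h g f = ios X h g \<star>\<^sub>1 f \<odot> ios X (cmp1 B h g) f"
  using arg_cong[OF io_asc[of "sg X" f g h], of sm] by (simp add: sm_cp)

lemma uns_nat:
  "u \<in> Ar Q \<Longrightarrow> uns (cd Q u) \<odot> u \<star>\<^sub>1 id1 B (bs Q (sg (dm Q u))) = u \<odot> uns (dm Q u)"
  using arg_cong[OF un_nat[of "sm u"], of sm] by (simp add: sm_cp)

lemma uns_lun:
  "\<lbrakk>X \<in> Ob Q; f \<in> arr1 B; trg B f = bs Q (sg X)\<rbrakk> \<Longrightarrow> uns X \<star>\<^sub>1 f \<odot> ios X (id1 B (bs Q (sg X))) f = X \<star>\<^sub>2 lun B f"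
  using arg_cong[OF un_lun[of "sg X" f], of sm] by (simp add: sm_cp)

lemma uns_run:
  "\<lbrakk>X \<in> Ob Q; f \<in> arr1 B; trg B f = bs Q (sg X)\<rbrakk> \<Longrightarrow> uns (X \<star> f) \<odot> ios X f (id1 B (src B f)) = X \<star>\<^sub>2 run B f"
  using arg_cong[OF un_run[of "sg X" f], of sm] by (simp add: sm_cp)

end

section \<open>The volutive structure of a closed pairing\<close>

text \<open>\<open>d0\<close> prescribes d on objects only. Its values on 1- and 2-morphisms are
  recovered from \<open>ev_surj\<close>, \<open>ev_full\<close> and \<open>ev_faithful\<close>,
  which say that acting on \<open>ev a\<close> is essentially surjective, full and faithful over
  each fixed pair of bases.\<close>

locale closed_pairing = pairing B Q sg sm
  for B :: "('o, 'm, 'c) bicat" and Q :: "('o, 'm, 'c, 'x, 'y) rmod" and sg sm +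
  fixes d0 :: "'o \<Rightarrow> 'o" and ev :: "'o \<Rightarrow> 'x"
  assumes d0: "a \<in> obj B \<Longrightarrow> d0 a \<in> obj B"
    and ev: "a \<in> obj B \<Longrightarrow> ev a \<in> Ob Q \<and> bs Q (ev a) = d0 a \<and> bs Q (sg (ev a)) = a"
    and ev_surj: "X \<in> Ob Q \<Longrightarrow> \<exists>h u. h \<in> arr1 B \<and> src B h = bs Q X \<and> trg B h = d0 (bs Q (sg X)) \<and>
      isoP Q u \<and> dm Q u = ac Q (ev (bs Q (sg X))) h \<and> cd Q u = X"
    and ev_full: "\<lbrakk>a \<in> obj B; h \<in> arr1 B; k \<in> arr1 B; src B h = src B k; trg B h = d0 a; trg B k = d0 a;
      u \<in> Ar Q; dm Q u = ac Q (ev a) h; cd Q u = ac Q (ev a) k\<rbrakk>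
      \<Longrightarrow> \<exists>w. w \<in> arr2 B \<and> dom2 B w = h \<and> cod2 B w = k \<and> a2 Q (ev a) w = u"
    and ev_faithful: "\<lbrakk>a \<in> obj B; w \<in> arr2 B; w' \<in> arr2 B; dom2 B w = dom2 B w'; cod2 B w = cod2 B w';
      trg B (dom2 B w') = d0 a; a2 Q (ev a) w = a2 Q (ev a) w'\<rbrakk> \<Longrightarrow> w = w'"
begin

lemmas d0_simp [simp] = d0

lemma ev_simps [simp]: "a \<in> obj B \<Longrightarrow> ev a \<in> Ob Q" "a \<in> obj B \<Longrightarrow> bs Q (ev a) = d0 a"
  "a \<in> obj B \<Longrightarrow> bs Q (sg (ev a)) = a"
  using ev by auto

section \<open>Construction of d, \<eta> and \<tau> by lifting along evaluation\<close>

definition psi :: "'o \<Rightarrow> 'm \<Rightarrow> 'm \<Rightarrow> 'y \<Rightarrow> 'c" where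
  "psi a h k u = (SOME w. w \<in> arr2 B \<and> dom2 B w = h \<and> cod2 B w = k \<and> ev a \<cdot>\<^sub>2 w = u)"

lemma psi:
  assumes "a \<in> obj B" "h \<in> arr1 B" "k \<in> arr1 B" "src B h = src B k" "trg B h = d0 a" "trg B k = d0 a"
      "u \<in> Ar Q" "dm Q u = ev a \<cdot> h" "cd Q u = ev a \<cdot> k"
  shows "psi a h k u \<in> arr2 B \<and> dom2 B (psi a h k u) = h \<and> cod2 B (psi a h k u) = k \<and> ev a \<cdot>\<^sub>2 psi a h k u = u"
  unfolding psi_def by (rule someI_ex, rule ev_full) (fact assms)+

text \<open>A full and faithful functor reflects isomorphisms. This gives the invertibility of
  \<open>Fd\<close>, \<open>Ud\<close>, \<open>N\<close> and \<open>ta\<close>, which are known only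
  through their evaluations.\<close>

lemma iso_reflect:
  assumes "a \<in> obj B" "w \<in> arr2 B" "trg B (dom2 B w) = d0 a" "iso (ev a \<cdot>\<^sub>2 w)"
  shows "isoc w"
proof -
  let ?v = "psi a (cod2 B w) (dom2 B w) (inv (ev a \<cdot>\<^sub>2 w))"
  have v: "?v \<in> arr2 B \<and> dom2 B ?v = cod2 B w \<and> cod2 B ?v = dom2 B w \<and> ev a \<cdot>\<^sub>2 ?v = inv (ev a \<cdot>\<^sub>2 w)"
    by (rule psi) (use assms in auto)
  show ?thesis
  proof (rule isocI[of _ ?v])
    show "vc B ?v w = id2 B (dom2 B w)" "vc B w ?v = id2 B (cod2 B w)"
      by (rule ev_faithful[OF assms(1)]; use v assms in \<open>simp add: a2_vc\<close>)+
  qed (use v assms in auto)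
qed

text \<open>The 1-morphism and the isomorphism that characterizes it are chosen as one pair, since
  the second has no meaning for another choice of the first. The same holds for
  \<open>etth\<close>.\<close>

definition d1om where
  "d1om f = (SOME hu. fst hu \<in> arr1 B \<and> src B (fst hu) = d0 (trg B f) \<and> trg B (fst hu) = d0 (src B f) \<and>
      iso (snd hu) \<and> dm Q (snd hu) = ev (src B f) \<cdot> fst hu \<and> cd Q (snd hu) = ev (trg B f) \<star> f)"
definition d1 where "d1 f = fst (d1om f)"
definition om where "om f = snd (d1om f)"
definition etth where
  "etth a = (SOME hu. fst hu \<in> arr1 B \<and> src B (fst hu) = a \<and> trg B (fst hu) = d0 (d0 a) \<and>
      iso (snd hu) \<and> dm Q (snd hu) = ev (d0 a) \<cdot> fst hu \<and> cd Q (snd hu) = sg (ev a))"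
definition et where "et a = fst (etth a)"
definition th where "th a = snd (etth a)"

lemma d1_om_simps [simp]:
  assumes [simp]: "f \<in> arr1 B"
  shows "d1 f \<in> arr1 B" "src B (d1 f) = d0 (trg B f)" "trg B (d1 f) = d0 (src B f)"
    "iso (om f)" "om f \<in> Ar Q" "dm Q (om f) = ev (src B f) \<cdot> d1 f" "cd Q (om f) = ev (trg B f) \<star> f"
proof -
  have "\<exists>hu. fst hu \<in> arr1 B \<and> src B (fst hu) = d0 (trg B f) \<and> trg B (fst hu) = d0 (src B f) \<and>
      iso (snd hu) \<and> dm Q (snd hu) = ev (src B f) \<cdot> fst hu \<and> cd Q (snd hu) = ev (trg B f) \<star> f"
    using ev_surj[of "ev (trg B f) \<star> f"] by simp
  from someI_ex[OF this, folded d1om_def]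
  show "d1 f \<in> arr1 B" "src B (d1 f) = d0 (trg B f)" "trg B (d1 f) = d0 (src B f)"
    "iso (om f)" "om f \<in> Ar Q" "dm Q (om f) = ev (src B f) \<cdot> d1 f" "cd Q (om f) = ev (trg B f) \<star> f"
    by (auto simp: d1_def om_def iso_ar)
qed

lemma et_th_simps [simp]:
  assumes [simp]: "a \<in> obj B"
  shows "et a \<in> arr1 B" "src B (et a) = a" "trg B (et a) = d0 (d0 a)"
    "iso (th a)" "th a \<in> Ar Q" "dm Q (th a) = ev (d0 a) \<cdot> et a" "cd Q (th a) = sg (ev a)"
proof -
  have "\<exists>hu. fst hu \<in> arr1 B \<and> src B (fst hu) = a \<and> trg B (fst hu) = d0 (d0 a) \<and>
      iso (snd hu) \<and> dm Q (snd hu) = ev (d0 a) \<cdot> fst hu \<and> cd Q (snd hu) = sg (ev a)"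
    using ev_surj[of "sg (ev a)"] by simp
  from someI_ex[OF this, folded etth_def]
  show "et a \<in> arr1 B" "src B (et a) = a" "trg B (et a) = d0 (d0 a)"
    "iso (th a)" "th a \<in> Ar Q" "dm Q (th a) = ev (d0 a) \<cdot> et a" "cd Q (th a) = sg (ev a)"
    by (auto simp: et_def th_def iso_ar)
qed

text \<open>The canonical isomorphism \<open>ev a \<cdot> (d f \<circ> k) \<rightarrow> Z \<star> f\<close> induced by \<open>\<beta> : ev b \<cdot> k \<rightarrow> Z\<close>, for \<open>f : a \<rightarrow> b\<close>.\<close>

definition D where
  "D f \<beta> k = \<beta> \<star>\<^sub>1 f \<odot> om f \<cdot>\<^sub>1 k \<odot> io Q (ev (src B f)) (d1 f) k"

lemma D_simps [simp]:
  assumes "f \<in> arr1 B" "k \<in> arr1 B" "trg B k = d0 (trg B f)" "\<beta> \<in> Ar Q" "dm Q \<beta> = ev (trg B f) \<cdot> k"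
  shows "D f \<beta> k \<in> Ar Q" "dm Q (D f \<beta> k) = ev (src B f) \<cdot> cmp1 B (d1 f) k" "cd Q (D f \<beta> k) = cd Q \<beta> \<star> f"
  using assms by (simp_all add: D_def)

lemma D_iso [simp]:
  assumes "f \<in> arr1 B" "k \<in> arr1 B" "trg B k = d0 (trg B f)" "iso \<beta>" "dm Q \<beta> = ev (trg B f) \<cdot> k"
  shows "iso (D f \<beta> k)"
  using assms iso_ar[OF assms(4)] by (simp add: D_def)

lemma D_cp:
  assumes "f \<in> arr1 B" "k \<in> arr1 B" "trg B k = d0 (trg B f)" "\<beta> \<in> Ar Q" "dm Q \<beta> = ev (trg B f) \<cdot> k" "\<gamma> \<in> Ar Q" "dm Q \<gamma> = cd Q \<beta>"
  shows "D f (\<gamma> \<odot> \<beta>) k = \<gamma> \<star>\<^sub>1 f \<odot> D f \<beta> k"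
proof -
  have [simp]: "bs Q (sg (cd Q \<beta>)) = trg B f" using bs_sg_cd[of \<beta>] assms by (simp del: bs_sg_cd)
  show ?thesis using assms by (simp add: D_def stm_cp)
qed

text \<open>One of the rules by which \<open>D\<close> absorbs the structure 2-cells;
  \<open>D_asc\<close>, \<open>D_d2\<close>, \<open>D_Fd\<close> and \<open>D_Ud\<close> are others.
  An equation between pastings is proved by feeding the cells one by one into such a
  \<open>D\<close>.\<close>

lemma D_hcL:
  assumes [simp]: "f \<in> arr1 B" "w \<in> arr2 B" "trg B (dom2 B w) = d0 (trg B f)" "\<beta> \<in> Ar Q" "dm Q \<beta> = ev (trg B f) \<cdot> cod2 B w"
  shows "D f \<beta> (cod2 B w) \<odot> ev (src B f) \<cdot>\<^sub>2 hc B (id2 B (d1 f)) w = D f (\<beta> \<odot> ev (trg B f) \<cdot>\<^sub>2 w) (dom2 B w)"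
proof -
  let ?E = "ev (src B f)"
  have 1: "io Q ?E (d1 f) (cod2 B w) \<odot> ?E \<cdot>\<^sub>2 hc B (id2 B (d1 f)) w = (?E \<cdot> d1 f) \<cdot>\<^sub>2 w \<odot> io Q ?E (d1 f) (dom2 B w)"
    using io_hc[of ?E w "id2 B (d1 f)"] by simp
  have 2: "om f \<cdot>\<^sub>1 cod2 B w \<odot> (?E \<cdot> d1 f) \<cdot>\<^sub>2 w = ev (trg B f) \<cdot>\<^sub>2 w \<star>\<^sub>1 f \<odot> om f \<cdot>\<^sub>1 dom2 B w"
    using nat[of "om f" w] by simp
  show ?thesis
    using cp_reassoc[OF 2, of "io Q ?E (d1 f) (dom2 B w)"] by (simp add: D_def 1 stm_cp)
qed

lemma D_asc:
  assumes [simp]: "f \<in> arr1 B" "h \<in> arr1 B" "k \<in> arr1 B" "trg B h = d0 (trg B f)" "trg B k = src B h" "\<beta> \<in> Ar Q" "dm Q \<beta> = ev (trg B f) \<cdot> h"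
  shows "D f \<beta> h \<cdot>\<^sub>1 k \<odot> io Q (ev (src B f)) (cmp1 B (d1 f) h) k
    = D f (\<beta> \<cdot>\<^sub>1 k \<odot> io Q (ev (trg B f)) h k) (cmp1 B h k) \<odot> ev (src B f) \<cdot>\<^sub>2 asc B (d1 f) h k"
proof -
  let ?E = "ev (src B f)"
  have 1: "io Q (?E \<cdot> d1 f) h k \<odot> io Q ?E (d1 f) (cmp1 B h k) \<odot> ?E \<cdot>\<^sub>2 asc B (d1 f) h k
    = io Q ?E (d1 f) h \<cdot>\<^sub>1 k \<odot> io Q ?E (cmp1 B (d1 f) h) k"
    by (rule io_asc) simp_all
  have 2: "io Q (ev (trg B f)) h k \<star>\<^sub>1 f \<odot> om f \<cdot>\<^sub>1 cmp1 B h k = om f \<cdot>\<^sub>1 h \<cdot>\<^sub>1 k \<odot> io Q (?E \<cdot> d1 f) h k"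
    using io_nat[of "om f" k h] by simp
  show ?thesis
    using cp_reassoc[OF 2, of "io Q ?E (d1 f) (cmp1 B h k) \<odot> ?E \<cdot>\<^sub>2 asc B (d1 f) h k"] 1
    by (simp add: D_def stm_cp am_cp)
qed

text \<open>Evaluation is faithful, so equations of 2-cells may be tested on \<open>ev a\<close>.
  The isomorphism \<alpha> serves to replace the common target by one for which the defining
  equations, such as \<open>d2_eq\<close>, contain no inverses.\<close>

lemma ev_eqI:
  assumes "\<alpha> \<odot> ev a \<cdot>\<^sub>2 w = \<alpha> \<odot> ev a \<cdot>\<^sub>2 w'" "iso \<alpha>" "a \<in> obj B" "w \<in> arr2 B" "w' \<in> arr2 B" "dom2 B w = dom2 B w'"
    "cod2 B w = cod2 B w'" "trg B (dom2 B w') = d0 a" "dm Q \<alpha> = ev a \<cdot> cod2 B w'"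
  shows "w = w'"
proof (rule ev_faithful[of a])
  show "ev a \<cdot>\<^sub>2 w = ev a \<cdot>\<^sub>2 w'"
    by (rule iso_cancel_left[OF assms(1,2)]) (use assms(3-) in simp_all)
qed (use assms in simp_all)

text \<open>\<open>d2\<close>, \<open>Fd\<close>, \<open>Ud\<close>, \<open>N\<close> and
  \<open>ta\<close> are the 2-cells with the prescribed evaluation. The lemmas ending in
  \<open>_eq\<close> restate each prescription with the inverses moved to the other side.\<close>

definition d2 where
  "d2 w = psi (src B (dom2 B w)) (d1 (dom2 B w)) (d1 (cod2 B w))
     (inv (om (cod2 B w)) \<odot> ev (trg B (dom2 B w)) \<star>\<^sub>2 w \<odot> om (dom2 B w))"
definition Fd where
  "Fd g f = psi (src B f) (cmp1 B (d1 f) (d1 g)) (d1 (cmp1 B g f))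
     (inv (om (cmp1 B g f)) \<odot> inv (ios (ev (trg B g)) g f) \<odot> D f (om g) (d1 g))"
definition Ud where
  "Ud a = psi a (id1 B (d0 a)) (d1 (id1 B a)) (inv (om (id1 B a)) \<odot> inv (uns (ev a)) \<odot> un Q (ev a))"
text \<open>Computes the evaluation of \<open>et b\<close> precomposed with \<open>k\<close>, using
  that \<open>et b\<close> represents \<open>sg (ev b)\<close>.\<close>

definition H where
  "H b k = th b \<cdot>\<^sub>1 k \<odot> io Q (ev (d0 b)) (et b) k"
text \<open>For \<open>f\<close> from \<open>a\<close> to \<open>b\<close>, both sides of the
  naturality square evaluate to \<open>sg (ev b) \<cdot> f\<close>: one by \<open>H\<close>, the
  other by \<open>th\<close> at \<open>a\<close>, which leads to
  \<open>sg (ev a) \<star> d1 f\<close>, followed by the reflection of \<open>om f\<close>.\<close>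

definition N where
  "N f = psi (d0 (trg B f)) (cmp1 B (d1 (d1 f)) (et (src B f))) (cmp1 B (et (trg B f)) f)
     (inv (H (trg B f) f) \<odot> sm (om f) \<odot> D (d1 f) (th (src B f)) (et (src B f)))"
text \<open>By \<open>th\<close> at \<open>d0 a\<close>, the composite of \<open>et (d0 a)\<close>
  with \<open>d1 (et a)\<close> evaluates to \<open>sg (ev (d0 a)) \<star> et a\<close>. This is the
  reflection of \<open>ev (d0 a) \<cdot> et a\<close>, so the reflected \<open>th a\<close> leads on
  to \<open>sg (sg (ev a))\<close>, that is, to \<open>ev a\<close>.\<close>

definition ta where
  "ta a = psi a (cmp1 B (d1 (et a)) (et (d0 a))) (id1 B (d0 a))
     (inv (un Q (ev a)) \<odot> sm (th a) \<odot> D (et a) (th (d0 a)) (et (d0 a)))"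

lemma d2_simps:
  assumes [simp]: "w \<in> arr2 B"
  shows "d2 w \<in> arr2 B" "dom2 B (d2 w) = d1 (dom2 B w)" "cod2 B (d2 w) = d1 (cod2 B w)"
    "ev (src B (dom2 B w)) \<cdot>\<^sub>2 d2 w = inv (om (cod2 B w)) \<odot> ev (trg B (dom2 B w)) \<star>\<^sub>2 w \<odot> om (dom2 B w)"
  using psi[of "src B (dom2 B w)" "d1 (dom2 B w)" "d1 (cod2 B w)" "inv (om (cod2 B w)) \<odot> ev (trg B (dom2 B w)) \<star>\<^sub>2 w \<odot> om (dom2 B w)"]
  by (simp_all add: d2_def)

lemmas d2_typ [simp] = d2_simps(1-3)

lemma d2_eq:
  assumes [simp]: "w \<in> arr2 B"
  shows "om (cod2 B w) \<odot> ev (src B (dom2 B w)) \<cdot>\<^sub>2 d2 w = ev (trg B (dom2 B w)) \<star>\<^sub>2 w \<odot> om (dom2 B w)"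
  by (simp add: d2_simps)

lemma d2_id [simp]: "f \<in> arr1 B \<Longrightarrow> d2 (id2 B f) = id2 B (d1 f)"
  by (rule ev_eqI[of "om f" "src B f"]) (use d2_eq[of "id2 B f"] in simp_all)

lemma d2_vc:
  assumes [simp]: "u \<in> arr2 B" "v \<in> arr2 B" "dom2 B v = cod2 B u"
  shows "d2 (vc B v u) = vc B (d2 v) (d2 u)"
proof (rule ev_eqI[of "om (cod2 B v)" "src B (dom2 B u)"])
  let ?E = "ev (src B (dom2 B u))" and ?F = "ev (trg B (dom2 B u))"
  have 1: "om (cod2 B u) \<odot> ?E \<cdot>\<^sub>2 d2 u = ?F \<star>\<^sub>2 u \<odot> om (dom2 B u)" using d2_eq[of u] by simp
  have 2: "om (cod2 B v) \<odot> ?E \<cdot>\<^sub>2 d2 v = ?F \<star>\<^sub>2 v \<odot> om (cod2 B u)" using d2_eq[of v] by simp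
  have "om (cod2 B v) \<odot> ?E \<cdot>\<^sub>2 d2 (vc B v u) = ?F \<star>\<^sub>2 vc B v u \<odot> om (dom2 B u)" using d2_eq[of "vc B v u"] by simp
  then show "om (cod2 B v) \<odot> ?E \<cdot>\<^sub>2 d2 (vc B v u) = om (cod2 B v) \<odot> ?E \<cdot>\<^sub>2 vc B (d2 v) (d2 u)"
    using cp_reassoc[OF 2, of "?E \<cdot>\<^sub>2 d2 u"] 1 by (simp add: a2_vc st2_vc)
qed simp_all

lemma d2_iso [simp]:
  assumes "isoc w"
  shows "isoc (d2 w)" "inv2 B (d2 w) = d2 (inv2 B w)"
proof -
  note [simp] = isoc_arr2[OF assms]
  have 1: "vc B (d2 (inv2 B w)) (d2 w) = id2 B (d1 (dom2 B w))" "vc B (d2 w) (d2 (inv2 B w)) = id2 B (d1 (cod2 B w))"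
    using assms by (simp_all flip: d2_vc)
  show "isoc (d2 w)" by (rule isocI[of _ "d2 (inv2 B w)"]) (use assms 1 in auto)
  show "inv2 B (d2 w) = d2 (inv2 B w)" by (rule inv2_eqI) (use assms 1 in auto)
qed

lemma Fd_simps:
  assumes [simp]: "f \<in> arr1 B" "g \<in> arr1 B" "trg B f = src B g"
  shows "Fd g f \<in> arr2 B" "dom2 B (Fd g f) = cmp1 B (d1 f) (d1 g)" "cod2 B (Fd g f) = d1 (cmp1 B g f)"
    "ev (src B f) \<cdot>\<^sub>2 Fd g f = inv (om (cmp1 B g f)) \<odot> inv (ios (ev (trg B g)) g f) \<odot> D f (om g) (d1 g)"
  using psi[of "src B f" "cmp1 B (d1 f) (d1 g)" "d1 (cmp1 B g f)" "inv (om (cmp1 B g f)) \<odot> inv (ios (ev (trg B g)) g f) \<odot> D f (om g) (d1 g)"]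
  by (simp_all add: Fd_def)

lemma Fd_iso [simp]:
  assumes [simp]: "f \<in> arr1 B" "g \<in> arr1 B" "trg B f = src B g"
  shows "isoc (Fd g f)"
  by (rule iso_reflect[of "src B f"]) (simp_all add: Fd_simps)

lemmas Fd_typ [simp] = Fd_simps(1-3)

lemma Fd_eq:
  assumes [simp]: "f \<in> arr1 B" "g \<in> arr1 B" "trg B f = src B g"
  shows "ios (ev (trg B g)) g f \<odot> om (cmp1 B g f) \<odot> ev (src B f) \<cdot>\<^sub>2 Fd g f = D f (om g) (d1 g)"
  by (simp add: Fd_simps)

lemma Ud_simps:
  assumes [simp]: "a \<in> obj B"
  shows "Ud a \<in> arr2 B" "dom2 B (Ud a) = id1 B (d0 a)" "cod2 B (Ud a) = d1 (id1 B a)"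
    "ev a \<cdot>\<^sub>2 Ud a = inv (om (id1 B a)) \<odot> inv (uns (ev a)) \<odot> un Q (ev a)"
  using psi[of a "id1 B (d0 a)" "d1 (id1 B a)" "inv (om (id1 B a)) \<odot> inv (uns (ev a)) \<odot> un Q (ev a)"]
  by (simp_all add: Ud_def)

lemma Ud_iso [simp]:
  assumes [simp]: "a \<in> obj B"
  shows "isoc (Ud a)"
  by (rule iso_reflect[of a]) (simp_all add: Ud_simps)

lemmas Ud_typ [simp] = Ud_simps(1-3)

lemma Ud_eq:
  assumes [simp]: "a \<in> obj B"
  shows "uns (ev a) \<odot> om (id1 B a) \<odot> ev a \<cdot>\<^sub>2 Ud a = un Q (ev a)"
  by (simp add: Ud_simps)

lemma H_simps [simp]:
  assumes "b \<in> obj B" "k \<in> arr1 B" "trg B k = b"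
  shows "iso (H b k)" "H b k \<in> Ar Q" "dm Q (H b k) = ev (d0 b) \<cdot> cmp1 B (et b) k" "cd Q (H b k) = sg (ev b) \<cdot> k"
  using assms by (simp_all add: H_def)

lemma N_simps:
  assumes [simp]: "f \<in> arr1 B"
  shows "N f \<in> arr2 B" "dom2 B (N f) = cmp1 B (d1 (d1 f)) (et (src B f))" "cod2 B (N f) = cmp1 B (et (trg B f)) f"
    "ev (d0 (trg B f)) \<cdot>\<^sub>2 N f = inv (H (trg B f) f) \<odot> sm (om f) \<odot> D (d1 f) (th (src B f)) (et (src B f))"
  using psi[of "d0 (trg B f)" "cmp1 B (d1 (d1 f)) (et (src B f))" "cmp1 B (et (trg B f)) f"
    "inv (H (trg B f) f) \<odot> sm (om f) \<odot> D (d1 f) (th (src B f)) (et (src B f))"]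
  by (simp_all add: N_def)

lemma N_iso [simp]:
  assumes [simp]: "f \<in> arr1 B"
  shows "isoc (N f)"
  by (rule iso_reflect[of "d0 (trg B f)"]) (simp_all add: N_simps)

lemmas N_typ [simp] = N_simps(1-3)

lemma N_eq:
  assumes [simp]: "f \<in> arr1 B"
  shows "H (trg B f) f \<odot> ev (d0 (trg B f)) \<cdot>\<^sub>2 N f = sm (om f) \<odot> D (d1 f) (th (src B f)) (et (src B f))"
  by (simp add: N_simps)

lemma ta_simps:
  assumes [simp]: "a \<in> obj B"
  shows "ta a \<in> arr2 B" "dom2 B (ta a) = cmp1 B (d1 (et a)) (et (d0 a))" "cod2 B (ta a) = id1 B (d0 a)"
    "ev a \<cdot>\<^sub>2 ta a = inv (un Q (ev a)) \<odot> sm (th a) \<odot> D (et a) (th (d0 a)) (et (d0 a))"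
  using psi[of a "cmp1 B (d1 (et a)) (et (d0 a))" "id1 B (d0 a)" "inv (un Q (ev a)) \<odot> sm (th a) \<odot> D (et a) (th (d0 a)) (et (d0 a))"]
  by (simp_all add: ta_def)

lemma ta_iso [simp]:
  assumes [simp]: "a \<in> obj B"
  shows "isoc (ta a)"
  by (rule iso_reflect[of a]) (simp_all add: ta_simps)

lemmas ta_typ [simp] = ta_simps(1-3)

lemma ta_eq:
  assumes [simp]: "a \<in> obj B"
  shows "un Q (ev a) \<odot> ev a \<cdot>\<^sub>2 ta a = sm (th a) \<odot> D (et a) (th (d0 a)) (et (d0 a))"
  by (simp add: ta_simps)

lemma D_d2:
  assumes [simp]: "w \<in> arr2 B" "k \<in> arr1 B" "trg B k = d0 (trg B (dom2 B w))" "\<beta> \<in> Ar Q" "dm Q \<beta> = ev (trg B (dom2 B w)) \<cdot> k"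
  shows "D (cod2 B w) \<beta> k \<odot> ev (src B (dom2 B w)) \<cdot>\<^sub>2 hc B (d2 w) (id2 B k) = cd Q \<beta> \<star>\<^sub>2 w \<odot> D (dom2 B w) \<beta> k"
proof -
  let ?E = "ev (src B (dom2 B w))" and ?F = "ev (trg B (dom2 B w))"
  have 1: "io Q ?E (d1 (cod2 B w)) k \<odot> ?E \<cdot>\<^sub>2 hc B (d2 w) (id2 B k) = (?E \<cdot>\<^sub>2 d2 w) \<cdot>\<^sub>1 k \<odot> io Q ?E (d1 (dom2 B w)) k"
    using io_hc[of ?E "id2 B k" "d2 w"] by simp
  have 2: "om (cod2 B w) \<cdot>\<^sub>1 k \<odot> (?E \<cdot>\<^sub>2 d2 w) \<cdot>\<^sub>1 k = (?F \<cdot> k) \<star>\<^sub>2 w \<odot> om (dom2 B w) \<cdot>\<^sub>1 k"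
    using arg_cong[OF d2_eq[of w], of "\<lambda>u. u \<cdot>\<^sub>1 k"] by (simp add: am_cp)
  have 3: "\<beta> \<star>\<^sub>1 cod2 B w \<odot> (?F \<cdot> k) \<star>\<^sub>2 w = cd Q \<beta> \<star>\<^sub>2 w \<odot> \<beta> \<star>\<^sub>1 dom2 B w"
    using st_nat[of \<beta> w] by simp
  show ?thesis
    using cp_reassoc[OF 2, of "io Q ?E (d1 (dom2 B w)) k"] cp_reassoc[OF 3, of "om (dom2 B w) \<cdot>\<^sub>1 k \<odot> io Q ?E (d1 (dom2 B w)) k"]
    by (simp add: D_def 1)
qed

text \<open>Evaluating \<open>d1\<close> of a composite means evaluating twice, which is how
  \<open>Fd\<close> was chosen. The case of general \<beta> follows from that of \<open>om g\<close>
  by naturality, and the associator comes from regrouping \<open>d1 f\<close>, \<open>d1 g\<close>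
  and \<open>k\<close>.\<close>

lemma D_Fd:
  assumes [simp]: "f \<in> arr1 B" "g \<in> arr1 B" "k \<in> arr1 B" "trg B f = src B g" "trg B k = d0 (trg B g)"
    "\<beta> \<in> Ar Q" "dm Q \<beta> = ev (trg B g) \<cdot> k"
  shows "ios (cd Q \<beta>) g f \<odot> D (cmp1 B g f) \<beta> k \<odot> ev (src B f) \<cdot>\<^sub>2 hc B (Fd g f) (id2 B k)
    = D f (D g \<beta> k) (cmp1 B (d1 g) k) \<odot> ev (src B f) \<cdot>\<^sub>2 asc B (d1 f) (d1 g) k"
proof -
  let ?E = "ev (src B f)" and ?G = "ev (trg B g)" and ?gf = "cmp1 B g f" and ?c = "cmp1 B (d1 f) (d1 g)"
  have 1: "io Q ?E (d1 ?gf) k \<odot> ?E \<cdot>\<^sub>2 hc B (Fd g f) (id2 B k) = (?E \<cdot>\<^sub>2 Fd g f) \<cdot>\<^sub>1 k \<odot> io Q ?E ?c k"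
    using io_hc[of ?E "id2 B k" "Fd g f"] by simp
  have 2: "ios (cd Q \<beta>) g f \<odot> \<beta> \<star>\<^sub>1 ?gf = \<beta> \<star>\<^sub>1 g \<star>\<^sub>1 f \<odot> ios (?G \<cdot> k) g f"
    using ios_nat[of \<beta> f g] by simp
  have 3: "ios (?G \<cdot> k) g f \<odot> om ?gf \<cdot>\<^sub>1 k \<odot> (?E \<cdot>\<^sub>2 Fd g f) \<cdot>\<^sub>1 k = D f (om g) (d1 g) \<cdot>\<^sub>1 k"
    using arg_cong[OF Fd_eq[of f g], of "\<lambda>u. u \<cdot>\<^sub>1 k"] by (simp add: am_cp)
  have 4: "D f (om g) (d1 g) \<cdot>\<^sub>1 k \<odot> io Q ?E ?c k
    = D f (om g \<cdot>\<^sub>1 k \<odot> io Q (ev (src B g)) (d1 g) k) (cmp1 B (d1 g) k) \<odot> ?E \<cdot>\<^sub>2 asc B (d1 f) (d1 g) k"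
    using D_asc[of f "d1 g" k "om g"] by simp
  have "ios (cd Q \<beta>) g f \<odot> D ?gf \<beta> k \<odot> ?E \<cdot>\<^sub>2 hc B (Fd g f) (id2 B k)
    = (ios (cd Q \<beta>) g f \<odot> \<beta> \<star>\<^sub>1 ?gf) \<odot> om ?gf \<cdot>\<^sub>1 k \<odot> (?E \<cdot>\<^sub>2 Fd g f) \<cdot>\<^sub>1 k \<odot> io Q ?E ?c k"
    by (simp add: D_def 1)
  also have "\<dots> = \<beta> \<star>\<^sub>1 g \<star>\<^sub>1 f \<odot> (ios (?G \<cdot> k) g f \<odot> om ?gf \<cdot>\<^sub>1 k \<odot> (?E \<cdot>\<^sub>2 Fd g f) \<cdot>\<^sub>1 k) \<odot> io Q ?E ?c k"
    unfolding 2 by simp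
  also have "\<dots> = \<beta> \<star>\<^sub>1 g \<star>\<^sub>1 f \<odot> D f (om g \<cdot>\<^sub>1 k \<odot> io Q (ev (src B g)) (d1 g) k) (cmp1 B (d1 g) k) \<odot> ?E \<cdot>\<^sub>2 asc B (d1 f) (d1 g) k"
    unfolding 3 4 ..
  also have "\<dots> = D f (D g \<beta> k) (cmp1 B (d1 g) k) \<odot> ?E \<cdot>\<^sub>2 asc B (d1 f) (d1 g) k"
    by (simp add: D_def[of g] D_cp)
  finally show ?thesis .
qed

lemma D_id_un:
  assumes [simp]: "f \<in> arr1 B"
  shows "D f (un Q (ev (trg B f))) (id1 B (d0 (trg B f))) = om f \<odot> ev (src B f) \<cdot>\<^sub>2 run B (d1 f)"
proof -
  let ?E = "ev (src B f)"
  have 1: "un Q (ev (trg B f)) \<star>\<^sub>1 f \<odot> om f \<cdot>\<^sub>1 id1 B (d0 (trg B f)) = om f \<odot> un Q (?E \<cdot> d1 f)"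
    using un_nat[of "om f"] by simp
  show ?thesis
    using cp_reassoc[OF 1, of "io Q ?E (d1 f) (id1 B (d0 (trg B f)))"] un_run[of ?E "d1 f"] by (simp add: D_def)
qed

lemma D_Ud:
  assumes [simp]: "a \<in> obj B" "k \<in> arr1 B" "trg B k = d0 a" "\<beta> \<in> Ar Q" "dm Q \<beta> = ev a \<cdot> k"
  shows "uns (cd Q \<beta>) \<odot> D (id1 B a) \<beta> k \<odot> ev a \<cdot>\<^sub>2 hc B (Ud a) (id2 B k) = \<beta> \<odot> ev a \<cdot>\<^sub>2 lun B k"
proof -
  let ?E = "ev a" and ?e = "id1 B a" and ?i = "id1 B (d0 a)"
  have 1: "io Q ?E (d1 ?e) k \<odot> ?E \<cdot>\<^sub>2 hc B (Ud a) (id2 B k) = (?E \<cdot>\<^sub>2 Ud a) \<cdot>\<^sub>1 k \<odot> io Q ?E ?i k"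
    using io_hc[of ?E "id2 B k" "Ud a"] by simp
  have 2: "uns (cd Q \<beta>) \<odot> \<beta> \<star>\<^sub>1 ?e = \<beta> \<odot> uns (?E \<cdot> k)"
    using uns_nat[of \<beta>] by simp
  have 3: "uns (?E \<cdot> k) \<odot> om ?e \<cdot>\<^sub>1 k \<odot> (?E \<cdot>\<^sub>2 Ud a) \<cdot>\<^sub>1 k = un Q ?E \<cdot>\<^sub>1 k"
    using arg_cong[OF Ud_eq[of a], of "\<lambda>u. u \<cdot>\<^sub>1 k"] by (simp add: am_cp)
  have "uns (cd Q \<beta>) \<odot> D ?e \<beta> k \<odot> ?E \<cdot>\<^sub>2 hc B (Ud a) (id2 B k)
    = (uns (cd Q \<beta>) \<odot> \<beta> \<star>\<^sub>1 ?e) \<odot> om ?e \<cdot>\<^sub>1 k \<odot> (?E \<cdot>\<^sub>2 Ud a) \<cdot>\<^sub>1 k \<odot> io Q ?E ?i k"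
    by (simp add: D_def 1)
  also have "\<dots> = \<beta> \<odot> (uns (?E \<cdot> k) \<odot> om ?e \<cdot>\<^sub>1 k \<odot> (?E \<cdot>\<^sub>2 Ud a) \<cdot>\<^sub>1 k) \<odot> io Q ?E ?i k"
    unfolding 2 by simp
  also have "\<dots> = \<beta> \<odot> ?E \<cdot>\<^sub>2 lun B k"
    unfolding 3 using un_lun[of ?E k] by simp
  finally show ?thesis .
qed

lemma H_hcL:
  assumes [simp]: "b \<in> obj B" "w \<in> arr2 B" "trg B (dom2 B w) = b"
  shows "H b (cod2 B w) \<odot> ev (d0 b) \<cdot>\<^sub>2 hc B (id2 B (et b)) w = sg (ev b) \<cdot>\<^sub>2 w \<odot> H b (dom2 B w)"
proof -
  let ?E = "ev (d0 b)"
  have 1: "io Q ?E (et b) (cod2 B w) \<odot> ?E \<cdot>\<^sub>2 hc B (id2 B (et b)) w = (?E \<cdot> et b) \<cdot>\<^sub>2 w \<odot> io Q ?E (et b) (dom2 B w)"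
    using io_hc[of ?E w "id2 B (et b)"] by simp
  have 2: "th b \<cdot>\<^sub>1 cod2 B w \<odot> (?E \<cdot> et b) \<cdot>\<^sub>2 w = sg (ev b) \<cdot>\<^sub>2 w \<odot> th b \<cdot>\<^sub>1 dom2 B w"
    using nat[of "th b" w] by simp
  show ?thesis using cp_reassoc[OF 2, of "io Q ?E (et b) (dom2 B w)"] by (simp add: H_def 1)
qed

lemma sm_D:
  assumes [simp]: "f \<in> arr1 B" "k \<in> arr1 B" "trg B k = d0 (trg B f)" "\<beta> \<in> Ar Q" "dm Q \<beta> = ev (trg B f) \<cdot> k"
  shows "sm (D f \<beta> k) = sm \<beta> \<cdot>\<^sub>1 f \<odot> sm (om f) \<star>\<^sub>1 k \<odot> ios (sg (ev (src B f))) (d1 f) k"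
  by (simp add: D_def sm_cp)

end

section \<open>The pseudofunctor d into the reversed bicategory\<close>

lemma opB_simps [simp]:
  "obj (opB B) = obj B" "arr1 (opB B) = arr1 B" "arr2 (opB B) = arr2 B" "src (opB B) = trg B" "trg (opB B) = src B"
  "dom2 (opB B) = dom2 B" "cod2 (opB B) = cod2 B" "id1 (opB B) = id1 B" "id2 (opB B) = id2 B"
  "cmp1 (opB B) g f = cmp1 B f g" "vc (opB B) = vc B" "hc (opB B) v u = hc B u v"
  "asc (opB B) h g f = inv2 B (asc B f g h)" "lun (opB B) = run B" "run (opB B) = lun B"
  by (simp_all add: opB_def)

lemma hom_opB [simp]: "hom1 (opB B) a b = hom1 B b a" "hom2 (opB B) f g = hom2 B f g"
  by (auto simp: hom1_def hom2_def)

lemma iso2_opB [simp]: "iso2 (opB B) f g = iso2 B f g"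
  by (simp add: iso2_def is_inv2_def)

context bicategory
begin

lemma hc_split:
  assumes "u \<in> arr2 B" "v \<in> arr2 B" "trg B (dom2 B u) = src B (dom2 B v)"
  shows "hc B v u = vc B (hc B v (id2 B (cod2 B u))) (hc B (id2 B (dom2 B v)) u)"
  using interchange'[of u "id2 B (cod2 B u)" "id2 B (dom2 B v)" v] assms by simp

lemma hc_vc_id:
  assumes "u \<in> arr2 B" "v \<in> arr2 B" "dom2 B v = cod2 B u" "f \<in> arr1 B" "trg B f = src B (dom2 B u)"
  shows "hc B (vc B v u) (id2 B f) = vc B (hc B v (id2 B f)) (hc B u (id2 B f))"
  using interchange'[of "id2 B f" "id2 B f" u v] assms by simp

end

context closed_pairing
begin

definition dF :: "('o, 'm, 'c, 'o, 'm, 'c) pfun" where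
  "dF = \<lparr>F0 = d0, F1 = d1, F2 = d2, Fc = Fd, Fu = Ud\<rparr>"

definition etT :: "('o, 'm, 'c, 'o, 'm, 'c) ptrans" where
  "etT = \<lparr>tsrc = idF B, ttrg = compF B (opF dF) dF, t1 = et, t2 = N\<rparr>"

lemma dF_simps [simp]: "F0 dF = d0" "F1 dF = d1" "F2 dF = d2" "Fc dF = Fd" "Fu dF = Ud"
  by (simp_all add: dF_def)

text \<open>On both sides \<open>u\<close> and \<open>v\<close> end up acting in the second variable
  after one and the same \<open>D ?f (om ?g) (d1 ?g)\<close>; the two orders of action agree by
  \<open>st_nat\<close>.\<close>

lemma Fd_natural:
  assumes [simp]: "u \<in> arr2 B" "v \<in> arr2 B" "trg B (dom2 B u) = src B (dom2 B v)"
  shows "vc B (Fd (cod2 B v) (cod2 B u)) (hc B (d2 u) (d2 v)) = vc B (d2 (hc B v u)) (Fd (dom2 B v) (dom2 B u))"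
proof -
  let ?f = "dom2 B u" and ?f' = "cod2 B u" and ?g = "dom2 B v" and ?g' = "cod2 B v"
  let ?E = "ev (src B ?f)" and ?G = "ev (trg B ?g)"
  let ?\<alpha> = "ios ?G ?g' ?f' \<odot> om (cmp1 B ?g' ?f')"
  show ?thesis
  proof (rule ev_eqI[of ?\<alpha> "src B ?f"])
    have 1: "?\<alpha> \<odot> ?E \<cdot>\<^sub>2 Fd ?g' ?f' = D ?f' (om ?g') (d1 ?g')" using Fd_eq[of ?f' ?g'] by simp
    have 2: "D ?f' (om ?g') (d1 ?g') \<odot> ?E \<cdot>\<^sub>2 hc B (d2 u) (id2 B (d1 ?g')) = (?G \<star> ?g') \<star>\<^sub>2 u \<odot> D ?f (om ?g') (d1 ?g')"
      using D_d2[of u "d1 ?g'" "om ?g'"] by simp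
    have 3: "D ?f (om ?g') (d1 ?g') \<odot> ?E \<cdot>\<^sub>2 hc B (id2 B (d1 ?f)) (d2 v) = ?G \<star>\<^sub>2 v \<star>\<^sub>1 ?f \<odot> D ?f (om ?g) (d1 ?g)"
      using D_hcL[of ?f "d2 v" "om ?g'"] d2_eq[of v] by (simp add: D_cp)
    have "?\<alpha> \<odot> ?E \<cdot>\<^sub>2 vc B (Fd ?g' ?f') (hc B (d2 u) (d2 v))
      = (?\<alpha> \<odot> ?E \<cdot>\<^sub>2 Fd ?g' ?f') \<odot> ?E \<cdot>\<^sub>2 hc B (d2 u) (id2 B (d1 ?g')) \<odot> ?E \<cdot>\<^sub>2 hc B (id2 B (d1 ?f)) (d2 v)"
      using hc_split[of "d2 v" "d2 u"] by (simp add: a2_vc)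
    also have "\<dots> = (?G \<star> ?g') \<star>\<^sub>2 u \<odot> ?G \<star>\<^sub>2 v \<star>\<^sub>1 ?f \<odot> D ?f (om ?g) (d1 ?g)"
      unfolding 1 using cp_reassoc[OF 2, of "?E \<cdot>\<^sub>2 hc B (id2 B (d1 ?f)) (d2 v)"] 3 by simp
    also have "\<dots> = (?G \<star>\<^sub>2 v \<star>\<^sub>1 ?f' \<odot> (?G \<star> ?g) \<star>\<^sub>2 u) \<odot> D ?f (om ?g) (d1 ?g)"
      using arg_cong[OF st_nat[of "?G \<star>\<^sub>2 v" u], of "\<lambda>x. x \<odot> D ?f (om ?g) (d1 ?g)"] by simp
    finally have L: "?\<alpha> \<odot> ?E \<cdot>\<^sub>2 vc B (Fd ?g' ?f') (hc B (d2 u) (d2 v)) = \<dots>" .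
    have 4: "om (cmp1 B ?g' ?f') \<odot> ?E \<cdot>\<^sub>2 d2 (hc B v u) = ?G \<star>\<^sub>2 hc B v u \<odot> om (cmp1 B ?g ?f)"
      using d2_eq[of "hc B v u"] by simp
    have 5: "ios ?G ?g' ?f' \<odot> ?G \<star>\<^sub>2 hc B v u = ?G \<star>\<^sub>2 v \<star>\<^sub>1 ?f' \<odot> (?G \<star> ?g) \<star>\<^sub>2 u \<odot> ios ?G ?g ?f"
      by (rule ios_hc) simp_all
    have "?\<alpha> \<odot> ?E \<cdot>\<^sub>2 vc B (d2 (hc B v u)) (Fd ?g ?f)
      = ios ?G ?g' ?f' \<odot> (om (cmp1 B ?g' ?f') \<odot> ?E \<cdot>\<^sub>2 d2 (hc B v u)) \<odot> ?E \<cdot>\<^sub>2 Fd ?g ?f"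
      by (simp add: a2_vc)
    also have "\<dots> = (ios ?G ?g' ?f' \<odot> ?G \<star>\<^sub>2 hc B v u) \<odot> om (cmp1 B ?g ?f) \<odot> ?E \<cdot>\<^sub>2 Fd ?g ?f"
      unfolding 4 by simp
    also have "\<dots> = (?G \<star>\<^sub>2 v \<star>\<^sub>1 ?f' \<odot> (?G \<star> ?g) \<star>\<^sub>2 u) \<odot> D ?f (om ?g) (d1 ?g)"
      unfolding 5 using Fd_eq[of ?f ?g] by simp
    finally show "?\<alpha> \<odot> ?E \<cdot>\<^sub>2 vc B (Fd ?g' ?f') (hc B (d2 u) (d2 v)) = ?\<alpha> \<odot> ?E \<cdot>\<^sub>2 vc B (d2 (hc B v u)) (Fd ?g ?f)"
      unfolding L by simp
  qed simp_all
qed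

text \<open>Both sides evaluate to the iterated \<open>D f (D g (om h) (d1 h))\<close>, the left one
  by \<open>ios_asc\<close> and the right one by \<open>D_Fd\<close>. The associator on the right is
  inverted because it belongs to the reversed bicategory.\<close>

lemma Fd_assoc:
  assumes [simp]: "f \<in> arr1 B" "g \<in> arr1 B" "h \<in> arr1 B" "trg B f = src B g" "trg B g = src B h"
  shows "vc B (d2 (asc B h g f)) (vc B (Fd (cmp1 B h g) f) (hc B (id2 B (d1 f)) (Fd h g)))
    = vc B (Fd h (cmp1 B g f)) (vc B (hc B (Fd g f) (id2 B (d1 h))) (inv2 B (asc B (d1 f) (d1 g) (d1 h))))"
proof -
  let ?E = "ev (src B f)" and ?G = "ev (trg B h)" and ?hg = "cmp1 B h g" and ?gf = "cmp1 B g f"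
  let ?\<alpha> = "ios (?G \<star> h) g f \<odot> ios ?G h ?gf \<odot> om (cmp1 B h ?gf)"
  show ?thesis
  proof (rule ev_eqI[of ?\<alpha> "src B f"])
    have 1: "om (cmp1 B h ?gf) \<odot> ?E \<cdot>\<^sub>2 d2 (asc B h g f) = ?G \<star>\<^sub>2 asc B h g f \<odot> om (cmp1 B ?hg f)"
      using d2_eq[of "asc B h g f"] by simp
    have 2: "ios (?G \<star> h) g f \<odot> ios ?G h ?gf \<odot> ?G \<star>\<^sub>2 asc B h g f = ios ?G h g \<star>\<^sub>1 f \<odot> ios ?G ?hg f"
      by (rule ios_asc) simp_all
    have 3: "ios ?G ?hg f \<odot> om (cmp1 B ?hg f) \<odot> ?E \<cdot>\<^sub>2 Fd ?hg f = D f (om ?hg) (d1 ?hg)"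
      using Fd_eq[of f ?hg] by simp
    have 4: "ios ?G h g \<star>\<^sub>1 f \<odot> D f (om ?hg) (d1 ?hg) = D f (ios ?G h g \<odot> om ?hg) (d1 ?hg)"
      by (simp add: D_cp)
    have 5: "D f (ios ?G h g \<odot> om ?hg) (d1 ?hg) \<odot> ?E \<cdot>\<^sub>2 hc B (id2 B (d1 f)) (Fd h g) = D f (D g (om h) (d1 h)) (cmp1 B (d1 g) (d1 h))"
      using D_hcL[of f "Fd h g" "ios ?G h g \<odot> om ?hg"] Fd_eq[of g h] by simp
    let ?x = "?E \<cdot>\<^sub>2 Fd ?hg f \<odot> ?E \<cdot>\<^sub>2 hc B (id2 B (d1 f)) (Fd h g)"
    have "?\<alpha> \<odot> ?E \<cdot>\<^sub>2 vc B (d2 (asc B h g f)) (vc B (Fd ?hg f) (hc B (id2 B (d1 f)) (Fd h g)))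
      = ios (?G \<star> h) g f \<odot> ios ?G h ?gf \<odot> (om (cmp1 B h ?gf) \<odot> ?E \<cdot>\<^sub>2 d2 (asc B h g f)) \<odot> ?x"
      by (simp add: a2_vc)
    also have "\<dots> = (ios (?G \<star> h) g f \<odot> ios ?G h ?gf \<odot> ?G \<star>\<^sub>2 asc B h g f) \<odot> om (cmp1 B ?hg f) \<odot> ?x"
      unfolding 1 by simp
    also have "\<dots> = ios ?G h g \<star>\<^sub>1 f \<odot> (ios ?G ?hg f \<odot> om (cmp1 B ?hg f) \<odot> ?E \<cdot>\<^sub>2 Fd ?hg f) \<odot> ?E \<cdot>\<^sub>2 hc B (id2 B (d1 f)) (Fd h g)"
      unfolding 2 by simp
    also have "\<dots> = (ios ?G h g \<star>\<^sub>1 f \<odot> D f (om ?hg) (d1 ?hg)) \<odot> ?E \<cdot>\<^sub>2 hc B (id2 B (d1 f)) (Fd h g)"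
      unfolding 3 by simp
    also have "\<dots> = D f (D g (om h) (d1 h)) (cmp1 B (d1 g) (d1 h))"
      unfolding 4 5 ..
    finally have L: "?\<alpha> \<odot> ?E \<cdot>\<^sub>2 vc B (d2 (asc B h g f)) (vc B (Fd ?hg f) (hc B (id2 B (d1 f)) (Fd h g))) = \<dots>" .
    let ?a = "asc B (d1 f) (d1 g) (d1 h)"
    have 6: "ios ?G h ?gf \<odot> om (cmp1 B h ?gf) \<odot> ?E \<cdot>\<^sub>2 Fd h ?gf = D ?gf (om h) (d1 h)"
      using Fd_eq[of ?gf h] by simp
    have 7: "ios (?G \<star> h) g f \<odot> D ?gf (om h) (d1 h) \<odot> ?E \<cdot>\<^sub>2 hc B (Fd g f) (id2 B (d1 h)) = D f (D g (om h) (d1 h)) (cmp1 B (d1 g) (d1 h)) \<odot> ?E \<cdot>\<^sub>2 ?a"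
      using D_Fd[of f g "d1 h" "om h"] by simp
    have "?\<alpha> \<odot> ?E \<cdot>\<^sub>2 vc B (Fd h ?gf) (vc B (hc B (Fd g f) (id2 B (d1 h))) (inv2 B ?a))
      = ios (?G \<star> h) g f \<odot> (ios ?G h ?gf \<odot> om (cmp1 B h ?gf) \<odot> ?E \<cdot>\<^sub>2 Fd h ?gf) \<odot> ?E \<cdot>\<^sub>2 hc B (Fd g f) (id2 B (d1 h)) \<odot> inv (?E \<cdot>\<^sub>2 ?a)"
      by (simp add: a2_vc)
    also have "\<dots> = (ios (?G \<star> h) g f \<odot> D ?gf (om h) (d1 h) \<odot> ?E \<cdot>\<^sub>2 hc B (Fd g f) (id2 B (d1 h))) \<odot> inv (?E \<cdot>\<^sub>2 ?a)"
      unfolding 6 by simp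
    also have "\<dots> = D f (D g (om h) (d1 h)) (cmp1 B (d1 g) (d1 h))"
      by (rule cp_inv_right[OF 7]) simp_all
    finally show "?\<alpha> \<odot> ?E \<cdot>\<^sub>2 vc B (d2 (asc B h g f)) (vc B (Fd ?hg f) (hc B (id2 B (d1 f)) (Fd h g)))
      = ?\<alpha> \<odot> ?E \<cdot>\<^sub>2 vc B (Fd h ?gf) (vc B (hc B (Fd g f) (id2 B (d1 h))) (inv2 B ?a))"
      unfolding L by simp
  qed simp_all
qed

lemma Ud_left:
  assumes [simp]: "f \<in> arr1 B"
  shows "vc B (d2 (lun B f)) (vc B (Fd (id1 B (trg B f)) f) (hc B (id2 B (d1 f)) (Ud (trg B f)))) = run B (d1 f)"
proof (rule ev_eqI[of "om f" "src B f"])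
  let ?E = "ev (src B f)" and ?G = "ev (trg B f)" and ?e = "id1 B (trg B f)"
  have 1: "om f \<odot> ?E \<cdot>\<^sub>2 d2 (lun B f) = uns ?G \<star>\<^sub>1 f \<odot> ios ?G ?e f \<odot> om (cmp1 B ?e f)"
    using d2_eq[of "lun B f"] uns_lun[of ?G f] by (simp flip: uns_lun)
  have 2: "ios ?G ?e f \<odot> om (cmp1 B ?e f) \<odot> ?E \<cdot>\<^sub>2 Fd ?e f = D f (om ?e) (d1 ?e)"
    using Fd_eq[of f ?e] by simp
  have 3: "uns ?G \<star>\<^sub>1 f \<odot> D f (om ?e) (d1 ?e) = D f (uns ?G \<odot> om ?e) (d1 ?e)"
    by (simp add: D_cp)
  have 4: "D f (uns ?G \<odot> om ?e) (d1 ?e) \<odot> ?E \<cdot>\<^sub>2 hc B (id2 B (d1 f)) (Ud (trg B f)) = om f \<odot> ?E \<cdot>\<^sub>2 run B (d1 f)"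
    using D_hcL[of f "Ud (trg B f)" "uns ?G \<odot> om ?e"] Ud_eq[of "trg B f"] D_id_un[of f] by simp
  have "om f \<odot> ?E \<cdot>\<^sub>2 vc B (d2 (lun B f)) (vc B (Fd ?e f) (hc B (id2 B (d1 f)) (Ud (trg B f))))
    = (om f \<odot> ?E \<cdot>\<^sub>2 d2 (lun B f)) \<odot> ?E \<cdot>\<^sub>2 Fd ?e f \<odot> ?E \<cdot>\<^sub>2 hc B (id2 B (d1 f)) (Ud (trg B f))"
    by (simp add: a2_vc)
  also have "\<dots> = uns ?G \<star>\<^sub>1 f \<odot> (ios ?G ?e f \<odot> om (cmp1 B ?e f) \<odot> ?E \<cdot>\<^sub>2 Fd ?e f) \<odot> ?E \<cdot>\<^sub>2 hc B (id2 B (d1 f)) (Ud (trg B f))"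
    unfolding 1 by simp
  also have "\<dots> = (uns ?G \<star>\<^sub>1 f \<odot> D f (om ?e) (d1 ?e)) \<odot> ?E \<cdot>\<^sub>2 hc B (id2 B (d1 f)) (Ud (trg B f))"
    unfolding 2 by simp
  also have "\<dots> = om f \<odot> ?E \<cdot>\<^sub>2 run B (d1 f)" unfolding 3 4 ..
  finally show "om f \<odot> ?E \<cdot>\<^sub>2 vc B (d2 (lun B f)) (vc B (Fd ?e f) (hc B (id2 B (d1 f)) (Ud (trg B f)))) = om f \<odot> ?E \<cdot>\<^sub>2 run B (d1 f)" .
qed simp_all

lemma Ud_right:
  assumes [simp]: "f \<in> arr1 B"
  shows "vc B (d2 (run B f)) (vc B (Fd f (id1 B (src B f))) (hc B (Ud (src B f)) (id2 B (d1 f)))) = lun B (d1 f)"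
proof (rule ev_eqI[of "om f" "src B f"])
  let ?E = "ev (src B f)" and ?G = "ev (trg B f)" and ?e = "id1 B (src B f)"
  have 1: "om f \<odot> ?E \<cdot>\<^sub>2 d2 (run B f) = uns (?G \<star> f) \<odot> ios ?G f ?e \<odot> om (cmp1 B f ?e)"
    using d2_eq[of "run B f"] by (simp flip: uns_run)
  have 2: "ios ?G f ?e \<odot> om (cmp1 B f ?e) \<odot> ?E \<cdot>\<^sub>2 Fd f ?e = D ?e (om f) (d1 f)"
    using Fd_eq[of ?e f] by simp
  have "om f \<odot> ?E \<cdot>\<^sub>2 vc B (d2 (run B f)) (vc B (Fd f ?e) (hc B (Ud (src B f)) (id2 B (d1 f))))
    = (om f \<odot> ?E \<cdot>\<^sub>2 d2 (run B f)) \<odot> ?E \<cdot>\<^sub>2 Fd f ?e \<odot> ?E \<cdot>\<^sub>2 hc B (Ud (src B f)) (id2 B (d1 f))"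
    by (simp add: a2_vc)
  also have "\<dots> = uns (?G \<star> f) \<odot> (ios ?G f ?e \<odot> om (cmp1 B f ?e) \<odot> ?E \<cdot>\<^sub>2 Fd f ?e) \<odot> ?E \<cdot>\<^sub>2 hc B (Ud (src B f)) (id2 B (d1 f))"
    unfolding 1 by simp
  also have "\<dots> = om f \<odot> ?E \<cdot>\<^sub>2 lun B (d1 f)" unfolding 2 using D_Ud[of "src B f" "d1 f" "om f"] by simp
  finally show "om f \<odot> ?E \<cdot>\<^sub>2 vc B (d2 (run B f)) (vc B (Fd f ?e) (hc B (Ud (src B f)) (id2 B (d1 f)))) = om f \<odot> ?E \<cdot>\<^sub>2 lun B (d1 f)" .
qed simp_all

lemma dF_pseudofunctor: "pseudofunctor B (opB B) dF"
  by unfold_locales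
    (use Fd_natural Fd_assoc Ud_left Ud_right in \<open>auto simp: hom1_def hom2_def iso2_iff d2_vc\<close>)

section \<open>The transformation \<eta>\<close>

lemma N_natural:
  assumes [simp]: "u \<in> arr2 B"
  shows "vc B (N (cod2 B u)) (hc B (d2 (d2 u)) (id2 B (et (src B (dom2 B u)))))
    = vc B (hc B (id2 B (et (trg B (dom2 B u)))) u) (N (dom2 B u))"
proof -
  let ?f = "dom2 B u" and ?g = "cod2 B u"
  let ?a = "src B ?f" and ?b = "trg B ?f"
  let ?E = "ev (d0 ?b)" and ?e = "et ?a"
  show ?thesis
  proof (rule ev_eqI[of "H ?b ?g" "d0 ?b"])
    have 1: "H ?b ?g \<odot> ?E \<cdot>\<^sub>2 N ?g = sm (om ?g) \<odot> D (d1 ?g) (th ?a) ?e" using N_eq[of ?g] by simp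
    have 2: "D (d1 ?g) (th ?a) ?e \<odot> ?E \<cdot>\<^sub>2 hc B (d2 (d2 u)) (id2 B ?e) = sg (ev ?a) \<star>\<^sub>2 d2 u \<odot> D (d1 ?f) (th ?a) ?e"
      using D_d2[of "d2 u" ?e "th ?a"] by simp
    \<comment> \<open>The characterization of \<open>d2 u\<close>, reflected: \<open>u\<close> now
      acts in the first variable and \<open>d2 u\<close> in the second.\<close>
    have 3: "sm (om ?g) \<odot> sg (ev ?a) \<star>\<^sub>2 d2 u = sg (ev ?b) \<cdot>\<^sub>2 u \<odot> sm (om ?f)"
      using arg_cong[OF d2_eq[of u], of sm] by (simp add: sm_cp)
    have 4: "H ?b ?g \<odot> ?E \<cdot>\<^sub>2 hc B (id2 B (et ?b)) u = sg (ev ?b) \<cdot>\<^sub>2 u \<odot> H ?b ?f"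
      using H_hcL[of ?b u] by simp
    have 5: "H ?b ?f \<odot> ?E \<cdot>\<^sub>2 N ?f = sm (om ?f) \<odot> D (d1 ?f) (th ?a) ?e" using N_eq[of ?f] by simp
    have "H ?b ?g \<odot> ?E \<cdot>\<^sub>2 vc B (N ?g) (hc B (d2 (d2 u)) (id2 B ?e)) = (H ?b ?g \<odot> ?E \<cdot>\<^sub>2 N ?g) \<odot> ?E \<cdot>\<^sub>2 hc B (d2 (d2 u)) (id2 B ?e)"
      by (simp add: a2_vc)
    also have "\<dots> = (sm (om ?g) \<odot> sg (ev ?a) \<star>\<^sub>2 d2 u) \<odot> D (d1 ?f) (th ?a) ?e"
      unfolding 1 using 2 by simp
    also have "\<dots> = sg (ev ?b) \<cdot>\<^sub>2 u \<odot> H ?b ?f \<odot> ?E \<cdot>\<^sub>2 N ?f" unfolding 3 5 by simp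
    also have "\<dots> = H ?b ?g \<odot> ?E \<cdot>\<^sub>2 vc B (hc B (id2 B (et ?b)) u) (N ?f)"
      using cp_reassoc[OF 4, of "?E \<cdot>\<^sub>2 N ?f"] by (simp add: a2_vc)
    finally show "H ?b ?g \<odot> ?E \<cdot>\<^sub>2 vc B (N ?g) (hc B (d2 (d2 u)) (id2 B ?e)) = H ?b ?g \<odot> ?E \<cdot>\<^sub>2 vc B (hc B (id2 B (et ?b)) u) (N ?f)" .
  qed simp_all
qed

text \<open>Both sides evaluate to the reflected \<open>om f\<close> and \<open>om g\<close>,
  applied after the iterated evaluation \<open>?T\<close>. On the left \<open>Fd g f\<close> occurs
  under \<open>d2\<close>, hence acts in the second variable, where the reflection of
  \<open>Fd_eq\<close> splits \<open>om\<close> of the composite.\<close>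

lemma N_cmp:
  assumes [simp]: "f \<in> arr1 B" "g \<in> arr1 B" "trg B f = src B g"
  shows "vc B (N (cmp1 B g f)) (hc B (vc B (d2 (Fd g f)) (Fd (d1 f) (d1 g))) (id2 B (et (src B f))))
    = vc B (asc B (et (trg B g)) g f) (vc B (hc B (N g) (id2 B f)) (vc B (inv2 B (asc B (d1 (d1 g)) (et (src B g)) f))
       (vc B (hc B (id2 B (d1 (d1 g))) (N f)) (asc B (d1 (d1 g)) (d1 (d1 f)) (et (src B f))))))"
proof -
  let ?a = "src B f" and ?b = "src B g" and ?c = "trg B g" and ?gf = "cmp1 B g f"
  let ?df = "d1 f" and ?dg = "d1 g"
  let ?E = "ev (d0 ?c)" and ?e = "et ?a"
  let ?ddg = "d1 ?dg" and ?ddf = "d1 ?df"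
  let ?\<alpha> = "io Q (sg (ev ?c)) g f \<odot> H ?c ?gf"
  let ?A = "asc B ?ddg ?ddf ?e" and ?A' = "asc B ?ddg (et ?b) f"
  let ?T = "D ?dg (D ?df (th ?a) ?e) (cmp1 B ?ddf ?e)"
  show ?thesis
  proof (rule ev_eqI[of ?\<alpha> "d0 ?c"])
    have 1: "H ?c ?gf \<odot> ?E \<cdot>\<^sub>2 N ?gf = sm (om ?gf) \<odot> D (d1 ?gf) (th ?a) ?e" using N_eq[of ?gf] by simp
    have 2: "D (d1 ?gf) (th ?a) ?e \<odot> ?E \<cdot>\<^sub>2 hc B (d2 (Fd g f)) (id2 B ?e) = sg (ev ?a) \<star>\<^sub>2 Fd g f \<odot> D (cmp1 B ?df ?dg) (th ?a) ?e"
      using D_d2[of "Fd g f" ?e "th ?a"] by simp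
    have 3: "io Q (sg (ev ?c)) g f \<odot> sm (om ?gf) \<odot> sg (ev ?a) \<star>\<^sub>2 Fd g f = sm (om g) \<cdot>\<^sub>1 f \<odot> sm (om f) \<star>\<^sub>1 ?dg \<odot> ios (sg (ev ?a)) ?df ?dg"
      using arg_cong[OF Fd_eq[of f g], of sm] sm_D[of f ?dg "om g"] by (simp add: sm_cp)
    have 4: "ios (sg (ev ?a)) ?df ?dg \<odot> D (cmp1 B ?df ?dg) (th ?a) ?e \<odot> ?E \<cdot>\<^sub>2 hc B (Fd ?df ?dg) (id2 B ?e) = ?T \<odot> ?E \<cdot>\<^sub>2 ?A"
      using D_Fd[of ?dg ?df ?e "th ?a"] by simp
    let ?h = "?E \<cdot>\<^sub>2 hc B (d2 (Fd g f)) (id2 B ?e)" and ?h' = "?E \<cdot>\<^sub>2 hc B (Fd ?df ?dg) (id2 B ?e)"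
    have "?\<alpha> \<odot> ?E \<cdot>\<^sub>2 vc B (N ?gf) (hc B (vc B (d2 (Fd g f)) (Fd ?df ?dg)) (id2 B ?e))
      = io Q (sg (ev ?c)) g f \<odot> (H ?c ?gf \<odot> ?E \<cdot>\<^sub>2 N ?gf) \<odot> ?h \<odot> ?h'"
      by (simp add: a2_vc hc_vc_id)
    also have "\<dots> = io Q (sg (ev ?c)) g f \<odot> sm (om ?gf) \<odot> (D (d1 ?gf) (th ?a) ?e \<odot> ?h) \<odot> ?h'"
      unfolding 1 by simp
    also have "\<dots> = (io Q (sg (ev ?c)) g f \<odot> sm (om ?gf) \<odot> sg (ev ?a) \<star>\<^sub>2 Fd g f) \<odot> D (cmp1 B ?df ?dg) (th ?a) ?e \<odot> ?h'"
      unfolding 2 by simp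
    also have "\<dots> = sm (om g) \<cdot>\<^sub>1 f \<odot> sm (om f) \<star>\<^sub>1 ?dg \<odot> (ios (sg (ev ?a)) ?df ?dg \<odot> D (cmp1 B ?df ?dg) (th ?a) ?e \<odot> ?h')"
      unfolding 3 by simp
    also have "\<dots> = sm (om g) \<cdot>\<^sub>1 f \<odot> sm (om f) \<star>\<^sub>1 ?dg \<odot> ?T \<odot> ?E \<cdot>\<^sub>2 ?A"
      unfolding 4 ..
    finally have L: "?\<alpha> \<odot> ?E \<cdot>\<^sub>2 vc B (N ?gf) (hc B (vc B (d2 (Fd g f)) (Fd ?df ?dg)) (id2 B ?e)) = \<dots>" .
    have 5: "?\<alpha> \<odot> ?E \<cdot>\<^sub>2 asc B (et ?c) g f = H ?c g \<cdot>\<^sub>1 f \<odot> io Q ?E (cmp1 B (et ?c) g) f"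
    proof -
      have a: "io Q (sg (ev ?c)) g f \<odot> th ?c \<cdot>\<^sub>1 ?gf = th ?c \<cdot>\<^sub>1 g \<cdot>\<^sub>1 f \<odot> io Q (?E \<cdot> et ?c) g f"
        using io_nat[of "th ?c" f g] by simp
      have b: "io Q (?E \<cdot> et ?c) g f \<odot> io Q ?E (et ?c) ?gf \<odot> ?E \<cdot>\<^sub>2 asc B (et ?c) g f = io Q ?E (et ?c) g \<cdot>\<^sub>1 f \<odot> io Q ?E (cmp1 B (et ?c) g) f"
        by (rule io_asc) simp_all
      show ?thesis using cp_reassoc[OF a, of "io Q ?E (et ?c) ?gf \<odot> ?E \<cdot>\<^sub>2 asc B (et ?c) g f"] b by (simp add: H_def am_cp)
    qed
    have 6: "io Q ?E (cmp1 B (et ?c) g) f \<odot> ?E \<cdot>\<^sub>2 hc B (N g) (id2 B f) = (?E \<cdot>\<^sub>2 N g) \<cdot>\<^sub>1 f \<odot> io Q ?E (cmp1 B ?ddg (et ?b)) f"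
      using io_hc[of ?E "id2 B f" "N g"] by simp
    have 7: "H ?c g \<cdot>\<^sub>1 f \<odot> (?E \<cdot>\<^sub>2 N g) \<cdot>\<^sub>1 f = sm (om g) \<cdot>\<^sub>1 f \<odot> D ?dg (th ?b) (et ?b) \<cdot>\<^sub>1 f"
      using arg_cong[OF N_eq[of g], of "\<lambda>u. u \<cdot>\<^sub>1 f"] by (simp add: am_cp del: sm_am)
    have 8: "D ?dg (th ?b) (et ?b) \<cdot>\<^sub>1 f \<odot> io Q ?E (cmp1 B ?ddg (et ?b)) f = D ?dg (H ?b f) (cmp1 B (et ?b) f) \<odot> ?E \<cdot>\<^sub>2 ?A'"
      using D_asc[of ?dg "et ?b" f "th ?b"] by (simp add: H_def)
    have 9: "D ?dg (H ?b f) (cmp1 B (et ?b) f) \<odot> ?E \<cdot>\<^sub>2 hc B (id2 B ?ddg) (N f) = sm (om f) \<star>\<^sub>1 ?dg \<odot> ?T"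
    proof -
      have "D ?dg (H ?b f) (cmp1 B (et ?b) f) \<odot> ?E \<cdot>\<^sub>2 hc B (id2 B ?ddg) (N f) = D ?dg (sm (om f) \<odot> D ?df (th ?a) ?e) (cmp1 B ?ddf ?e)"
        using D_hcL[of ?dg "N f" "H ?b f"] N_eq[of f] by simp
      then show ?thesis by (simp add: D_cp)
    qed
    let ?p = "?E \<cdot>\<^sub>2 hc B (N g) (id2 B f)" and ?q = "?E \<cdot>\<^sub>2 hc B (id2 B ?ddg) (N f)"
    have "?\<alpha> \<odot> ?E \<cdot>\<^sub>2 vc B (asc B (et ?c) g f) (vc B (hc B (N g) (id2 B f)) (vc B (inv2 B ?A') (vc B (hc B (id2 B ?ddg) (N f)) ?A)))
      = (?\<alpha> \<odot> ?E \<cdot>\<^sub>2 asc B (et ?c) g f) \<odot> ?p \<odot> inv (?E \<cdot>\<^sub>2 ?A') \<odot> ?q \<odot> ?E \<cdot>\<^sub>2 ?A"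
      by (simp add: a2_vc)
    also have "\<dots> = H ?c g \<cdot>\<^sub>1 f \<odot> (io Q ?E (cmp1 B (et ?c) g) f \<odot> ?p) \<odot> inv (?E \<cdot>\<^sub>2 ?A') \<odot> ?q \<odot> ?E \<cdot>\<^sub>2 ?A"
      unfolding 5 by simp
    also have "\<dots> = (H ?c g \<cdot>\<^sub>1 f \<odot> (?E \<cdot>\<^sub>2 N g) \<cdot>\<^sub>1 f) \<odot> io Q ?E (cmp1 B ?ddg (et ?b)) f \<odot> inv (?E \<cdot>\<^sub>2 ?A') \<odot> ?q \<odot> ?E \<cdot>\<^sub>2 ?A"
      unfolding 6 by simp
    also have "\<dots> = sm (om g) \<cdot>\<^sub>1 f \<odot> (D ?dg (th ?b) (et ?b) \<cdot>\<^sub>1 f \<odot> io Q ?E (cmp1 B ?ddg (et ?b)) f) \<odot> inv (?E \<cdot>\<^sub>2 ?A') \<odot> ?q \<odot> ?E \<cdot>\<^sub>2 ?A"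
      unfolding 7 by simp
    also have "\<dots> = sm (om g) \<cdot>\<^sub>1 f \<odot> (D ?dg (H ?b f) (cmp1 B (et ?b) f) \<odot> ?q) \<odot> ?E \<cdot>\<^sub>2 ?A"
      unfolding 8 by (simp del: iso_a2(2))
    also have "\<dots> = sm (om g) \<cdot>\<^sub>1 f \<odot> sm (om f) \<star>\<^sub>1 ?dg \<odot> ?T \<odot> ?E \<cdot>\<^sub>2 ?A"
      unfolding 9 by simp
    finally show "?\<alpha> \<odot> ?E \<cdot>\<^sub>2 vc B (N ?gf) (hc B (vc B (d2 (Fd g f)) (Fd ?df ?dg)) (id2 B ?e))
      = ?\<alpha> \<odot> ?E \<cdot>\<^sub>2 vc B (asc B (et ?c) g f) (vc B (hc B (N g) (id2 B f)) (vc B (inv2 B ?A') (vc B (hc B (id2 B ?ddg) (N f)) ?A)))"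
      unfolding L by simp
  qed simp_all
qed

text \<open>\<open>Ud\<close> occurs once under \<open>d2\<close>, where the reflection of
  \<open>Ud_eq\<close> applies, and once directly, where \<open>D_Ud\<close> applies. Composing
  further with \<open>un\<close> makes both sides equal to \<open>th a\<close> after the evaluated
  \<open>lun\<close>.\<close>

lemma N_id:
  assumes [simp]: "a \<in> obj B"
  shows "vc B (N (id1 B a)) (hc B (vc B (d2 (Ud a)) (Ud (d0 a))) (id2 B (et a)))
    = vc B (inv2 B (run B (et a))) (lun B (et a))"
proof (rule ev_eqI[of "H a (id1 B a)" "d0 a"])
  let ?E = "ev (d0 a)" and ?e = "et a" and ?i = "id1 B a" and ?j = "id1 B (d0 a)"
  have 1: "H a ?i \<odot> ?E \<cdot>\<^sub>2 N ?i = sm (om ?i) \<odot> D (d1 ?i) (th a) ?e" using N_eq[of ?i] by simp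
  have 2: "D (d1 ?i) (th a) ?e \<odot> ?E \<cdot>\<^sub>2 hc B (d2 (Ud a)) (id2 B ?e) = sg (ev a) \<star>\<^sub>2 Ud a \<odot> D ?j (th a) ?e"
    using D_d2[of "Ud a" ?e "th a"] by simp
  have 3: "un Q (sg (ev a)) \<odot> sm (om ?i) \<odot> sg (ev a) \<star>\<^sub>2 Ud a = uns (sg (ev a))"
    using arg_cong[OF Ud_eq[of a], of sm] by (simp add: sm_cp)
  have 4: "uns (sg (ev a)) \<odot> D ?j (th a) ?e \<odot> ?E \<cdot>\<^sub>2 hc B (Ud (d0 a)) (id2 B ?e) = th a \<odot> ?E \<cdot>\<^sub>2 lun B ?e"
    using D_Ud[of "d0 a" ?e "th a"] by simp
  let ?h = "?E \<cdot>\<^sub>2 hc B (d2 (Ud a)) (id2 B ?e)" and ?h' = "?E \<cdot>\<^sub>2 hc B (Ud (d0 a)) (id2 B ?e)"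
  have "un Q (sg (ev a)) \<odot> H a ?i \<odot> ?E \<cdot>\<^sub>2 vc B (N ?i) (hc B (vc B (d2 (Ud a)) (Ud (d0 a))) (id2 B ?e))
    = un Q (sg (ev a)) \<odot> (H a ?i \<odot> ?E \<cdot>\<^sub>2 N ?i) \<odot> ?h \<odot> ?h'"
    by (simp add: a2_vc hc_vc_id)
  also have "\<dots> = un Q (sg (ev a)) \<odot> sm (om ?i) \<odot> (D (d1 ?i) (th a) ?e \<odot> ?h) \<odot> ?h'"
    unfolding 1 by simp
  also have "\<dots> = (un Q (sg (ev a)) \<odot> sm (om ?i) \<odot> sg (ev a) \<star>\<^sub>2 Ud a) \<odot> D ?j (th a) ?e \<odot> ?h'"
    unfolding 2 by simp
  also have "\<dots> = th a \<odot> ?E \<cdot>\<^sub>2 lun B ?e" unfolding 3 4 ..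
  finally have L: "un Q (sg (ev a)) \<odot> H a ?i \<odot> ?E \<cdot>\<^sub>2 vc B (N ?i) (hc B (vc B (d2 (Ud a)) (Ud (d0 a))) (id2 B ?e)) = \<dots>" .
  have 5: "un Q (sg (ev a)) \<odot> H a ?i = th a \<odot> ?E \<cdot>\<^sub>2 run B ?e"
  proof -
    have a: "un Q (sg (ev a)) \<odot> th a \<cdot>\<^sub>1 ?i = th a \<odot> un Q (?E \<cdot> ?e)"
      using un_nat[of "th a"] by simp
    show ?thesis using cp_reassoc[OF a, of "io Q ?E ?e ?i"] un_run[of ?E ?e] by (simp add: H_def)
  qed
  have R: "un Q (sg (ev a)) \<odot> H a ?i \<odot> ?E \<cdot>\<^sub>2 vc B (inv2 B (run B ?e)) (lun B ?e) = th a \<odot> ?E \<cdot>\<^sub>2 lun B ?e"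
    using arg_cong[OF 5, of "\<lambda>u. u \<odot> ?E \<cdot>\<^sub>2 vc B (inv2 B (run B ?e)) (lun B ?e)"] by (simp flip: a2_vc)
  show "H a ?i \<odot> ?E \<cdot>\<^sub>2 vc B (N ?i) (hc B (vc B (d2 (Ud a)) (Ud (d0 a))) (id2 B ?e)) = H a ?i \<odot> ?E \<cdot>\<^sub>2 vc B (inv2 B (run B ?e)) (lun B ?e)"
    by (rule iso_cancel_left[of "un Q (sg (ev a))"]) (use L R in simp_all)
qed simp_all

lemma etT_pseudonatural: "pseudonatural B B (idF B) (compF B (opF dF) dF) etT"
proof
  fix f a b u g assume "f \<in> hom1 B a b" "u \<in> hom2 B f g"
  then show "vc B (t2 etT g) (hc B (F2 (compF B (opF dF) dF) u) (id2 B (t1 etT a))) =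
       vc B (hc B (id2 B (t1 etT b)) (F2 (idF B) u)) (t2 etT f)"
    using N_natural[of u] by (auto simp: etT_def compF_def opF_def strictF_def hom1_def hom2_def)
next
  fix f a b g c assume "f \<in> hom1 B a b" "g \<in> hom1 B b c"
  then have [simp]: "f \<in> arr1 B" "g \<in> arr1 B" "trg B f = src B g" "a = src B f" "b = src B g" "c = trg B g"
    by (auto simp: hom1_def)
  show "vc B (t2 etT (cmp1 B g f)) (hc B (Fc (compF B (opF dF) dF) g f) (id2 B (t1 etT a))) =
       vc B (hc B (id2 B (t1 etT c)) (Fc (idF B) g f))
        (vc B (asc B (t1 etT c) (F1 (idF B) g) (F1 (idF B) f))
          (vc B (hc B (t2 etT g) (id2 B (F1 (idF B) f)))
            (vc B (inv2 B (asc B (F1 (compF B (opF dF) dF) g) (t1 etT b) (F1 (idF B) f)))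
              (vc B (hc B (id2 B (F1 (compF B (opF dF) dF) g)) (t2 etT f))
                (asc B (F1 (compF B (opF dF) dF) g) (F1 (compF B (opF dF) dF) f) (t1 etT a))))))"
    using N_cmp[of f g] by (simp add: etT_def compF_def opF_def strictF_def)
next
  fix a assume "a \<in> obj B"
  then show "vc B (t2 etT (id1 B a)) (hc B (Fu (compF B (opF dF) dF) a) (id2 B (t1 etT a))) =
         vc B (hc B (id2 B (t1 etT a)) (Fu (idF B) a)) (vc B (inv2 B (run B (t1 etT a))) (lun B (t1 etT a)))"
    using N_id[of a] by (simp add: etT_def compF_def opF_def strictF_def)
qed (auto simp: etT_def compF_def opF_def strictF_def hom1_def iso2_iff)

section \<open>The modification \<tau> and its coherence\<close>

lemma un_hc:
  assumes [simp]: "a \<in> obj B" "w \<in> arr2 B" "cod2 B w = id1 B (d0 a)" "src B (dom2 B w) = d0 a" "trg B (dom2 B w) = d0 a"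
    "k \<in> arr1 B" "trg B k = d0 a"
  shows "ev a \<cdot>\<^sub>2 lun B k \<odot> ev a \<cdot>\<^sub>2 hc B w (id2 B k) = (un Q (ev a) \<odot> ev a \<cdot>\<^sub>2 w) \<cdot>\<^sub>1 k \<odot> io Q (ev a) (dom2 B w) k"
proof -
  have "ev a \<cdot>\<^sub>2 lun B k = un Q (ev a) \<cdot>\<^sub>1 k \<odot> io Q (ev a) (id1 B (d0 a)) k"
    using un_lun[of "ev a" k] by simp
  then show ?thesis using io_hc[of "ev a" "id2 B k" w] by (simp add: am_cp)
qed

lemma sm_H:
  assumes [simp]: "b \<in> obj B" "k \<in> arr1 B" "trg B k = b"
  shows "sm (H b k) = sm (th b) \<star>\<^sub>1 k \<odot> ios (sg (ev (d0 b))) (et b) k"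
  by (simp add: H_def sm_cp)

text \<open>All but the outermost factor on the left is the unfolded naturality cell of the
  composite transformation. Both sides evaluate to \<open>sm (th a) \<star>\<^sub>1 f\<close> after
  \<open>?T\<close>, where \<open>a\<close> is the target of \<open>f\<close>.\<close>

lemma ta_natural:
  assumes [simp]: "f \<in> arr1 B"
  shows "vc B (hc B (ta (src B f)) (id2 B (d1 f)))
     (vc B (inv2 B (asc B (d1 (et (src B f))) (et (d0 (src B f))) (d1 f)))
     (vc B (hc B (id2 B (d1 (et (src B f)))) (N (d1 f)))
     (vc B (asc B (d1 (et (src B f))) (d1 (d1 (d1 f))) (et (d0 (trg B f))))
     (vc B (hc B (vc B (inv2 B (Fd (d1 (d1 f)) (et (src B f)))) (vc B (d2 (inv2 B (N f))) (Fd (et (trg B f)) f))) (id2 B (et (d0 (trg B f)))))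
        (inv2 B (asc B (d1 f) (d1 (et (trg B f))) (et (d0 (trg B f)))))))))
    = vc B (vc B (inv2 B (lun B (d1 f))) (run B (d1 f))) (hc B (id2 B (d1 f)) (ta (trg B f)))"
    (is "?L = ?R")
proof -
  let ?b = "src B f" and ?a = "trg B f"
  let ?E = "ev ?b" and ?df = "d1 f" and ?ddf = "d1 (d1 f)" and ?k = "et (d0 ?a)"
  let ?Z = "sg (ev (d0 ?a))" and ?\<beta> = "th (d0 ?a)"
  let ?eb = "et ?b" and ?ea = "et ?a" and ?edb = "et (d0 ?b)"
  let ?A1 = "asc B (d1 ?eb) ?edb ?df" and ?A2 = "asc B (d1 ?eb) (d1 ?ddf) ?k" and ?A3 = "asc B ?df (d1 ?ea) ?k"
  let ?h1 = "hc B (ta ?b) (id2 B ?df)" and ?h2 = "hc B (id2 B (d1 ?eb)) (N ?df)"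
    and ?h3 = "hc B (Fd ?ddf ?eb) (id2 B ?k)" and ?h4 = "hc B (d2 (inv2 B (N f))) (id2 B ?k)"
    and ?h5 = "hc B (Fd ?ea f) (id2 B ?k)"
  let ?T = "D f (D ?ea ?\<beta> ?k) (cmp1 B (d1 ?ea) ?k)"
  let ?S = "D ?eb (D ?ddf ?\<beta> ?k) (cmp1 B (d1 ?ddf) ?k)"
  have 1: "?E \<cdot>\<^sub>2 lun B ?df \<odot> ?E \<cdot>\<^sub>2 ?h1 = sm (th ?b) \<cdot>\<^sub>1 ?df \<odot> D ?eb (th (d0 ?b)) ?edb \<cdot>\<^sub>1 ?df \<odot> io Q ?E (cmp1 B (d1 ?eb) ?edb) ?df"
    using un_hc[of ?b "ta ?b" ?df] ta_eq[of ?b] by (simp add: am_cp)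
  have 2: "D ?eb (th (d0 ?b)) ?edb \<cdot>\<^sub>1 ?df \<odot> io Q ?E (cmp1 B (d1 ?eb) ?edb) ?df = D ?eb (H (d0 ?b) ?df) (cmp1 B ?edb ?df) \<odot> ?E \<cdot>\<^sub>2 ?A1"
    using D_asc[of ?eb ?edb ?df "th (d0 ?b)"] by (simp add: H_def)
  have 3: "D ?eb (H (d0 ?b) ?df) (cmp1 B ?edb ?df) \<odot> ?E \<cdot>\<^sub>2 ?h2 = sm (om ?df) \<star>\<^sub>1 ?eb \<odot> ?S"
  proof -
    have "D ?eb (H (d0 ?b) ?df) (cmp1 B ?edb ?df) \<odot> ?E \<cdot>\<^sub>2 ?h2 = D ?eb (sm (om ?df) \<odot> D ?ddf ?\<beta> ?k) (cmp1 B (d1 ?ddf) ?k)"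
      using D_hcL[of ?eb "N ?df" "H (d0 ?b) ?df"] N_eq[of ?df] by simp
    then show ?thesis by (simp add: D_cp)
  qed
  have 4: "?S \<odot> ?E \<cdot>\<^sub>2 ?A2 \<odot> ?E \<cdot>\<^sub>2 inv2 B ?h3 = ios ?Z ?ddf ?eb \<odot> D (cmp1 B ?ddf ?eb) ?\<beta> ?k"
  proof -
    have "(?S \<odot> ?E \<cdot>\<^sub>2 ?A2) \<odot> inv (?E \<cdot>\<^sub>2 ?h3) = ios ?Z ?ddf ?eb \<odot> D (cmp1 B ?ddf ?eb) ?\<beta> ?k"
      by (rule cp_inv_right) (use D_Fd[of ?eb ?ddf ?k ?\<beta>] in simp_all)
    then show ?thesis by simp
  qed
  have 5: "D (cmp1 B ?ddf ?eb) ?\<beta> ?k \<odot> ?E \<cdot>\<^sub>2 ?h4 = ?Z \<star>\<^sub>2 inv2 B (N f) \<odot> D (cmp1 B ?ea f) ?\<beta> ?k"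
    using D_d2[of "inv2 B (N f)" ?k ?\<beta>] by simp
  have 6: "D (cmp1 B ?ea f) ?\<beta> ?k \<odot> ?E \<cdot>\<^sub>2 ?h5 \<odot> inv (?E \<cdot>\<^sub>2 ?A3) = inv (ios ?Z ?ea f) \<odot> ?T"
  proof -
    have "(ios ?Z ?ea f \<odot> D (cmp1 B ?ea f) ?\<beta> ?k \<odot> ?E \<cdot>\<^sub>2 ?h5) \<odot> inv (?E \<cdot>\<^sub>2 ?A3) = ?T"
      by (rule cp_inv_right) (use D_Fd[of f ?ea ?k ?\<beta>] in simp_all)
    from arg_cong[OF this, of "\<lambda>u. inv (ios ?Z ?ea f) \<odot> u"] show ?thesis by simp
  qed
  \<comment> \<open>The defining equation of \<open>N f\<close>, reflected. The \<open>N f\<close>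
    that it produces cancels against the inverse of \<open>N f\<close> that \<open>opT\<close>
    brings in.\<close>
  have 7: "om f \<odot> sm (th ?b) \<cdot>\<^sub>1 ?df \<odot> sm (om ?df) \<star>\<^sub>1 ?eb \<odot> ios ?Z ?ddf ?eb = sm (th ?a) \<star>\<^sub>1 f \<odot> ios ?Z ?ea f \<odot> ?Z \<star>\<^sub>2 N f"
    using arg_cong[OF N_eq[of f], of sm] sm_D[of ?df ?eb "th ?b"] sm_H[of ?a f] by (simp add: sm_cp)
  let ?M = "om f \<odot> ?E \<cdot>\<^sub>2 lun B ?df"
  have h: "hc B (vc B (inv2 B (Fd ?ddf ?eb)) (vc B (d2 (inv2 B (N f))) (Fd ?ea f))) (id2 B ?k)
    = vc B (inv2 B ?h3) (vc B ?h4 ?h5)"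
    by (simp add: hc_vc_id)
  show ?thesis
  proof (rule ev_eqI[of ?M ?b])
    \<comment> \<open>\<open>r3\<close>, \<open>r2\<close> and \<open>r1\<close> are growing tails
      of the pasting, named so that each fact above can be applied at the head of a short
      chain.\<close>
    define r3 where "r3 = ?E \<cdot>\<^sub>2 ?h4 \<odot> ?E \<cdot>\<^sub>2 ?h5 \<odot> inv (?E \<cdot>\<^sub>2 ?A3)"
    define r2 where "r2 = ?E \<cdot>\<^sub>2 ?A2 \<odot> ?E \<cdot>\<^sub>2 inv2 B ?h3 \<odot> r3"
    define r1 where "r1 = inv (?E \<cdot>\<^sub>2 ?A1) \<odot> ?E \<cdot>\<^sub>2 ?h2 \<odot> r2"
    have [simp]: "r3 \<in> Ar Q" "dm Q r3 = ?E \<cdot> cmp1 B ?df (cmp1 B (d1 ?ea) ?k)" "cd Q r3 = ?E \<cdot> cmp1 B (d1 (cmp1 B ?ddf ?eb)) ?k"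
      by (simp_all add: r3_def)
    have [simp]: "r2 \<in> Ar Q" "dm Q r2 = ?E \<cdot> cmp1 B ?df (cmp1 B (d1 ?ea) ?k)" "cd Q r2 = ?E \<cdot> cmp1 B (d1 ?eb) (cmp1 B (d1 ?ddf) ?k)"
      by (simp_all add: r2_def)
    have [simp]: "r1 \<in> Ar Q" "dm Q r1 = ?E \<cdot> cmp1 B ?df (cmp1 B (d1 ?ea) ?k)" "cd Q r1 = ?E \<cdot> cmp1 B (cmp1 B (d1 ?eb) ?edb) ?df"
      by (simp_all add: r1_def)
    have a1: "?E \<cdot>\<^sub>2 ?L = ?E \<cdot>\<^sub>2 ?h1 \<odot> r1"
      unfolding h by (simp add: a2_vc r1_def r2_def r3_def)
    have a2: "D ?eb (th (d0 ?b)) ?edb \<cdot>\<^sub>1 ?df \<odot> io Q ?E (cmp1 B (d1 ?eb) ?edb) ?df \<odot> r1 = sm (om ?df) \<star>\<^sub>1 ?eb \<odot> ?S \<odot> r2"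
    proof -
      have "D ?eb (th (d0 ?b)) ?edb \<cdot>\<^sub>1 ?df \<odot> io Q ?E (cmp1 B (d1 ?eb) ?edb) ?df \<odot> r1
        = (D ?eb (th (d0 ?b)) ?edb \<cdot>\<^sub>1 ?df \<odot> io Q ?E (cmp1 B (d1 ?eb) ?edb) ?df) \<odot> r1" by simp
      also have "\<dots> = (D ?eb (H (d0 ?b) ?df) (cmp1 B ?edb ?df) \<odot> ?E \<cdot>\<^sub>2 ?h2) \<odot> r2"
        unfolding 2 by (simp add: r1_def del: iso_a2(2))
      finally show ?thesis unfolding 3 by simp
    qed
    have a3: "?S \<odot> r2 = ios ?Z ?ddf ?eb \<odot> D (cmp1 B ?ddf ?eb) ?\<beta> ?k \<odot> r3"
      using arg_cong[OF 4, of "\<lambda>u. u \<odot> r3"] by (simp add: r2_def)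
    have a4: "D (cmp1 B ?ddf ?eb) ?\<beta> ?k \<odot> r3 = inv (?Z \<star>\<^sub>2 N f) \<odot> inv (ios ?Z ?ea f) \<odot> ?T"
    proof -
      have "D (cmp1 B ?ddf ?eb) ?\<beta> ?k \<odot> r3 = (D (cmp1 B ?ddf ?eb) ?\<beta> ?k \<odot> ?E \<cdot>\<^sub>2 ?h4) \<odot> ?E \<cdot>\<^sub>2 ?h5 \<odot> inv (?E \<cdot>\<^sub>2 ?A3)"
        by (simp add: r3_def)
      also have "\<dots> = inv (?Z \<star>\<^sub>2 N f) \<odot> (D (cmp1 B ?ea f) ?\<beta> ?k \<odot> ?E \<cdot>\<^sub>2 ?h5 \<odot> inv (?E \<cdot>\<^sub>2 ?A3))"
        unfolding 5 by simp
      finally show ?thesis unfolding 6 .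
    qed
    have "?M \<odot> ?E \<cdot>\<^sub>2 ?L = om f \<odot> (?E \<cdot>\<^sub>2 lun B ?df \<odot> ?E \<cdot>\<^sub>2 ?h1) \<odot> r1"
      unfolding a1 by simp
    also have "\<dots> = om f \<odot> sm (th ?b) \<cdot>\<^sub>1 ?df \<odot> (D ?eb (th (d0 ?b)) ?edb \<cdot>\<^sub>1 ?df \<odot> io Q ?E (cmp1 B (d1 ?eb) ?edb) ?df \<odot> r1)"
      unfolding 1 by simp
    also have "\<dots> = (om f \<odot> sm (th ?b) \<cdot>\<^sub>1 ?df \<odot> sm (om ?df) \<star>\<^sub>1 ?eb \<odot> ios ?Z ?ddf ?eb) \<odot> inv (?Z \<star>\<^sub>2 N f) \<odot> inv (ios ?Z ?ea f) \<odot> ?T"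
      unfolding a2 a3 a4 by simp
    also have "\<dots> = sm (th ?a) \<star>\<^sub>1 f \<odot> ?T"
      unfolding 7 by (simp del: iso_st2(2))
    finally have L: "?M \<odot> ?E \<cdot>\<^sub>2 ?L = sm (th ?a) \<star>\<^sub>1 f \<odot> ?T" .
    have 8: "D f (un Q (ev ?a)) (id1 B (d0 ?a)) \<odot> ?E \<cdot>\<^sub>2 hc B (id2 B ?df) (ta ?a) = sm (th ?a) \<star>\<^sub>1 f \<odot> ?T"
    proof -
      have "D f (un Q (ev ?a)) (id1 B (d0 ?a)) \<odot> ?E \<cdot>\<^sub>2 hc B (id2 B ?df) (ta ?a) = D f (sm (th ?a) \<odot> D ?ea ?\<beta> ?k) (cmp1 B (d1 ?ea) ?k)"
        using D_hcL[of f "ta ?a" "un Q (ev ?a)"] ta_eq[of ?a] by simp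
      then show ?thesis by (simp add: D_cp)
    qed
    have "?M \<odot> ?E \<cdot>\<^sub>2 ?R = om f \<odot> ?E \<cdot>\<^sub>2 lun B ?df \<odot> inv (?E \<cdot>\<^sub>2 lun B ?df) \<odot> ?E \<cdot>\<^sub>2 run B ?df \<odot> ?E \<cdot>\<^sub>2 hc B (id2 B ?df) (ta ?a)"
      by (simp add: a2_vc)
    also have "\<dots> = D f (un Q (ev ?a)) (id1 B (d0 ?a)) \<odot> ?E \<cdot>\<^sub>2 hc B (id2 B ?df) (ta ?a)"
      unfolding D_id_un[OF assms] by (simp del: iso_a2(2))
    finally show "?M \<odot> ?E \<cdot>\<^sub>2 ?L = ?M \<odot> ?E \<cdot>\<^sub>2 ?R"
      unfolding L 8 by (rule sym)
  qed simp_all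
qed

text \<open>Composed with \<open>th a\<close>, both sides become the same chain after
  \<open>?W\<close>. On the left \<open>ta a\<close> occurs under \<open>d2\<close> and so acts in
  the second variable on \<open>ev (d0 a) \<cdot> et a\<close>; \<open>th a\<close> carries it to
  \<open>sg (ev a)\<close>, where its action is the reflection of the defining equation of
  \<open>ta a\<close>. On the right the same factors come from \<open>ta (d0 a)\<close> and
  \<open>N (et a)\<close>.\<close>

lemma ta_coherence:
  assumes [simp]: "a \<in> obj B"
  shows "vc B (lun B (et a)) (vc B (hc B (vc B (inv2 B (Ud (d0 a))) (vc B (d2 (ta a)) (Fd (d1 (et a)) (et (d0 a))))) (id2 B (et a)))
       (inv2 B (asc B (d1 (et (d0 a))) (d1 (d1 (et a))) (et a))))
    = vc B (lun B (et a)) (vc B (hc B (ta (d0 a)) (id2 B (et a)))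
       (vc B (inv2 B (asc B (d1 (et (d0 a))) (et (d0 (d0 a))) (et a))) (hc B (id2 B (d1 (et (d0 a)))) (N (et a)))))"
    (is "?L = ?R")
proof -
  let ?E = "ev (d0 a)" and ?e = "et a" and ?f = "et (d0 a)" and ?g = "et (d0 (d0 a))" and ?Z = "sg (ev a)"
  let ?de = "d1 (et a)"
  let ?dde = "d1 ?de" and ?A = "d1 ?f"
  let ?G = "ev (d0 (d0 (d0 a)))"
  let ?X = "vc B (inv2 B (Ud (d0 a))) (vc B (d2 (ta a)) (Fd ?de ?f))"
  let ?a1 = "asc B ?A ?dde ?e" and ?a2 = "asc B ?A ?g ?e"
  let ?w = "om ?de \<cdot>\<^sub>1 ?e \<odot> io Q ?G ?dde ?e"
  let ?W = "D ?f ?w (cmp1 B ?dde ?e)"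
  have 1: "un Q ?E \<odot> ?E \<cdot>\<^sub>2 ?X = uns ?E \<odot> ?E \<star>\<^sub>2 ta a \<odot> inv (ios ?E ?de ?f) \<odot> D ?f (om ?de) ?dde"
  proof -
    have a: "un Q ?E \<odot> inv (?E \<cdot>\<^sub>2 Ud (d0 a)) = uns ?E \<odot> om (id1 B (d0 a))"
      by (rule cp_inv_right) (use Ud_eq[of "d0 a"] in simp_all)
    have b: "om (id1 B (d0 a)) \<odot> ?E \<cdot>\<^sub>2 d2 (ta a) = ?E \<star>\<^sub>2 ta a \<odot> om (cmp1 B ?de ?f)"
      using d2_eq[of "ta a"] by simp
    have c: "om (cmp1 B ?de ?f) \<odot> ?E \<cdot>\<^sub>2 Fd ?de ?f = inv (ios ?E ?de ?f) \<odot> D ?f (om ?de) ?dde"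
      using arg_cong[OF Fd_eq[of ?f ?de], of "\<lambda>u. inv (ios ?E ?de ?f) \<odot> u"] by simp
    have "un Q ?E \<odot> ?E \<cdot>\<^sub>2 ?X = (un Q ?E \<odot> inv (?E \<cdot>\<^sub>2 Ud (d0 a))) \<odot> ?E \<cdot>\<^sub>2 d2 (ta a) \<odot> ?E \<cdot>\<^sub>2 Fd ?de ?f"
      by (simp add: a2_vc)
    also have "\<dots> = uns ?E \<odot> (om (id1 B (d0 a)) \<odot> ?E \<cdot>\<^sub>2 d2 (ta a)) \<odot> ?E \<cdot>\<^sub>2 Fd ?de ?f" unfolding a by simp
    also have "\<dots> = uns ?E \<odot> ?E \<star>\<^sub>2 ta a \<odot> (om (cmp1 B ?de ?f) \<odot> ?E \<cdot>\<^sub>2 Fd ?de ?f)" unfolding b by simp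
    finally show ?thesis unfolding c .
  qed
  have 2: "D ?f (om ?de) ?dde \<cdot>\<^sub>1 ?e \<odot> io Q ?E (cmp1 B ?A ?dde) ?e = ?W \<odot> ?E \<cdot>\<^sub>2 ?a1"
    using D_asc[of ?f ?dde ?e "om ?de"] by simp
  let ?U = "uns (?E \<cdot> ?e) \<odot> (?E \<cdot> ?e) \<star>\<^sub>2 ta a \<odot> inv (ios (?E \<cdot> ?e) ?de ?f)"
  have 3: "(uns ?E \<odot> ?E \<star>\<^sub>2 ta a \<odot> inv (ios ?E ?de ?f)) \<cdot>\<^sub>1 ?e = ?U"
  proof -
    have "inv (ios ?E ?de ?f) \<cdot>\<^sub>1 ?e = inv (ios (?E \<cdot> ?e) ?de ?f)"
      using iso_am(2)[of "ios ?E ?de ?f" ?e] by simp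
    then show ?thesis by (simp add: am_cp)
  qed
  have "?E \<cdot>\<^sub>2 ?L = (?E \<cdot>\<^sub>2 lun B ?e \<odot> ?E \<cdot>\<^sub>2 hc B ?X (id2 B ?e)) \<odot> inv (?E \<cdot>\<^sub>2 ?a1)"
    by (simp add: a2_vc)
  also have "?E \<cdot>\<^sub>2 lun B ?e \<odot> ?E \<cdot>\<^sub>2 hc B ?X (id2 B ?e) = (un Q ?E \<odot> ?E \<cdot>\<^sub>2 ?X) \<cdot>\<^sub>1 ?e \<odot> io Q ?E (cmp1 B ?A ?dde) ?e"
    using un_hc[of "d0 a" ?X ?e] by simp
  also have "(un Q ?E \<odot> ?E \<cdot>\<^sub>2 ?X) \<cdot>\<^sub>1 ?e = (uns ?E \<odot> ?E \<star>\<^sub>2 ta a \<odot> inv (ios ?E ?de ?f)) \<cdot>\<^sub>1 ?e \<odot> D ?f (om ?de) ?dde \<cdot>\<^sub>1 ?e"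
    unfolding 1 by (simp add: am_cp)
  finally have "?E \<cdot>\<^sub>2 ?L = ?U \<odot> (D ?f (om ?de) ?dde \<cdot>\<^sub>1 ?e \<odot> io Q ?E (cmp1 B ?A ?dde) ?e) \<odot> inv (?E \<cdot>\<^sub>2 ?a1)"
    unfolding 3 by simp
  then have L: "th a \<odot> ?E \<cdot>\<^sub>2 ?L = th a \<odot> ?U \<odot> ?W"
    unfolding 2 by (simp del: iso_a2(2))
  have 4: "D ?f (th (d0 (d0 a))) ?g \<cdot>\<^sub>1 ?e \<odot> io Q ?E (cmp1 B ?A ?g) ?e = D ?f (H (d0 (d0 a)) ?e) (cmp1 B ?g ?e) \<odot> ?E \<cdot>\<^sub>2 ?a2"
    using D_asc[of ?f ?g ?e "th (d0 (d0 a))"] by (simp add: H_def)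
  have 5: "D ?f (H (d0 (d0 a)) ?e) (cmp1 B ?g ?e) \<odot> ?E \<cdot>\<^sub>2 hc B (id2 B ?A) (N ?e) = sm (om ?e) \<star>\<^sub>1 ?f \<odot> th a \<star>\<^sub>1 ?de \<star>\<^sub>1 ?f \<odot> ?W"
  proof -
    have "D ?f (H (d0 (d0 a)) ?e) (cmp1 B ?g ?e) \<odot> ?E \<cdot>\<^sub>2 hc B (id2 B ?A) (N ?e)
      = D ?f (sm (om ?e) \<odot> D ?de (th a) ?e) (cmp1 B ?dde ?e)"
      using D_hcL[of ?f "N ?e" "H (d0 (d0 a)) ?e"] N_eq[of ?e] by simp
    also have "\<dots> = sm (om ?e) \<star>\<^sub>1 ?f \<odot> D ?f (th a \<star>\<^sub>1 ?de \<odot> ?w) (cmp1 B ?dde ?e)"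
      by (simp add: D_cp) (simp add: D_def[of ?de] D_cp)
    finally show ?thesis by (simp add: D_cp[where \<beta> = ?w])
  qed
  have "?E \<cdot>\<^sub>2 ?R = (?E \<cdot>\<^sub>2 lun B ?e \<odot> ?E \<cdot>\<^sub>2 hc B (ta (d0 a)) (id2 B ?e)) \<odot> inv (?E \<cdot>\<^sub>2 ?a2) \<odot> ?E \<cdot>\<^sub>2 hc B (id2 B ?A) (N ?e)"
    by (simp add: a2_vc)
  also have "?E \<cdot>\<^sub>2 lun B ?e \<odot> ?E \<cdot>\<^sub>2 hc B (ta (d0 a)) (id2 B ?e)
    = sm (th (d0 a)) \<cdot>\<^sub>1 ?e \<odot> D ?f (th (d0 (d0 a))) ?g \<cdot>\<^sub>1 ?e \<odot> io Q ?E (cmp1 B ?A ?g) ?e"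
    using un_hc[of "d0 a" "ta (d0 a)" ?e] ta_eq[of "d0 a"] by (simp add: am_cp)
  finally have "?E \<cdot>\<^sub>2 ?R = sm (th (d0 a)) \<cdot>\<^sub>1 ?e \<odot> (D ?f (th (d0 (d0 a))) ?g \<cdot>\<^sub>1 ?e \<odot> io Q ?E (cmp1 B ?A ?g) ?e)
     \<odot> inv (?E \<cdot>\<^sub>2 ?a2) \<odot> ?E \<cdot>\<^sub>2 hc B (id2 B ?A) (N ?e)" by simp
  then have "?E \<cdot>\<^sub>2 ?R = sm (th (d0 a)) \<cdot>\<^sub>1 ?e \<odot> (D ?f (H (d0 (d0 a)) ?e) (cmp1 B ?g ?e) \<odot> ?E \<cdot>\<^sub>2 hc B (id2 B ?A) (N ?e))"
    unfolding 4 by (simp del: iso_a2(2))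
  then have R: "th a \<odot> ?E \<cdot>\<^sub>2 ?R = th a \<odot> sm (th (d0 a)) \<cdot>\<^sub>1 ?e \<odot> sm (om ?e) \<star>\<^sub>1 ?f \<odot> th a \<star>\<^sub>1 ?de \<star>\<^sub>1 ?f \<odot> ?W"
    unfolding 5 by simp
  \<comment> \<open>\<open>ta_eq\<close> reflected: the definition of \<open>ta a\<close> read in
    the second variable. The next three facts move \<open>th a\<close> past the unit,
    \<open>ta a\<close> and the composition constraint, so that this equation applies.\<close>
  have 6: "uns ?Z \<odot> ?Z \<star>\<^sub>2 ta a = th a \<odot> sm (th (d0 a)) \<cdot>\<^sub>1 ?e \<odot> sm (om ?e) \<star>\<^sub>1 ?f \<odot> ios ?Z ?de ?f"
    using arg_cong[OF ta_eq[of a], of sm] sm_D[of ?e ?f "th (d0 a)"] by (simp add: sm_cp)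
  have 7: "th a \<odot> uns (?E \<cdot> ?e) = uns ?Z \<odot> th a \<star>\<^sub>1 id1 B (d0 a)"
    using uns_nat[of "th a"] by simp
  have 8: "th a \<star>\<^sub>1 id1 B (d0 a) \<odot> (?E \<cdot> ?e) \<star>\<^sub>2 ta a = ?Z \<star>\<^sub>2 ta a \<odot> th a \<star>\<^sub>1 cmp1 B ?de ?f"
    using st_nat[of "th a" "ta a"] by simp
  have 9: "th a \<star>\<^sub>1 cmp1 B ?de ?f \<odot> inv (ios (?E \<cdot> ?e) ?de ?f) = inv (ios ?Z ?de ?f) \<odot> th a \<star>\<^sub>1 ?de \<star>\<^sub>1 ?f"
    by (rule inP_swap[symmetric]) (use ios_nat[of "th a" ?f ?de] in simp_all)
  have "th a \<odot> ?U = (th a \<odot> uns (?E \<cdot> ?e)) \<odot> (?E \<cdot> ?e) \<star>\<^sub>2 ta a \<odot> inv (ios (?E \<cdot> ?e) ?de ?f)" by simp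
  also have "\<dots> = uns ?Z \<odot> (th a \<star>\<^sub>1 id1 B (d0 a) \<odot> (?E \<cdot> ?e) \<star>\<^sub>2 ta a) \<odot> inv (ios (?E \<cdot> ?e) ?de ?f)" unfolding 7 by simp
  also have "\<dots> = (uns ?Z \<odot> ?Z \<star>\<^sub>2 ta a) \<odot> (th a \<star>\<^sub>1 cmp1 B ?de ?f \<odot> inv (ios (?E \<cdot> ?e) ?de ?f))" unfolding 8 by simp
  also have "\<dots> = th a \<odot> sm (th (d0 a)) \<cdot>\<^sub>1 ?e \<odot> sm (om ?e) \<star>\<^sub>1 ?f \<odot> th a \<star>\<^sub>1 ?de \<star>\<^sub>1 ?f" unfolding 6 9 by simp
  finally have K: "th a \<odot> ?U = \<dots>" .
  have "th a \<odot> ?U \<odot> ?W = (th a \<odot> ?U) \<odot> ?W" by simp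
  also have "\<dots> = th a \<odot> sm (th (d0 a)) \<cdot>\<^sub>1 ?e \<odot> sm (om ?e) \<star>\<^sub>1 ?f \<odot> th a \<star>\<^sub>1 ?de \<star>\<^sub>1 ?f \<odot> ?W" unfolding K by simp
  finally have "th a \<odot> ?E \<cdot>\<^sub>2 ?L = th a \<odot> ?E \<cdot>\<^sub>2 ?R" unfolding L R .
  then show ?thesis by (rule ev_eqI) simp_all
qed

lemma dF_volutive: "lax_contravariant_O1_volutive B dF etT ta"
  unfolding lax_contravariant_O1_volutive_def
proof (intro conjI ballI)
  show "pseudofunctor B (opB B) dF" by (rule dF_pseudofunctor)
  show "pseudonatural B B (idF B) (compF B (opF dF) dF) etT" by (rule etT_pseudonatural)
  show "invertible_modification (opB B) B (opF dF) (opF dF)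
     (vcT (opB B) B (whiskL (opB B) B (opF dF) (opT B etT)) (whiskR B etT (opF dF))) (idT B (opF dF)) ta"
    unfolding invertible_modification_def
  proof (intro conjI ballI allI)
    fix a assume "a \<in> obj (opB B)"
    then show "ta a \<in> iso2 B (t1 (vcT (opB B) B (whiskL (opB B) B (opF dF) (opT B etT)) (whiskR B etT (opF dF))) a) (t1 (idT B (opF dF)) a)"
      by (simp add: vcT_def whiskL_def whiskR_def opT_def idT_def etT_def opF_def iso2_iff)
  next
    fix a b f assume "f \<in> hom1 (opB B) a b"
    then have [simp]: "f \<in> arr1 B" "a = trg B f" "b = src B f" by (auto simp: hom1_def)
    show "vc B (hc B (ta b) (id2 B (F1 (opF dF) f))) (t2 (vcT (opB B) B (whiskL (opB B) B (opF dF) (opT B etT)) (whiskR B etT (opF dF))) f)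
       = vc B (t2 (idT B (opF dF)) f) (hc B (id2 B (F1 (opF dF) f)) (ta a))"
      using ta_natural[of f] by (simp add: vcT_def whiskL_def whiskR_def opT_def idT_def etT_def opF_def compF_def strictF_def Let_def)
  qed
next
  fix a assume [simp]: "a \<in> obj B"
  let ?e = "et a" and ?A = "d1 (et (d0 a))" and ?dde = "d1 (d1 (et a))" and ?g = "et (d0 (d0 a))"
  let ?X = "vc B (inv2 B (Ud (d0 a))) (vc B (d2 (ta a)) (Fd (d1 (et a)) (et (d0 a))))"
  \<comment> \<open>A step with nothing to the left of its cell still has left unitors at both ends;
    naturality of \<open>lun\<close> removes them.\<close>
  have step: "pstep B a ([], PCell (d0 (d0 a)) [?A, h] [] X, [?e]) = vc B (lun B ?e) (vc B (hc B X (id2 B ?e)) (inv2 B (asc B ?A h ?e)))"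
    if [simp]: "X \<in> arr2 B" "dom2 B X = cmp1 B ?A h" "cod2 B X = id1 B (d0 (d0 a))" "h \<in> arr1 B" "src B h = d0 (d0 a)" "trg B h = d0 (d0 (d0 (d0 a)))"
    for X h
  proof -
    let ?u = "vc B (lun B ?e) (vc B (hc B X (id2 B ?e)) (inv2 B (asc B ?A h ?e)))"
    have j: "join B a [?A, h] [?e] = asc B ?A h ?e" by simp
    have "vc B (lun B ?e) (hc B (id2 B (id1 B (d0 (d0 a)))) ?u) = vc B ?u (lun B (cmp1 B ?A (cmp1 B h ?e)))"
      using lun_nat'[of ?u] by simp
    from vc_inv_right[OF this] have k: "vc B (lun B ?e) (vc B (hc B (id2 B (id1 B (d0 (d0 a)))) ?u) (inv2 B (lun B (cmp1 B ?A (cmp1 B h ?e))))) = ?u"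
      by simp
    show ?thesis using k by (simp add: pstep_def Let_def)
  qed
  \<comment> \<open>With nothing to the right there are right unitors instead;
    \<open>run_cmp1\<close> recognizes them in \<open>join\<close> with an empty path.\<close>
  have N_step: "pstep B a ([?A], PCell a [?dde, ?e] [?g, ?e] (N ?e), []) = hc B (id2 B ?A) (N ?e)"
  proof -
    have "vc B (run B (cmp1 B ?g ?e)) (hc B (N ?e) (id2 B (id1 B a))) = vc B (N ?e) (run B (cmp1 B ?dde ?e))"
      using run_nat'[of "N ?e"] by simp
    from vc_inv_right[OF this] have k: "vc B (run B (cmp1 B ?g ?e)) (vc B (hc B (N ?e) (id2 B (id1 B a))) (inv2 B (run B (cmp1 B ?dde ?e)))) = N ?e"
      by simp
    have j: "join B a [?g, ?e] [] = run B (cmp1 B ?g ?e)" "join B a [?dde, ?e] [] = run B (cmp1 B ?dde ?e)"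
      by (simp_all add: run_cmp1)
    show ?thesis using k unfolding pstep_def by (simp add: Let_def j del: join.simps(4))
  qed
  show "let da = F0 dF a; dda = F0 dF da; e = t1 etT a; de = F1 dF e; d_eda = F1 dF (t1 etT da);
            D = PCell dda [d_eda, F1 dF de] []
              (vc B (inv2 B (Fu dF da)) (vc B (F2 dF (ta a)) (Fc dF de (t1 etT da))));
            T = PCell dda [d_eda, t1 etT dda] [] (ta da);
            N = PCell a [F1 dF de, e] [t1 etT dda, e] (t2 etT e)
        in paste B a [d_eda, F1 dF de, e] [([], D, [e])] =
           paste B a [d_eda, F1 dF de, e] [([d_eda], N, []), ([], T, [e])]"
    using ta_coherence[of a] step[of ?X ?dde] step[of "ta (d0 a)" ?g] N_step
    by (simp add: etT_def Let_def paste_def)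
qed

end

section \<open>The pairing of a sylleptic braiding\<close>

text \<open>\<open>Q\<close> is kept general here; the theorem takes the representable action at the
  unit, whose restriction along the tensor product is the pairing to be strictified.\<close>

locale braided = symmetric_monoidal_bicategory B M + bimodule B Q
  for B :: "('o, 'm, 'c) bicat" and M :: "('o, 'm, 'c) symmon" and Q :: "('o, 'm, 'c, 'x, 'y) rmod"
begin

lemma prod_bicat: "bicategory B2"
  by (rule prodB_bicategory) (rule bicategory_axioms)+

end

sublocale braided \<subseteq> T: pseudofunctor' "prodB B B" B "tensor M"
  by (simp add: pseudofunctor'_def tensor prod_bicat bicategory_axioms)

section \<open>Components of the braiding and the syllepsis\<close>

context braided
begin

abbreviation T0 where "T0 \<equiv> F0 (tensor M)"
abbreviation T1 where "T1 \<equiv> F1 (tensor M)"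
abbreviation T2 where "T2 \<equiv> F2 (tensor M)"
abbreviation Tc where "Tc \<equiv> Fc (tensor M)"
abbreviation Tu where "Tu \<equiv> Fu (tensor M)"

definition be where "be = t1 (br M)"
definition bt where "bt = t2 (br M)"

lemma swap_conv [simp]: "prod.swap p = (snd p, fst p)"
  by (simp add: prod.swap_def)

lemma pair_iff [simp]: "f \<in> arr1 B \<times> arr1 B \<longleftrightarrow> fst f \<in> arr1 B \<and> snd f \<in> arr1 B"
  "u \<in> arr2 B \<times> arr2 B \<longleftrightarrow> fst u \<in> arr2 B \<and> snd u \<in> arr2 B"
  "y \<in> obj B \<times> obj B \<longleftrightarrow> fst y \<in> obj B \<and> snd y \<in> obj B"
  by (simp_all add: mem_Times_iff)

lemma br_natural: "pseudonatural B2 B (P1of2 \<Otimes> P2of2) (P2of2 \<Otimes> P1of2) (br M)"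
  using br_equiv by (auto simp: adjoint_equivalence_def)

lemma be_simps [simp]:
  assumes "a \<in> obj B" "b \<in> obj B"
  shows "be (a, b) \<in> arr1 B" "src B (be (a, b)) = T0 (a, b)" "trg B (be (a, b)) = T0 (b, a)"
  using pseudonatural.t1_hom[OF br_natural, of "(a, b)"] assms
  by (simp_all add: be_def hom1_def compF_def pairF_def strictF_def)

lemma bt_simps [simp]:
  assumes "h \<in> arr1 B" "k \<in> arr1 B"
  shows "isoc (bt (h, k))" "bt (h, k) \<in> arr2 B"
    "dom2 B (bt (h, k)) = cmp1 B (T1 (k, h)) (be (src B h, src B k))"
    "cod2 B (bt (h, k)) = cmp1 B (be (trg B h, trg B k)) (T1 (h, k))"
  using pseudonatural.t2_iso[OF br_natural, of "(h, k)" "(src B h, src B k)" "(trg B h, trg B k)"] assms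
  by (simp_all add: be_def bt_def hom1_def compF_def pairF_def strictF_def iso2_iff isoc_arr2)

lemma bt_nat:
  assumes "p \<in> arr2 B" "q \<in> arr2 B"
  shows "vc B (bt (cod2 B p, cod2 B q)) (hc B (T2 (q, p)) (id2 B (be (src B (dom2 B p), src B (dom2 B q)))))
    = vc B (hc B (id2 B (be (trg B (dom2 B p), trg B (dom2 B q)))) (T2 (p, q))) (bt (dom2 B p, dom2 B q))"
  using pseudonatural.t2_nat[OF br_natural, of "(dom2 B p, dom2 B q)" "(src B (dom2 B p), src B (dom2 B q))"
      "(trg B (dom2 B p), trg B (dom2 B q))" "(p, q)" "(cod2 B p, cod2 B q)"] assms
  by (simp add: be_def bt_def hom1_def hom2_def compF_def pairF_def strictF_def)

lemma T2_id_pair [simp]: "\<lbrakk>f \<in> arr1 B; g \<in> arr1 B\<rbrakk> \<Longrightarrow> T2 (id2 B f, id2 B g) = id2 B (T1 (f, g))"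
  using T.F2_id[of "(f, g)"] by simp

lemma bt_cmp:
  assumes "f \<in> arr1 B" "g \<in> arr1 B" "trg B f = src B g" "f' \<in> arr1 B" "g' \<in> arr1 B" "trg B f' = src B g'"
  shows "vc B (bt (cmp1 B g f, cmp1 B g' f')) (hc B (Tc (g', g) (f', f)) (id2 B (be (src B f, src B f'))))
    = vc B (hc B (id2 B (be (trg B g, trg B g'))) (Tc (g, g') (f, f')))
        (vc B (asc B (be (trg B g, trg B g')) (T1 (g, g')) (T1 (f, f')))
        (vc B (hc B (bt (g, g')) (id2 B (T1 (f, f'))))
        (vc B (inv2 B (asc B (T1 (g', g)) (be (src B g, src B g')) (T1 (f, f'))))
        (vc B (hc B (id2 B (T1 (g', g))) (bt (f, f')))
          (asc B (T1 (g', g)) (T1 (f', f)) (be (src B f, src B f')))))))"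
  using pseudonatural.t2_cmp[OF br_natural, of "(f, f')" "(src B f, src B f')" "(trg B f, trg B f')" "(g, g')" "(trg B g, trg B g')"] assms
  by (simp add: be_def[symmetric] bt_def[symmetric] hom1_def compF_def pairF_def strictF_def)

lemma bt_id:
  assumes "a \<in> obj B" "b \<in> obj B"
  shows "vc B (bt (id1 B a, id1 B b)) (hc B (Tu (b, a)) (id2 B (be (a, b))))
    = vc B (hc B (id2 B (be (a, b))) (Tu (a, b))) (vc B (inv2 B (run B (be (a, b)))) (lun B (be (a, b))))"
  using pseudonatural.t2_id[OF br_natural, of "(a, b)"] assms
  by (simp add: be_def[symmetric] bt_def[symmetric] compF_def pairF_def strictF_def)

lemma syl_simps [simp]:
  assumes "a \<in> obj B" "b \<in> obj B"
  shows "isoc (sylM M (a, b))" "sylM M (a, b) \<in> arr2 B" "dom2 B (sylM M (a, b)) = id1 B (T0 (a, b))"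
    "cod2 B (sylM M (a, b)) = cmp1 B (be (b, a)) (be (a, b))"
proof -
  have "\<forall>y\<in>obj B2. sylM M y \<in> iso2 B (id1 B (T0 (fst y, snd y))) (cmp1 B (be (snd y, fst y)) (be y))"
    using syl_modification
    by (simp add: invertible_modification_def Let_def vcT_def whiskR_def idT_def compF_def pairF_def strictF_def be_def)
  then show "isoc (sylM M (a, b))" "sylM M (a, b) \<in> arr2 B" "dom2 B (sylM M (a, b)) = id1 B (T0 (a, b))"
    "cod2 B (sylM M (a, b)) = cmp1 B (be (b, a)) (be (a, b))"
    using assms by (auto simp: iso2_iff isoc_arr2)
qed

lemma syl_natural:
  assumes [simp]: "h \<in> arr1 B" "k \<in> arr1 B"
  defines "y \<equiv> (src B h, src B k)" and "sy \<equiv> (src B k, src B h)" and "z \<equiv> (trg B h, trg B k)" and "sz \<equiv> (trg B k, trg B h)"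
  shows "vc B (hc B (sylM M z) (id2 B (T1 (h, k)))) (vc B (inv2 B (lun B (T1 (h, k)))) (run B (T1 (h, k))))
    = vc B (vc B (inv2 B (asc B (be sz) (be z) (T1 (h, k)))) (vc B (hc B (id2 B (be sz)) (bt (h, k)))
       (vc B (asc B (be sz) (T1 (k, h)) (be y)) (vc B (hc B (bt (k, h)) (id2 B (be y))) (inv2 B (asc B (T1 (h, k)) (be sy) (be y)))))))
      (hc B (id2 B (T1 (h, k))) (sylM M y))"
proof -
  have t: "tsrc (br M) = P1of2 \<Otimes> P2of2" "ttrg (br M) = P2of2 \<Otimes> P1of2"
    using pseudonatural.tsrc[OF br_natural] pseudonatural.ttrg[OF br_natural] .
  have "(h, k) \<in> hom1 B2 y z" by (simp add: hom1_def y_def z_def)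
  with syl_modification show ?thesis
    unfolding invertible_modification_def Let_def
    by (force simp: vcT_def whiskR_def idT_def compF_def pairF_def strictF_def be_def[symmetric] bt_def[symmetric] t Let_def
        y_def sy_def z_def sz_def hom1_def)
qed

text \<open>This is \<open>symmetry_axiom\<close> with its two pastings evaluated. The empty paths
  contribute unitors, and naturality of the unitors removes those that surround a whole
  step.\<close>

lemma syl_symmetric:
  assumes [simp]: "a \<in> obj B" "b \<in> obj B"
  shows "vc B (hc B (id2 B (be (a, b))) (sylM M (a, b))) (inv2 B (run B (be (a, b))))
    = vc B (asc B (be (a, b)) (be (b, a)) (be (a, b))) (vc B (hc B (sylM M (b, a)) (id2 B (be (a, b)))) (inv2 B (lun B (be (a, b)))))"
proof -
  let ?s = "sylM M (a, b)" and ?s' = "sylM M (b, a)" and ?p = "be (a, b)" and ?q = "be (b, a)"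
  let ?e = "id1 B (T0 (a, b))"
  have j: "join B (T0 (a, b)) [?q, ?p] [] = run B (cmp1 B ?q ?p)"
    using run_cmp1[of ?p ?q] by simp
  have "vc B (run B (cmp1 B ?q ?p)) (hc B ?s (id2 B ?e)) = vc B ?s (run B ?e)"
    using run_nat'[of ?s] by simp
  from vc_inv_right[OF this]
  have 1: "vc B (run B (cmp1 B ?q ?p)) (vc B (hc B ?s (id2 B ?e)) (inv2 B (run B ?e))) = ?s" by simp
  have L: "pstep B (T0 (a, b)) ([?p], PCell (T0 (a, b)) [] [?q, ?p] ?s, []) = vc B (hc B (id2 B ?p) ?s) (inv2 B (run B ?p))"
    using 1 by (simp add: pstep_def Let_def j lun_id1_eq_run_id1 del: join.simps(4))
  let ?u = "vc B (asc B ?p ?q ?p) (vc B (hc B ?s' (id2 B ?p)) (inv2 B (lun B ?p)))"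
  have "vc B (lun B (cmp1 B ?p (cmp1 B ?q ?p))) (hc B (id2 B (id1 B (T0 (b, a)))) ?u) = vc B ?u (lun B ?p)"
    using lun_nat'[of ?u] by simp
  from vc_inv_right[OF this]
  have 2: "vc B (lun B (cmp1 B ?p (cmp1 B ?q ?p))) (vc B (hc B (id2 B (id1 B (T0 (b, a)))) ?u) (inv2 B (lun B ?p))) = ?u" by simp
  have R: "pstep B (T0 (a, b)) ([], PCell (T0 (b, a)) [] [?p, ?q] ?s', [?p]) = ?u"
    using 2 by (simp add: pstep_def Let_def)
  show ?thesis
    using symmetry[OF assms] L R
    by (simp add: symmetry_axiom_def commutes_def paste_def Syl_def be_def[symmetric])
qed

section \<open>The braiding and the syllepsis acting on an object of \<open>Q\<close>\<close>

definition Nb where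
  "Nb X h k = io Q X (be (trg B h, trg B k)) (T1 (h, k)) \<odot> X \<cdot>\<^sub>2 bt (h, k) \<odot> inv (io Q X (T1 (k, h)) (be (src B h, src B k)))"

definition syb where
  "syb X a b = io Q X (be (b, a)) (be (a, b)) \<odot> X \<cdot>\<^sub>2 sylM M (a, b) \<odot> inv (un Q X)"

lemma Nb_simps [simp]:
  assumes "X \<in> Ob Q" "h \<in> arr1 B" "k \<in> arr1 B" "bs Q X = T0 (trg B k, trg B h)"
  shows "iso (Nb X h k)" "Nb X h k \<in> Ar Q" "dm Q (Nb X h k) = X \<cdot> T1 (k, h) \<cdot> be (src B h, src B k)"
    "cd Q (Nb X h k) = X \<cdot> be (trg B h, trg B k) \<cdot> T1 (h, k)"
  using assms by (simp_all add: Nb_def)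

lemma syb_simps [simp]:
  assumes "X \<in> Ob Q" "a \<in> obj B" "b \<in> obj B" "bs Q X = T0 (a, b)"
  shows "iso (syb X a b)" "syb X a b \<in> Ar Q" "dm Q (syb X a b) = X" "cd Q (syb X a b) = X \<cdot> be (b, a) \<cdot> be (a, b)"
  using assms by (simp_all add: syb_def)

lemma Nb_nat:
  assumes [simp]: "u \<in> Ar Q" "h \<in> arr1 B" "k \<in> arr1 B" "bs Q (dm Q u) = T0 (trg B k, trg B h)"
  shows "Nb (cd Q u) h k \<odot> u \<cdot>\<^sub>1 T1 (k, h) \<cdot>\<^sub>1 be (src B h, src B k) = u \<cdot>\<^sub>1 be (trg B h, trg B k) \<cdot>\<^sub>1 T1 (h, k) \<odot> Nb (dm Q u) h k"
proof -
  let ?b = "be (src B h, src B k)" and ?b' = "be (trg B h, trg B k)" and ?X = "dm Q u" and ?Y = "cd Q u"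
  have 1: "inv (io Q ?Y (T1 (k, h)) ?b) \<odot> u \<cdot>\<^sub>1 T1 (k, h) \<cdot>\<^sub>1 ?b = u \<cdot>\<^sub>1 cmp1 B (T1 (k, h)) ?b \<odot> inv (io Q ?X (T1 (k, h)) ?b)"
    by (rule inP_swap) (use io_nat[of u ?b "T1 (k, h)"] in simp_all)
  have 2: "?Y \<cdot>\<^sub>2 bt (h, k) \<odot> u \<cdot>\<^sub>1 cmp1 B (T1 (k, h)) ?b = u \<cdot>\<^sub>1 cmp1 B ?b' (T1 (h, k)) \<odot> ?X \<cdot>\<^sub>2 bt (h, k)"
    using nat[of u "bt (h, k)"] by simp
  have 3: "io Q ?Y ?b' (T1 (h, k)) \<odot> u \<cdot>\<^sub>1 cmp1 B ?b' (T1 (h, k)) = u \<cdot>\<^sub>1 ?b' \<cdot>\<^sub>1 T1 (h, k) \<odot> io Q ?X ?b' (T1 (h, k))"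
    using io_nat[of u "T1 (h, k)" ?b'] by simp
  have "Nb ?Y h k \<odot> u \<cdot>\<^sub>1 T1 (k, h) \<cdot>\<^sub>1 ?b = io Q ?Y ?b' (T1 (h, k)) \<odot> ?Y \<cdot>\<^sub>2 bt (h, k) \<odot> (inv (io Q ?Y (T1 (k, h)) ?b) \<odot> u \<cdot>\<^sub>1 T1 (k, h) \<cdot>\<^sub>1 ?b)"
    by (simp add: Nb_def)
  also have "\<dots> = io Q ?Y ?b' (T1 (h, k)) \<odot> (?Y \<cdot>\<^sub>2 bt (h, k) \<odot> u \<cdot>\<^sub>1 cmp1 B (T1 (k, h)) ?b) \<odot> inv (io Q ?X (T1 (k, h)) ?b)"
    unfolding 1 by simp
  also have "\<dots> = (io Q ?Y ?b' (T1 (h, k)) \<odot> u \<cdot>\<^sub>1 cmp1 B ?b' (T1 (h, k))) \<odot> ?X \<cdot>\<^sub>2 bt (h, k) \<odot> inv (io Q ?X (T1 (k, h)) ?b)"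
    unfolding 2 by simp
  also have "\<dots> = u \<cdot>\<^sub>1 ?b' \<cdot>\<^sub>1 T1 (h, k) \<odot> Nb ?X h k"
    unfolding 3 by (simp add: Nb_def)
  finally show ?thesis .
qed

lemma Nb_cell:
  assumes [simp]: "X \<in> Ob Q" "p \<in> arr2 B" "q \<in> arr2 B" "bs Q X = T0 (trg B (dom2 B q), trg B (dom2 B p))"
  shows "Nb X (cod2 B p) (cod2 B q) \<odot> (X \<cdot>\<^sub>2 T2 (q, p)) \<cdot>\<^sub>1 be (src B (dom2 B p), src B (dom2 B q))
    = (X \<cdot> be (trg B (dom2 B p), trg B (dom2 B q))) \<cdot>\<^sub>2 T2 (p, q) \<odot> Nb X (dom2 B p) (dom2 B q)"
proof -
  let ?h = "dom2 B p" and ?h' = "cod2 B p" and ?k = "dom2 B q" and ?k' = "cod2 B q"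
  let ?b = "be (src B ?h, src B ?k)" and ?b' = "be (trg B ?h, trg B ?k)"
  have 1: "inv (io Q X (T1 (?k', ?h')) ?b) \<odot> (X \<cdot>\<^sub>2 T2 (q, p)) \<cdot>\<^sub>1 ?b = X \<cdot>\<^sub>2 hc B (T2 (q, p)) (id2 B ?b) \<odot> inv (io Q X (T1 (?k, ?h)) ?b)"
    by (rule inP_swap) (use io_hc[of X "id2 B ?b" "T2 (q, p)"] in simp_all)
  have 2: "X \<cdot>\<^sub>2 bt (?h', ?k') \<odot> X \<cdot>\<^sub>2 hc B (T2 (q, p)) (id2 B ?b) = X \<cdot>\<^sub>2 hc B (id2 B ?b') (T2 (p, q)) \<odot> X \<cdot>\<^sub>2 bt (?h, ?k)"
    using bt_nat[of p q] by (simp flip: a2_vc)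
  have 3: "io Q X ?b' (T1 (?h', ?k')) \<odot> X \<cdot>\<^sub>2 hc B (id2 B ?b') (T2 (p, q)) = (X \<cdot> ?b') \<cdot>\<^sub>2 T2 (p, q) \<odot> io Q X ?b' (T1 (?h, ?k))"
    using io_hc[of X "T2 (p, q)" "id2 B ?b'"] by simp
  have "Nb X ?h' ?k' \<odot> (X \<cdot>\<^sub>2 T2 (q, p)) \<cdot>\<^sub>1 ?b = io Q X ?b' (T1 (?h', ?k')) \<odot> X \<cdot>\<^sub>2 bt (?h', ?k') \<odot> (inv (io Q X (T1 (?k', ?h')) ?b) \<odot> (X \<cdot>\<^sub>2 T2 (q, p)) \<cdot>\<^sub>1 ?b)"
    by (simp add: Nb_def)
  also have "\<dots> = io Q X ?b' (T1 (?h', ?k')) \<odot> (X \<cdot>\<^sub>2 bt (?h', ?k') \<odot> X \<cdot>\<^sub>2 hc B (T2 (q, p)) (id2 B ?b)) \<odot> inv (io Q X (T1 (?k, ?h)) ?b)"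
    unfolding 1 by simp
  also have "\<dots> = (io Q X ?b' (T1 (?h', ?k')) \<odot> X \<cdot>\<^sub>2 hc B (id2 B ?b') (T2 (p, q))) \<odot> X \<cdot>\<^sub>2 bt (?h, ?k) \<odot> inv (io Q X (T1 (?k, ?h)) ?b)"
    unfolding 2 by simp
  also have "\<dots> = (X \<cdot> ?b') \<cdot>\<^sub>2 T2 (p, q) \<odot> Nb X ?h ?k"
    unfolding 3 by (simp add: Nb_def)
  finally show ?thesis .
qed

lemma Tc_simps_pair [simp]:
  assumes "f \<in> arr1 B" "g \<in> arr1 B" "trg B f = src B g" "f' \<in> arr1 B" "g' \<in> arr1 B" "trg B f' = src B g'"
  shows "isoc (Tc (g, g') (f, f'))" "Tc (g, g') (f, f') \<in> arr2 B"
    "dom2 B (Tc (g, g') (f, f')) = cmp1 B (T1 (g, g')) (T1 (f, f'))" "cod2 B (Tc (g, g') (f, f')) = T1 (cmp1 B g f, cmp1 B g' f')"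
  using T.Fc_simps[of "(f, f')" "(g, g')"] assms by simp_all

text \<open>The compatibility \<open>bt_cmp\<close> of the braiding with composition, transported to
  the action on \<open>X\<close>: each cell of that pasting is pushed through \<open>io\<close> by
  \<open>io_hc\<close>, and \<open>io_asc\<close> accounts for the associators.\<close>

lemma Nb_cmp:
  assumes [simp]: "X \<in> Ob Q" "f \<in> arr1 B" "g \<in> arr1 B" "trg B f = src B g" "f' \<in> arr1 B" "g' \<in> arr1 B" "trg B f' = src B g'"
    "bs Q X = T0 (trg B g', trg B g)"
  defines "b0 \<equiv> be (src B f, src B f')" and "b1 \<equiv> be (src B g, src B g')" and "b2 \<equiv> be (trg B g, trg B g')"
  shows "Nb X g g' \<cdot>\<^sub>1 T1 (f, f') \<odot> Nb (X \<cdot> T1 (g', g)) f f' \<odot> io Q X (T1 (g', g)) (T1 (f', f)) \<cdot>\<^sub>1 b0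
    = io Q (X \<cdot> b2) (T1 (g, g')) (T1 (f, f')) \<odot> (X \<cdot> b2) \<cdot>\<^sub>2 inv2 B (Tc (g, g') (f, f')) \<odot> Nb X (cmp1 B g f) (cmp1 B g' f')
       \<odot> (X \<cdot>\<^sub>2 Tc (g', g) (f', f)) \<cdot>\<^sub>1 b0"
proof -
  have b [simp]: "b0 \<in> arr1 B" "src B b0 = T0 (src B f, src B f')" "trg B b0 = T0 (src B f', src B f)"
    "b1 \<in> arr1 B" "src B b1 = T0 (src B g, src B g')" "trg B b1 = T0 (src B g', src B g)"
    "b2 \<in> arr1 B" "src B b2 = T0 (trg B g, trg B g')" "trg B b2 = T0 (trg B g', trg B g)"
    by (simp_all add: b0_def b1_def b2_def)
  define G F SG SF where "G = T1 (g, g')" and "F = T1 (f, f')" and "SG = T1 (g', g)" and "SF = T1 (f', f)"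
  have t [simp]: "G \<in> arr1 B" "src B G = T0 (src B g, src B g')" "trg B G = T0 (trg B g, trg B g')"
    "F \<in> arr1 B" "src B F = T0 (src B f, src B f')" "trg B F = T0 (src B g, src B g')"
    "SG \<in> arr1 B" "src B SG = T0 (src B g', src B g)" "trg B SG = T0 (trg B g', trg B g)"
    "SF \<in> arr1 B" "src B SF = T0 (src B f', src B f)" "trg B SF = T0 (src B g', src B g)"
    by (simp_all add: G_def F_def SG_def SF_def)
  define TF where "TF = T1 (cmp1 B g f, cmp1 B g' f')"
  define TS where "TS = T1 (cmp1 B g' f', cmp1 B g f)"
  have u [simp]: "TF \<in> arr1 B" "src B TF = T0 (src B f, src B f')" "trg B TF = T0 (trg B g, trg B g')"
    "TS \<in> arr1 B" "src B TS = T0 (src B f', src B f)" "trg B TS = T0 (trg B g', trg B g)"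
    by (simp_all add: TF_def TS_def)
  define C C' where "C = Tc (g, g') (f, f')" and "C' = Tc (g', g) (f', f)"
  have c [simp]: "isoc C" "C \<in> arr2 B" "dom2 B C = cmp1 B G F" "cod2 B C = TF"
    "C' \<in> arr2 B" "dom2 B C' = cmp1 B SG SF" "cod2 B C' = TS"
    by (simp_all add: C_def C'_def G_def F_def SG_def SF_def TF_def TS_def)
  define p q r where "p = bt (g, g')" and "q = bt (f, f')" and "r = bt (cmp1 B g f, cmp1 B g' f')"
  have w [simp]: "p \<in> arr2 B" "dom2 B p = cmp1 B SG b1" "cod2 B p = cmp1 B b2 G"
    "q \<in> arr2 B" "dom2 B q = cmp1 B SF b0" "cod2 B q = cmp1 B b1 F"
    "r \<in> arr2 B" "dom2 B r = cmp1 B TS b0" "cod2 B r = cmp1 B b2 TF"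
    by (simp_all add: p_def q_def r_def G_def F_def SG_def SF_def TF_def TS_def b0_def b1_def b2_def)
  have main: "vc B r (hc B C' (id2 B b0)) = vc B (hc B (id2 B b2) C) (vc B (asc B b2 G F) (vc B (hc B p (id2 B F))
     (vc B (inv2 B (asc B SG b1 F)) (vc B (hc B (id2 B SG) q) (asc B SG SF b0)))))"
    using bt_cmp[of f g f' g'] by (simp add: p_def q_def r_def C_def C'_def G_def F_def SG_def SF_def b0_def b1_def b2_def)
  let ?Y = "X \<cdot> SG"
  have N1: "Nb X g g' = io Q X b2 G \<odot> X \<cdot>\<^sub>2 p \<odot> inv (io Q X SG b1)"
    by (simp add: Nb_def p_def G_def SG_def b1_def b2_def)
  have N2: "Nb ?Y f f' = io Q ?Y b1 F \<odot> ?Y \<cdot>\<^sub>2 q \<odot> inv (io Q ?Y SF b0)"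
    by (simp add: Nb_def q_def F_def SF_def b0_def b1_def)
  have N3: "Nb X (cmp1 B g f) (cmp1 B g' f') = io Q X b2 TF \<odot> X \<cdot>\<^sub>2 r \<odot> inv (io Q X TS b0)"
    by (simp add: Nb_def r_def TF_def TS_def b0_def b2_def)
  define J where "J = inv (io Q X (cmp1 B SG SF) b0)"
  have J [simp]: "J \<in> Ar Q" "dm Q J = X \<cdot> cmp1 B SG SF \<cdot> b0" "cd Q J = X \<cdot> cmp1 B (cmp1 B SG SF) b0"
    by (simp_all add: J_def)
  have e1: "inv (io Q X TS b0) \<odot> (X \<cdot>\<^sub>2 C') \<cdot>\<^sub>1 b0 = X \<cdot>\<^sub>2 hc B C' (id2 B b0) \<odot> J"
    unfolding J_def by (rule inP_swap) (use io_hc[of X "id2 B b0" C'] in simp_all)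
  have e2: "io Q X b2 TF \<odot> X \<cdot>\<^sub>2 hc B (id2 B b2) C = (X \<cdot> b2) \<cdot>\<^sub>2 C \<odot> io Q X b2 (cmp1 B G F)"
    using io_hc[of X C "id2 B b2"] by simp
  have e3: "io Q (X \<cdot> b2) G F \<odot> io Q X b2 (cmp1 B G F) \<odot> X \<cdot>\<^sub>2 asc B b2 G F = io Q X b2 G \<cdot>\<^sub>1 F \<odot> io Q X (cmp1 B b2 G) F"
    by (rule io_asc) simp_all
  have e4: "io Q X (cmp1 B b2 G) F \<odot> X \<cdot>\<^sub>2 hc B p (id2 B F) = (X \<cdot>\<^sub>2 p) \<cdot>\<^sub>1 F \<odot> io Q X (cmp1 B SG b1) F"
    using io_hc[of X "id2 B F" p] by simp
  have e5: "io Q X (cmp1 B SG b1) F \<odot> X \<cdot>\<^sub>2 inv2 B (asc B SG b1 F) = inv (io Q X SG b1) \<cdot>\<^sub>1 F \<odot> io Q ?Y b1 F \<odot> io Q X SG (cmp1 B b1 F)"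
  proof -
    have a: "io Q ?Y b1 F \<odot> io Q X SG (cmp1 B b1 F) \<odot> X \<cdot>\<^sub>2 asc B SG b1 F = io Q X SG b1 \<cdot>\<^sub>1 F \<odot> io Q X (cmp1 B SG b1) F"
      by (rule io_asc) simp_all
    have "inv (io Q X SG b1 \<cdot>\<^sub>1 F) \<odot> (io Q ?Y b1 F \<odot> io Q X SG (cmp1 B b1 F)) = io Q X (cmp1 B SG b1) F \<odot> inv (X \<cdot>\<^sub>2 asc B SG b1 F)"
      by (rule inP_swap) (use a in simp_all)
    then show ?thesis by simp
  qed
  have e6: "io Q X SG (cmp1 B b1 F) \<odot> X \<cdot>\<^sub>2 hc B (id2 B SG) q = ?Y \<cdot>\<^sub>2 q \<odot> io Q X SG (cmp1 B SF b0)"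
    using io_hc[of X q "id2 B SG"] by simp
  have e7: "io Q X SG (cmp1 B SF b0) \<odot> X \<cdot>\<^sub>2 asc B SG SF b0 \<odot> J = inv (io Q ?Y SF b0) \<odot> io Q X SG SF \<cdot>\<^sub>1 b0"
  proof -
    have a: "io Q ?Y SF b0 \<odot> io Q X SG (cmp1 B SF b0) \<odot> X \<cdot>\<^sub>2 asc B SG SF b0 = io Q X SG SF \<cdot>\<^sub>1 b0 \<odot> io Q X (cmp1 B SG SF) b0"
      by (rule io_asc) simp_all
    have "inv (io Q ?Y SF b0) \<odot> io Q X SG SF \<cdot>\<^sub>1 b0 = (io Q X SG (cmp1 B SF b0) \<odot> X \<cdot>\<^sub>2 asc B SG SF b0) \<odot> J"
      unfolding J_def by (rule inP_swap) (use a in simp_all)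
    then show ?thesis by simp
  qed
  have s1: "X \<cdot>\<^sub>2 r \<odot> X \<cdot>\<^sub>2 hc B C' (id2 B b0) = X \<cdot>\<^sub>2 hc B (id2 B b2) C \<odot> X \<cdot>\<^sub>2 asc B b2 G F \<odot> X \<cdot>\<^sub>2 hc B p (id2 B F)
     \<odot> X \<cdot>\<^sub>2 inv2 B (asc B SG b1 F) \<odot> X \<cdot>\<^sub>2 hc B (id2 B SG) q \<odot> X \<cdot>\<^sub>2 asc B SG SF b0"
    using arg_cong[OF main, of "a2 Q X"] by (simp add: a2_vc)
  \<comment> \<open>\<open>K5\<close>, \<open>K4\<close> and \<open>K3\<close> are growing tails of
    the pasting; \<open>k5\<close>, \<open>k4\<close> and \<open>k3\<close> rewrite each of them
    together with the \<open>io\<close> that meets it.\<close>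
  define K5 where "K5 = X \<cdot>\<^sub>2 hc B (id2 B SG) q \<odot> X \<cdot>\<^sub>2 asc B SG SF b0 \<odot> J"
  have [simp]: "K5 \<in> Ar Q" "dm Q K5 = X \<cdot> cmp1 B SG SF \<cdot> b0" "cd Q K5 = X \<cdot> cmp1 B SG (cmp1 B b1 F)"
    by (simp_all add: K5_def)
  have k5: "io Q X SG (cmp1 B b1 F) \<odot> K5 = ?Y \<cdot>\<^sub>2 q \<odot> inv (io Q ?Y SF b0) \<odot> io Q X SG SF \<cdot>\<^sub>1 b0"
    using cp_reassoc[OF e6, of "X \<cdot>\<^sub>2 asc B SG SF b0 \<odot> J"] e7 by (simp add: K5_def)
  define K4 where "K4 = X \<cdot>\<^sub>2 inv2 B (asc B SG b1 F) \<odot> K5"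
  have [simp]: "K4 \<in> Ar Q" "dm Q K4 = X \<cdot> cmp1 B SG SF \<cdot> b0" "cd Q K4 = X \<cdot> cmp1 B (cmp1 B SG b1) F"
    by (simp_all add: K4_def)
  have k4: "io Q X (cmp1 B SG b1) F \<odot> K4 = inv (io Q X SG b1) \<cdot>\<^sub>1 F \<odot> Nb ?Y f f' \<odot> io Q X SG SF \<cdot>\<^sub>1 b0"
    using cp_reassoc[OF e5, of K5] k5 by (simp add: K4_def N2)
  define K3 where "K3 = X \<cdot>\<^sub>2 hc B p (id2 B F) \<odot> K4"
  have [simp]: "K3 \<in> Ar Q" "dm Q K3 = X \<cdot> cmp1 B SG SF \<cdot> b0" "cd Q K3 = X \<cdot> cmp1 B (cmp1 B b2 G) F"
    by (simp_all add: K3_def)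
  have [simp]: "Nb ?Y f f' \<in> Ar Q" "dm Q (Nb ?Y f f') = ?Y \<cdot> SF \<cdot> b0" "cd Q (Nb ?Y f f') = ?Y \<cdot> b1 \<cdot> F"
    by (simp_all add: N2)
  have k3: "io Q X b2 G \<cdot>\<^sub>1 F \<odot> io Q X (cmp1 B b2 G) F \<odot> K3 = Nb X g g' \<cdot>\<^sub>1 F \<odot> Nb ?Y f f' \<odot> io Q X SG SF \<cdot>\<^sub>1 b0"
    using cp_reassoc[OF e4, of K4] k4 by (simp add: K3_def N1 am_cp)
  have "io Q (X \<cdot> b2) G F \<odot> (X \<cdot> b2) \<cdot>\<^sub>2 inv2 B C \<odot> Nb X (cmp1 B g f) (cmp1 B g' f') \<odot> (X \<cdot>\<^sub>2 C') \<cdot>\<^sub>1 b0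
    = io Q (X \<cdot> b2) G F \<odot> (X \<cdot> b2) \<cdot>\<^sub>2 inv2 B C \<odot> io Q X b2 TF \<odot> X \<cdot>\<^sub>2 r \<odot> (inv (io Q X TS b0) \<odot> (X \<cdot>\<^sub>2 C') \<cdot>\<^sub>1 b0)"
    by (simp add: N3)
  also have "\<dots> = io Q (X \<cdot> b2) G F \<odot> (X \<cdot> b2) \<cdot>\<^sub>2 inv2 B C \<odot> io Q X b2 TF \<odot> (X \<cdot>\<^sub>2 r \<odot> X \<cdot>\<^sub>2 hc B C' (id2 B b0)) \<odot> J"
    unfolding e1 by simp
  also have "\<dots> = io Q (X \<cdot> b2) G F \<odot> (X \<cdot> b2) \<cdot>\<^sub>2 inv2 B C \<odot> (io Q X b2 TF \<odot> X \<cdot>\<^sub>2 hc B (id2 B b2) C) \<odot> X \<cdot>\<^sub>2 asc B b2 G F \<odot> K3"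
    unfolding s1 by (simp add: K3_def K4_def K5_def)
  also have "\<dots> = io Q (X \<cdot> b2) G F \<odot> inv ((X \<cdot> b2) \<cdot>\<^sub>2 C) \<odot> (X \<cdot> b2) \<cdot>\<^sub>2 C \<odot> io Q X b2 (cmp1 B G F) \<odot> X \<cdot>\<^sub>2 asc B b2 G F \<odot> K3"
    unfolding e2 by simp
  also have "\<dots> = (io Q (X \<cdot> b2) G F \<odot> io Q X b2 (cmp1 B G F) \<odot> X \<cdot>\<^sub>2 asc B b2 G F) \<odot> K3"
    by (simp del: iso_a2(2))
  also have "\<dots> = Nb X g g' \<cdot>\<^sub>1 F \<odot> Nb ?Y f f' \<odot> io Q X SG SF \<cdot>\<^sub>1 b0"
    unfolding e3 using k3 by simp
  finally show ?thesis by (simp add: G_def F_def SG_def SF_def C_def C'_def)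
qed

lemma Nb_un:
  assumes [simp]: "X \<in> Ob Q" "a \<in> obj B" "b \<in> obj B" "bs Q X = T0 (b, a)"
  shows "Nb X (id1 B a) (id1 B b) \<odot> (X \<cdot>\<^sub>2 Tu (b, a)) \<cdot>\<^sub>1 be (a, b)
    = (X \<cdot> be (a, b)) \<cdot>\<^sub>2 Tu (a, b) \<odot> inv (un Q (X \<cdot> be (a, b))) \<odot> un Q X \<cdot>\<^sub>1 be (a, b)"
proof -
  let ?b = "be (a, b)" and ?i = "id1 B (T0 (b, a))" and ?j = "id1 B (T0 (a, b))"
  have [simp]: "Tu (b, a) \<in> arr2 B" "dom2 B (Tu (b, a)) = ?i" "cod2 B (Tu (b, a)) = T1 (id1 B b, id1 B a)"
    "Tu (a, b) \<in> arr2 B" "dom2 B (Tu (a, b)) = ?j" "cod2 B (Tu (a, b)) = T1 (id1 B a, id1 B b)"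
    using T.Fu_simps[of "(b, a)"] T.Fu_simps[of "(a, b)"] by simp_all
  let ?t = "bt (id1 B a, id1 B b)"
  have e1: "inv (io Q X (T1 (id1 B b, id1 B a)) ?b) \<odot> (X \<cdot>\<^sub>2 Tu (b, a)) \<cdot>\<^sub>1 ?b = X \<cdot>\<^sub>2 hc B (Tu (b, a)) (id2 B ?b) \<odot> inv (io Q X ?i ?b)"
    by (rule inP_swap) (use io_hc[of X "id2 B ?b" "Tu (b, a)"] in simp_all)
  have e2: "X \<cdot>\<^sub>2 ?t \<odot> X \<cdot>\<^sub>2 hc B (Tu (b, a)) (id2 B ?b) = X \<cdot>\<^sub>2 hc B (id2 B ?b) (Tu (a, b)) \<odot> X \<cdot>\<^sub>2 inv2 B (run B ?b) \<odot> X \<cdot>\<^sub>2 lun B ?b"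
    using arg_cong[OF bt_id[of a b], of "a2 Q X"] by (simp add: a2_vc)
  have e3: "io Q X ?b (T1 (id1 B a, id1 B b)) \<odot> X \<cdot>\<^sub>2 hc B (id2 B ?b) (Tu (a, b)) = (X \<cdot> ?b) \<cdot>\<^sub>2 Tu (a, b) \<odot> io Q X ?b ?j"
    using io_hc[of X "Tu (a, b)" "id2 B ?b"] by simp
  have e4: "X \<cdot>\<^sub>2 lun B ?b \<odot> inv (io Q X ?i ?b) = un Q X \<cdot>\<^sub>1 ?b"
    by (rule cp_inv_right) (use un_lun[of X ?b] in simp_all)
  have e5: "inv (un Q (X \<cdot> ?b)) \<odot> X \<cdot>\<^sub>2 run B ?b = io Q X ?b ?j"
    using arg_cong[OF un_run[of X ?b], of "\<lambda>u. inv (un Q (X \<cdot> ?b)) \<odot> u"] by simp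
  have e5: "io Q X ?b ?j \<odot> X \<cdot>\<^sub>2 inv2 B (run B ?b) = inv (un Q (X \<cdot> ?b))"
    using cp_inv_right[OF e5[symmetric]] by simp
  have "Nb X (id1 B a) (id1 B b) \<odot> (X \<cdot>\<^sub>2 Tu (b, a)) \<cdot>\<^sub>1 ?b
    = io Q X ?b (T1 (id1 B a, id1 B b)) \<odot> X \<cdot>\<^sub>2 ?t \<odot> (inv (io Q X (T1 (id1 B b, id1 B a)) ?b) \<odot> (X \<cdot>\<^sub>2 Tu (b, a)) \<cdot>\<^sub>1 ?b)"
    by (simp add: Nb_def)
  also have "\<dots> = io Q X ?b (T1 (id1 B a, id1 B b)) \<odot> (X \<cdot>\<^sub>2 ?t \<odot> X \<cdot>\<^sub>2 hc B (Tu (b, a)) (id2 B ?b)) \<odot> inv (io Q X ?i ?b)"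
    unfolding e1 by simp
  also have "\<dots> = (io Q X ?b (T1 (id1 B a, id1 B b)) \<odot> X \<cdot>\<^sub>2 hc B (id2 B ?b) (Tu (a, b))) \<odot> X \<cdot>\<^sub>2 inv2 B (run B ?b) \<odot> (X \<cdot>\<^sub>2 lun B ?b \<odot> inv (io Q X ?i ?b))"
    unfolding e2 by simp
  also have "\<dots> = (X \<cdot> ?b) \<cdot>\<^sub>2 Tu (a, b) \<odot> (io Q X ?b ?j \<odot> X \<cdot>\<^sub>2 inv2 B (run B ?b)) \<odot> un Q X \<cdot>\<^sub>1 ?b"
    unfolding e3 e4 by simp
  finally show ?thesis unfolding e5 .
qed

lemma syb_nat:
  assumes [simp]: "u \<in> Ar Q" "a \<in> obj B" "b \<in> obj B" "bs Q (dm Q u) = T0 (a, b)"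
  shows "syb (cd Q u) a b \<odot> u = u \<cdot>\<^sub>1 be (b, a) \<cdot>\<^sub>1 be (a, b) \<odot> syb (dm Q u) a b"
proof -
  let ?p = "be (a, b)" and ?q = "be (b, a)" and ?X = "dm Q u" and ?Y = "cd Q u" and ?s = "sylM M (a, b)"
  let ?i = "id1 B (T0 (a, b))"
  have 1: "inv (un Q ?Y) \<odot> u = u \<cdot>\<^sub>1 ?i \<odot> inv (un Q ?X)"
    by (rule inP_swap) (use un_nat[of u] in simp_all)
  have 2: "?Y \<cdot>\<^sub>2 ?s \<odot> u \<cdot>\<^sub>1 ?i = u \<cdot>\<^sub>1 cmp1 B ?q ?p \<odot> ?X \<cdot>\<^sub>2 ?s"
    using nat[of u ?s] by simp
  have 3: "io Q ?Y ?q ?p \<odot> u \<cdot>\<^sub>1 cmp1 B ?q ?p = u \<cdot>\<^sub>1 ?q \<cdot>\<^sub>1 ?p \<odot> io Q ?X ?q ?p"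
    using io_nat[of u ?p ?q] by simp
  show ?thesis
    using cp_reassoc[OF 2, of "inv (un Q ?X)"] cp_reassoc[OF 3, of "?X \<cdot>\<^sub>2 ?s \<odot> inv (un Q ?X)"] by (simp add: syb_def 1)
qed

text \<open>The symmetry axiom transported to the action on \<open>X\<close>. It supplies the law
  \<open>sy_sg\<close>, on which the strict involution depends.\<close>

lemma syb_be:
  assumes [simp]: "X \<in> Ob Q" "a \<in> obj B" "b \<in> obj B" "bs Q X = T0 (b, a)"
  shows "syb (X \<cdot> be (a, b)) a b = syb X b a \<cdot>\<^sub>1 be (a, b)"
proof -
  let ?p = "be (a, b)" and ?q = "be (b, a)" and ?s = "sylM M (a, b)" and ?s' = "sylM M (b, a)"
  let ?i = "id1 B (T0 (a, b))" and ?j = "id1 B (T0 (b, a))"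
  have 1: "inv (un Q (X \<cdot> ?p)) = io Q X ?p ?i \<odot> X \<cdot>\<^sub>2 inv2 B (run B ?p)"
  proof -
    have "inv (un Q (X \<cdot> ?p)) \<odot> X \<cdot>\<^sub>2 run B ?p = io Q X ?p ?i"
      using arg_cong[OF un_run[of X ?p], of "\<lambda>u. inv (un Q (X \<cdot> ?p)) \<odot> u"] by simp
    from cp_inv_right[OF this[symmetric]] show ?thesis by simp
  qed
  have 2: "(X \<cdot> ?p) \<cdot>\<^sub>2 ?s \<odot> io Q X ?p ?i = io Q X ?p (cmp1 B ?q ?p) \<odot> X \<cdot>\<^sub>2 hc B (id2 B ?p) ?s"
    using io_hc[of X ?s "id2 B ?p"] by simp
  have 3: "X \<cdot>\<^sub>2 hc B (id2 B ?p) ?s \<odot> X \<cdot>\<^sub>2 inv2 B (run B ?p) = X \<cdot>\<^sub>2 asc B ?p ?q ?p \<odot> X \<cdot>\<^sub>2 hc B ?s' (id2 B ?p) \<odot> X \<cdot>\<^sub>2 inv2 B (lun B ?p)"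
    using arg_cong[OF syl_symmetric[of a b], of "a2 Q X"] by (simp add: a2_vc)
  have 4: "io Q (X \<cdot> ?p) ?q ?p \<odot> io Q X ?p (cmp1 B ?q ?p) \<odot> X \<cdot>\<^sub>2 asc B ?p ?q ?p = io Q X ?p ?q \<cdot>\<^sub>1 ?p \<odot> io Q X (cmp1 B ?p ?q) ?p"
    by (rule io_asc) simp_all
  have 5: "io Q X (cmp1 B ?p ?q) ?p \<odot> X \<cdot>\<^sub>2 hc B ?s' (id2 B ?p) = (X \<cdot>\<^sub>2 ?s') \<cdot>\<^sub>1 ?p \<odot> io Q X ?j ?p"
    using io_hc[of X "id2 B ?p" ?s'] by simp
  have 6: "io Q X ?j ?p \<odot> X \<cdot>\<^sub>2 inv2 B (lun B ?p) = inv (un Q X) \<cdot>\<^sub>1 ?p"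
  proof -
    have "inv (un Q X \<cdot>\<^sub>1 ?p) \<odot> X \<cdot>\<^sub>2 lun B ?p = io Q X ?j ?p"
      using arg_cong[OF un_lun[of X ?p], of "\<lambda>u. inv (un Q X \<cdot>\<^sub>1 ?p) \<odot> u"] by (simp del: iso_am(2))
    from cp_inv_right[OF this[symmetric]] show ?thesis by simp
  qed
  have "syb (X \<cdot> ?p) a b = io Q (X \<cdot> ?p) ?q ?p \<odot> ((X \<cdot> ?p) \<cdot>\<^sub>2 ?s \<odot> io Q X ?p ?i) \<odot> X \<cdot>\<^sub>2 inv2 B (run B ?p)"
    by (simp add: syb_def 1)
  also have "\<dots> = io Q (X \<cdot> ?p) ?q ?p \<odot> io Q X ?p (cmp1 B ?q ?p) \<odot> (X \<cdot>\<^sub>2 hc B (id2 B ?p) ?s \<odot> X \<cdot>\<^sub>2 inv2 B (run B ?p))"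
    unfolding 2 by simp
  also have "\<dots> = (io Q (X \<cdot> ?p) ?q ?p \<odot> io Q X ?p (cmp1 B ?q ?p) \<odot> X \<cdot>\<^sub>2 asc B ?p ?q ?p) \<odot> X \<cdot>\<^sub>2 hc B ?s' (id2 B ?p) \<odot> X \<cdot>\<^sub>2 inv2 B (lun B ?p)"
    unfolding 3 by simp
  also have "\<dots> = io Q X ?p ?q \<cdot>\<^sub>1 ?p \<odot> (io Q X (cmp1 B ?p ?q) ?p \<odot> X \<cdot>\<^sub>2 hc B ?s' (id2 B ?p)) \<odot> X \<cdot>\<^sub>2 inv2 B (lun B ?p)"
    unfolding 4 by simp
  also have "\<dots> = io Q X ?p ?q \<cdot>\<^sub>1 ?p \<odot> (X \<cdot>\<^sub>2 ?s') \<cdot>\<^sub>1 ?p \<odot> (io Q X ?j ?p \<odot> X \<cdot>\<^sub>2 inv2 B (lun B ?p))"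
    unfolding 5 by simp
  also have "\<dots> = syb X b a \<cdot>\<^sub>1 ?p" unfolding 6 by (simp add: syb_def am_cp)
  finally show ?thesis .
qed

text \<open>The modification law of the syllepsis transported to the action on \<open>X\<close>; it
  supplies \<open>sy_nu\<close>.\<close>

lemma syb_Nb:
  assumes [simp]: "X \<in> Ob Q" "h \<in> arr1 B" "k \<in> arr1 B" "bs Q X = T0 (trg B h, trg B k)"
  shows "Nb (X \<cdot> be (trg B k, trg B h)) h k \<odot> Nb X k h \<cdot>\<^sub>1 be (src B h, src B k) \<odot> syb (X \<cdot> T1 (h, k)) (src B h) (src B k)
    = syb X (trg B h) (trg B k) \<cdot>\<^sub>1 T1 (h, k)"
proof -
  define b c b' c' where "b = be (src B h, src B k)" and "c = be (src B k, src B h)"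
    and "b' = be (trg B h, trg B k)" and "c' = be (trg B k, trg B h)"
  define H K where "H = T1 (h, k)" and "K = T1 (k, h)"
  define y z where "y = T0 (src B h, src B k)" and "z = T0 (trg B h, trg B k)"
  define y' z' where "y' = T0 (src B k, src B h)" and "z' = T0 (trg B k, trg B h)"
  have o [simp]: "y \<in> obj B" "z \<in> obj B" "bs Q X = z" by (simp_all add: y_def z_def)
  have t [simp]: "b \<in> arr1 B" "src B b = y" "trg B b = y'" "c \<in> arr1 B" "src B c = y'" "trg B c = y"
    "b' \<in> arr1 B" "src B b' = z" "trg B b' = z'" "c' \<in> arr1 B" "src B c' = z'" "trg B c' = z"
    "H \<in> arr1 B" "src B H = y" "trg B H = z" "K \<in> arr1 B" "src B K = y'" "trg B K = z'"
    by (simp_all add: b_def c_def b'_def c'_def H_def K_def y_def z_def y'_def z'_def)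
  define p q s s' where "p = bt (h, k)" and "q = bt (k, h)" and "s = sylM M (src B h, src B k)" and "s' = sylM M (trg B h, trg B k)"
  have w [simp]: "p \<in> arr2 B" "dom2 B p = cmp1 B K b" "cod2 B p = cmp1 B b' H"
    "q \<in> arr2 B" "dom2 B q = cmp1 B H c" "cod2 B q = cmp1 B c' K"
    "s \<in> arr2 B" "dom2 B s = id1 B y" "cod2 B s = cmp1 B c b"
    "s' \<in> arr2 B" "dom2 B s' = id1 B z" "cod2 B s' = cmp1 B c' b'"
    by (simp_all add: p_def q_def s_def s'_def b_def c_def b'_def c'_def H_def K_def y_def z_def)
  have main: "vc B (hc B s' (id2 B H)) (vc B (inv2 B (lun B H)) (run B H))
    = vc B (vc B (inv2 B (asc B c' b' H)) (vc B (hc B (id2 B c') p)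
       (vc B (asc B c' K b) (vc B (hc B q (id2 B b)) (inv2 B (asc B H c b)))))) (hc B (id2 B H) s)"
    using syl_natural[of h k] by (simp add: b_def c_def b'_def c'_def H_def K_def p_def q_def s_def s'_def)
  let ?c = "X \<cdot> c'" and ?H = "X \<cdot> H"
  have N1: "Nb ?c h k = io Q ?c b' H \<odot> ?c \<cdot>\<^sub>2 p \<odot> inv (io Q ?c K b)"
    by (simp add: Nb_def p_def H_def K_def b_def b'_def)
  have N2: "Nb X k h = io Q X c' K \<odot> X \<cdot>\<^sub>2 q \<odot> inv (io Q X H c)"
    by (simp add: Nb_def q_def H_def K_def c_def c'_def)
  have S1: "syb ?H (src B h) (src B k) = io Q ?H c b \<odot> ?H \<cdot>\<^sub>2 s \<odot> inv (un Q ?H)"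
    by (simp add: syb_def s_def b_def c_def)
  have S2: "syb X (trg B h) (trg B k) = io Q X c' b' \<odot> X \<cdot>\<^sub>2 s' \<odot> inv (un Q X)"
    by (simp add: syb_def s'_def b'_def c'_def)
  note [simp] = z_def[symmetric]
  have tN [simp]: "Nb ?c h k \<in> Ar Q" "dm Q (Nb ?c h k) = ?c \<cdot> K \<cdot> b" "cd Q (Nb ?c h k) = ?c \<cdot> b' \<cdot> H"
    "Nb X k h \<in> Ar Q" "dm Q (Nb X k h) = ?H \<cdot> c" "cd Q (Nb X k h) = ?c \<cdot> K"
    "iso (un Q X)" "iso (un Q ?H)"
    by (simp_all add: N1 N2)
  define L where "L = inv (X \<cdot>\<^sub>2 run B H)"
  have L [simp]: "L \<in> Ar Q" "dm Q L = ?H" "cd Q L = X \<cdot> cmp1 B H (id1 B y)"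
    by (simp_all add: L_def)
  have e1: "inv (un Q ?H) = io Q X H (id1 B y) \<odot> L"
  proof -
    have "inv (un Q ?H) \<odot> X \<cdot>\<^sub>2 run B H = io Q X H (id1 B y)"
      using arg_cong[OF un_run[of X H], of "\<lambda>u. inv (un Q ?H) \<odot> u"] by simp
    from cp_inv_right[OF this[symmetric]] show ?thesis by (simp add: L_def)
  qed
  have e2: "?H \<cdot>\<^sub>2 s \<odot> io Q X H (id1 B y) = io Q X H (cmp1 B c b) \<odot> X \<cdot>\<^sub>2 hc B (id2 B H) s"
    using io_hc[of X s "id2 B H"] by simp
  have e3: "io Q ?H c b \<odot> io Q X H (cmp1 B c b) = io Q X H c \<cdot>\<^sub>1 b \<odot> io Q X (cmp1 B H c) b \<odot> X \<cdot>\<^sub>2 inv2 B (asc B H c b)"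
  proof -
    have "io Q ?H c b \<odot> io Q X H (cmp1 B c b) \<odot> X \<cdot>\<^sub>2 asc B H c b = io Q X H c \<cdot>\<^sub>1 b \<odot> io Q X (cmp1 B H c) b"
      by (rule io_asc) simp_all
    then have "(io Q X H c \<cdot>\<^sub>1 b \<odot> io Q X (cmp1 B H c) b) \<odot> inv (X \<cdot>\<^sub>2 asc B H c b) = io Q ?H c b \<odot> io Q X H (cmp1 B c b)"
      by (intro cp_inv_right) simp_all
    then show ?thesis by simp
  qed
  have e4: "Nb X k h \<cdot>\<^sub>1 b \<odot> io Q X H c \<cdot>\<^sub>1 b \<odot> io Q X (cmp1 B H c) b = io Q X c' K \<cdot>\<^sub>1 b \<odot> io Q X (cmp1 B c' K) b \<odot> X \<cdot>\<^sub>2 hc B q (id2 B b)"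
  proof -
    have "io Q X (cmp1 B c' K) b \<odot> X \<cdot>\<^sub>2 hc B q (id2 B b) = (X \<cdot>\<^sub>2 q) \<cdot>\<^sub>1 b \<odot> io Q X (cmp1 B H c) b"
      using io_hc[of X "id2 B b" q] by simp
    moreover have "Nb X k h \<cdot>\<^sub>1 b \<odot> io Q X H c \<cdot>\<^sub>1 b = io Q X c' K \<cdot>\<^sub>1 b \<odot> (X \<cdot>\<^sub>2 q) \<cdot>\<^sub>1 b"
      by (simp add: N2 flip: am_cp)
    ultimately show ?thesis using cp_reassoc[of "Nb X k h \<cdot>\<^sub>1 b" "io Q X H c \<cdot>\<^sub>1 b" _ "io Q X (cmp1 B H c) b"] by simp
  qed
  have e5: "io Q X c' K \<cdot>\<^sub>1 b \<odot> io Q X (cmp1 B c' K) b = io Q ?c K b \<odot> io Q X c' (cmp1 B K b) \<odot> X \<cdot>\<^sub>2 asc B c' K b"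
    by (rule io_asc[symmetric]) simp_all
  have e6: "Nb ?c h k \<odot> io Q ?c K b \<odot> io Q X c' (cmp1 B K b) = io Q ?c b' H \<odot> io Q X c' (cmp1 B b' H) \<odot> X \<cdot>\<^sub>2 hc B (id2 B c') p"
    using io_hc[of X p "id2 B c'"] by (simp add: N1)
  have e7: "io Q ?c b' H \<odot> io Q X c' (cmp1 B b' H) = io Q X c' b' \<cdot>\<^sub>1 H \<odot> io Q X (cmp1 B c' b') H \<odot> X \<cdot>\<^sub>2 inv2 B (asc B c' b' H)"
  proof -
    have "io Q ?c b' H \<odot> io Q X c' (cmp1 B b' H) \<odot> X \<cdot>\<^sub>2 asc B c' b' H = io Q X c' b' \<cdot>\<^sub>1 H \<odot> io Q X (cmp1 B c' b') H"
      by (rule io_asc) simp_all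
    then have "(io Q X c' b' \<cdot>\<^sub>1 H \<odot> io Q X (cmp1 B c' b') H) \<odot> inv (X \<cdot>\<^sub>2 asc B c' b' H) = io Q ?c b' H \<odot> io Q X c' (cmp1 B b' H)"
      by (intro cp_inv_right) simp_all
    then show ?thesis by simp
  qed
  \<comment> \<open>\<open>M1\<close> to \<open>M5\<close> are growing tails of the right side of
    \<open>main\<close>, with the right unitor moved over as \<open>L\<close>; fact \<open>m\<close>
    then exchanges them for the left side.\<close>
  define M1 where "M1 = X \<cdot>\<^sub>2 hc B (id2 B H) s \<odot> L"
  have [simp]: "M1 \<in> Ar Q" "dm Q M1 = ?H" "cd Q M1 = X \<cdot> cmp1 B H (cmp1 B c b)" by (simp_all add: M1_def)
  define M2 where "M2 = X \<cdot>\<^sub>2 inv2 B (asc B H c b) \<odot> M1"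
  have [simp]: "M2 \<in> Ar Q" "dm Q M2 = ?H" "cd Q M2 = X \<cdot> cmp1 B (cmp1 B H c) b" by (simp_all add: M2_def)
  define M3 where "M3 = X \<cdot>\<^sub>2 hc B q (id2 B b) \<odot> M2"
  have [simp]: "M3 \<in> Ar Q" "dm Q M3 = ?H" "cd Q M3 = X \<cdot> cmp1 B (cmp1 B c' K) b" by (simp_all add: M3_def)
  define M4 where "M4 = X \<cdot>\<^sub>2 asc B c' K b \<odot> M3"
  have [simp]: "M4 \<in> Ar Q" "dm Q M4 = ?H" "cd Q M4 = X \<cdot> cmp1 B c' (cmp1 B K b)" by (simp_all add: M4_def)
  define M5 where "M5 = X \<cdot>\<^sub>2 hc B (id2 B c') p \<odot> M4"
  have [simp]: "M5 \<in> Ar Q" "dm Q M5 = ?H" "cd Q M5 = X \<cdot> cmp1 B c' (cmp1 B b' H)" by (simp_all add: M5_def)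
  have m: "X \<cdot>\<^sub>2 inv2 B (asc B c' b' H) \<odot> M5 = X \<cdot>\<^sub>2 hc B s' (id2 B H) \<odot> X \<cdot>\<^sub>2 inv2 B (lun B H)"
  proof -
    have "X \<cdot>\<^sub>2 hc B s' (id2 B H) \<odot> X \<cdot>\<^sub>2 inv2 B (lun B H) \<odot> X \<cdot>\<^sub>2 run B H = X \<cdot>\<^sub>2 inv2 B (asc B c' b' H) \<odot> X \<cdot>\<^sub>2 hc B (id2 B c') p \<odot>
       X \<cdot>\<^sub>2 asc B c' K b \<odot> X \<cdot>\<^sub>2 hc B q (id2 B b) \<odot> X \<cdot>\<^sub>2 inv2 B (asc B H c b) \<odot> X \<cdot>\<^sub>2 hc B (id2 B H) s"
      using arg_cong[OF main, of "a2 Q X"] by (simp add: a2_vc)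
    from arg_cong[OF this, of "\<lambda>u. u \<odot> L"]
    have "X \<cdot>\<^sub>2 hc B s' (id2 B H) \<odot> X \<cdot>\<^sub>2 inv2 B (lun B H) \<odot> X \<cdot>\<^sub>2 run B H \<odot> L = X \<cdot>\<^sub>2 inv2 B (asc B c' b' H) \<odot> M5"
      by (simp add: M5_def M4_def M3_def M2_def M1_def)
    then show ?thesis by (simp add: L_def del: iso_a2(2))
  qed
  have f1: "syb ?H (src B h) (src B k) = io Q X H c \<cdot>\<^sub>1 b \<odot> io Q X (cmp1 B H c) b \<odot> M2"
    using cp_reassoc[OF e2, of L] arg_cong[OF e3, of "\<lambda>u. u \<odot> M1"] by (simp add: S1 e1 M1_def M2_def)
  have f2: "Nb X k h \<cdot>\<^sub>1 b \<odot> syb ?H (src B h) (src B k) = io Q ?c K b \<odot> io Q X c' (cmp1 B K b) \<odot> M4"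
    using arg_cong[OF e4, of "\<lambda>u. u \<odot> M2"] arg_cong[OF e5, of "\<lambda>u. u \<odot> M3"] by (simp add: f1 M3_def M4_def)
  have f3: "Nb ?c h k \<odot> io Q ?c K b \<odot> io Q X c' (cmp1 B K b) \<odot> M4 = io Q X c' b' \<cdot>\<^sub>1 H \<odot> io Q X (cmp1 B c' b') H \<odot> X \<cdot>\<^sub>2 inv2 B (asc B c' b' H) \<odot> M5"
    using arg_cong[OF e6, of "\<lambda>u. u \<odot> M4"] arg_cong[OF e7, of "\<lambda>u. u \<odot> M5"] by (simp add: M5_def)
  have g1: "io Q X (cmp1 B c' b') H \<odot> X \<cdot>\<^sub>2 hc B s' (id2 B H) = (X \<cdot>\<^sub>2 s') \<cdot>\<^sub>1 H \<odot> io Q X (id1 B z) H"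
    using io_hc[of X "id2 B H" s'] by simp
  have g2: "io Q X (id1 B z) H \<odot> X \<cdot>\<^sub>2 inv2 B (lun B H) = inv (un Q X) \<cdot>\<^sub>1 H"
  proof -
    have "inv (un Q X \<cdot>\<^sub>1 H) \<odot> X \<cdot>\<^sub>2 lun B H = io Q X (id1 B z) H"
      using arg_cong[OF un_lun[of X H], of "\<lambda>u. inv (un Q X \<cdot>\<^sub>1 H) \<odot> u"] by (simp del: iso_am(2))
    from cp_inv_right[OF this[symmetric]] show ?thesis by simp
  qed
  have "Nb ?c h k \<odot> Nb X k h \<cdot>\<^sub>1 b \<odot> syb ?H (src B h) (src B k) = io Q X c' b' \<cdot>\<^sub>1 H \<odot> (io Q X (cmp1 B c' b') H \<odot> X \<cdot>\<^sub>2 hc B s' (id2 B H)) \<odot> X \<cdot>\<^sub>2 inv2 B (lun B H)"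
    unfolding f2 f3 m by simp
  also have "\<dots> = io Q X c' b' \<cdot>\<^sub>1 H \<odot> (X \<cdot>\<^sub>2 s') \<cdot>\<^sub>1 H \<odot> (io Q X (id1 B z) H \<odot> X \<cdot>\<^sub>2 inv2 B (lun B H))"
    unfolding g1 by simp
  also have "\<dots> = syb X (trg B h) (trg B k) \<cdot>\<^sub>1 H"
    unfolding g2 by (simp add: S2 am_cp)
  finally show ?thesis by (simp add: b_def c'_def H_def)
qed

section \<open>The pairing as an action of \<open>prodB B B\<close> with a pseudo-involution\<close>

definition sgB where "sgB = (\<lambda>(r, c, a). (r \<cdot> be (a, c), a, c))"
definition smB where "smB = (\<lambda>(u, c, a). (u \<cdot>\<^sub>1 be (a, c), a, c))"
text \<open>\<open>Nb\<close> is inverted because \<open>nu\<close> starts with the action outside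
  the involution, which is where the naturality cell of the braiding ends.\<close>

definition nuB where "nuB = (\<lambda>(r, y) (h, k). (inv (Nb r h k), src B h, src B k))"
definition syB where "syB = (\<lambda>(r, c, a). (syb r c a, c, a))"

lemma B_simps [simp]:
  "sgB (r, c, a) = (r \<cdot> be (a, c), a, c)" "smB (u, c, a) = (u \<cdot>\<^sub>1 be (a, c), a, c)"
  "nuB (r, y) (h, k) = (inv (Nb r h k), src B h, src B k)" "syB (r, c, a) = (syb r c a, c, a)"
  by (simp_all add: sgB_def smB_def nuB_def syB_def)

lemma Tu_simps_pair [simp]:
  assumes "a \<in> obj B" "b \<in> obj B"
  shows "isoc (Tu (a, b))" "Tu (a, b) \<in> arr2 B" "dom2 B (Tu (a, b)) = id1 B (T0 (a, b))"
    "cod2 B (Tu (a, b)) = T1 (id1 B a, id1 B b)"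
  using T.Fu_simps[of "(a, b)"] assms by simp_all

text \<open>The laws of \<open>nu\<close> are the pseudonaturality of the braiding, solved for the
  inverse cell; those relating \<open>sy\<close> to \<open>nu\<close> and to \<open>sg\<close> come
  from the modification law of the syllepsis and the symmetry axiom.\<close>

lemma braided_imodule: "imodule B (pull B2 B (tensor M) Q) sgB smB nuB syB"
proof -
  interpret PQ: bimodule B2 "pull B2 B (tensor M) Q"
    by (rule pull_rmodule) (simp_all add: prod_bicat bimodule_axioms tensor)
  show ?thesis
  proof (unfold_locales, goal_cases)
    case (1 X)
    obtain r c a where "X = (r, c, a)" by (metis prod_cases3)
    with 1 show ?case by simp
  next
    case (2 u)
    obtain v c a where "u = (v, c, a)" by (metis prod_cases3)
    with 2 show ?case by simp
  next
    case (3 X)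
    obtain r c a where "X = (r, c, a)" by (metis prod_cases3)
    with 3 show ?case by simp
  next
    case (4 u v)
    obtain w c a where "u = (w, c, a)" by (metis prod_cases3)
    moreover obtain w' c' a' where "v = (w', c', a')" by (metis prod_cases3)
    ultimately show ?case using 4 by (simp add: am_cp)
  next
    case (5 X k)
    obtain r c a where "X = (r, c, a)" by (metis prod_cases3)
    moreover obtain h l where "k = (h, l)" by (metis surj_pair)
    ultimately show ?case using 5 by (simp add: isoP_pull)
  next
    case (6 u k)
    obtain v c a where u: "u = (v, c, a)" by (metis prod_cases3)
    obtain h l where k: "k = (h, l)" by (metis surj_pair)
    from 6 u k have [simp]: "v \<in> Ar Q" "a \<in> obj B" "c \<in> obj B" "h \<in> arr1 B" "l \<in> arr1 B" "trg B h = a" "trg B l = c" "bs Q (dm Q v) = T0 (c, a)" by auto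
    have "inv (Nb (cd Q v) h l) \<odot> v \<cdot>\<^sub>1 be (trg B h, trg B l) \<cdot>\<^sub>1 T1 (h, l) = v \<cdot>\<^sub>1 T1 (l, h) \<cdot>\<^sub>1 be (src B h, src B l) \<odot> inv (Nb (dm Q v) h l)"
      by (rule inP_swap[OF Nb_nat]) simp_all
    then show ?case by (simp add: u k)
  next
    case (7 X p)
    obtain r c a where X: "X = (r, c, a)" by (metis prod_cases3)
    obtain v w where p: "p = (v, w)" by (metis surj_pair)
    from 7 X p have [simp]: "a \<in> obj B" "c \<in> obj B" "r \<in> Ob Q" "v \<in> arr2 B" "w \<in> arr2 B" "trg B (dom2 B v) = a" "trg B (dom2 B w) = c" "bs Q r = T0 (c, a)" by auto
    have "inv (Nb r (cod2 B v) (cod2 B w)) \<odot> (r \<cdot> be (trg B (dom2 B v), trg B (dom2 B w))) \<cdot>\<^sub>2 T2 (v, w)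
      = (r \<cdot>\<^sub>2 T2 (w, v)) \<cdot>\<^sub>1 be (src B (dom2 B v), src B (dom2 B w)) \<odot> inv (Nb r (dom2 B v) (dom2 B w))"
      by (rule inP_swap[OF Nb_cell]) simp_all
    then show ?case by (simp add: X p)
  next
    case (8 X f g)
    obtain r c a where X: "X = (r, c, a)" by (metis prod_cases3)
    obtain f1 f2 where f: "f = (f1, f2)" by (metis surj_pair)
    obtain g1 g2 where g: "g = (g1, g2)" by (metis surj_pair)
    from 8 X f g have [simp]: "a \<in> obj B" "c \<in> obj B" "r \<in> Ob Q" "f1 \<in> arr1 B" "f2 \<in> arr1 B" "g1 \<in> arr1 B" "g2 \<in> arr1 B" "trg B g1 = a" "trg B g2 = c"
      "trg B f1 = src B g1" "trg B f2 = src B g2" "bs Q r = T0 (c, a)" by auto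
    let ?b0 = "be (src B f1, src B f2)" and ?b2 = "be (trg B g1, trg B g2)"
    let ?C = "Tc (g2, g1) (f2, f1)"
    let ?q = "Nb r g1 g2 \<cdot>\<^sub>1 T1 (f1, f2) \<odot> Nb (r \<cdot> T1 (g2, g1)) f1 f2"
    let ?v = "io Q (r \<cdot> ?b2) (T1 (g1, g2)) (T1 (f1, f2)) \<odot> (r \<cdot> ?b2) \<cdot>\<^sub>2 inv2 B (Tc (g1, g2) (f1, f2))"
    let ?p = "Nb r (cmp1 B g1 f1) (cmp1 B g2 f2) \<odot> (r \<cdot>\<^sub>2 ?C) \<cdot>\<^sub>1 ?b0"
    have "inv ?q \<odot> ?v = io Q r (T1 (g2, g1)) (T1 (f2, f1)) \<cdot>\<^sub>1 ?b0 \<odot> inv ?p"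
      by (rule inP_swap) (use Nb_cmp[of r f1 g1 f2 g2] in simp_all)
    then show ?case by (simp add: X f g am_cp)
  next
    case (9 X)
    obtain r c a where X: "X = (r, c, a)" by (metis prod_cases3)
    from 9 X have [simp]: "r \<in> Ob Q" "a \<in> obj B" "c \<in> obj B" "bs Q r = T0 (c, a)" by auto
    let ?b = "be (a, c)" and ?N = "Nb r (id1 B a) (id1 B c)"
    have "inv (?N \<odot> (r \<cdot>\<^sub>2 Tu (c, a)) \<cdot>\<^sub>1 ?b) = inv ((r \<cdot> ?b) \<cdot>\<^sub>2 Tu (a, c) \<odot> inv (un Q (r \<cdot> ?b)) \<odot> un Q r \<cdot>\<^sub>1 ?b)"
      using Nb_un[of r a c] by simp
    then have "un Q r \<cdot>\<^sub>1 ?b \<odot> inv (?N \<odot> (r \<cdot>\<^sub>2 Tu (c, a)) \<cdot>\<^sub>1 ?b) = un Q r \<cdot>\<^sub>1 ?b \<odot> inv (un Q r \<cdot>\<^sub>1 ?b) \<odot> un Q (r \<cdot> ?b) \<odot> inv ((r \<cdot> ?b) \<cdot>\<^sub>2 Tu (a, c))"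
      by simp
    also have "\<dots> = un Q (r \<cdot> ?b) \<odot> inv ((r \<cdot> ?b) \<cdot>\<^sub>2 Tu (a, c))"
      by (rule inv_cancel(2)) simp_all
    finally show ?case by (simp add: X am_cp)
  next
    case (10 X)
    obtain r c a where "X = (r, c, a)" by (metis prod_cases3)
    with 10 show ?case by (simp add: isoP_pull)
  next
    case (11 u)
    obtain v c a where "u = (v, c, a)" by (metis prod_cases3)
    with 11 show ?case by (simp add: syb_nat)
  next
    case (12 X k)
    obtain r c a where X: "X = (r, c, a)" by (metis prod_cases3)
    obtain h l where k: "k = (h, l)" by (metis surj_pair)
    from 12 X k have [simp]: "a \<in> obj B" "c \<in> obj B" "r \<in> Ob Q" "h \<in> arr1 B" "l \<in> arr1 B" "trg B h = c" "trg B l = a" "bs Q r = T0 (c, a)" by auto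
    let ?b = "be (src B h, src B l)" and ?s = "syb (r \<cdot> T1 (h, l)) (src B h) (src B l)"
    let ?N = "Nb (r \<cdot> be (a, c)) h l" and ?N' = "Nb r l h \<cdot>\<^sub>1 ?b"
    have 1: "?N \<odot> ?N' \<odot> ?s = syb r c a \<cdot>\<^sub>1 T1 (h, l)" using syb_Nb[of r h l] by simp
    have "inv ?N' \<odot> inv ?N \<odot> syb r c a \<cdot>\<^sub>1 T1 (h, l) = ?s"
      unfolding 1[symmetric] by (simp del: iso_am(2))
    then show ?case by (simp add: X k)
  next
    case (13 X)
    obtain r c a where "X = (r, c, a)" by (metis prod_cases3)
    with 13 show ?case by (simp add: syb_be)
  qed
qed

end

section \<open>Biadjunctions and universal arrows\<close>

context bicategory
begin

text \<open>Commuting squares that share the side \<open>v\<close> paste to one. Iterated, this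
  turns a chain of elementary naturality squares into the naturality of a long composite.\<close>

lemma sq_comp:
  assumes "vc B q u = vc B v p" "vc B q' v = vc B w p'" "u \<in> arr2 B" "v \<in> arr2 B" "w \<in> arr2 B" "p \<in> arr2 B" "p' \<in> arr2 B"
    "q \<in> arr2 B" "q' \<in> arr2 B" "cod2 B u = dom2 B q" "cod2 B q = dom2 B q'" "cod2 B p = dom2 B v" "cod2 B p' = dom2 B w"
    "cod2 B v = dom2 B q'" "cod2 B p = dom2 B p'"
  shows "vc B (vc B q' q) u = vc B w (vc B p' p)"
proof -
  have "vc B (vc B q' q) u = vc B q' (vc B q u)" by (rule vc_assoc') (use assms(3-) in auto)
  also have "\<dots> = vc B (vc B q' v) p" unfolding assms(1) by (rule vc_assoc'[symmetric]) (use assms(3-) in auto)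
  also have "\<dots> = vc B w (vc B p' p)" unfolding assms(2) by (rule vc_assoc') (use assms(3-) in auto)
  finally show ?thesis .
qed

lemma sq_hcR:
  assumes "vc B q u = vc B v p" "u \<in> arr2 B" "v \<in> arr2 B" "p \<in> arr2 B" "q \<in> arr2 B" "cod2 B u = dom2 B q" "cod2 B p = dom2 B v"
    "k \<in> arr1 B" "trg B k = src B (dom2 B u)" "src B (dom2 B p) = src B (dom2 B u)"
  shows "vc B (hc B q (id2 B k)) (hc B u (id2 B k)) = vc B (hc B v (id2 B k)) (hc B p (id2 B k))"
  using interchange'[of "id2 B k" "id2 B k" u q] interchange'[of "id2 B k" "id2 B k" p v] assms by simp

lemma sq_hcL:
  assumes "vc B q u = vc B v p" "u \<in> arr2 B" "v \<in> arr2 B" "p \<in> arr2 B" "q \<in> arr2 B" "cod2 B u = dom2 B q" "cod2 B p = dom2 B v"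
    "k \<in> arr1 B" "src B k = trg B (dom2 B u)" "trg B (dom2 B p) = trg B (dom2 B u)"
  shows "vc B (hc B (id2 B k) q) (hc B (id2 B k) u) = vc B (hc B (id2 B k) v) (hc B (id2 B k) p)"
  using interchange'[of u q "id2 B k" "id2 B k"] interchange'[of p v "id2 B k" "id2 B k"] assms by simp

end

text \<open>\<open>\<Phi>\<close> and \<open>\<Psi>\<close> are the functors between Hom(c, R x) and
  Hom(L c, x) given by the counit and the unit, respectively. The triangle modifications
  \<open>t\<close> and \<open>s\<close> yield natural isomorphisms \<open>\<zeta>\<close> and
  \<open>\<xi>\<close> from the two composites to the identities, so \<open>\<Phi>\<close> is an
  equivalence.\<close>

lemma biadjunction_universal:
  assumes "bicategory B" "bicategory C" "biadjunction B C L R \<eta> \<epsilon> s t" and x: "x \<in> obj C"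
  defines "e \<equiv> t1 \<epsilon> x"
  shows "F0 R x \<in> obj B" "e \<in> hom1 C (F0 L (F0 R x)) x"
    "\<And>c r. \<lbrakk>c \<in> obj B; r \<in> hom1 C (F0 L c) x\<rbrakk> \<Longrightarrow> \<exists>h u. h \<in> hom1 B c (F0 R x) \<and> u \<in> iso2 C (cmp1 C e (F1 L h)) r"
    "\<And>c h k w. \<lbrakk>h \<in> hom1 B c (F0 R x); k \<in> hom1 B c (F0 R x); w \<in> hom2 C (cmp1 C e (F1 L h)) (cmp1 C e (F1 L k))\<rbrakk>
      \<Longrightarrow> \<exists>u \<in> hom2 B h k. hc C (id2 C e) (F2 L u) = w"
    "\<And>c h k u v. \<lbrakk>h \<in> hom1 B c (F0 R x); k \<in> hom1 B c (F0 R x); u \<in> hom2 B h k; v \<in> hom2 B h k;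
       hc C (id2 C e) (F2 L u) = hc C (id2 C e) (F2 L v)\<rbrakk> \<Longrightarrow> u = v"
proof -
  interpret B: bicategory B by fact
  interpret C: bicategory C by fact
  have adj: "pseudofunctor B C L" "pseudofunctor C B R" "pseudonatural B B (idF B) (compF B R L) \<eta>"
    "pseudonatural C C (compF C L R) (idF C) \<epsilon>"
    "invertible_modification B C L L (vcT B C (whiskR C \<epsilon> L) (whiskL B C L \<eta>)) (idT C L) s"
    "invertible_modification C B R R (vcT C B (whiskL C B R \<epsilon>) (whiskR B \<eta> R)) (idT B R) t"
    using assms(3) by (auto simp: biadjunction_def)
  interpret L: pseudofunctor' B C L using adj(1) by (simp add: pseudofunctor'_def B.bicategory_axioms C.bicategory_axioms)
  interpret R: pseudofunctor' C B R using adj(2) by (simp add: pseudofunctor'_def B.bicategory_axioms C.bicategory_axioms)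
  interpret n: pseudonatural B B "idF B" "compF B R L" \<eta> by (rule adj(3))
  interpret p: pseudonatural C C "compF C L R" "idF C" \<epsilon> by (rule adj(4))
  note [simp] = x
  have n1 [simp]: "t1 \<eta> c \<in> arr1 B" "src B (t1 \<eta> c) = c" "trg B (t1 \<eta> c) = F0 R (F0 L c)" if "c \<in> obj B" for c
    using n.t1_hom[OF that] by (simp_all add: hom1_def compF_def strictF_def)
  have p1 [simp]: "t1 \<epsilon> y \<in> arr1 C" "src C (t1 \<epsilon> y) = F0 L (F0 R y)" "trg C (t1 \<epsilon> y) = y" if "y \<in> obj C" for y
    using p.t1_hom[OF that] by (simp_all add: hom1_def compF_def strictF_def)
  have n2 [simp]: "B.isoc (t2 \<eta> h)" "t2 \<eta> h \<in> arr2 B" "dom2 B (t2 \<eta> h) = cmp1 B (F1 R (F1 L h)) (t1 \<eta> (src B h))"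
    "cod2 B (t2 \<eta> h) = cmp1 B (t1 \<eta> (trg B h)) h" if "h \<in> arr1 B" for h
    using n.t2_iso[OF B.arr1_hom1[OF that]] by (simp_all add: B.iso2_iff B.isoc_arr2 compF_def strictF_def)
  have p2 [simp]: "C.isoc (t2 \<epsilon> r)" "t2 \<epsilon> r \<in> arr2 C" "dom2 C (t2 \<epsilon> r) = cmp1 C r (t1 \<epsilon> (src C r))"
    "cod2 C (t2 \<epsilon> r) = cmp1 C (t1 \<epsilon> (trg C r)) (F1 L (F1 R r))" if "r \<in> arr1 C" for r
    using p.t2_iso[OF C.arr1_hom1[OF that]] by (simp_all add: C.iso2_iff C.isoc_arr2 compF_def strictF_def)
  have n3: "vc B (t2 \<eta> (cod2 B u)) (hc B (F2 R (F2 L u)) (id2 B (t1 \<eta> (src B (dom2 B u)))))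
     = vc B (hc B (id2 B (t1 \<eta> (trg B (dom2 B u)))) u) (t2 \<eta> (dom2 B u))" if "u \<in> arr2 B" for u
    using n.t2_nat[OF B.arr1_hom1 B.arr2_hom2[OF that]] that by (simp add: compF_def strictF_def)
  have p3: "vc C (t2 \<epsilon> (cod2 C v)) (hc C v (id2 C (t1 \<epsilon> (src C (dom2 C v)))))
     = vc C (hc C (id2 C (t1 \<epsilon> (trg C (dom2 C v)))) (F2 L (F2 R v))) (t2 \<epsilon> (dom2 C v))" if "v \<in> arr2 C" for v
    using p.t2_nat[OF C.arr1_hom1 C.arr2_hom2[OF that]] that by (simp add: compF_def strictF_def)
  have s [simp]: "C.isoc (s c)" "s c \<in> arr2 C" "dom2 C (s c) = cmp1 C (t1 \<epsilon> (F0 L c)) (F1 L (t1 \<eta> c))" "cod2 C (s c) = id1 C (F0 L c)"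
    if "c \<in> obj B" for c
  proof -
    have "s c \<in> iso2 C (cmp1 C (t1 \<epsilon> (F0 L c)) (F1 L (t1 \<eta> c))) (id1 C (F0 L c))"
      using adj(5) that by (simp add: invertible_modification_def vcT_def whiskL_def whiskR_def idT_def)
    then show "C.isoc (s c)" "s c \<in> arr2 C" "dom2 C (s c) = cmp1 C (t1 \<epsilon> (F0 L c)) (F1 L (t1 \<eta> c))" "cod2 C (s c) = id1 C (F0 L c)"
      by (simp_all add: C.iso2_iff C.isoc_arr2)
  qed
  have t [simp]: "B.isoc (t x)" "t x \<in> arr2 B" "dom2 B (t x) = cmp1 B (F1 R e) (t1 \<eta> (F0 R x))" "cod2 B (t x) = id1 B (F0 R x)"
  proof -
    have "t x \<in> iso2 B (cmp1 B (F1 R e) (t1 \<eta> (F0 R x))) (id1 B (F0 R x))"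
      using adj(6) by (simp add: invertible_modification_def vcT_def whiskL_def whiskR_def idT_def e_def)
    then show "B.isoc (t x)" "t x \<in> arr2 B" "dom2 B (t x) = cmp1 B (F1 R e) (t1 \<eta> (F0 R x))" "cod2 B (t x) = id1 B (F0 R x)"
      by (simp_all add: B.iso2_iff B.isoc_arr2)
  qed
  define y where "y = F0 R x"
  have y [simp]: "y \<in> obj B" by (simp add: y_def)
  note [simp] = y_def[symmetric]
  have e [simp]: "e \<in> arr1 C" "src C e = F0 L y" "trg C e = x" by (simp_all add: e_def)
  define \<Phi> where "\<Phi> h = cmp1 C e (F1 L h)" for h
  define \<Phi>2 where "\<Phi>2 u = hc C (id2 C e) (F2 L u)" for u
  define \<Psi> where "\<Psi> c r = cmp1 B (F1 R r) (t1 \<eta> c)" for c r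
  define \<Psi>2 where "\<Psi>2 c v = hc B (F2 R v) (id2 B (t1 \<eta> c))" for c v
  have P [simp]: "\<Phi> h \<in> arr1 C" "src C (\<Phi> h) = F0 L (src B h)" "trg C (\<Phi> h) = x" if "h \<in> arr1 B" "trg B h = y" for h
    using that by (simp_all add: \<Phi>_def)
  have P2 [simp]: "\<Phi>2 u \<in> arr2 C" "dom2 C (\<Phi>2 u) = \<Phi> (dom2 B u)" "cod2 C (\<Phi>2 u) = \<Phi> (cod2 B u)" if "u \<in> arr2 B" "trg B (dom2 B u) = y" for u
    using that by (simp_all add: \<Phi>2_def \<Phi>_def)
  have S [simp]: "\<Psi> c r \<in> arr1 B" "src B (\<Psi> c r) = c" "trg B (\<Psi> c r) = y" if "c \<in> obj B" "r \<in> arr1 C" "src C r = F0 L c" "trg C r = x" for c r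
    using that by (simp_all add: \<Psi>_def)
  have S2 [simp]: "\<Psi>2 c v \<in> arr2 B" "dom2 B (\<Psi>2 c v) = \<Psi> c (dom2 C v)" "cod2 B (\<Psi>2 c v) = \<Psi> c (cod2 C v)"
    if "c \<in> obj B" "v \<in> arr2 C" "src C (dom2 C v) = F0 L c" "trg C (dom2 C v) = x" for c v
    using that by (simp_all add: \<Psi>2_def \<Psi>_def)
  \<comment> \<open>Naturality of the unit at \<open>h\<close> moves \<open>h\<close> to the right
    of \<open>F1 R e\<close> composed with the unit at \<open>F0 R x\<close>; \<open>t x\<close>
    contracts that composite to an identity.\<close>
  define \<zeta> where "\<zeta> h = (let c = src B h in
    vc B (lun B h) (vc B (hc B (t x) (id2 B h)) (vc B (inv2 B (asc B (F1 R e) (t1 \<eta> y) h))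
    (vc B (hc B (id2 B (F1 R e)) (t2 \<eta> h)) (vc B (asc B (F1 R e) (F1 R (F1 L h)) (t1 \<eta> c))
      (hc B (inv2 B (Fc R e (F1 L h))) (id2 B (t1 \<eta> c))))))))" for h
  have \<zeta> [simp]: "B.isoc (\<zeta> h)" "\<zeta> h \<in> arr2 B" "dom2 B (\<zeta> h) = \<Psi> (src B h) (\<Phi> h)" "cod2 B (\<zeta> h) = h" if "h \<in> arr1 B" "trg B h = y" for h
    using that by (simp_all add: \<zeta>_def Let_def \<Psi>_def \<Phi>_def)
  have \<zeta>_nat: "vc B (\<zeta> (cod2 B u)) (\<Psi>2 (src B (dom2 B u)) (\<Phi>2 u)) = vc B u (\<zeta> (dom2 B u))" if [simp]: "u \<in> arr2 B" "trg B (dom2 B u) = y" for u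
  proof -
    let ?h = "dom2 B u" and ?k = "cod2 B u" and ?c = "src B (dom2 B u)" and ?n = "t1 \<eta> (src B (dom2 B u))" and ?m = "t1 \<eta> y"
    let ?r = "F1 R e"
    have 1: "vc B (hc B (inv2 B (Fc R e (F1 L ?k))) (id2 B ?n)) (\<Psi>2 ?c (\<Phi>2 u))
      = vc B (hc B (hc B (id2 B ?r) (F2 R (F2 L u))) (id2 B ?n)) (hc B (inv2 B (Fc R e (F1 L ?h))) (id2 B ?n))"
      unfolding \<Psi>2_def \<Phi>2_def using R.inv_Fc_nat[of "F2 L u" "id2 C e"] by (intro B.sq_hcR) simp_all
    have 2: "vc B (asc B ?r (F1 R (F1 L ?k)) ?n) (hc B (hc B (id2 B ?r) (F2 R (F2 L u))) (id2 B ?n))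
      = vc B (hc B (id2 B ?r) (hc B (F2 R (F2 L u)) (id2 B ?n))) (asc B ?r (F1 R (F1 L ?h)) ?n)"
      using B.asc_nat'[of "id2 B ?n" "F2 R (F2 L u)" "id2 B ?r"] by simp
    have 3: "vc B (hc B (id2 B ?r) (t2 \<eta> ?k)) (hc B (id2 B ?r) (hc B (F2 R (F2 L u)) (id2 B ?n)))
      = vc B (hc B (id2 B ?r) (hc B (id2 B ?m) u)) (hc B (id2 B ?r) (t2 \<eta> ?h))"
      using n3[of u] by (intro B.sq_hcL) simp_all
    have 4: "vc B (inv2 B (asc B ?r ?m ?k)) (hc B (id2 B ?r) (hc B (id2 B ?m) u)) = vc B (hc B (id2 B (cmp1 B ?r ?m)) u) (inv2 B (asc B ?r ?m ?h))"
      using B.inv2_swap[OF B.asc_nat'[of u "id2 B ?m" "id2 B ?r"]] by simp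
    have 5: "vc B (hc B (t x) (id2 B ?k)) (hc B (id2 B (cmp1 B ?r ?m)) u) = vc B (hc B (id2 B (id1 B y)) u) (hc B (t x) (id2 B ?h))"
      using B.interchange'[of u "id2 B ?k" "id2 B (cmp1 B ?r ?m)" "t x"] B.interchange'[of "id2 B ?h" u "t x" "id2 B (id1 B y)"] by simp
    have 6: "vc B (lun B ?k) (hc B (id2 B (id1 B y)) u) = vc B u (lun B ?h)"
      using B.lun_nat'[of u] by simp
    note sq = B.sq_comp[OF B.sq_comp[OF B.sq_comp[OF B.sq_comp[OF B.sq_comp[OF 1 2] 3] 4] 5] 6]
    show ?thesis using sq by (simp add: \<zeta>_def Let_def \<Psi>_def \<Phi>_def)
  qed
  \<comment> \<open>Dually, the inverse naturality cell of the counit at \<open>r\<close> brings the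
    counit at \<open>F0 L c\<close> next to \<open>F1 L\<close> of the unit, and \<open>s c\<close>
    contracts the two.\<close>
  define \<xi> where "\<xi> c r =
    vc C (run C r) (vc C (hc C (id2 C r) (s c)) (vc C (asc C r (t1 \<epsilon> (F0 L c)) (F1 L (t1 \<eta> c)))
    (vc C (hc C (inv2 C (t2 \<epsilon> r)) (id2 C (F1 L (t1 \<eta> c)))) (vc C (inv2 C (asc C e (F1 L (F1 R r)) (F1 L (t1 \<eta> c))))
      (hc C (id2 C e) (inv2 C (Fc L (F1 R r) (t1 \<eta> c))))))))" for c r
  have \<xi> [simp]: "C.isoc (\<xi> c r)" "\<xi> c r \<in> arr2 C" "dom2 C (\<xi> c r) = \<Phi> (\<Psi> c r)" "cod2 C (\<xi> c r) = r"
    if "c \<in> obj B" "r \<in> arr1 C" "src C r = F0 L c" "trg C r = x" for c r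
    using that by (simp_all add: \<xi>_def \<Psi>_def \<Phi>_def e_def[symmetric])
  have \<xi>_nat: "vc C (\<xi> c (cod2 C v)) (\<Phi>2 (\<Psi>2 c v)) = vc C v (\<xi> c (dom2 C v))"
    if [simp]: "c \<in> obj B" "v \<in> arr2 C" "src C (dom2 C v) = F0 L c" "trg C (dom2 C v) = x" for c v
  proof -
    let ?h = "dom2 C v" and ?k = "cod2 C v" and ?n = "t1 \<eta> c" and ?p = "t1 \<epsilon> (F0 L c)"
    let ?l = "F1 L (t1 \<eta> c)"
    note [simp] = e_def[symmetric]
    have 1: "vc C (hc C (id2 C e) (inv2 C (Fc L (F1 R ?k) ?n))) (\<Phi>2 (\<Psi>2 c v))
      = vc C (hc C (id2 C e) (hc C (F2 L (F2 R v)) (id2 C ?l))) (hc C (id2 C e) (inv2 C (Fc L (F1 R ?h) ?n)))"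
      unfolding \<Psi>2_def \<Phi>2_def using L.inv_Fc_nat[of "id2 B ?n" "F2 R v"] by (intro C.sq_hcL) simp_all
    have 2: "vc C (inv2 C (asc C e (F1 L (F1 R ?k)) ?l)) (hc C (id2 C e) (hc C (F2 L (F2 R v)) (id2 C ?l)))
      = vc C (hc C (hc C (id2 C e) (F2 L (F2 R v))) (id2 C ?l)) (inv2 C (asc C e (F1 L (F1 R ?h)) ?l))"
      using C.inv2_swap[OF C.asc_nat'[of "id2 C ?l" "F2 L (F2 R v)" "id2 C e"]] by simp
    have "vc C (inv2 C (t2 \<epsilon> ?k)) (hc C (id2 C e) (F2 L (F2 R v))) = vc C (hc C v (id2 C ?p)) (inv2 C (t2 \<epsilon> ?h))"
      using C.inv2_swap[OF p3[of v]] by simp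
    then have 3: "vc C (hc C (inv2 C (t2 \<epsilon> ?k)) (id2 C ?l)) (hc C (hc C (id2 C e) (F2 L (F2 R v))) (id2 C ?l))
      = vc C (hc C (hc C v (id2 C ?p)) (id2 C ?l)) (hc C (inv2 C (t2 \<epsilon> ?h)) (id2 C ?l))"
      by (rule C.sq_hcR) simp_all
    have 4: "vc C (asc C ?k ?p ?l) (hc C (hc C v (id2 C ?p)) (id2 C ?l)) = vc C (hc C v (id2 C (cmp1 C ?p ?l))) (asc C ?h ?p ?l)"
      using C.asc_nat'[of "id2 C ?l" "id2 C ?p" v] by simp
    have 5: "vc C (hc C (id2 C ?k) (s c)) (hc C v (id2 C (cmp1 C ?p ?l))) = vc C (hc C v (id2 C (id1 C (F0 L c)))) (hc C (id2 C ?h) (s c))"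
      using C.interchange'[of "id2 C (cmp1 C ?p ?l)" "s c" v "id2 C ?k"] C.interchange'[of "s c" "id2 C (id1 C (F0 L c))" "id2 C ?h" v] by simp
    have 6: "vc C (run C ?k) (hc C v (id2 C (id1 C (F0 L c)))) = vc C v (run C ?h)"
      using C.run_nat'[of v] by simp
    note sq = C.sq_comp[OF C.sq_comp[OF C.sq_comp[OF C.sq_comp[OF C.sq_comp[OF 1 2] 3] 4] 5] 6]
    show ?thesis using sq by (simp add: \<xi>_def \<Psi>_def \<Phi>_def)
  qed
  show "F0 R x \<in> obj B" by simp
  show "e \<in> hom1 C (F0 L (F0 R x)) x" by (simp add: hom1_def)
  have faithful: "u = v" if "h \<in> hom1 B c y" "u \<in> hom2 B h k" "v \<in> hom2 B h k" "\<Phi>2 u = \<Phi>2 v" for c h k u v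
  proof -
    have [simp]: "u \<in> arr2 B" "v \<in> arr2 B" "dom2 B u = h" "dom2 B v = h" "cod2 B u = k" "cod2 B v = k" "h \<in> arr1 B" "src B h = c" "trg B h = y"
      using that by (auto simp: hom1_def hom2_def)
    have "vc B u (\<zeta> h) = vc B v (\<zeta> h)" using \<zeta>_nat[of u] \<zeta>_nat[of v] that(4) by simp
    then show ?thesis by (rule B.iso_cancel_right[rotated]) simp_all
  qed
  then show "u = v" if "h \<in> hom1 B c (F0 R x)" "k \<in> hom1 B c (F0 R x)" "u \<in> hom2 B h k" "v \<in> hom2 B h k"
     "hc C (id2 C e) (F2 L u) = hc C (id2 C e) (F2 L v)" for c h k u v
    using that by (simp add: \<Phi>2_def)
  show "\<exists>h u. h \<in> hom1 B c (F0 R x) \<and> u \<in> iso2 C (cmp1 C e (F1 L h)) r" if "c \<in> obj B" "r \<in> hom1 C (F0 L c) x" for c r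
  proof -
    have [simp]: "c \<in> obj B" "r \<in> arr1 C" "src C r = F0 L c" "trg C r = x" using that by (auto simp: hom1_def)
    have "\<Psi> c r \<in> hom1 B c (F0 R x)" by (simp add: hom1_def)
    moreover have "\<xi> c r \<in> iso2 C (cmp1 C e (F1 L (\<Psi> c r))) r" by (simp add: C.iso2_iff \<Phi>_def)
    ultimately show ?thesis by blast
  qed
  show "\<exists>u \<in> hom2 B h k. hc C (id2 C e) (F2 L u) = w"
    if "h \<in> hom1 B c (F0 R x)" "k \<in> hom1 B c (F0 R x)" "w \<in> hom2 C (cmp1 C e (F1 L h)) (cmp1 C e (F1 L k))" for c h k w
  proof -
    have [simp]: "h \<in> arr1 B" "src B h = c" "trg B h = y" "k \<in> arr1 B" "src B k = c" "trg B k = y" "w \<in> arr2 C" "dom2 C w = \<Phi> h" "cod2 C w = \<Phi> k"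
      using that by (auto simp: hom1_def hom2_def \<Phi>_def)
    have [simp]: "c \<in> obj B" using B.src_obj[of h] by simp
    \<comment> \<open>The cell \<open>w\<close> transported back through the inverse equivalence. By
      construction \<open>\<Psi>2\<close> identifies \<open>\<Phi>2 u\<close> with \<open>w\<close>,
      and \<open>\<Psi>2\<close> is faithful because of \<open>\<xi>\<close>.\<close>
    define u where "u = vc B (\<zeta> k) (vc B (\<Psi>2 c w) (inv2 B (\<zeta> h)))"
    have u [simp]: "u \<in> arr2 B" "dom2 B u = h" "cod2 B u = k" by (simp_all add: u_def)
    have "vc B (\<zeta> k) (\<Psi>2 c (\<Phi>2 u)) = vc B u (\<zeta> h)" using \<zeta>_nat[of u] by simp
    also have "\<dots> = vc B (\<zeta> k) (\<Psi>2 c w)" by (simp add: u_def)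
    finally have 1: "\<Psi>2 c (\<Phi>2 u) = \<Psi>2 c w" by (rule B.iso_cancel_left[rotated]) simp_all
    have "vc C (\<Phi>2 u) (\<xi> c (\<Phi> h)) = vc C w (\<xi> c (\<Phi> h))"
      using \<xi>_nat[of c "\<Phi>2 u"] \<xi>_nat[of c w] by (simp add: 1)
    then have "\<Phi>2 u = w" by (rule C.iso_cancel_right[rotated]) simp_all
    then show ?thesis by (intro bexI[of _ u]) (simp_all add: \<Phi>2_def hom2_def)
  qed
qed

section \<open>Closedness of the strictified pairing\<close>

context imodule
begin

lemma rep_cell_cp:
  assumes "P \<in> Ob Q" "p \<in> arr2 B" "q \<in> arr2 B" "cod2 B p = dom2 B q" "bs Q P = (trg B (dom2 B p), a)"
  shows "P \<cdot>\<^sub>2 (vc B q p, id2 B (id1 B a)) = P \<cdot>\<^sub>2 (q, id2 B (id1 B a)) \<odot> P \<cdot>\<^sub>2 (p, id2 B (id1 B a))"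
proof -
  have "a \<in> obj B" using bs_obj[OF assms(1)] assms(5) by simp
  then show ?thesis using a2_vc[of P "(p, id2 B (id1 B a))" "(q, id2 B (id1 B a))"] assms by simp
qed

text \<open>The formal evaluation object has an identity as its recorded first factor, so 2-cells
  act on it after whiskering with this identity; these formulas trade the whiskering for
  unitors.\<close>

lemma lun_conj:
  assumes [simp]: "w \<in> arr2 B"
  shows "hc B (id2 B (id1 B (trg B (dom2 B w)))) w = vc B (inv2 B (lun B (cod2 B w))) (vc B w (lun B (dom2 B w)))"
    "w = vc B (lun B (cod2 B w)) (vc B (hc B (id2 B (id1 B (trg B (dom2 B w)))) w) (inv2 B (lun B (dom2 B w))))"
proof -
  show 1: "hc B (id2 B (id1 B (trg B (dom2 B w)))) w = vc B (inv2 B (lun B (cod2 B w))) (vc B w (lun B (dom2 B w)))"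
    by (simp flip: B.lun_nat')
  show "w = vc B (lun B (cod2 B w)) (vc B (hc B (id2 B (id1 B (trg B (dom2 B w)))) w) (inv2 B (lun B (dom2 B w))))"
    unfolding 1 by simp
qed

text \<open>The representing property of \<open>E a\<close> survives strictification because acting
  with \<open>h\<close> on the formal object records \<open>h\<close> composed with an identity,
  which \<open>lun\<close> removes.\<close>

lemma strict_closed_pairing:
  assumes d0: "\<And>a. a \<in> obj B \<Longrightarrow> d0 a \<in> obj B"
    and E: "\<And>a. a \<in> obj B \<Longrightarrow> E a \<in> Ob Q \<and> bs Q (E a) = (d0 a, a)"
    and surj: "\<And>P c a. \<lbrakk>P \<in> Ob Q; bs Q P = (c, a)\<rbrakk> \<Longrightarrow> \<exists>h u. h \<in> arr1 B \<and> src B h = c \<and> trg B h = d0 a \<and>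
      iso u \<and> dm Q u = E a \<cdot> (h, id1 B a) \<and> cd Q u = P"
    and full: "\<And>a h k u. \<lbrakk>a \<in> obj B; h \<in> arr1 B; k \<in> arr1 B; src B h = src B k; trg B h = d0 a; trg B k = d0 a;
      u \<in> Ar Q; dm Q u = E a \<cdot> (h, id1 B a); cd Q u = E a \<cdot> (k, id1 B a)\<rbrakk>
      \<Longrightarrow> \<exists>w. w \<in> arr2 B \<and> dom2 B w = h \<and> cod2 B w = k \<and> E a \<cdot>\<^sub>2 (w, id2 B (id1 B a)) = u"
    and faithful: "\<And>a w w'. \<lbrakk>a \<in> obj B; w \<in> arr2 B; w' \<in> arr2 B; dom2 B w = dom2 B w'; cod2 B w = cod2 B w';
      trg B (dom2 B w') = d0 a; E a \<cdot>\<^sub>2 (w, id2 B (id1 B a)) = E a \<cdot>\<^sub>2 (w', id2 B (id1 B a))\<rbrakk> \<Longrightarrow> w = w'"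
  shows "closed_pairing B strict sgS smS d0 (\<lambda>a. (False, E a, id1 B (d0 a), id1 B a))"
proof -
  interpret S: pairing B strict sgS smS by (rule strict_pairing)
  note [simp] = d0
  have [simp]: "E a \<in> Ob Q" "bs Q (E a) = (d0 a, a)" if "a \<in> obj B" for a using E[OF that] by auto
  have [simp]: "wf False (E a) (d0 a, a)" if "a \<in> obj B" for a using that by (simp add: wf_def)
  show ?thesis
  proof (unfold_locales, goal_cases)
    case (1 a) then show ?case by simp
  next
    case (2 a) then show ?case by simp
  next
    case (3 X)
    then obtain fl P f g where X: "X = (fl, P, f, g)" and [simp]: "f \<in> arr1 B" "g \<in> arr1 B" "wf fl P (trg B f, trg B g)"
      by (auto elim: strict_ObE)
    have r: "rO fl P (f, g) \<in> Ob Q" "bs Q (rO fl P (f, g)) = (src B f, src B g)" by simp_all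
    let ?a = "src B g"
    obtain h u where [simp]: "h \<in> arr1 B" "src B h = src B f" "trg B h = d0 ?a" "iso u" "dm Q u = E ?a \<cdot> (h, id1 B ?a)"
      "cd Q u = rO fl P (f, g)"
      using surj[OF r] by auto
    have [simp]: "u \<in> Ar Q" by (simp add: iso_ar)
    let ?v = "u \<odot> E ?a \<cdot>\<^sub>2 (lun B h, id2 B (id1 B ?a))"
    have "iso (E ?a \<cdot>\<^sub>2 (lun B h, id2 B (id1 B ?a)))"
      using rh_iso[of False "E ?a" "lun B h" "id2 B (id1 B ?a)"] by (simp add: rh_def)
    then have "isoP strict ((False, E ?a, cmp1 B (id1 B (d0 ?a)) h, id1 B ?a), ?v, X)"
      by (intro isoP_strict) (simp_all add: X rO_def)
    then show ?case
      by (intro exI[of _ h] exI[of _ "((False, E ?a, cmp1 B (id1 B (d0 ?a)) h, id1 B ?a), ?v, X)"]) (simp add: X)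
  next
    case (4 a h k u)
    note [simp] = 4(1-6)
    let ?i = "id2 B (id1 B a)" and ?d = "id1 B (d0 a)"
    obtain v where u: "u = ((False, E a, cmp1 B ?d h, id1 B a), v, (False, E a, cmp1 B ?d k, id1 B a))"
      using 4(8,9) by (cases u) auto
    have [simp]: "v \<in> Ar Q" "dm Q v = E a \<cdot> (cmp1 B ?d h, id1 B a)" "cd Q v = E a \<cdot> (cmp1 B ?d k, id1 B a)"
      using 4(7) by (auto simp: u rO_def)
    \<comment> \<open>Corrected by \<open>lun\<close> at both ends, \<open>v\<close> becomes a
      morphism to which \<open>full\<close> applies; undoing the correction gives back
      \<open>v\<close>.\<close>
    obtain w where w [simp]: "w \<in> arr2 B" "dom2 B w = h" "cod2 B w = k"
      "E a \<cdot>\<^sub>2 (w, ?i) = E a \<cdot>\<^sub>2 (lun B k, ?i) \<odot> v \<odot> E a \<cdot>\<^sub>2 (inv2 B (lun B h), ?i)"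
      using full[of a h k "E a \<cdot>\<^sub>2 (lun B k, ?i) \<odot> v \<odot> E a \<cdot>\<^sub>2 (inv2 B (lun B h), ?i)"] by auto
    have 1: "E a \<cdot>\<^sub>2 (inv2 B (lun B k), ?i) \<odot> E a \<cdot>\<^sub>2 (lun B k, ?i) \<odot> v = v"
      using cp_reassoc[OF rep_cell_cp[of "E a" "lun B k" "inv2 B (lun B k)" a, symmetric], of v] by simp
    have 2: "E a \<cdot>\<^sub>2 (inv2 B (lun B h), ?i) \<odot> E a \<cdot>\<^sub>2 (lun B h, ?i) = one Q (E a \<cdot> (cmp1 B ?d h, id1 B a))"
      using rep_cell_cp[of "E a" "lun B h" "inv2 B (lun B h)" a] by simp
    have "E a \<cdot>\<^sub>2 (hc B (id2 B ?d) w, ?i) = v"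
      using lun_conj(1)[of w] 1 2 cp_reassoc[OF 1, of "one Q (E a \<cdot> (cmp1 B ?d h, id1 B a))"] by (simp add: rep_cell_cp)
    then show ?case by (intro exI[of _ w]) (simp add: u rh_def)
  next
    case (5 a w w')
    note [simp] = 5(1-6)
    have [simp]: "src B (cod2 B w') = src B (dom2 B w')" by simp
    let ?i = "id2 B (id1 B a)" and ?d = "id2 B (id1 B (d0 a))"
    let ?g = "\<lambda>w. vc B (lun B (cod2 B w')) (vc B (hc B ?d w) (inv2 B (lun B (dom2 B w'))))"
    have "E a \<cdot>\<^sub>2 (hc B ?d w, ?i) = E a \<cdot>\<^sub>2 (hc B ?d w', ?i)" using 5(7) by (simp add: rh_def)
    then have "E a \<cdot>\<^sub>2 (?g w, ?i) = E a \<cdot>\<^sub>2 (?g w', ?i)" by (simp add: rep_cell_cp)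
    moreover have "?g w = w" "?g w' = w'" using lun_conj(2)[of w] lun_conj(2)[of w'] by simp_all
    ultimately have "E a \<cdot>\<^sub>2 (w, ?i) = E a \<cdot>\<^sub>2 (w', ?i)" by metis
    then show ?case by (rule faithful[rotated -1]) simp_all
  qed
qed

end

text \<open>The dual of \<open>a\<close> is the value at the unit of the right adjoint to tensoring
  with \<open>a\<close>, and the evaluation is the component of the counit there; the claims are
  then instances of \<open>biadjunction_universal\<close>.\<close>

lemma (in zero_closed_symmetric_monoidal_bicategory) dual_representation:
  obtains d0 e where
    "\<And>a. a \<in> obj B \<Longrightarrow> d0 a \<in> obj B \<and> e a \<in> hom1 B (F0 (tensor M) (d0 a, a)) I"
    "\<And>a c r. \<lbrakk>a \<in> obj B; c \<in> obj B; r \<in> hom1 B (F0 (tensor M) (c, a)) I\<rbrakk>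
      \<Longrightarrow> \<exists>h u. h \<in> hom1 B c (d0 a) \<and> u \<in> iso2 B (cmp1 B (e a) (F1 (tensor M) (h, id1 B a))) r"
    "\<And>a c h k w. \<lbrakk>a \<in> obj B; h \<in> hom1 B c (d0 a); k \<in> hom1 B c (d0 a);
        w \<in> hom2 B (cmp1 B (e a) (F1 (tensor M) (h, id1 B a))) (cmp1 B (e a) (F1 (tensor M) (k, id1 B a)))\<rbrakk>
      \<Longrightarrow> \<exists>u \<in> hom2 B h k. hc B (id2 B (e a)) (F2 (tensor M) (u, id2 B (id1 B a))) = w"
    "\<And>a c h k u v. \<lbrakk>a \<in> obj B; h \<in> hom1 B c (d0 a); k \<in> hom1 B c (d0 a); u \<in> hom2 B h k; v \<in> hom2 B h k;
        hc B (id2 B (e a)) (F2 (tensor M) (u, id2 B (id1 B a))) = hc B (id2 B (e a)) (F2 (tensor M) (v, id2 B (id1 B a)))\<rbrakk>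
      \<Longrightarrow> u = v"
proof -
  \<comment> \<open>The right adjoint and its counit are chosen as one pair, so that both belong to
    the same biadjunction.\<close>
  define d0 where "d0 a = (SOME p. \<exists>\<eta> s t. biadjunction B B (tensR a) (fst p) \<eta> (snd p) s t)" for a
  have adj: "\<exists>\<eta> s t. biadjunction B B (tensR a) (fst (d0 a)) \<eta> (snd (d0 a)) s t" if a: "a \<in> obj B" for a
  proof -
    obtain H \<eta> \<epsilon> s t where "biadjunction B B (tensR a) H \<eta> \<epsilon> s t" using zero_closed[OF a] by blast
    then have "\<exists>\<eta> s t. biadjunction B B (tensR a) (fst (H, \<epsilon>)) \<eta> (snd (H, \<epsilon>)) s t" by auto
    then show ?thesis unfolding d0_def by (rule someI)
  qed
  have T [simp]: "F0 (tensR a) c = F0 (tensor M) (c, a)" "F1 (tensR a) f = F1 (tensor M) (f, id1 B a)"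
    "F2 (tensR a) u = F2 (tensor M) (u, id2 B (id1 B a))" for a c f u
    by (simp_all add: tensR_def compF_def pairF_def strictF_def constF_def)
  note univ = biadjunction_universal[OF bicategory_axioms bicategory_axioms _ unit_obj, of "tensR a" for a, unfolded T]
  show thesis
  proof (rule that[of "\<lambda>a. F0 (fst (d0 a)) I" "\<lambda>a. t1 (snd (d0 a)) I"], goal_cases)
    case (1 a) with adj[OF 1] univ(1,2) show ?case by blast
  next
    case (2 a c r) with adj[OF 2(1)] univ(3)[of a] show ?case by blast
  next
    case (3 a c h k w) with adj[OF 3(1)] univ(4)[of a] show ?case by blast
  next
    case (4 a c h k u v)
    obtain \<eta> s t where "biadjunction B B (tensR a) (fst (d0 a)) \<eta> (snd (d0 a)) s t" using adj[OF 4(1)] by blast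
    then show ?case by (rule univ(5)) (use 4 in auto)
  qed
qed

theorem proposition6p3p5:
  fixes B :: "('o, 'm, 'c) bicat" and M :: "('o, 'm, 'c) symmon"
  assumes "zero_closed_symmetric_monoidal_bicategory B M"
  shows "\<exists>d \<eta> \<tau>. lax_contravariant_O1_volutive B d \<eta> \<tau>"
proof -
  interpret zero_closed_symmetric_monoidal_bicategory B M by fact
  interpret bi: braided B M "rep (unit M)"
    by (simp add: braided_def symmetric_monoidal_bicategory_axioms rep_rmodule unit_obj)
  interpret im: imodule B "pull (prodB B B) B (tensor M) (rep (unit M))" bi.sgB bi.smB bi.nuB bi.syB
    by (rule bi.braided_imodule)
  obtain d0 e where e: "\<And>a. a \<in> obj B \<Longrightarrow> d0 a \<in> obj B \<and> e a \<in> hom1 B (F0 (tensor M) (d0 a, a)) (unit M)"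
    and surj: "\<And>a c r. \<lbrakk>a \<in> obj B; c \<in> obj B; r \<in> hom1 B (F0 (tensor M) (c, a)) (unit M)\<rbrakk>
      \<Longrightarrow> \<exists>h u. h \<in> hom1 B c (d0 a) \<and> u \<in> iso2 B (cmp1 B (e a) (F1 (tensor M) (h, id1 B a))) r"
    and full: "\<And>a c h k w. \<lbrakk>a \<in> obj B; h \<in> hom1 B c (d0 a); k \<in> hom1 B c (d0 a);
        w \<in> hom2 B (cmp1 B (e a) (F1 (tensor M) (h, id1 B a))) (cmp1 B (e a) (F1 (tensor M) (k, id1 B a)))\<rbrakk>
      \<Longrightarrow> \<exists>u \<in> hom2 B h k. hc B (id2 B (e a)) (F2 (tensor M) (u, id2 B (id1 B a))) = w"
    and faithful: "\<And>a c h k u v. \<lbrakk>a \<in> obj B; h \<in> hom1 B c (d0 a); k \<in> hom1 B c (d0 a); u \<in> hom2 B h k; v \<in> hom2 B h k;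
        hc B (id2 B (e a)) (F2 (tensor M) (u, id2 B (id1 B a))) = hc B (id2 B (e a)) (F2 (tensor M) (v, id2 B (id1 B a)))\<rbrakk>
      \<Longrightarrow> u = v"
    using dual_representation by blast
  have [simp]: "d0 a \<in> obj B" "e a \<in> arr1 B" "src B (e a) = F0 (tensor M) (d0 a, a)" "trg B (e a) = unit M"
    if "a \<in> obj B" for a
    using e[OF that] by (auto simp: hom1_def)
  \<comment> \<open>The evaluation enters with the flag not set and with identities as recorded
    factors; its base \<open>(d0 a, a)\<close> stands next to it because objects of
    \<open>pull\<close> carry their base.\<close>
  have "closed_pairing B im.strict im.sgS im.smS d0 (\<lambda>a. (False, (e a, (d0 a, a)), id1 B (d0 a), id1 B a))"
  proof (rule im.strict_closed_pairing, goal_cases)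
    case (1 a) then show ?case by simp
  next
    case (2 a) then show ?case by simp
  next
    case (3 P c a)
    then obtain r where P: "P = (r, c, a)" by (cases P) auto
    with 3 have r [simp]: "r \<in> arr1 B" "trg B r = unit M" "src B r = F0 (tensor M) (c, a)" "c \<in> obj B" "a \<in> obj B" by auto
    obtain h u where [simp]: "h \<in> arr1 B" "src B h = c" "trg B h = d0 a" "isoc u"
      "dom2 B u = cmp1 B (e a) (F1 (tensor M) (h, id1 B a))" "cod2 B u = r"
      using surj[of a c r] by (auto simp: hom1_def iso2_iff)
    have "isoP (pull (prodB B B) B (tensor M) (rep (unit M))) (u, c, a)"
      by (rule bi.isoP_pull) (simp_all add: isoP_rep)
    then show ?case by (intro exI[of _ h] exI[of _ "(u, c, a)"]) (simp add: P)
  next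
    case (4 a h k u)
    obtain v p where u: "u = (v, p)" by (cases u)
    from 4 have [simp]: "h \<in> arr1 B" "k \<in> arr1 B" "a \<in> obj B" "src B h = src B k" "trg B h = d0 a" "trg B k = d0 a"
      "v \<in> arr2 B" "dom2 B v = cmp1 B (e a) (F1 (tensor M) (h, id1 B a))"
      "cod2 B v = cmp1 B (e a) (F1 (tensor M) (k, id1 B a))" "p = (src B k, a)" by (auto simp: u)
    obtain w where "w \<in> hom2 B h k" "hc B (id2 B (e a)) (F2 (tensor M) (w, id2 B (id1 B a))) = v"
      using full[of a h "src B k" k v] by (auto simp: hom1_def hom2_def)
    then show ?case by (intro exI[of _ w]) (auto simp: hom2_def u)
  next
    case (5 a w w')
    have "hc B (id2 B (e a)) (F2 (tensor M) (w, id2 B (id1 B a))) = hc B (id2 B (e a)) (F2 (tensor M) (w', id2 B (id1 B a)))"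
      using 5(7) by simp
    moreover have "dom2 B w' \<in> hom1 B (src B (dom2 B w')) (d0 a)" "cod2 B w' \<in> hom1 B (src B (dom2 B w')) (d0 a)"
      using 5(3,6) by (simp_all add: hom1_def)
    moreover have "w \<in> hom2 B (dom2 B w') (cod2 B w')" "w' \<in> hom2 B (dom2 B w') (cod2 B w')"
      using 5(2-5) by (simp_all add: hom2_def)
    ultimately show ?case using faithful[OF 5(1)] by blast
  qed
  then show ?thesis using closed_pairing.dF_volutive by blast
qed

end
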